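(* Let $\Omega=[0,L/\gamma]\times[0,L]$ with $L>0$ and $0<\gamma\le1$, let $\nu>0$ and $\mu>0$, and consider the damped-driven two-dimensional Navier--Stokes system $$\partial_t u+\sum_{i=1}^2u^i\partial_iu=\nu\Delta u-\mu u-\nabla p+f,\qquad \operatorname{div}u=0,\qquad u(0)=u_0,$$ in $\Omega$ with periodic boundary conditions, with forcing satisfying $\limsup_{t\to\infty}\|\operatorname{rot}f(t)\|_{L_\infty(\Omega)}=\mathbf{F}_\infty<\infty$. Let $w_1,w_2,\dots$ be the eigenfunctions of the Stokes operator with periodic boundary conditions, ordered so that the eigenvalues are non-decreasing. (1) The first $m$ modes $\{w_1,\dots,w_m\}$ of the Stokes operator are determining for this system if $$m+1>\frac2\gamma+\frac{2}{\pi^2}\,\frac{\mathbf{F}_\infty|\Omega|}{\mu\nu}.$$ (2) If $\Omega$ is tiled by $N$ equal squares, then any collection of $N$ nodes (one in each square) is determining for this system if $$N>\sqrt{68}\,\frac{\mathbf{F}_\infty|\Omega|}{\mu\nu}.$$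
   Context: $\|\cdot\|$ is the $L_2(\Omega)$ norm, $\|\cdot\|_\infty$ the $L_\infty(\Omega)$ norm, $|\Omega|=L^2/\gamma$, and $\operatorname{rot}u=\partial_1u^2-\partial_2u^1$. All of $u$, $p$, $f$ are $\Omega$-periodic with mean value zero, and $f$ is divergence-free. The Stokes operator is $A=-P\Delta$, with $P$ the orthogonal projection onto the space of periodic divergence-free mean-zero fields in $L_2(\Omega)^2$; its eigenvalues $0<\lambda_1\le\lambda_2\le\cdots$ coincide with those of the scalar $-\Delta$ on periodic mean-zero functions, $-\Delta\varphi_j=\lambda_j\varphi_j$, and its eigenfunctions are $w_j=\lambda_j^{-1/2}(-\partial_2\varphi_j,\partial_1\varphi_j)$. $P_m$ is the $L_2$-orthogonal projection onto $\mathrm{Span}\{w_1,\dots,w_m\}$. Let $u$, $v$ denote any two solutions of the system with forcing terms $f$, $g$ and initial data $u_0$, $v_0$ respectively, where $\limsup_{t\to\infty}\|\operatorname{rot}f(t)\|_\infty=\mathbf{F}_\infty<\infty$ and $\lim_{t\to\infty}\|\operatorname{rot}(f(t)-g(t))\|_\infty=0$. The modes $\{w_1,\dots,w_m\}$ are determining if for all such $u,v,f,g$, $\lim_{t\to\infty}\|P_m(u(t)-v(t))\|=0$ implies $\lim_{t\to\infty}\|u(t)-v(t)\|=0$. The nodes $\{x^1,\dots,x^N\}$ are determining if for all such $u,v,f,g$, $\lim_{t\to\infty}\eta(u(t)-v(t))=0$ implies $\lim_{t\to\infty}\|u(t)-v(t)\|=0$, where $\eta(w)=\max_{j=1,\dots,N}|w(x^j)|$.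 *)

theory Defs
  imports "HOL-Analysis.Analysis" "HOL-Probability.Essential_Supremum"
begin

section \<open>Periodic functions on the plane\<close>

definition Omega :: "real \<Rightarrow> real \<Rightarrow> (real^2) set" where
  "Omega L \<gamma> = cbox 0 (vector [L / \<gamma>, L])"

definition periodic :: "real \<Rightarrow> real \<Rightarrow> (real^2 \<Rightarrow> 'a) \<Rightarrow> bool" where
  "periodic L \<gamma> h \<longleftrightarrow> (\<forall>x. h (x + axis 1 (L / \<gamma>)) = h x \<and> h (x + axis 2 L) = h x)"

definition pd :: "2 \<Rightarrow> (real^2 \<Rightarrow> real) \<Rightarrow> real^2 \<Rightarrow> real" where
  "pd i h x = deriv (\<lambda>s. h (x + s *\<^sub>R axis i 1)) 0"

primrec Ck :: "nat \<Rightarrow> (real^2 \<Rightarrow> real) \<Rightarrow> bool" where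
  "Ck 0 h \<longleftrightarrow> continuous_on UNIV h"
| "Ck (Suc k) h \<longleftrightarrow> h differentiable_on UNIV \<and> (\<forall>i. Ck k (pd i h))"

definition test_function :: "real \<Rightarrow> real \<Rightarrow> (real^2 \<Rightarrow> real) \<Rightarrow> bool" where
  "test_function L \<gamma> \<phi> \<longleftrightarrow> periodic L \<gamma> \<phi> \<and> (\<forall>k. Ck k \<phi>)"

text \<open>Elements of \<open>L\<^sub>2(\<Omega>)\<close> are represented by periodic Borel functions on the whole plane.\<close>

definition L2_per :: "real \<Rightarrow> real \<Rightarrow> (real^2 \<Rightarrow> 'a::euclidean_space) \<Rightarrow> bool" where
  "L2_per L \<gamma> h \<longleftrightarrow> periodic L \<gamma> h \<and> h \<in> borel_measurable borel \<and>
     set_integrable lborel (Omega L \<gamma>) (\<lambda>x. (norm (h x))\<^sup>2)"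

definition L2_inner :: "real \<Rightarrow> real \<Rightarrow> (real^2 \<Rightarrow> 'a::euclidean_space) \<Rightarrow> (real^2 \<Rightarrow> 'a) \<Rightarrow> real" where
  "L2_inner L \<gamma> g h = (LINT x:Omega L \<gamma>|lborel. g x \<bullet> h x)"

definition L2_norm :: "real \<Rightarrow> real \<Rightarrow> (real^2 \<Rightarrow> 'a::euclidean_space) \<Rightarrow> real" where
  "L2_norm L \<gamma> h = sqrt (LINT x:Omega L \<gamma>|lborel. (norm (h x))\<^sup>2)"

definition Linf_norm :: "real \<Rightarrow> real \<Rightarrow> (real^2 \<Rightarrow> real) \<Rightarrow> ereal" where
  "Linf_norm L \<gamma> h = esssup (restrict_space lborel (Omega L \<gamma>)) (\<lambda>x. ereal \<bar>h x\<bar>)"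

definition mean_zero :: "real \<Rightarrow> real \<Rightarrow> (real^2 \<Rightarrow> 'a::euclidean_space) \<Rightarrow> bool" where
  "mean_zero L \<gamma> h \<longleftrightarrow> (LINT x:Omega L \<gamma>|lborel. h x) = 0"


section \<open>Weak derivatives of periodic functions\<close>

definition has_weak_pd ::
    "real \<Rightarrow> real \<Rightarrow> 2 \<Rightarrow> (real^2 \<Rightarrow> 'a::euclidean_space) \<Rightarrow> (real^2 \<Rightarrow> 'a) \<Rightarrow> bool" where
  "has_weak_pd L \<gamma> i h d \<longleftrightarrow> L2_per L \<gamma> h \<and> L2_per L \<gamma> d \<and>
     (\<forall>\<phi>. test_function L \<gamma> \<phi> \<longrightarrow>
        (LINT x:Omega L \<gamma>|lborel. \<phi> x *\<^sub>R d x) = - (LINT x:Omega L \<gamma>|lborel. pd i \<phi> x *\<^sub>R h x))"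

text \<open>\<open>h\<close> lies in the periodic Sobolev space \<open>H\<^sup>2\<close> and \<open>l = \<Delta> h\<close>.\<close>

definition has_weak_laplacian ::
    "real \<Rightarrow> real \<Rightarrow> (real^2 \<Rightarrow> 'a::euclidean_space) \<Rightarrow> (real^2 \<Rightarrow> 'a) \<Rightarrow> bool" where
  "has_weak_laplacian L \<gamma> h l \<longleftrightarrow>
     (\<exists>d dd. (\<forall>i. has_weak_pd L \<gamma> i h (d i)) \<and> (\<forall>i j. has_weak_pd L \<gamma> j (d i) (dd i j)) \<and>
             l = (\<lambda>x. \<Sum>i\<in>UNIV. dd i i x))"

text \<open>\<open>r = rot h = \<partial>\<^sub>1 h\<^sup>2 - \<partial>\<^sub>2 h\<^sup>1\<close> in the sense of distributions.\<close>

definition has_weak_rot :: "real \<Rightarrow> real \<Rightarrow> (real^2 \<Rightarrow> real^2) \<Rightarrow> (real^2 \<Rightarrow> real) \<Rightarrow> bool" where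
  "has_weak_rot L \<gamma> h r \<longleftrightarrow> periodic L \<gamma> r \<and> r \<in> borel_measurable borel \<and>
     set_integrable lborel (Omega L \<gamma>) r \<and>
     (\<forall>\<phi>. test_function L \<gamma> \<phi> \<longrightarrow>
        (LINT x:Omega L \<gamma>|lborel. \<phi> x * r x) =
          - (LINT x:Omega L \<gamma>|lborel. pd 1 \<phi> x * h x $ 2 - pd 2 \<phi> x * h x $ 1))"

definition weak_div_free :: "real \<Rightarrow> real \<Rightarrow> (real^2 \<Rightarrow> real^2) \<Rightarrow> bool" where
  "weak_div_free L \<gamma> h \<longleftrightarrow>
     (\<forall>\<phi>. test_function L \<gamma> \<phi> \<longrightarrow>
        (LINT x:Omega L \<gamma>|lborel. \<Sum>i\<in>UNIV. h x $ i * pd i \<phi> x) = 0)"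


section \<open>The Stokes operator and its eigenfunctions\<close>

definition H_space :: "real \<Rightarrow> real \<Rightarrow> (real^2 \<Rightarrow> real^2) set" where
  "H_space L \<gamma> = {h. L2_per L \<gamma> h \<and> mean_zero L \<gamma> h \<and> weak_div_free L \<gamma> h}"

text \<open>\<open>q = P h\<close>, where \<open>P\<close> is the orthogonal projection of \<open>L\<^sub>2(\<Omega>)\<^sup>2\<close> onto \<^term>\<open>H_space L \<gamma>\<close>;
  a relation, since \<open>q\<close> is determined only almost everywhere.\<close>

definition is_leray_projection ::
    "real \<Rightarrow> real \<Rightarrow> (real^2 \<Rightarrow> real^2) \<Rightarrow> (real^2 \<Rightarrow> real^2) \<Rightarrow> bool" where
  "is_leray_projection L \<gamma> h q \<longleftrightarrow>
     q \<in> H_space L \<gamma> \<and> (\<forall>z\<in>H_space L \<gamma>. L2_inner L \<gamma> (\<lambda>x. h x - q x) z = 0)"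

text \<open>\<open>w\<close> lies in the domain of the Stokes operator \<open>A = -P\<Delta>\<close>, and \<open>A w = a\<close>.\<close>

definition stokes_op :: "real \<Rightarrow> real \<Rightarrow> (real^2 \<Rightarrow> real^2) \<Rightarrow> (real^2 \<Rightarrow> real^2) \<Rightarrow> bool" where
  "stokes_op L \<gamma> w a \<longleftrightarrow> w \<in> H_space L \<gamma> \<and>
     (\<exists>l. has_weak_laplacian L \<gamma> w l \<and> is_leray_projection L \<gamma> (\<lambda>x. - l x) a)"

text \<open>\<open>w 1, w 2, \<dots>\<close> is a complete orthonormal system of eigenfunctions in \<^term>\<open>H_space L \<gamma>\<close>, with
  eigenvalues \<open>ev 1 \<le> ev 2 \<le> \<dots>\<close>, repeated according to multiplicity.  The index \<open>0\<close> is unused.\<close>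

definition stokes_eigensystem ::
    "real \<Rightarrow> real \<Rightarrow> (nat \<Rightarrow> real) \<Rightarrow> (nat \<Rightarrow> real^2 \<Rightarrow> real^2) \<Rightarrow> bool" where
  "stokes_eigensystem L \<gamma> ev w \<longleftrightarrow>
     (\<forall>j\<ge>1. stokes_op L \<gamma> (w j) (\<lambda>x. ev j *\<^sub>R w j x)) \<and>
     (\<forall>i\<ge>1. \<forall>j\<ge>i. ev i \<le> ev j) \<and>
     (\<forall>i\<ge>1. \<forall>j\<ge>1. L2_inner L \<gamma> (w i) (w j) = (if i = j then 1 else 0)) \<and>
     (\<forall>h\<in>H_space L \<gamma>. (\<forall>j\<ge>1. L2_inner L \<gamma> h (w j) = 0) \<longrightarrow> L2_norm L \<gamma> h = 0)"

text \<open>The orthogonal projection \<open>P\<^sub>m\<close> onto the span of \<open>w 1, \<dots>, w m\<close>.\<close>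

definition modes_proj ::
    "real \<Rightarrow> real \<Rightarrow> (nat \<Rightarrow> real^2 \<Rightarrow> real^2) \<Rightarrow> nat \<Rightarrow> (real^2 \<Rightarrow> real^2) \<Rightarrow> real^2 \<Rightarrow> real^2" where
  "modes_proj L \<gamma> w m h =
     (THE q. (\<exists>c. q = (\<lambda>x. \<Sum>j=1..m. c j *\<^sub>R w j x)) \<and>
             (\<forall>j\<in>{1..m}. L2_inner L \<gamma> (\<lambda>x. h x - q x) (w j) = 0))"


section \<open>Solutions of the damped Navier--Stokes system\<close>

text \<open>\<open>L\<^sub>2\<close> on \<open>[a, b] \<times> \<Omega>\<close> for every compact interval \<open>[a, b]\<close> contained in the time set \<open>J\<close>.\<close>

definition L2_loc ::
    "real \<Rightarrow> real \<Rightarrow> real set \<Rightarrow> (real \<Rightarrow> real^2 \<Rightarrow> 'a::euclidean_space) \<Rightarrow> bool" where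
  "L2_loc L \<gamma> J h \<longleftrightarrow> set_borel_measurable lborel (J \<times> UNIV) (\<lambda>z. h (fst z) (snd z)) \<and>
     (\<forall>a b. {a..b} \<subseteq> J \<longrightarrow>
        set_integrable lborel ({a..b} \<times> Omega L \<gamma>) (\<lambda>z. (norm (h (fst z) (snd z)))\<^sup>2))"

definition forcing :: "real \<Rightarrow> real \<Rightarrow> (real \<Rightarrow> real^2 \<Rightarrow> real^2) \<Rightarrow> bool" where
  "forcing L \<gamma> f \<longleftrightarrow> L2_loc L \<gamma> {0..} f \<and> (\<forall>t\<ge>0. f t \<in> H_space L \<gamma>)"

text \<open>
  \<open>(u, p)\<close> is a global solution with forcing \<open>f\<close> and initial value \<open>u0\<close>.  The solution is continuous
  from \<open>[0, \<infinity>)\<close> to \<^term>\<open>H_space L \<gamma>\<close>, and for positive times it is strong: \<open>ut = \<partial>\<^sub>t u\<close>,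
  \<open>du i = \<partial>\<^sub>i u\<close>, \<open>lap = \<Delta> u\<close> and \<open>dp i = \<partial>\<^sub>i p\<close> are locally square integrable in time with values
  in \<open>L\<^sub>2(\<Omega>)\<close>, and the equation holds almost everywhere.  In two dimensions every Leray--Hopf weak
  solution with forcing as in \<^const>\<open>forcing\<close> is of this kind, by parabolic regularization, so
  arbitrary \<open>u0\<close> in \<^term>\<open>H_space L \<gamma>\<close> are covered.
\<close>

definition ns_solution ::
    "real \<Rightarrow> real \<Rightarrow> real \<Rightarrow> real \<Rightarrow> (real \<Rightarrow> real^2 \<Rightarrow> real^2) \<Rightarrow> (real^2 \<Rightarrow> real^2) \<Rightarrow>
     (real \<Rightarrow> real^2 \<Rightarrow> real^2) \<Rightarrow> (real \<Rightarrow> real^2 \<Rightarrow> real) \<Rightarrow> bool" where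
  "ns_solution L \<gamma> \<nu> \<mu> f u0 u p \<longleftrightarrow>
     (\<forall>t\<ge>0. u t \<in> H_space L \<gamma>) \<and> u 0 = u0 \<and>
     L2_loc L \<gamma> {0..} u \<and>
     (\<forall>t\<ge>0. ((\<lambda>s. L2_norm L \<gamma> (\<lambda>x. u s x - u t x)) \<longlongrightarrow> 0) (at t within {0..})) \<and>
     (\<exists>ut du lap dp.
        L2_loc L \<gamma> {0<..} ut \<and> (\<forall>i. L2_loc L \<gamma> {0<..} (du i)) \<and> L2_loc L \<gamma> {0<..} lap \<and>
        L2_loc L \<gamma> {0<..} p \<and> (\<forall>i. L2_loc L \<gamma> {0<..} (dp i)) \<and>
        (AE t in lborel. 0 < t \<longrightarrow>
           L2_per L \<gamma> (ut t) \<and>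
           (\<forall>i. has_weak_pd L \<gamma> i (u t) (du i t)) \<and> has_weak_laplacian L \<gamma> (u t) (lap t) \<and>
           mean_zero L \<gamma> (p t) \<and> (\<forall>i. has_weak_pd L \<gamma> i (p t) (dp i t))) \<and>
        (\<forall>s t. 0 < s \<and> s \<le> t \<longrightarrow>
           (AE x in lborel. u t x - u s x = (LINT r:{s..t}|lborel. ut r x))) \<and>
        (AE t in lborel. 0 < t \<longrightarrow>
           (AE x in lborel.
              ut t x + (\<Sum>i\<in>UNIV. (u t x $ i) *\<^sub>R du i t x) =
                \<nu> *\<^sub>R lap t x - \<mu> *\<^sub>R u t x - (\<chi> i. dp i t x) + f t x)))"

text \<open>\<open>u\<close> and \<open>v\<close> are solutions whose forcings \<open>f\<close> and \<open>g\<close> satisfy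
  \<open>limsup \<parallel>rot f(t)\<parallel>\<^sub>\<infinity> = F\<close> and \<open>lim \<parallel>rot (f(t) - g(t))\<parallel>\<^sub>\<infinity> = 0\<close> as \<open>t \<rightarrow> \<infinity>\<close>;
  \<open>rf\<close> and \<open>rg\<close> are \<open>rot f\<close> and \<open>rot g\<close>.\<close>

definition solution_pair ::
    "real \<Rightarrow> real \<Rightarrow> real \<Rightarrow> real \<Rightarrow> real \<Rightarrow>
     (real \<Rightarrow> real^2 \<Rightarrow> real^2) \<Rightarrow> (real \<Rightarrow> real^2 \<Rightarrow> real^2) \<Rightarrow> bool" where
  "solution_pair L \<gamma> \<nu> \<mu> F u v \<longleftrightarrow>
     (\<exists>f g rf rg u0 v0 p q.
        forcing L \<gamma> f \<and> forcing L \<gamma> g \<and>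
        ns_solution L \<gamma> \<nu> \<mu> f u0 u p \<and> ns_solution L \<gamma> \<nu> \<mu> g v0 v q \<and>
        (\<forall>t\<ge>0. has_weak_rot L \<gamma> (f t) (rf t) \<and> has_weak_rot L \<gamma> (g t) (rg t)) \<and>
        Limsup at_top (\<lambda>t. Linf_norm L \<gamma> (rf t)) = ereal F \<and>
        ((\<lambda>t. Linf_norm L \<gamma> (\<lambda>x. rf t x - rg t x)) \<longlongrightarrow> 0) at_top)"


section \<open>Determining modes and nodes\<close>

definition determining_modes ::
    "real \<Rightarrow> real \<Rightarrow> real \<Rightarrow> real \<Rightarrow> real \<Rightarrow> (nat \<Rightarrow> real^2 \<Rightarrow> real^2) \<Rightarrow> nat \<Rightarrow> bool" where
  "determining_modes L \<gamma> \<nu> \<mu> F w m \<longleftrightarrow>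
     (\<forall>u v. solution_pair L \<gamma> \<nu> \<mu> F u v \<longrightarrow>
        ((\<lambda>t. L2_norm L \<gamma> (modes_proj L \<gamma> w m (\<lambda>x. u t x - v t x))) \<longlongrightarrow> 0) at_top \<longrightarrow>
        ((\<lambda>t. L2_norm L \<gamma> (\<lambda>x. u t x - v t x)) \<longlongrightarrow> 0) at_top)"

text \<open>Values at points refer to the continuous representatives of \<open>u(t)\<close> and \<open>v(t)\<close>.  These exist for
  all large \<open>t\<close>, because \<open>u(t)\<close> and \<open>v(t)\<close> lie in \<open>H\<^sup>2\<close> once \<open>rot f\<close> and \<open>rot g\<close> are bounded.\<close>

definition determining_nodes ::
    "real \<Rightarrow> real \<Rightarrow> real \<Rightarrow> real \<Rightarrow> real \<Rightarrow> (nat \<Rightarrow> real^2) \<Rightarrow> nat \<Rightarrow> bool" where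
  "determining_nodes L \<gamma> \<nu> \<mu> F x N \<longleftrightarrow>
     (\<forall>u v. solution_pair L \<gamma> \<nu> \<mu> F u v \<longrightarrow>
        (\<forall>\<^sub>F t in at_top. continuous_on UNIV (u t) \<and> continuous_on UNIV (v t)) \<longrightarrow>
        ((\<lambda>t. MAX j\<in>{1..N}. norm (u t (x j) - v t (x j))) \<longlongrightarrow> 0) at_top \<longrightarrow>
        ((\<lambda>t. L2_norm L \<gamma> (\<lambda>y. u t y - v t y)) \<longlongrightarrow> 0) at_top)"

definition square_tiling :: "(real^2) set \<Rightarrow> nat \<Rightarrow> (nat \<Rightarrow> (real^2) set) \<Rightarrow> bool" where
  "square_tiling S N Q \<longleftrightarrow>
     (\<exists>l>0. \<forall>j\<in>{1..N}. \<exists>c. Q j = cbox c (c + vector [l, l])) \<and>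
     (\<Union>j\<in>{1..N}. Q j) = S \<and>
     (\<forall>i\<in>{1..N}. \<forall>j\<in>{1..N}. i \<noteq> j \<longrightarrow> interior (Q i) \<inter> interior (Q j) = {})"

end

theory Submission
  imports Defs
begin

text \<open>
Let \<open>w = u - v\<close>, let \<open>\<omega> = rot u\<close> and \<open>z = rot w\<close>.  Two facts about the vorticity carry both parts.

  Large vorticity disappears.  The vorticity satisfies
  \<open>\<partial>\<^sub>t \<omega> + u \<cdot> \<nabla>\<omega> = \<nu> \<Delta>\<omega> - \<mu> \<omega> + rot f\<close>.  Multiplying by \<open>J \<omega>\<close>, where \<open>J\<close> is the derivative of an even convex
  function that vanishes on \<open>[-m, m]\<close>, removes the transport term, gives the viscous term a favourable sign, and
  leaves a damping term that dominates the force as soon as \<open>\<mu> m\<close> exceeds its supremum.  Hence for every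
  \<open>m > F / \<mu>\<close> the part of \<open>\<omega>\<close> outside \<open>[-m, m]\<close> tends to zero in mean square (\<open>excess_decay\<close>).  This
  substitutes for a pointwise maximum principle.

  Differences decay if viscosity can absorb the nonlinearity.  Pairing the equation for \<open>w\<close> with \<open>- \<Delta>w\<close>
  gives
  \<open>d/dt \<parallel>z\<parallel>\<^sup>2 / 2 = - \<nu> \<parallel>\<Delta>w\<parallel>\<^sup>2 - \<mu> \<parallel>z\<parallel>\<^sup>2 + (rot (f - g), z) + \<integral> \<omega> (\<Delta>w\<^sup>2 w\<^sup>1 - \<Delta>w\<^sup>1 w\<^sup>2)\<close>
  (\<open>difference_balance\<close>).  The last integral is at most \<open>m \<parallel>w\<parallel> \<parallel>\<Delta>w\<parallel>\<close> plus the vanishing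
  excess of \<open>\<omega>\<close> times \<open>\<parallel>w\<parallel>\<^sub>\<infinity> \<parallel>\<Delta>w\<parallel>\<close>, and the Sobolev inequality bounds the latter by
  a small multiple of \<open>\<parallel>\<Delta>w\<parallel>\<^sup>2\<close> (\<open>trilinear_bound\<close>).  So if \<open>\<parallel>w\<parallel> \<le> c \<parallel>\<Delta>w\<parallel> + S t\<close> with
  \<open>S t \<rightarrow> 0\<close> and \<open>c F / \<mu> < \<nu>\<close>, then \<open>\<parallel>z\<parallel>\<close> and with it \<open>\<parallel>w\<parallel>\<close> tends to zero
  (\<open>difference_decay\<close>, \<open>determining_criterion\<close>).

  It remains to find such a \<open>c\<close>.  If the first \<open>n\<close> modes of \<open>w\<close> tend to zero, \<open>c = 1 / \<lambda>\<close> works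
  with \<open>\<lambda>\<close> the eigenvalue of number \<open>n + 1\<close>, and counting the lattice points in an ellipse bounds \<open>\<lambda>\<close> from
  below (\<open>eigenvalue_lower\<close>).  If the values of \<open>w\<close> at one point in each of \<open>N\<close> squares of side \<open>l\<close>
  tend to zero, a Poincare inequality on each square gives \<open>c = 8 l\<^sup>2\<close> with \<open>l\<^sup>2 = |\<Omega>| / N\<close>
  (\<open>square_node_bound\<close>, \<open>node_inequality\<close>), and \<open>8 < \<surd>68\<close>.

  Weak derivatives enter only through Fourier coefficients, on which they act as multiplication.  An identity
  between products is first shown for the square partial sums of the Fourier series, which are smooth, and then
  passes to the mean-square limit (\<open>conv_P\<close>, \<open>rot_by_parts\<close>, \<open>transport_zero\<close>).  In time, each Fourier coefficient
  is an indefinite integral, and a chain rule for such functions yields the balance of a functional of the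
  vorticity (\<open>chain_rule_indefinite_integral\<close>, \<open>time_identity\<close>).
\<close>

section \<open>Square-integrable functions\<close>

definition sq :: "'a measure \<Rightarrow> ('a \<Rightarrow> real) \<Rightarrow> bool" where
  "sq M h \<longleftrightarrow> h \<in> borel_measurable M \<and> integrable M (\<lambda>x. (h x)\<^sup>2)"

definition nrm :: "'a measure \<Rightarrow> ('a \<Rightarrow> real) \<Rightarrow> real" where
  "nrm M h = sqrt (\<integral>x. (h x)\<^sup>2 \<partial>M)"

text \<open>Mean-square convergence.  Square integrability of all functions involved is part of the notion, so that it need not be carried as a side condition.\<close>

definition conv :: "'a measure \<Rightarrow> (nat \<Rightarrow> 'a \<Rightarrow> real) \<Rightarrow> ('a \<Rightarrow> real) \<Rightarrow> bool" where
  "conv M hn h \<longleftrightarrow> (\<forall>n. sq M (hn n)) \<and> sq M h \<and> (\<lambda>n. nrm M (\<lambda>x. hn n x - h x)) \<longlonglongrightarrow> 0"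

lemma sqI: "h \<in> borel_measurable M \<Longrightarrow> integrable M (\<lambda>x. (h x)\<^sup>2) \<Longrightarrow> sq M h"
  by (simp add: sq_def)

lemma sq_measurable [measurable_dest]: "sq M h \<Longrightarrow> h \<in> borel_measurable M"
  by (simp add: sq_def)

lemma sq_integrable: "sq M h \<Longrightarrow> integrable M (\<lambda>x. (h x)\<^sup>2)"
  by (simp add: sq_def)

lemma nrm_ge0 [simp]: "0 \<le> nrm M h"
  by (simp add: nrm_def)

lemma nrm_power2: "(nrm M h)\<^sup>2 = (\<integral>x. (h x)\<^sup>2 \<partial>M)"
  by (simp add: nrm_def)

lemma sq_mult_integrable:
  assumes "sq M g" "sq M h" shows "integrable M (\<lambda>x. g x * h x)"
proof (rule Bochner_Integration.integrable_bound[of M "\<lambda>x. (g x)\<^sup>2 + (h x)\<^sup>2"])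
  show "integrable M (\<lambda>x. (g x)\<^sup>2 + (h x)\<^sup>2)" using assms by (auto simp: sq_def)
  show "(\<lambda>x. g x * h x) \<in> borel_measurable M" using assms by (auto simp: sq_def)
  have "\<bar>a * b\<bar> \<le> \<bar>a\<^sup>2 + b\<^sup>2\<bar>" for a b :: real
  proof -
    have "0 \<le> \<bar>a\<bar> * \<bar>b\<bar>" by simp
    moreover have "2 * (\<bar>a\<bar> * \<bar>b\<bar>) \<le> a\<^sup>2 + b\<^sup>2"
      using sum_squares_bound[of "\<bar>a\<bar>" "\<bar>b\<bar>"] by (simp add: mult.assoc)
    ultimately show ?thesis using abs_ge_self[of "a\<^sup>2 + b\<^sup>2"] unfolding abs_mult by linarith
  qed
  then show "AE x in M. norm (g x * h x) \<le> norm ((g x)\<^sup>2 + (h x)\<^sup>2)" by simp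
qed

lemma sq_bound:
  assumes "sq M g" "h \<in> borel_measurable M" "AE x in M. \<bar>h x\<bar> \<le> C * \<bar>g x\<bar>"
  shows "sq M h"
proof (rule sqI[OF assms(2)])
  show "integrable M (\<lambda>x. (h x)\<^sup>2)"
  proof (rule Bochner_Integration.integrable_bound[of M "\<lambda>x. C\<^sup>2 * (g x)\<^sup>2"])
    show "AE x in M. norm ((h x)\<^sup>2) \<le> norm (C\<^sup>2 * (g x)\<^sup>2)"
      using assms(3) by eventually_elim
        (metis abs_le_square_iff abs_mult abs_power2 power_mult_distrib power2_abs real_norm_def abs_ge_zero abs_of_nonneg order_trans)
  qed (use assms in \<open>auto simp: sq_def\<close>)
qed

lemma sq_cmult: "sq M h \<Longrightarrow> sq M (\<lambda>x. c * h x)"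
  by (auto simp: sq_def power_mult_distrib)

lemma sq_minus: "sq M h \<Longrightarrow> sq M (\<lambda>x. - h x)"
  by (auto simp: sq_def)

lemma sq_add: assumes "sq M g" "sq M h" shows "sq M (\<lambda>x. g x + h x)"
proof (rule sqI)
  have "integrable M (\<lambda>x. (g x)\<^sup>2 + (h x)\<^sup>2 + 2 * (g x * h x))"
    using assms sq_mult_integrable[OF assms] by (auto simp: sq_def)
  then show "integrable M (\<lambda>x. (g x + h x)\<^sup>2)" by (simp add: power2_sum algebra_simps)
qed (use assms in \<open>auto simp: sq_def\<close>)

lemma sq_diff: "sq M g \<Longrightarrow> sq M h \<Longrightarrow> sq M (\<lambda>x. g x - h x)"
  using sq_add[of M g "\<lambda>x. - h x"] sq_minus[of M h] by simp

lemma sq_zero [simp]: "sq M (\<lambda>x. 0)" by (simp add: sq_def)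

lemma sq_bdd_mult:
  assumes "sq M h" "b \<in> borel_measurable M" "AE x in M. \<bar>b x\<bar> \<le> C"
  shows "sq M (\<lambda>x. b x * h x)"
proof (rule sq_bound[OF assms(1), where C = C])
  show "AE x in M. \<bar>b x * h x\<bar> \<le> C * \<bar>h x\<bar>"
    using assms(3) by eventually_elim (simp add: abs_mult mult_right_mono)
qed (use assms in auto)

lemma sq_AE_cong:
  assumes "sq M g" "h \<in> borel_measurable M" "AE x in M. g x = h x" shows "sq M h"
  by (rule sq_bound[OF assms(1,2), where C = 1]) (use assms(3) in auto)

lemma Cauchy_Schwarz_integral:
  assumes "sq M g" "sq M h"
  shows "\<bar>\<integral>x. g x * h x \<partial>M\<bar> \<le> nrm M g * nrm M h"
proof -
  define a where "a = (\<integral>x. (g x)\<^sup>2 \<partial>M)"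
  define b where "b = (\<integral>x. g x * h x \<partial>M)"
  define c where "c = (\<integral>x. (h x)\<^sup>2 \<partial>M)"
  have i: "integrable M (\<lambda>x. (g x)\<^sup>2)" "integrable M (\<lambda>x. (h x)\<^sup>2)" "integrable M (\<lambda>x. g x * h x)"
    using assms sq_mult_integrable[OF assms] by (auto simp: sq_def)
  have q: "0 \<le> a - 2 * t * b + t\<^sup>2 * c" for t
  proof -
    have "0 \<le> (\<integral>x. (g x - t * h x)\<^sup>2 \<partial>M)" by simp
    also have "\<dots> = (\<integral>x. ((g x)\<^sup>2 - 2 * t * (g x * h x)) + t\<^sup>2 * (h x)\<^sup>2 \<partial>M)"
      by (intro Bochner_Integration.integral_cong) (auto simp: power2_eq_square algebra_simps)
    also have "\<dots> = a - 2 * t * b + t\<^sup>2 * c" using i by (simp add: a_def b_def c_def)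
    finally show ?thesis .
  qed
  have "b\<^sup>2 \<le> a * c"
  proof (cases "c = 0")
    case True
    have "b = 0"
    proof (rule ccontr)
      assume "b \<noteq> 0"
      then show False using q[of "(a + 1) / (2 * b)"] True by (simp add: field_simps)
    qed
    then show ?thesis using True by simp
  next
    case False
    then have "c > 0" by (simp add: c_def less_le)
    have "a - 2 * (b/c) * b + (b/c)\<^sup>2 * c = a - b\<^sup>2 / c"
      using False by (simp add: power2_eq_square field_simps)
    then have "b\<^sup>2 / c \<le> a" using q[of "b / c"] by simp
    then show ?thesis using \<open>c > 0\<close> by (simp add: field_simps)
  qed
  then have "\<bar>b\<bar> \<le> sqrt (a * c)" using real_le_rsqrt[of "\<bar>b\<bar>"] by simp
  then show ?thesis by (simp add: a_def b_def c_def nrm_def real_sqrt_mult)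
qed

lemma nrm_triangle:
  assumes "sq M g" "sq M h" shows "nrm M (\<lambda>x. g x + h x) \<le> nrm M g + nrm M h"
proof (rule power2_le_imp_le)
  have i: "integrable M (\<lambda>x. (g x)\<^sup>2)" "integrable M (\<lambda>x. (h x)\<^sup>2)" "integrable M (\<lambda>x. g x * h x)"
    using assms sq_mult_integrable[OF assms] by (auto simp: sq_def)
  have "(nrm M (\<lambda>x. g x + h x))\<^sup>2 = (\<integral>x. ((g x)\<^sup>2 + 2 * (g x * h x)) + (h x)\<^sup>2 \<partial>M)"
    unfolding nrm_power2
    by (intro Bochner_Integration.integral_cong) (auto simp: power2_eq_square algebra_simps)
  also have "\<dots> = (nrm M g)\<^sup>2 + 2 * (\<integral>x. g x * h x \<partial>M) + (nrm M h)\<^sup>2"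
    using i by (simp add: nrm_power2)
  also have "\<dots> \<le> (nrm M g)\<^sup>2 + 2 * (nrm M g * nrm M h) + (nrm M h)\<^sup>2"
    using Cauchy_Schwarz_integral[OF assms] by simp
  finally show "(nrm M (\<lambda>x. g x + h x))\<^sup>2 \<le> (nrm M g + nrm M h)\<^sup>2"
    by (simp add: power2_eq_square algebra_simps)
qed simp

lemma nrm_cmult: "nrm M (\<lambda>x. c * h x) = \<bar>c\<bar> * nrm M h"
  by (simp add: nrm_def power_mult_distrib real_sqrt_mult)

lemma nrm_minus_commute: "nrm M (\<lambda>x. g x - h x) = nrm M (\<lambda>x. h x - g x)"
  by (simp add: nrm_def power2_commute)

lemma nrm_mono:
  assumes "sq M g" "h \<in> borel_measurable M" "AE x in M. \<bar>h x\<bar> \<le> \<bar>g x\<bar>"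
  shows "nrm M h \<le> nrm M g"
  unfolding nrm_def
proof (rule real_sqrt_le_mono, rule integral_mono_AE)
  show "integrable M (\<lambda>x. (h x)\<^sup>2)" using sq_bound[OF assms(1,2), of 1] assms(3) by (auto simp: sq_def)
  show "AE x in M. (h x)\<^sup>2 \<le> (g x)\<^sup>2" using assms(3) by eventually_elim (simp add: abs_le_square_iff)
qed (use assms(1) in \<open>auto simp: sq_def\<close>)

lemma nrm_bdd_mult:
  assumes "sq M h" "b \<in> borel_measurable M" "AE x in M. \<bar>b x\<bar> \<le> C"
  shows "nrm M (\<lambda>x. b x * h x) \<le> \<bar>C\<bar> * nrm M h"
proof -
  have "nrm M (\<lambda>x. b x * h x) \<le> nrm M (\<lambda>x. C * h x)"
  proof (rule nrm_mono[OF sq_cmult[OF assms(1)]])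
    show "AE x in M. \<bar>b x * h x\<bar> \<le> \<bar>C * h x\<bar>"
      using assms(3) by eventually_elim (auto simp: abs_mult intro!: mult_right_mono)
  qed (use assms in auto)
  then show ?thesis by (simp add: nrm_cmult)
qed

lemma nrm_eq_0_AE: "sq M h \<Longrightarrow> nrm M h = 0 \<Longrightarrow> AE x in M. h x = 0"
  using integral_nonneg_eq_0_iff_AE[of M "\<lambda>x. (h x)\<^sup>2"] by (simp add: sq_def nrm_def)

lemma nrm_AE_cong:
  assumes "sq M g" "h \<in> borel_measurable M" "AE x in M. g x = h x" shows "nrm M g = nrm M h"
proof (rule antisym)
  show "nrm M g \<le> nrm M h"
    by (rule nrm_mono[OF sq_AE_cong[OF assms] sq_measurable[OF assms(1)]])
      (use assms(3) in eventually_elim, simp)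
  show "nrm M h \<le> nrm M g"
    by (rule nrm_mono[OF assms(1,2)]) (use assms(3) in eventually_elim, simp)
qed

lemma convD: assumes "conv M hn h"
  shows "sq M (hn n)" "sq M h" "(\<lambda>n. nrm M (\<lambda>x. hn n x - h x)) \<longlonglongrightarrow> 0"
  using assms by (auto simp: conv_def)

lemma conv_const: "sq M h \<Longrightarrow> conv M (\<lambda>n. h) h"
  by (simp add: conv_def nrm_def)

lemma conv_bound:
  assumes "\<And>n. sq M (hn n)" "sq M h" "\<And>n. nrm M (\<lambda>x. hn n x - h x) \<le> e n" "e \<longlonglongrightarrow> 0"
  shows "conv M hn h"
  unfolding conv_def using assms
  by (auto intro!: tendsto_sandwich[OF _ _ tendsto_const assms(4)] always_eventually)

lemma conv_add:
  assumes "conv M gn g" "conv M hn h" shows "conv M (\<lambda>n x. gn n x + hn n x) (\<lambda>x. g x + h x)"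
proof (rule conv_bound[where e = "\<lambda>n. nrm M (\<lambda>x. gn n x - g x) + nrm M (\<lambda>x. hn n x - h x)"])
  note s = convD[OF assms(1)] convD[OF assms(2)]
  fix n
  have "nrm M (\<lambda>x. gn n x + hn n x - (g x + h x)) = nrm M (\<lambda>x. (gn n x - g x) + (hn n x - h x))"
    by (simp add: algebra_simps)
  also have "\<dots> \<le> nrm M (\<lambda>x. gn n x - g x) + nrm M (\<lambda>x. hn n x - h x)"
    by (intro nrm_triangle sq_diff s)
  finally show "nrm M (\<lambda>x. gn n x + hn n x - (g x + h x)) \<le> \<dots>" .
  show "(\<lambda>n. nrm M (\<lambda>x. gn n x - g x) + nrm M (\<lambda>x. hn n x - h x)) \<longlonglongrightarrow> 0"
    using tendsto_add[OF s(3) s(6)] by simp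
qed (auto intro: sq_add convD[OF assms(1)] convD[OF assms(2)])

lemma conv_nrm: assumes "conv M hn h" shows "(\<lambda>n. nrm M (hn n)) \<longlonglongrightarrow> nrm M h"
proof (rule LIM_zero_cancel, rule tendsto_rabs_zero_cancel,
    rule tendsto_sandwich[OF _ _ tendsto_const convD(3)[OF assms]])
  note s = convD[OF assms]
  have "\<bar>nrm M (hn n) - nrm M h\<bar> \<le> nrm M (\<lambda>x. hn n x - h x)" for n
    using nrm_triangle[OF sq_diff[OF s(1)[of n] s(2)] s(2)]
      nrm_triangle[OF sq_diff[OF s(2) s(1)[of n]] s(1)[of n]] nrm_minus_commute[of M h "hn n"]
    by simp
  then show "\<forall>\<^sub>F n in sequentially. \<bar>nrm M (hn n) - nrm M h\<bar> \<le> nrm M (\<lambda>x. hn n x - h x)" by simp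
qed simp

text \<open>Both factors converge strongly, so the error splits into two products with one small factor each.\<close>

lemma conv_integral_mult:
  assumes "conv M gn g" "conv M hn h"
  shows "(\<lambda>n. \<integral>x. gn n x * hn n x \<partial>M) \<longlonglongrightarrow> (\<integral>x. g x * h x \<partial>M)"
proof (rule LIM_zero_cancel, rule tendsto_rabs_zero_cancel, rule tendsto_sandwich[OF _ _ tendsto_const])
  note s = convD[OF assms(1)] convD[OF assms(2)]
  let ?e = "\<lambda>n. nrm M (\<lambda>x. gn n x - g x) * nrm M (hn n) + nrm M g * nrm M (\<lambda>x. hn n x - h x)"
  show "?e \<longlonglongrightarrow> 0"
    using tendsto_add[OF tendsto_mult[OF s(3) conv_nrm[OF assms(2)]] tendsto_mult_left[OF s(6), of "nrm M g"]]
    by simp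
  have "\<bar>(\<integral>x. gn n x * hn n x \<partial>M) - (\<integral>x. g x * h x \<partial>M)\<bar> \<le> ?e n" for n
  proof -
    have "(\<integral>x. gn n x * hn n x \<partial>M) - (\<integral>x. g x * h x \<partial>M) =
        (\<integral>x. (gn n x - g x) * hn n x + g x * (hn n x - h x) \<partial>M)"
      by (subst Bochner_Integration.integral_diff[symmetric])
        (auto intro!: sq_mult_integrable s simp: algebra_simps)
    also have "\<dots> = (\<integral>x. (gn n x - g x) * hn n x \<partial>M) + (\<integral>x. g x * (hn n x - h x) \<partial>M)"
      by (intro Bochner_Integration.integral_add sq_mult_integrable sq_diff s)
    finally show ?thesis
      using Cauchy_Schwarz_integral[OF sq_diff[OF s(1)[of n] s(2)] s(4)[of n]]
        Cauchy_Schwarz_integral[OF s(2) sq_diff[OF s(4)[of n] s(5)]] by linarith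
  qed
  then show "\<forall>\<^sub>F n in sequentially.
     \<bar>(\<integral>x. gn n x * hn n x \<partial>M) - (\<integral>x. g x * h x \<partial>M)\<bar> \<le> ?e n" by simp
qed simp

text \<open>A Lipschitz function does not increase distances by more than a constant factor, pointwise and hence in mean square.\<close>

lemma conv_lipschitz:
  assumes "conv M hn h" and L: "\<And>a b. \<bar>f a - f b\<bar> \<le> K * \<bar>a - b\<bar>" and "f 0 = (0::real)"
    and [measurable]: "f \<in> borel_measurable borel"
  shows "conv M (\<lambda>n x. f (hn n x)) (\<lambda>x. f (h x))"
proof (rule conv_bound[where e = "\<lambda>n. \<bar>K\<bar> * nrm M (\<lambda>x. hn n x - h x)"])
  note s = convD[OF assms(1)]
  note [measurable] = sq_measurable[OF s(1)] sq_measurable[OF s(2)]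
  have b: "\<bar>f a\<bar> \<le> K * \<bar>a\<bar>" for a using L[of a 0] assms(3) by simp
  show "sq M (\<lambda>x. f (hn n x))" for n by (rule sq_bound[OF s(1)[of n], where C = K]) (auto simp: b)
  show "sq M (\<lambda>x. f (h x))" by (rule sq_bound[OF s(2), where C = K]) (auto simp: b)
  have "\<bar>f a - f b\<bar> \<le> \<bar>K\<bar> * \<bar>a - b\<bar>" for a b
    by (rule order_trans[OF L]) (simp add: mult_right_mono)
  then have "nrm M (\<lambda>x. f (hn n x) - f (h x)) \<le> nrm M (\<lambda>x. K * (hn n x - h x))" for n
    by (intro nrm_mono sq_cmult sq_diff s) (auto simp: abs_mult)
  then show "nrm M (\<lambda>x. f (hn n x) - f (h x)) \<le> \<bar>K\<bar> * nrm M (\<lambda>x. hn n x - h x)" for n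
    by (simp add: nrm_cmult)
  show "(\<lambda>n. \<bar>K\<bar> * nrm M (\<lambda>x. hn n x - h x)) \<longlonglongrightarrow> 0"
    using tendsto_mult_left[OF s(3)] by simp
qed

text \<open>The product of two mean-square limits is in general only an integrable limit.  It is a mean-square limit if
  one factor stays uniformly bounded: where the fixed function is large its mass is small, and elsewhere the
  convergence of the bounded factor suffices.\<close>

lemma tendsto_nrm_bdd_mult:
  assumes b: "\<And>n. b n \<in> borel_measurable M" "\<And>n. AE x in M. \<bar>b n x\<bar> \<le> C"
    and b0: "(\<lambda>n. nrm M (b n)) \<longlonglongrightarrow> 0" "\<And>n. sq M (b n)" and X: "sq M X"
  shows "(\<lambda>n. nrm M (\<lambda>x. b n x * X x)) \<longlonglongrightarrow> 0"
proof -
  note [measurable] = b(1) sq_measurable[OF X]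
  have sqb: "sq M (\<lambda>x. b n x * X x)" for n by (rule sq_bdd_mult[OF X b])
  have tail: "(\<lambda>m. \<integral>x. indicator {x. \<bar>X x\<bar> > real m} x * (X x)\<^sup>2 \<partial>M) \<longlonglongrightarrow> (\<integral>x. 0 \<partial>M)"
  proof (rule integral_dominated_convergence[where w = "\<lambda>x. (X x)\<^sup>2"])
    show "AE x in M. (\<lambda>m. indicator {x. \<bar>X x\<bar> > real m} x * (X x)\<^sup>2) \<longlonglongrightarrow> 0"
    proof (rule AE_I2, rule tendsto_eventually)
      fix x
      obtain m0 where "\<bar>X x\<bar> \<le> real m0" using real_arch_simple by blast
      then show "\<forall>\<^sub>F m in sequentially. indicator {x. \<bar>X x\<bar> > real m} x * (X x)\<^sup>2 = 0"
        by (intro eventually_sequentiallyI[of m0]) (auto simp: indicator_def)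
    qed
  qed (use X in \<open>auto simp: sq_def indicator_def\<close>)
  have sqr: "(\<lambda>n. (nrm M (\<lambda>x. b n x * X x))\<^sup>2) \<longlonglongrightarrow> 0"
  proof (rule LIMSEQ_I)
    fix e :: real assume "e > 0"
    define C1 where "C1 = C\<^sup>2 + 1"
    have "C1 > 0" by (simp add: C1_def add_nonneg_pos)
    then have "e / (2 * C1) > 0" using \<open>e > 0\<close> by simp
    with LIMSEQ_D[OF tail this] obtain m where
      m: "\<bar>\<integral>x. indicator {x. \<bar>X x\<bar> > real m} x * (X x)\<^sup>2 \<partial>M\<bar> < e / (2 * C1)" by auto
    define K where "K = real m ^ 2 + 1"
    have "K > 0" by (simp add: K_def add_nonneg_pos)
    have "(\<lambda>n. K * (nrm M (b n))\<^sup>2) \<longlonglongrightarrow> 0"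
      using tendsto_mult_left[OF tendsto_power[OF b0(1), of 2]] by simp
    then obtain N where N: "\<And>n. n \<ge> N \<Longrightarrow> \<bar>K * (nrm M (b n))\<^sup>2\<bar> < e / 2"
      using LIMSEQ_D[of _ 0 "e/2"] \<open>e > 0\<close> by fastforce
    have "(nrm M (\<lambda>x. b n x * X x))\<^sup>2 < e" if "n \<ge> N" for n
    proof -
      have i2: "integrable M (\<lambda>x. indicator {x. \<bar>X x\<bar> > real m} x * (X x)\<^sup>2)"
        by (rule Bochner_Integration.integrable_bound[OF sq_integrable[OF X]]) (auto simp: indicator_def)
      have "(nrm M (\<lambda>x. b n x * X x))\<^sup>2 \<le>
          (\<integral>x. K * (b n x)\<^sup>2 + C1 * (indicator {x. \<bar>X x\<bar> > real m} x * (X x)\<^sup>2) \<partial>M)"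
        unfolding nrm_power2
      proof (rule integral_mono_AE)
        show "AE x in M. (b n x * X x)\<^sup>2 \<le> K * (b n x)\<^sup>2 + C1 * (indicator {x. \<bar>X x\<bar> > real m} x * (X x)\<^sup>2)"
          using b(2)[of n]
        proof eventually_elim
          case (elim x)
          show ?case
          proof (cases "\<bar>X x\<bar> > real m")
            case True
            have "(b n x)\<^sup>2 \<le> C\<^sup>2" using elim abs_le_square_iff[of "b n x" C] by linarith
            then have "(b n x)\<^sup>2 * (X x)\<^sup>2 \<le> C1 * (X x)\<^sup>2"
              unfolding C1_def by (intro mult_right_mono) auto
            moreover have "0 \<le> K * (b n x)\<^sup>2" using \<open>K > 0\<close> by simp
            ultimately show ?thesis using True by (simp add: power_mult_distrib)
          next
            case False
            then have "(X x)\<^sup>2 \<le> (real m)\<^sup>2" using abs_le_square_iff[of "X x" "real m"] by simp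
            then have "(b n x)\<^sup>2 * (X x)\<^sup>2 \<le> (b n x)\<^sup>2 * K"
              unfolding K_def by (intro mult_left_mono) auto
            then show ?thesis using False by (simp add: power_mult_distrib mult.commute)
          qed
        qed
        show "integrable M (\<lambda>x. (b n x * X x)\<^sup>2)" by (rule sq_integrable[OF sqb])
        show "integrable M (\<lambda>x. K * (b n x)\<^sup>2 + C1 * (indicator {x. \<bar>X x\<bar> > real m} x * (X x)\<^sup>2))"
          using i2 sq_integrable[OF b0(2)[of n]] by auto
      qed
      also have "\<dots> = K * (nrm M (b n))\<^sup>2 + C1 * (\<integral>x. indicator {x. \<bar>X x\<bar> > real m} x * (X x)\<^sup>2 \<partial>M)"
        using i2 sq_integrable[OF b0(2)[of n]] by (simp add: nrm_power2)
      also have "\<dots> < e / 2 + C1 * (e / (2 * C1))"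
        using N[OF that] m \<open>C1 > 0\<close> by (intro add_strict_mono mult_strict_left_mono) auto
      also have "\<dots> = e" using \<open>C1 > 0\<close> by simp
      finally show ?thesis .
    qed
    then show "\<exists>N. \<forall>n\<ge>N. norm ((nrm M (\<lambda>x. b n x * X x))\<^sup>2 - 0) < e" by auto
  qed
  show ?thesis using tendsto_real_sqrt[OF sqr] by simp
qed

lemma conv_bdd_mult:
  assumes b: "conv M bn b" "\<And>n. AE x in M. \<bar>bn n x\<bar> \<le> C" "AE x in M. \<bar>b x\<bar> \<le> C" and X: "conv M Xn X"
  shows "conv M (\<lambda>n x. bn n x * Xn n x) (\<lambda>x. b x * X x)"
proof (rule conv_bound[where e = "\<lambda>n. \<bar>C\<bar> * nrm M (\<lambda>x. Xn n x - X x) + nrm M (\<lambda>x. (bn n x - b x) * X x)"])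
  note s = convD[OF b(1)] convD[OF X]
  have bd: "AE x in M. \<bar>bn n x - b x\<bar> \<le> 2 * C" for n
    using b(2)[of n] b(3) by eventually_elim linarith
  have m: "(\<lambda>x. bn n x - b x) \<in> borel_measurable M" for n
    using sq_measurable[OF sq_diff[OF s(1)[of n] s(2)]] .
  show "(\<lambda>n. \<bar>C\<bar> * nrm M (\<lambda>x. Xn n x - X x) + nrm M (\<lambda>x. (bn n x - b x) * X x)) \<longlonglongrightarrow> 0"
    using tendsto_add[OF tendsto_mult_left[OF s(6), of "\<bar>C\<bar>"]
        tendsto_nrm_bdd_mult[OF m bd s(3) sq_diff[OF s(1) s(2)] s(5)]] by simp
  show s1: "sq M (\<lambda>x. bn n x * Xn n x)" for n
    by (rule sq_bdd_mult[OF s(4) sq_measurable[OF s(1)] b(2)])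
  show s2: "sq M (\<lambda>x. b x * X x)"
    by (rule sq_bdd_mult[OF s(5) sq_measurable[OF s(2)] b(3)])
  fix n
  have "nrm M (\<lambda>x. bn n x * Xn n x - b x * X x) =
      nrm M (\<lambda>x. bn n x * (Xn n x - X x) + (bn n x - b x) * X x)"
    by (simp add: algebra_simps)
  also have "\<dots> \<le> nrm M (\<lambda>x. bn n x * (Xn n x - X x)) + nrm M (\<lambda>x. (bn n x - b x) * X x)"
    by (intro nrm_triangle sq_bdd_mult[OF sq_diff[OF s(4) s(5)] sq_measurable[OF s(1)] b(2)]
        sq_bdd_mult[OF s(5) m bd])
  also have "\<dots> \<le> \<bar>C\<bar> * nrm M (\<lambda>x. Xn n x - X x) + nrm M (\<lambda>x. (bn n x - b x) * X x)"
    using nrm_bdd_mult[OF sq_diff[OF s(4)[of n] s(5)] sq_measurable[OF s(1)[of n]] b(2)[of n]] by simp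
  finally show "nrm M (\<lambda>x. bn n x * Xn n x - b x * X x) \<le> \<dots>" .
qed

text \<open>The excess of the limit over \<open>C\<close> is at most its distance to each member of the sequence.\<close>

lemma conv_AE_bound:
  assumes "conv M hn h" "\<And>n. AE x in M. \<bar>hn n x\<bar> \<le> C"
  shows "AE x in M. \<bar>h x\<bar> \<le> C"
proof -
  note s = convD[OF assms(1)]
  note [measurable] = sq_measurable[OF s(1)] sq_measurable[OF s(2)]
  let ?e = "\<lambda>x. max 0 (\<bar>h x\<bar> - C)"
  have le: "AE x in M. \<bar>?e x\<bar> \<le> \<bar>hn n x - h x\<bar>" for n
    using assms(2)[of n] by eventually_elim linarith
  have se: "sq M ?e"
    by (rule sq_bound[OF sq_diff[OF s(1)[of 0] s(2)], where C = 1]) (use le[of 0] in auto)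
  have "nrm M ?e \<le> nrm M (\<lambda>x. hn n x - h x)" for n
    by (rule nrm_mono[OF sq_diff[OF s(1) s(2)] _ le]) simp
  then have "nrm M ?e \<le> 0" by (intro LIMSEQ_le_const[OF s(3)]) auto
  then have "AE x in M. ?e x = 0" by (intro nrm_eq_0_AE[OF se]) (simp add: order.antisym)
  then show ?thesis by eventually_elim linarith
qed

lemma quadratic_growth_tendsto:
  fixes j :: "real \<Rightarrow> real"
  assumes "conv M hn h" and L: "\<And>a b. \<bar>j a - j b\<bar> \<le> K * (\<bar>a\<bar> + \<bar>b\<bar>) * \<bar>a - b\<bar>" and "j 0 = 0"
    and [measurable]: "j \<in> borel_measurable borel"
  shows "(\<lambda>n. \<integral>x. j (hn n x) \<partial>M) \<longlonglongrightarrow> (\<integral>x. j (h x) \<partial>M)"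
    and "integrable M (\<lambda>x. j (h x))"
proof -
  note s = convD[OF assms(1)]
  note [measurable] = sq_measurable[OF s(1)] sq_measurable[OF s(2)]
  have int: "integrable M (\<lambda>x. j (g x))" if "sq M g" for g
  proof (rule Bochner_Integration.integrable_bound[of M "\<lambda>x. K * (g x)\<^sup>2"])
    show "integrable M (\<lambda>x. K * (g x)\<^sup>2)" using that by (auto simp: sq_def)
    show "(\<lambda>x. j (g x)) \<in> borel_measurable M" using sq_measurable[OF that] by measurable
    have "\<bar>j a\<bar> \<le> \<bar>K * a\<^sup>2\<bar>" for a
      using L[of a 0] \<open>j 0 = 0\<close> by (auto simp: power2_eq_square ac_simps)
    then show "AE x in M. norm (j (g x)) \<le> norm (K * (g x)\<^sup>2)" by simp
  qed
  show "integrable M (\<lambda>x. j (h x))" by (rule int[OF s(2)])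
  have sa: "sq M (\<lambda>x. \<bar>g x\<bar>)" if "sq M g" for g using that by (auto simp: sq_def)
  have na: "nrm M (\<lambda>x. \<bar>g x\<bar>) = nrm M g" for g by (simp add: nrm_def)
  have t0: "(\<lambda>n. \<bar>K\<bar> * ((nrm M (hn n) + nrm M h) * nrm M (\<lambda>x. hn n x - h x))) \<longlonglongrightarrow> 0"
    using tendsto_mult_left[OF tendsto_mult[OF tendsto_add[OF conv_nrm[OF assms(1)] tendsto_const[of "nrm M h"]] s(3)], of "\<bar>K\<bar>"]
    by simp
  show "(\<lambda>n. \<integral>x. j (hn n x) \<partial>M) \<longlonglongrightarrow> (\<integral>x. j (h x) \<partial>M)"
  proof (rule LIM_zero_cancel, rule tendsto_rabs_zero_cancel, rule tendsto_sandwich[OF _ _ tendsto_const t0])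
    have "\<bar>(\<integral>x. j (hn n x) \<partial>M) - (\<integral>x. j (h x) \<partial>M)\<bar> \<le>
        \<bar>K\<bar> * ((nrm M (hn n) + nrm M h) * nrm M (\<lambda>x. hn n x - h x))" for n
    proof -
      let ?p = "\<lambda>x. (\<bar>hn n x\<bar> + \<bar>h x\<bar>) * \<bar>hn n x - h x\<bar>"
      have sp: "sq M (\<lambda>x. \<bar>hn n x\<bar> + \<bar>h x\<bar>)" "sq M (\<lambda>x. \<bar>hn n x - h x\<bar>)"
        by (intro sq_add sa sq_diff s)+
      have "\<bar>(\<integral>x. j (hn n x) \<partial>M) - (\<integral>x. j (h x) \<partial>M)\<bar> = \<bar>\<integral>x. j (hn n x) - j (h x) \<partial>M\<bar>"
        using int[OF s(1)[of n]] int[OF s(2)] by simp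
      also have "\<dots> \<le> (\<integral>x. \<bar>j (hn n x) - j (h x)\<bar> \<partial>M)" by (rule integral_abs_bound)
      also have "\<dots> \<le> (\<integral>x. \<bar>K\<bar> * ?p x \<partial>M)"
      proof (rule integral_mono)
        show "integrable M (\<lambda>x. \<bar>K\<bar> * ?p x)" using sq_mult_integrable[OF sp] by simp
        show "\<bar>j (hn n x) - j (h x)\<bar> \<le> \<bar>K\<bar> * ?p x" for x
          by (rule order_trans[OF L]) (auto simp: mult.assoc intro!: mult_right_mono)
      qed (use int[OF s(1)[of n]] int[OF s(2)] in auto)
      also have "\<dots> = \<bar>K\<bar> * (\<integral>x. ?p x \<partial>M)" by simp
      also have "\<dots> \<le> \<bar>K\<bar> * (nrm M (\<lambda>x. \<bar>hn n x\<bar> + \<bar>h x\<bar>) * nrm M (\<lambda>x. \<bar>hn n x - h x\<bar>))"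
        using Cauchy_Schwarz_integral[OF sp] by (intro mult_left_mono) auto
      also have "\<dots> \<le> \<bar>K\<bar> * ((nrm M (hn n) + nrm M h) * nrm M (\<lambda>x. hn n x - h x))"
        using nrm_triangle[OF sa[OF s(1)[of n]] sa[OF s(2)]]
        by (intro mult_left_mono mult_mono) (auto simp: na)
      finally show ?thesis .
    qed
    then show "\<forall>\<^sub>F n in sequentially. \<bar>(\<integral>x. j (hn n x) \<partial>M) - (\<integral>x. j (h x) \<partial>M)\<bar> \<le>
        \<bar>K\<bar> * ((nrm M (hn n) + nrm M h) * nrm M (\<lambda>x. hn n x - h x))" by simp
  qed simp
qed

section \<open>Absolutely continuous functions of time\<close>

text \<open>Over a fine partition the squares of the increments of a continuous monotone function add up to
  little.  In the chain rule this takes the place of differentiation almost everywhere.\<close>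

lemma square_increments_constant:
  fixes \<Phi> V :: "real \<Rightarrow> real"
  assumes "s \<le> t" and cont: "continuous_on {s..t} V"
    and V: "\<And>a b. s \<le> a \<Longrightarrow> a \<le> b \<Longrightarrow> b \<le> t \<Longrightarrow> V a \<le> V b"
    and \<Phi>: "\<And>a b. s \<le> a \<Longrightarrow> a \<le> b \<Longrightarrow> b \<le> t \<Longrightarrow> \<bar>\<Phi> b - \<Phi> a\<bar> \<le> C * (V b - V a)\<^sup>2"
  shows "\<Phi> t = \<Phi> s"
proof (cases "s < t")
  case False then show ?thesis using \<open>s \<le> t\<close> by simp
next
  case True
  have key: "\<bar>\<Phi> t - \<Phi> s\<bar> \<le> \<bar>C\<bar> * (V t - V s) * e" if "e > 0" for e
  proof -
    have "uniformly_continuous_on {s..t} V"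
      by (rule compact_uniformly_continuous[OF cont]) simp
    then obtain d where "d > 0" and d: "\<And>a b. a \<in> {s..t} \<Longrightarrow> b \<in> {s..t} \<Longrightarrow> dist b a < d \<Longrightarrow> dist (V b) (V a) < e"
      unfolding uniformly_continuous_on_def using \<open>e > 0\<close> by metis
    obtain N :: nat where N: "(t - s) / d < real N" using reals_Archimedean2 by blast
    then have "N > 0" using True \<open>d > 0\<close> by (metis divide_pos_pos diff_gt_0_iff_gt less_trans of_nat_0_less_iff)
    define p where "p i = s + real i * ((t - s) / real N)" for i
    have p0: "p 0 = s" and pN: "p N = t" using \<open>N > 0\<close> by (auto simp: p_def)
    have step: "p (Suc i) - p i = (t - s) / real N" for i
      unfolding p_def of_nat_Suc by algebra
    have stepd: "(t - s) / real N < d" using N \<open>N > 0\<close> \<open>d > 0\<close> by (simp add: field_simps)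
    have pm: "p i \<le> p (Suc i)" for i using step[of i] True by (smt (verit) divide_nonneg_nonneg of_nat_0_le_iff)
    have pin: "p i \<in> {s..t}" if "i \<le> N" for i
    proof -
      have "real i * ((t - s) / real N) \<le> real N * ((t - s) / real N)"
        using that True by (intro mult_right_mono) auto
      then show ?thesis using True \<open>N > 0\<close> by (auto simp: p_def)
    qed
    have "\<bar>\<Phi> (p n) - \<Phi> s\<bar> \<le> \<bar>C\<bar> * (V (p n) - V s) * e" if "n \<le> N" for n
      using that
    proof (induction n)
      case (Suc n)
      have in': "p n \<in> {s..t}" "p (Suc n) \<in> {s..t}" using pin[of n] pin[of "Suc n"] Suc.prems by auto
      let ?D = "V (p (Suc n)) - V (p n)"
      have D0: "0 \<le> ?D" using V[of "p n" "p (Suc n)"] in' pm[of n] by auto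
      have De: "?D \<le> e" using d[OF in'] step[of n] stepd True pm[of n] by (auto simp: dist_real_def)
      have "\<bar>\<Phi> (p (Suc n)) - \<Phi> (p n)\<bar> \<le> C * ?D\<^sup>2" using \<Phi>[of "p n" "p (Suc n)"] in' pm[of n] by auto
      also have "\<dots> \<le> \<bar>C\<bar> * ?D\<^sup>2" by (intro mult_right_mono) auto
      also have "\<dots> \<le> \<bar>C\<bar> * (?D * e)"
        unfolding power2_eq_square using D0 De by (intro mult_left_mono) auto
      finally have "\<bar>\<Phi> (p (Suc n)) - \<Phi> (p n)\<bar> \<le> \<bar>C\<bar> * (?D * e)" .
      moreover have "\<bar>\<Phi> (p n) - \<Phi> s\<bar> \<le> \<bar>C\<bar> * (V (p n) - V s) * e" using Suc by simp
      moreover have "\<bar>C\<bar> * (?D * e) + \<bar>C\<bar> * (V (p n) - V s) * e = \<bar>C\<bar> * (V (p (Suc n)) - V s) * e"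
        by (simp add: algebra_simps)
      ultimately show ?case by linarith
    qed (simp add: p0)
    from this[of N] show ?thesis by (simp add: pN)
  qed
  have small: "\<bar>\<Phi> t - \<Phi> s\<bar> \<le> e" if "e > 0" for e
  proof -
    have A: "0 \<le> \<bar>C\<bar> * (V t - V s)" using V[of s t] True by auto
    have "\<bar>\<Phi> t - \<Phi> s\<bar> \<le> \<bar>C\<bar> * (V t - V s) * (e / (\<bar>C\<bar> * (V t - V s) + 1))"
      by (rule key) (use A that in auto)
    also have "\<dots> \<le> e" using A that by (simp add: field_simps)
    finally show ?thesis .
  qed
  have "\<bar>\<Phi> t - \<Phi> s\<bar> \<le> 0" by (rule field_le_epsilon) (use small in simp)
  then show ?thesis by simp
qed

lemma set_integrable_split:
  fixes f :: "real \<Rightarrow> real"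
  assumes "set_integrable lborel {s..t} f" "s \<le> a" "a \<le> b" "b \<le> t"
  shows "(LINT r:{s..b}|lborel. f r) - (LINT r:{s..a}|lborel. f r) = (LINT r:{a..b}|lborel. f r)"
proof -
  have i: "set_integrable lborel {p..q} f" if "s \<le> p" "q \<le> t" for p q
    by (rule set_integrable_subset[OF assms(1)]) (use that in auto)
  have e: "(LINT r:{p..q}|lborel. f r) = integral {p..q} f" if "s \<le> p" "q \<le> t" for p q
    by (rule set_borel_integral_eq_integral(2)[OF i[OF that]])
  have "integral {s..a} f + integral {a..b} f = integral {s..b} f"
    by (rule Henstock_Kurzweil_Integration.integral_combine)
      (use assms set_borel_integral_eq_integral(1)[OF i[of s b]] in auto)
  then show ?thesis using assms by (simp add: e)
qed

lemma set_integral_continuous: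
  fixes f :: "real \<Rightarrow> real"
  assumes "set_integrable lborel {s..t} f"
  shows "continuous_on {s..t} (\<lambda>r. LINT q:{s..r}|lborel. f q)"
proof -
  have "continuous_on {s..t} (\<lambda>r. integral {s..r} f)"
    by (rule indefinite_integral_continuous_1[OF set_borel_integral_eq_integral(1)[OF assms]])
  moreover have "(LINT q:{s..r}|lborel. f q) = integral {s..r} f" if "r \<in> {s..t}" for r
    by (rule set_borel_integral_eq_integral(2)[OF set_integrable_subset[OF assms]]) (use that in auto)
  ultimately show ?thesis by (metis (no_types, lifting) continuous_on_eq)
qed

lemma set_integrable_continuous_mult:
  fixes f g :: "real \<Rightarrow> real"
  assumes "set_integrable lborel {s..t} f" "continuous_on {s..t} g"
  shows "set_integrable lborel {s..t} (\<lambda>r. g r * f r)"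
proof -
  have m: "(\<lambda>r. indicator {s..t} r *\<^sub>R g r) \<in> borel_measurable lborel"
    using borel_measurable_continuous_on_indicator[OF _ assms(2)] by simp
  have "bounded (g ` {s..t})" by (rule compact_imp_bounded[OF compact_continuous_image[OF assms(2)]]) simp
  then obtain B where "\<forall>z\<in>g ` {s..t}. \<bar>z\<bar> \<le> B" unfolding bounded_iff by auto
  then have B: "\<And>r. r \<in> {s..t} \<Longrightarrow> \<bar>g r\<bar> \<le> B" by blast
  have "integrable lborel (\<lambda>r. (indicator {s..t} r *\<^sub>R g r) * (indicator {s..t} r *\<^sub>R f r))"
  proof (rule Bochner_Integration.integrable_bound[of lborel "\<lambda>r. B * (indicator {s..t} r *\<^sub>R f r)"])
    show "integrable lborel (\<lambda>r. B * (indicator {s..t} r *\<^sub>R f r))"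
      using assms(1) unfolding set_integrable_def by (rule integrable_mult_right)
    show "(\<lambda>r. (indicator {s..t} r *\<^sub>R g r) * (indicator {s..t} r *\<^sub>R f r)) \<in> borel_measurable lborel"
      using m assms(1) unfolding set_integrable_def by (intro borel_measurable_times) auto
    show "AE r in lborel. norm ((indicator {s..t} r *\<^sub>R g r) * (indicator {s..t} r *\<^sub>R f r))
        \<le> norm (B * (indicator {s..t} r *\<^sub>R f r))"
    proof (rule AE_I2)
      fix r show "norm ((indicator {s..t} r *\<^sub>R g r) * (indicator {s..t} r *\<^sub>R f r))
        \<le> norm (B * (indicator {s..t} r *\<^sub>R f r))"
        using B[of r] by (cases "r \<in> {s..t}") (auto simp: abs_mult intro!: mult_right_mono)
    qed
  qed
  moreover have "(\<lambda>r. (indicator {s..t} r *\<^sub>R g r) * (indicator {s..t} r *\<^sub>R f r)) =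
      (\<lambda>r. indicator {s..t} r *\<^sub>R (g r * f r))"
    by (auto simp: indicator_def)
  ultimately show ?thesis unfolding set_integrable_def by simp
qed

text \<open>The inner function is an indefinite Lebesgue integral and need not be differentiable everywhere.  But the
  increments of the difference of the two sides are of second order in those of \<open>\<integral> \<bar>a\<bar>\<close>, so
  the difference is constant.\<close>

lemma chain_rule_indefinite_integral:
  fixes y a j j' :: "real \<Rightarrow> real"
  assumes "s \<le> t" and a: "set_integrable lborel {s..t} a"
    and y: "\<And>r. r \<in> {s..t} \<Longrightarrow> y r = y s + (LINT q:{s..r}|lborel. a q)"
    and j: "\<And>x. (j has_real_derivative j' x) (at x)"
    and K: "\<And>x z. \<bar>j' x - j' z\<bar> \<le> K * \<bar>x - z\<bar>"
  shows "j (y t) - j (y s) = (LINT r:{s..t}|lborel. j' (y r) * a r)"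
proof -
  have K0: "0 \<le> K" using K[of 1 0] by simp
  have ycont: "continuous_on {s..t} y"
  proof -
    have "continuous_on {s..t} (\<lambda>r. y s + (LINT q:{s..r}|lborel. a q))"
      by (intro continuous_intros set_integral_continuous a)
    then show ?thesis by (rule continuous_on_eq) (rule y[symmetric])
  qed
  have "K-lipschitz_on UNIV j'" using K K0 by (auto simp: lipschitz_on_def dist_real_def)
  then have jc: "continuous_on UNIV j'" by (rule lipschitz_on_continuous_on)
  have jyc: "continuous_on {s..t} (\<lambda>r. j' (y r))"
    using continuous_on_compose2[OF jc ycont] by auto
  have aa: "set_integrable lborel {s..t} (\<lambda>r. \<bar>a r\<bar>)" by (rule set_integrable_abs[OF a])
  have ja: "set_integrable lborel {s..t} (\<lambda>r. j' (y r) * a r)"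
    by (rule set_integrable_continuous_mult[OF a jyc])
  \<comment> \<open>the total variation of \<open>y\<close>, continuous and monotone\<close>
  define V where "V r = (LINT q:{s..r}|lborel. \<bar>a q\<bar>)" for r
  define \<Phi> where "\<Phi> r = j (y r) - (LINT q:{s..r}|lborel. j' (y q) * a q)" for r
  have "\<Phi> t = \<Phi> s"
  proof (rule square_increments_constant[where V = V and C = "2 * K", OF \<open>s \<le> t\<close>])
    show "continuous_on {s..t} V" unfolding V_def by (rule set_integral_continuous[OF aa])
    have Vd: "V b - V c = (LINT q:{c..b}|lborel. \<bar>a q\<bar>)" if "s \<le> c" "c \<le> b" "b \<le> t" for b c
      unfolding V_def by (rule set_integrable_split[OF aa that])
    show mono: "V c \<le> V b" if "s \<le> c" "c \<le> b" "b \<le> t" for b c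
    proof -
      have "0 \<le> (LINT q:{c..b}|lborel. \<bar>a q\<bar>)" 
        unfolding set_lebesgue_integral_def by (intro integral_nonneg_AE) auto
      then show ?thesis using Vd[OF that] by simp
    qed
    fix c b assume cb: "s \<le> c" "c \<le> b" "b \<le> t"
    have sub: "set_integrable lborel {c..b} f" if "set_integrable lborel {s..t} f" for f :: "real \<Rightarrow> real"
      by (rule set_integrable_subset[OF that]) (use cb in auto)
    have yd: "\<bar>y q - y c\<bar> \<le> V b - V c" if q: "q \<in> {c..b}" for q
    proof -
      have "y q - y c = (LINT q:{c..q}|lborel. a q)"
      proof -
        have "y q = y s + (LINT q:{s..q}|lborel. a q)" "y c = y s + (LINT q:{s..c}|lborel. a q)"
          by (rule y, use cb q in simp)+
        moreover have "(LINT r:{s..q}|lborel. a r) - (LINT r:{s..c}|lborel. a r) = (LINT r:{c..q}|lborel. a r)"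
          by (rule set_integrable_split[OF a cb(1)]) (use cb q in auto)
        ultimately show ?thesis by linarith
      qed
      moreover have "\<bar>LINT q:{c..q}|lborel. a q\<bar> \<le> (LINT q:{c..q}|lborel. \<bar>a q\<bar>)"
        using set_integral_norm_bound[of lborel "{c..q}" a] sub[OF a]
          set_integrable_subset[OF a, of "{c..q}"] cb q by auto
      moreover have "(LINT q:{c..q}|lborel. \<bar>a q\<bar>) = V q - V c" using Vd[of c q] cb q by simp
      moreover have "V q \<le> V b" using mono[of q b] cb q by simp
      ultimately show ?thesis by linarith
    qed
    have lin: "\<bar>j u - j v - j' v * (u - v)\<bar> \<le> K * \<bar>u - v\<bar>\<^sup>2" for u v
    proof -
      have *: "\<exists>z. \<bar>z - v\<bar> \<le> \<bar>u - v\<bar> \<and> j u - j v = j' z * (u - v)"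
      proof (cases u v rule: linorder_cases)
        case less
        from MVT2[OF less, of j j'] j obtain z where "u < z" "z < v" "j v - j u = (v - u) * j' z" by auto
        then show ?thesis using less by (intro exI[of _ z]) (auto simp: algebra_simps)
      next
        case greater
        from MVT2[OF greater, of j j'] j obtain z where "v < z" "z < u" "j u - j v = (u - v) * j' z" by auto
        then show ?thesis using greater by (intro exI[of _ z]) (auto simp: algebra_simps)
      qed auto
      then obtain z where z: "\<bar>z - v\<bar> \<le> \<bar>u - v\<bar>" "j u - j v = j' z * (u - v)" by blast
      have "\<bar>j u - j v - j' v * (u - v)\<bar> = \<bar>j' z - j' v\<bar> * \<bar>u - v\<bar>"
        unfolding z(2) left_diff_distrib[symmetric] abs_mult by simp
      also have "\<dots> \<le> (K * \<bar>u - v\<bar>) * \<bar>u - v\<bar>"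
        using order_trans[OF K[of z v] mult_left_mono[OF z(1) K0]] by (rule mult_right_mono) simp
      finally show ?thesis by (simp add: power2_eq_square)
    qed
    have e1: "\<bar>j (y b) - j (y c) - j' (y c) * (y b - y c)\<bar> \<le> K * (V b - V c)\<^sup>2"
    proof -
      have "\<bar>y b - y c\<bar>\<^sup>2 \<le> (V b - V c)\<^sup>2" using yd[of b] cb by (intro power_mono) auto
      then show ?thesis using order_trans[OF lin mult_left_mono] K0 by blast
    qed
    have ybc: "y b - y c = (LINT q:{c..b}|lborel. a q)"
    proof -
      have "y b = y s + (LINT q:{s..b}|lborel. a q)" "y c = y s + (LINT q:{s..c}|lborel. a q)"
        by (rule y, use cb in simp)+
      then show ?thesis using set_integrable_split[OF a cb] by linarith
    qed
    have "\<bar>(LINT q:{c..b}|lborel. j' (y q) * a q) - j' (y c) * (y b - y c)\<bar>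
        = \<bar>LINT q:{c..b}|lborel. (j' (y q) - j' (y c)) * a q\<bar>"
      unfolding ybc using sub[OF ja] sub[OF a] by (simp add: left_diff_distrib set_integral_diff)
    also have "\<dots> \<le> (LINT q:{c..b}|lborel. \<bar>(j' (y q) - j' (y c)) * a q\<bar>)"
      using set_integral_norm_bound[of lborel "{c..b}" "\<lambda>q. (j' (y q) - j' (y c)) * a q"]
        sub[OF ja] sub[OF a] by (simp add: left_diff_distrib)
    also have "\<dots> \<le> (LINT q:{c..b}|lborel. K * (V b - V c) * \<bar>a q\<bar>)"
    proof (rule set_integral_mono)
      show "set_integrable lborel {c..b} (\<lambda>q. \<bar>(j' (y q) - j' (y c)) * a q\<bar>)"
        using sub[OF ja] sub[OF a] by (intro set_integrable_abs) (simp add: left_diff_distrib)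
      show "set_integrable lborel {c..b} (\<lambda>q. K * (V b - V c) * \<bar>a q\<bar>)" using sub[OF aa] by simp
      fix q assume "q \<in> {c..b}"
      have "\<bar>j' (y q) - j' (y c)\<bar> \<le> K * (V b - V c)"
        using order_trans[OF K mult_left_mono[OF yd[OF \<open>q \<in> {c..b}\<close>] K0]] .
      then show "\<bar>(j' (y q) - j' (y c)) * a q\<bar> \<le> K * (V b - V c) * \<bar>a q\<bar>"
        unfolding abs_mult by (intro mult_right_mono) auto
    qed
    also have "\<dots> = K * (V b - V c)\<^sup>2" using Vd[OF cb] by (simp add: power2_eq_square)
    finally have e2: "\<bar>(LINT q:{c..b}|lborel. j' (y q) * a q) - j' (y c) * (y b - y c)\<bar> \<le> K * (V b - V c)\<^sup>2" .
    have "\<Phi> b - \<Phi> c = j (y b) - j (y c) - (LINT q:{c..b}|lborel. j' (y q) * a q)"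
      unfolding \<Phi>_def using set_integrable_split[OF ja cb] by simp
    then show "\<bar>\<Phi> b - \<Phi> c\<bar> \<le> 2 * K * (V b - V c)\<^sup>2" using e1 e2 by linarith
  qed
  moreover have "(LINT q:{s..s}|lborel. j' (y q) * a q) = 0"
  proof -
    have "AE q in lborel. q \<noteq> s" by (rule AE_lborel_singleton)
    then have "AE q in lborel. indicator {s..s} q *\<^sub>R (j' (y q) * a q) = 0" by eventually_elim auto
    then show ?thesis unfolding set_lebesgue_integral_def by (rule integral_eq_zero_AE)
  qed
  ultimately show ?thesis unfolding \<Phi>_def by simp
qed

text \<open>While \<open>y\<close> stays above a level it falls at a fixed rate.  So it reaches the level, and it cannot climb
  back above it, because it would have to do so continuously and while falling.\<close>

lemma decay_of_differential_inequality:
  fixes y I :: "real \<Rightarrow> real"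
  assumes "0 < \<mu>" and y0: "\<And>t. 0 < t \<Longrightarrow> 0 \<le> y t"
    and I: "\<And>s t. 0 < s \<Longrightarrow> s \<le> t \<Longrightarrow> set_integrable lborel {s..t} I"
    and yI: "\<And>s t. 0 < s \<Longrightarrow> s \<le> t \<Longrightarrow> y t - y s = (LINT r:{s..t}|lborel. I r)"
    and ev: "\<And>e. 0 < e \<Longrightarrow> \<exists>T>0. AE r in lborel. T \<le> r \<longrightarrow> I r \<le> - \<mu> * y r + e"
  shows "(y \<longlongrightarrow> 0) at_top"
proof (rule tendstoI)
  fix e' :: real assume "0 < e'"
  define e where "e = e' / 2"
  have "0 < e" "e < e'" using \<open>0 < e'\<close> by (auto simp: e_def)
  define d where "d = \<mu> * e / 2"
  have "d > 0" using \<open>0 < \<mu>\<close> \<open>0 < e\<close> by (simp add: d_def)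
  obtain T where "T > 0" and T: "AE r in lborel. T \<le> r \<longrightarrow> I r \<le> - \<mu> * y r + d" using ev[OF \<open>d > 0\<close>] by blast
  have drop: "y t \<le> y s - d * (t - s)" if st: "T \<le> s" "s \<le> t" and big: "\<And>r. s < r \<Longrightarrow> r \<le> t \<Longrightarrow> e < y r" for s t
  proof -
    have s0: "0 < s" using st \<open>T > 0\<close> by simp
    have "y t - y s = (LINT r:{s..t}|lborel. I r)" by (rule yI[OF s0 st(2)])
    also have "\<dots> \<le> (LINT r:{s..t}|lborel. - d)"
    proof (rule set_integral_mono_AE)
      show "set_integrable lborel {s..t} I" by (rule I[OF s0 st(2)])
      show "set_integrable lborel {s..t} (\<lambda>r. - d)" by (intro borel_integrable_atLeastAtMost' continuous_intros)
      show "AE r\<in>{s..t} in lborel. I r \<le> - d"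
        using T AE_lborel_singleton[of s]
      proof eventually_elim
        case (elim r)
        show ?case
        proof
          assume r: "r \<in> {s..t}"
          have "\<mu> * e \<le> \<mu> * y r" using big[of r] r elim(2) \<open>0 < \<mu>\<close> by (intro mult_left_mono) auto
          then show "I r \<le> - d" using elim(1) r st unfolding d_def by auto
        qed
      qed
    qed
    also have "\<dots> = - d * (t - s)" using st by (simp add: set_lebesgue_integral_def)
    finally show ?thesis by simp
  qed
  have "\<exists>t0\<ge>T. y t0 \<le> e"
  proof (rule ccontr)
    assume "\<not> ?thesis"
    then have big: "\<And>r. T \<le> r \<Longrightarrow> e < y r" by force
    obtain n :: nat where n: "y T / d < real n" using reals_Archimedean2 by blast
    have "y (T + real n) \<le> y T - d * real n" using drop[of T "T + real n"] big by simp
    moreover have "y T < d * real n" using n \<open>d > 0\<close> by (simp add: field_simps)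
    ultimately show False using y0[of "T + real n"] \<open>T > 0\<close> by simp
  qed
  then obtain t0 where t0: "T \<le> t0" "y t0 \<le> e" by blast
  have t00: "0 < t0" using t0 \<open>T > 0\<close> by simp
  have "y t \<le> e" if t: "t0 \<le> t" for t
  proof (rule ccontr)
    assume "\<not> y t \<le> e"
    have yc: "continuous_on {t0..t} y"
    proof -
      have "continuous_on {t0..t} (\<lambda>r. y t0 + (LINT q:{t0..r}|lborel. I q))"
        by (intro continuous_intros set_integral_continuous I t00 t)
      moreover have "y r = y t0 + (LINT q:{t0..r}|lborel. I q)" if "r \<in> {t0..t}" for r
        using yI[OF t00, of r] that by simp
      ultimately show ?thesis by (metis (no_types, lifting) continuous_on_eq)
    qed
    define S where "S = {r \<in> {t0..t}. y r \<le> e}"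
    have "closed S" unfolding S_def
      by (rule continuous_on_closed_Collect_le) (auto intro: yc)
    have ne: "t0 \<in> S" using t0 t by (simp add: S_def)
    have bd: "bdd_above S" by (auto simp: S_def bdd_above_def)
    define s where "s = Sup S"
    have sS: "s \<in> S" unfolding s_def by (rule closed_contains_Sup[OF _ bd \<open>closed S\<close>]) (use ne in auto)
    have big: "e < y r" if "s < r" "r \<le> t" for r
    proof (rule ccontr)
      assume "\<not> e < y r"
      then have "r \<in> S" using that sS by (auto simp: S_def)
      then have "r \<le> s" unfolding s_def by (rule cSup_upper[OF _ bd])
      then show False using that by simp
    qed
    have "y t \<le> y s - d * (t - s)" by (rule drop) (use sS t0 big in \<open>auto simp: S_def\<close>)
    moreover have "0 \<le> d * (t - s)" using \<open>d > 0\<close> sS by (auto simp: S_def)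
    ultimately show False using sS \<open>\<not> y t \<le> e\<close> by (auto simp: S_def)
  qed
  then show "\<forall>\<^sub>F t in at_top. dist (y t) 0 < e'"
    using y0 t00 \<open>e < e'\<close> by (intro eventually_at_top_linorderI[of t0]) (force simp: dist_real_def)
qed

section \<open>Iterated integrals and partial derivatives in the plane\<close>

definition vec2 :: "real \<times> real \<Rightarrow> real^2" where "vec2 p = vector [fst p, snd p]"

lemma vec2_nth [simp]: "vec2 p $ 1 = fst p" "vec2 p $ 2 = snd p"
  by (simp_all add: vec2_def)

lemma vec2_conv: "vec2 p = fst p *\<^sub>R axis 1 1 + snd p *\<^sub>R axis 2 1"
  by (simp add: vec_eq_iff forall_2 axis_def)

lemma continuous_on_vec2 [continuous_intros]: "continuous_on S vec2"
  unfolding vec2_conv by (intro continuous_intros)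

lemma measurable_vec2 [measurable]: "vec2 \<in> borel_measurable borel"
  by (intro borel_measurable_continuous_onI continuous_on_vec2)

lemma Basis_plane: "(Basis :: (real^2) set) = {axis 1 1, axis 2 1}"
  by (auto simp: Basis_vec_def UNIV_2)

lemma mem_cbox_plane: "x \<in> cbox a b \<longleftrightarrow> a$1 \<le> x$1 \<and> x$1 \<le> b$1 \<and> a$2 \<le> x$2 \<and> x$2 \<le> (b::real^2)$2"
  by (auto simp: mem_box_cart forall_2)

lemma mem_box_plane: "x \<in> box a b \<longleftrightarrow> a$1 < x$1 \<and> x$1 < b$1 \<and> a$2 < x$2 \<and> x$2 < (b::real^2)$2"
  by (auto simp: mem_box_cart forall_2)

lemma lborel_plane: "lborel = distr (lborel \<Otimes>\<^sub>M lborel) borel vec2"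
proof (rule lborel_eqI)
  fix l u :: "real^2" assume lu: "\<And>b. b \<in> Basis \<Longrightarrow> l \<bullet> b \<le> u \<bullet> b"
  have lu': "l$1 \<le> u$1" "l$2 \<le> u$2" using lu[of "axis 1 1"] lu[of "axis 2 1"] by (auto simp: Basis_plane inner_axis)
  have ne: "axis 1 (1::real) \<noteq> (axis 2 1 :: real^2)" by (simp add: axis_eq_axis)
  have "vec2 -` box l u \<inter> space (lborel \<Otimes>\<^sub>M lborel) = box (l$1) (u$1) \<times> box (l$2) (u$2)"
    by (auto simp: mem_box_plane space_pair_measure)
  moreover have "vec2 \<in> measurable (lborel \<Otimes>\<^sub>M lborel) borel" by (simp add: lborel_prod)
  ultimately have "emeasure (distr (lborel \<Otimes>\<^sub>M lborel) borel vec2) (box l u)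
      = emeasure (lborel \<Otimes>\<^sub>M lborel) (box (l$1) (u$1) \<times> box (l$2) (u$2))"
    by (simp add: emeasure_distr)
  also have "\<dots> = ennreal ((u$1 - l$1) * (u$2 - l$2))"
    using lu' by (simp add: lborel.emeasure_pair_measure_Times ennreal_mult)
  also have "\<dots> = (\<Prod>b\<in>Basis. (u - l) \<bullet> b)"
    using ne by (simp add: Basis_plane inner_axis)
  finally show "emeasure (distr (lborel \<Otimes>\<^sub>M lborel) borel vec2) (box l u) = (\<Prod>b\<in>Basis. (u - l) \<bullet> b)" .
qed simp

lemma integral_cbox_iterated:
  fixes f :: "real^2 \<Rightarrow> real"
  assumes "continuous_on UNIV f"
  shows "(LINT z:cbox a b|lborel. f z) = (LINT x:{a$1..b$1}|lborel. LINT y:{a$2..b$2}|lborel. f (vec2 (x, y)))"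
    and "(LINT z:cbox a b|lborel. f z) = (LINT y:{a$2..b$2}|lborel. LINT x:{a$1..b$1}|lborel. f (vec2 (x, y)))"
    and "set_integrable lborel {a$1..b$1} (\<lambda>x. LINT y:{a$2..b$2}|lborel. f (vec2 (x, y)))"
    and "set_integrable lborel {a$2..b$2} (\<lambda>y. LINT x:{a$1..b$1}|lborel. f (vec2 (x, y)))"
proof -
  let ?g = "\<lambda>z. indicator (cbox a b) z *\<^sub>R f z"
  let ?F = "\<lambda>x y. indicator {a$1..b$1} x *\<^sub>R (indicator {a$2..b$2} y *\<^sub>R f (vec2 (x, y)))"
  have F: "?g (vec2 p) = case_prod ?F p" for p
    by (auto simp: indicator_def mem_cbox_plane split: prod.splits)
  have mv: "vec2 \<in> measurable (lborel \<Otimes>\<^sub>M lborel) borel" by (simp add: lborel_prod)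
  have ig: "integrable lborel ?g"
    by (rule borel_integrable_compact) (auto intro: continuous_on_subset[OF assms])
  have mg: "?g \<in> borel_measurable borel" using borel_measurable_integrable[OF ig] by simp
  have iF: "integrable (lborel \<Otimes>\<^sub>M lborel) (case_prod ?F)"
    using ig integrable_distr_eq[OF mv mg] unfolding lborel_plane[symmetric] F by simp
  have e: "(LINT z:cbox a b|lborel. f z) = integral\<^sup>L (lborel \<Otimes>\<^sub>M lborel) (case_prod ?F)"
    using integral_distr[OF mv mg] unfolding lborel_plane[symmetric] F set_lebesgue_integral_def .
  have a1: "(\<integral>y. ?F x y \<partial>lborel) = indicator {a$1..b$1} x *\<^sub>R (LINT y:{a$2..b$2}|lborel. f (vec2 (x, y)))" for x
    unfolding set_lebesgue_integral_def by (rule integral_scaleR_right)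
  have a2: "(\<integral>x. ?F x y \<partial>lborel) = indicator {a$2..b$2} y *\<^sub>R (LINT x:{a$1..b$1}|lborel. f (vec2 (x, y)))" for y
    unfolding set_lebesgue_integral_def by (subst integral_scaleR_right[symmetric]) (simp add: ac_simps)
  show "(LINT z:cbox a b|lborel. f z) = (LINT x:{a$1..b$1}|lborel. LINT y:{a$2..b$2}|lborel. f (vec2 (x, y)))"
    unfolding e lborel_pair.integral_fst[OF iF, symmetric] a1 set_lebesgue_integral_def[of _ "{a$1..b$1}"] ..
  show "(LINT z:cbox a b|lborel. f z) = (LINT y:{a$2..b$2}|lborel. LINT x:{a$1..b$1}|lborel. f (vec2 (x, y)))"
    unfolding e lborel_pair.integral_snd[OF iF, symmetric] a2 set_lebesgue_integral_def[of _ "{a$2..b$2}"] ..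
  show "set_integrable lborel {a$1..b$1} (\<lambda>x. LINT y:{a$2..b$2}|lborel. f (vec2 (x, y)))"
    using lborel_pair.integrable_fst[OF iF] unfolding a1 set_integrable_def .
  show "set_integrable lborel {a$2..b$2} (\<lambda>y. LINT x:{a$1..b$1}|lborel. f (vec2 (x, y)))"
    using lborel_pair.integrable_snd[OF iF] unfolding a2 set_integrable_def .
qed

lemma AE_not_boundary: "AE x in lborel. x \<in> cbox a b \<longrightarrow> x \<in> box a (b :: 'a::euclidean_space)"
proof -
  have "emeasure lborel (cbox a b - box a b) = emeasure lborel (cbox a b) - emeasure lborel (box a b)"
    by (rule emeasure_Diff) (auto simp: emeasure_lborel_box_eq box_subset_cbox)
  then have "emeasure lborel (cbox a b - box a b) = 0" by (simp add: emeasure_lborel_box_eq emeasure_lborel_cbox_eq)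
  then have "cbox a b - box a b \<in> null_sets lborel" by (intro null_setsI) auto
  then have "AE x in lborel. x \<notin> cbox a b - box a b" by (rule AE_not_in)
  then show ?thesis by (auto elim: AE_mp)
qed

definition has_pd :: "2 \<Rightarrow> (real^2 \<Rightarrow> real) \<Rightarrow> (real^2 \<Rightarrow> real) \<Rightarrow> bool" where
  "has_pd i h d \<longleftrightarrow> (\<forall>x. ((\<lambda>s. h (x + s *\<^sub>R axis i 1)) has_real_derivative d x) (at 0))"

lemma has_pd_imp_pd: "has_pd i h d \<Longrightarrow> pd i h = d"
  unfolding has_pd_def pd_def by (intro ext DERIV_imp_deriv) auto

lemma has_pd_line:
  assumes "has_pd i h d"
  shows "((\<lambda>s. h (x + s *\<^sub>R axis i 1)) has_real_derivative d (x + s0 *\<^sub>R axis i 1)) (at s0)"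
proof -
  have "((\<lambda>s. h (x + s0 *\<^sub>R axis i 1 + s *\<^sub>R axis i 1)) has_real_derivative d (x + s0 *\<^sub>R axis i 1)) (at (s0 - s0))"
    using assms unfolding has_pd_def by simp
  then have "((\<lambda>s. h (x + s0 *\<^sub>R axis i 1 + (s - s0) *\<^sub>R axis i 1)) has_real_derivative d (x + s0 *\<^sub>R axis i 1)) (at s0)"
    using DERIV_shift[of "\<lambda>s. h (x + s0 *\<^sub>R axis i 1 + s *\<^sub>R axis i 1)" _ s0 "-s0"]
    by simp
  then show ?thesis by (simp add: algebra_simps)
qed

lemma has_pd_const: "has_pd i (\<lambda>x. c) (\<lambda>x. 0)"
  by (simp add: has_pd_def)

lemma has_pd_add: "has_pd i a a' \<Longrightarrow> has_pd i b b' \<Longrightarrow> has_pd i (\<lambda>x. a x + b x) (\<lambda>x. a' x + b' x)"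
  unfolding has_pd_def by (intro allI DERIV_add) auto

lemma has_pd_cmult: "has_pd i a a' \<Longrightarrow> has_pd i (\<lambda>x. c * a x) (\<lambda>x. c * a' x)"
  unfolding has_pd_def by (intro allI DERIV_cmult) auto

lemma has_pd_mult: "has_pd i a a' \<Longrightarrow> has_pd i b b' \<Longrightarrow> has_pd i (\<lambda>x. a x * b x) (\<lambda>x. a' x * b x + b' x * a x)"
  unfolding has_pd_def
proof (intro allI)
  fix x assume *: "\<forall>x. ((\<lambda>s. a (x + s *\<^sub>R axis i 1)) has_real_derivative a' x) (at 0)"
    "\<forall>x. ((\<lambda>s. b (x + s *\<^sub>R axis i 1)) has_real_derivative b' x) (at 0)"
  from DERIV_mult[OF *(1)[rule_format, of x] *(2)[rule_format, of x]]
  show "((\<lambda>s. a (x + s *\<^sub>R axis i 1) * b (x + s *\<^sub>R axis i 1)) has_real_derivative a' x * b x + b' x * a x) (at 0)"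
    by simp
qed

lemma has_pd_chain:
  assumes f: "\<And>y. (f has_real_derivative f' y) (at y)" and "has_pd i a a'"
  shows "has_pd i (\<lambda>x. f (a x)) (\<lambda>x. f' (a x) * a' x)"
  unfolding has_pd_def
proof
  fix x
  have "((\<lambda>s. a (x + s *\<^sub>R axis i 1)) has_real_derivative a' x) (at 0)" using assms(2) by (auto simp: has_pd_def)
  from DERIV_chain2[OF f this]
  show "((\<lambda>s. f (a (x + s *\<^sub>R axis i 1))) has_real_derivative f' (a x) * a' x) (at 0)" by simp
qed

lemma has_pd_sum: "(\<And>k. k \<in> K \<Longrightarrow> has_pd i (a k) (a' k)) \<Longrightarrow> has_pd i (\<lambda>x. \<Sum>k\<in>K. a k x) (\<lambda>x. \<Sum>k\<in>K. a' k x)"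
  by (induction K rule: infinite_finite_induct) (auto intro: has_pd_const has_pd_add)

lemma integral_pd_line:
  assumes "has_pd i h d" "continuous_on UNIV d" "p \<le> q"
  shows "(LINT s:{p..q}|lborel. d (x + s *\<^sub>R axis i 1)) = h (x + q *\<^sub>R axis i 1) - h (x + p *\<^sub>R axis i 1)"
proof -
  have c: "continuous_on {p..q} (\<lambda>s. d (x + s *\<^sub>R axis i 1))"
    by (rule continuous_on_compose2[OF assms(2)]) (auto intro!: continuous_intros)
  show ?thesis unfolding set_lebesgue_integral_def
    by (rule integral_FTC_atLeastAtMost[OF assms(3) _ c])
      (rule has_field_derivative_at_within[OF has_pd_line[OF assms(1)], unfolded has_real_derivative_iff_has_vector_derivative])
qed

lemma vec2_line: "vec2 (x, y) = vec2 (0, y) + x *\<^sub>R axis 1 1" "vec2 (x, y) = vec2 (x, 0) + y *\<^sub>R axis 2 1"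
  by (simp_all add: vec2_conv)

lemma axis_scaleR: "(axis i c :: real^2) = c *\<^sub>R axis i 1"
  by (simp add: vec_eq_iff axis_def)

text \<open>Integration in the direction of the derivative first leaves boundary values, which cancel by periodicity.\<close>

lemma integral_pd_periodic_zero:
  assumes per: "periodic L \<gamma> h" and pd: "has_pd i h d" and d: "continuous_on UNIV d" and "0 < L" "0 < \<gamma>"
  shows "(LINT x:Omega L \<gamma>|lborel. d x) = 0"
proof -
  have p: "h (x + (L / \<gamma>) *\<^sub>R axis 1 1) = h x" "h (x + L *\<^sub>R axis 2 1) = h x" for x
    using per unfolding periodic_def axis_scaleR[of 1 "L / \<gamma>"] axis_scaleR[of 2 L] by auto
  from exhaust_2[of i] show ?thesis
  proof
    assume i: "i = 1"
    have "(LINT x:{0..L / \<gamma>}|lborel. d (vec2 (x, y))) = 0" for y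
    proof -
      have "(\<lambda>x. d (vec2 (x, y))) = (\<lambda>s. d (vec2 (0, y) + s *\<^sub>R axis 1 1))"
        by (rule ext, subst vec2_line(1), rule refl)
      then show ?thesis
        using integral_pd_line[OF pd d, of 0 "L / \<gamma>" "vec2 (0, y)"] p(1)[of "vec2 (0, y)"] assms(4,5)
        unfolding i by simp
    qed
    then show ?thesis using integral_cbox_iterated(2)[OF d, of 0 "vector [L / \<gamma>, L]"]
      by (simp add: Omega_def)
  next
    assume i: "i = 2"
    have "(LINT y:{0..L}|lborel. d (vec2 (x, y))) = 0" for x
    proof -
      have "(\<lambda>y. d (vec2 (x, y))) = (\<lambda>s. d (vec2 (x, 0) + s *\<^sub>R axis 2 1))"
        by (rule ext, subst vec2_line(2), rule refl)
      then show ?thesis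
        using integral_pd_line[OF pd d, of 0 L "vec2 (x, 0)"] p(2)[of "vec2 (x, 0)"] assms(4,5)
        unfolding i by simp
    qed
    then show ?thesis using integral_cbox_iterated(1)[OF d, of 0 "vector [L / \<gamma>, L]"]
      by (simp add: Omega_def)
  qed
qed

section \<open>Fourier coefficients on the period rectangle\<close>

lemma conv_dominated:
  assumes "\<And>n. hn n \<in> borel_measurable M" "h \<in> borel_measurable M" "sq M g"
    and "AE x in M. (\<lambda>n. hn n x) \<longlonglongrightarrow> h x" "\<And>n. AE x in M. \<bar>hn n x\<bar> \<le> g x" "AE x in M. \<bar>h x\<bar> \<le> g x"
  shows "conv M hn h"
proof -
  have sn: "sq M (hn n)" for n
    by (rule sq_bound[OF assms(3,1), where C = 1]) (use assms(5)[of n] in eventually_elim, simp)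
  have s: "sq M h"
    by (rule sq_bound[OF assms(3,2), where C = 1]) (use assms(6) in eventually_elim, simp)
  have "(\<lambda>n. \<integral>x. (hn n x - h x)\<^sup>2 \<partial>M) \<longlonglongrightarrow> (\<integral>x. 0 \<partial>M)"
  proof (rule integral_dominated_convergence[where w = "\<lambda>x. 4 * (g x)\<^sup>2"])
    show "AE x in M. (\<lambda>n. (hn n x - h x)\<^sup>2) \<longlonglongrightarrow> 0"
      using assms(4)
    proof eventually_elim
      case (elim x)
      have "(\<lambda>n. (hn n x - h x)\<^sup>2) \<longlonglongrightarrow> (h x - h x)\<^sup>2" by (intro tendsto_intros elim)
      then show ?case by simp
    qed
    show "AE x in M. norm ((hn n x - h x)\<^sup>2) \<le> 4 * (g x)\<^sup>2" for n
      using assms(5)[of n] assms(6)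
    proof eventually_elim
      case (elim x)
      then have "\<bar>hn n x - h x\<bar> \<le> \<bar>2 * g x\<bar>" by linarith
      then show ?case unfolding abs_le_square_iff by (simp add: power_mult_distrib)
    qed
  qed (use assms in \<open>auto simp: sq_def\<close>)
  then have "(\<lambda>n. nrm M (\<lambda>x. hn n x - h x)) \<longlonglongrightarrow> 0"
    unfolding nrm_def using tendsto_real_sqrt[of _ 0] by fastforce
  then show ?thesis using sn s by (simp add: conv_def)
qed

locale cell =
  fixes L \<gamma> :: real
  assumes L0: "0 < L" and g0: "0 < \<gamma>"
begin

definition M :: "(real^2) measure" where "M = restrict_space lborel (Omega L \<gamma>)"
definition area :: real where "area = L\<^sup>2 / \<gamma>"

lemma area_pos: "0 < area" using L0 g0 by (simp add: area_def)

lemma mem_Omega: "x \<in> Omega L \<gamma> \<longleftrightarrow> 0 \<le> x$1 \<and> x$1 \<le> L / \<gamma> \<and> 0 \<le> x$2 \<and> x$2 \<le> L"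
  by (simp add: Omega_def mem_cbox_plane)

lemma Omega_sets [measurable, simp]: "Omega L \<gamma> \<in> sets borel" by (simp add: Omega_def)

lemma space_M: "space M = Omega L \<gamma>" by (simp add: M_def space_restrict_space)

lemma emeasure_Omega: "emeasure lborel (Omega L \<gamma>) = ennreal area"
proof -
  have ne: "axis 1 (1::real) \<noteq> (axis 2 1 :: real^2)" by (simp add: axis_eq_axis)
  have "emeasure lborel (Omega L \<gamma>) = (\<Prod>b\<in>Basis. (vector [L / \<gamma>, L] - 0 :: real^2) \<bullet> b)"
    unfolding Omega_def by (rule emeasure_lborel_cbox) (use L0 g0 in \<open>auto simp: Basis_plane inner_axis\<close>)
  also have "\<dots> = ennreal area" using ne by (simp add: Basis_plane inner_axis area_def power2_eq_square)
  finally show ?thesis .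
qed

lemma measure_Omega: "measure lborel (Omega L \<gamma>) = area"
  using area_pos by (simp add: measure_def emeasure_Omega)

lemma measure_M: "measure M (space M) = area"
  unfolding space_M unfolding M_def by (simp add: measure_restrict_space measure_Omega)

sublocale fm: finite_measure M
proof
  show "emeasure M (space M) \<noteq> \<infinity>"
    unfolding space_M unfolding M_def by (simp add: emeasure_restrict_space emeasure_Omega)
qed

lemma LINT_Omega: "(LINT x:Omega L \<gamma>|lborel. f x) = integral\<^sup>L M f" for f :: "real^2 \<Rightarrow> 'b::{banach, second_countable_topology}"
  unfolding M_def set_lebesgue_integral_def by (rule integral_restrict_space[symmetric]) simp

lemma integrable_Omega: "set_integrable lborel (Omega L \<gamma>) f \<longleftrightarrow> integrable M f" for f :: "real^2 \<Rightarrow> 'b::{banach, second_countable_topology}"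
  unfolding M_def set_integrable_def by (rule integrable_restrict_space[symmetric]) simp

lemma measurable_M: "f \<in> borel_measurable borel \<Longrightarrow> f \<in> borel_measurable M"
  unfolding M_def by (rule measurable_restrict_space1) simp

lemma bounded_sq: "f \<in> borel_measurable M \<Longrightarrow> (\<And>x. \<bar>f x\<bar> \<le> C) \<Longrightarrow> sq M f"
proof (rule sqI)
  assume f: "f \<in> borel_measurable M" and b: "\<And>x. \<bar>f x\<bar> \<le> C"
  show "integrable M (\<lambda>x. (f x)\<^sup>2)"
  proof (rule fm.integrable_const_bound[where B = "C\<^sup>2"])
    show "AE x in M. norm ((f x)\<^sup>2) \<le> C\<^sup>2"
    proof (rule AE_I2)
      fix x show "norm ((f x)\<^sup>2) \<le> C\<^sup>2" using power_mono[OF b[of x] abs_ge_zero, of 2] by simp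
    qed
  qed (use f in simp)
qed

lemma sq_const [simp]: "sq M (\<lambda>x. c)" by (rule bounded_sq[where C = "\<bar>c\<bar>"]) auto

lemma sq_imp_integrable: "sq M h \<Longrightarrow> integrable M h"
  using sq_mult_integrable[of M "\<lambda>x. 1" h] by simp

lemma continuous_measurable: "continuous_on UNIV f \<Longrightarrow> f \<in> borel_measurable M"
  by (intro measurable_M borel_measurable_continuous_onI)

lemma continuous_integrable: fixes f :: "real^2 \<Rightarrow> real" assumes "continuous_on UNIV f" shows "integrable M f"
  unfolding integrable_Omega[symmetric] set_integrable_def Omega_def
  by (rule borel_integrable_compact) (auto intro: continuous_on_subset[OF assms])

lemma continuous_sq: assumes "continuous_on UNIV f" shows "sq M f"
  using assms by (intro sqI continuous_measurable continuous_integrable continuous_intros)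

subsection \<open>Trigonometric functions, coefficients and partial sums\<close>

text \<open>The wave vector of a mode of the period rectangle, so that \<open>kap 1 k x\<^sub>1 + kap 2 k x\<^sub>2\<close> is its phase.\<close>

definition kap :: "2 \<Rightarrow> int \<times> int \<Rightarrow> real" where
  "kap i k = 2 * pi * (if i = 1 then \<gamma> * of_int (fst k) else of_int (snd k)) / L"

definition ph :: "int \<times> int \<Rightarrow> real^2 \<Rightarrow> real" where "ph k x = kap 1 k * x$1 + kap 2 k * x$2"
definition cs :: "int \<times> int \<Rightarrow> real^2 \<Rightarrow> real" where "cs k x = cos (ph k x)"
definition sn :: "int \<times> int \<Rightarrow> real^2 \<Rightarrow> real" where "sn k x = sin (ph k x)"

lemma kap_0 [simp]: "kap i 0 = 0" by (simp add: kap_def)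
lemma kap_uminus [simp]: "kap i (- k) = - kap i k" by (simp add: kap_def)
lemma kap_add: "kap i (k + l) = kap i k + kap i l" by (simp add: kap_def add_divide_distrib distrib_left)
lemma kap_diff: "kap i (k - l) = kap i k - kap i l" by (simp add: kap_def diff_divide_distrib right_diff_distrib)

lemma kap_eq_0: "kap 1 k = 0 \<longleftrightarrow> fst k = 0" "kap 2 k = 0 \<longleftrightarrow> snd k = 0"
  using L0 g0 by (simp_all add: kap_def)

lemma ph_simps [simp]: "ph 0 x = 0" "ph (- k) x = - ph k x" "ph (k + l) x = ph k x + ph l x" "ph (k - l) x = ph k x - ph l x"
  by (simp_all add: ph_def kap_add kap_diff algebra_simps)

lemma cs_0 [simp]: "cs 0 = (\<lambda>x. 1)" and sn_0 [simp]: "sn 0 = (\<lambda>x. 0)"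
  by (simp_all add: cs_def sn_def fun_eq_iff)

lemma cs_uminus [simp]: "cs (- k) = cs k" and sn_uminus [simp]: "sn (- k) = (\<lambda>x. - sn k x)"
  by (simp_all add: cs_def sn_def fun_eq_iff)

lemma cs_le: "\<bar>cs k x\<bar> \<le> 1" "\<bar>sn k x\<bar> \<le> 1" by (simp_all add: cs_def sn_def)

lemma continuous_cs [continuous_intros]: "continuous_on S (cs k)" "continuous_on S (sn k)"
  unfolding cs_def[abs_def] sn_def[abs_def] ph_def by (intro continuous_intros)+

lemma cs_measurable [measurable]: "cs k \<in> borel_measurable M" "sn k \<in> borel_measurable M"
  by (intro continuous_measurable continuous_intros)+

lemma cs_measurable' [measurable]: "cs k \<in> borel_measurable borel" "sn k \<in> borel_measurable borel"
  by (intro borel_measurable_continuous_onI continuous_intros)+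

lemma cs_sq [simp]: "sq M (cs k)" "sq M (sn k)" by (intro continuous_sq continuous_intros)+

lemma ph_line: "ph k (x + s *\<^sub>R axis i 1) = ph k x + s * kap i k"
  using exhaust_2[of i] by (auto simp: ph_def axis_def algebra_simps)

lemma has_pd_cs: "has_pd i (cs k) (\<lambda>x. - kap i k * sn k x)" "has_pd i (sn k) (\<lambda>x. kap i k * cs k x)"
  unfolding has_pd_def cs_def sn_def ph_line
  by (auto intro!: derivative_eq_intros)

lemma periodic_cs: "periodic L \<gamma> (cs k)" "periodic L \<gamma> (sn k)"
proof -
  have a: "ph k (x + axis 1 (L / \<gamma>)) = ph k x + 2 * pi * of_int (fst k)" "ph k (x + axis 2 L) = ph k x + 2 * pi * of_int (snd k)" for x
    using L0 g0 axis_scaleR[of 1 "L / \<gamma>"] axis_scaleR[of 2 L] ph_line[of k x "L/\<gamma>" 1] ph_line[of k x L 2]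
    by (simp_all add: kap_def)
  show "periodic L \<gamma> (cs k)" "periodic L \<gamma> (sn k)"
    unfolding periodic_def cs_def sn_def a by (simp_all add: cos_add sin_add)
qed

lemma differentiable_cs: "cs k differentiable_on UNIV" "sn k differentiable_on UNIV"
proof -
  have l: "bounded_linear (ph k)" unfolding ph_def
    by (intro bounded_linear_add bounded_linear_const_mult bounded_linear_vec_nth)
  have d: "(ph k has_derivative ph k) (at x within UNIV)" for x by (rule bounded_linear_imp_has_derivative[OF l])
  have "((\<lambda>x. cos (ph k x)) has_derivative (\<lambda>h. - sin (ph k x) * ph k h)) (at x)"
    "((\<lambda>x. sin (ph k x)) has_derivative (\<lambda>h. cos (ph k x) * ph k h)) (at x)" for x
    by (rule derivative_eq_intros d refl ext | simp add: mult.commute)+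
  then show "cs k differentiable_on UNIV" "sn k differentiable_on UNIV"
    unfolding differentiable_on_def differentiable_def cs_def[abs_def] sn_def[abs_def]
    by blast+
qed

lemma Ck_trig: "Ck n (\<lambda>x. c * cs k x + d * sn k x)"
proof (induction n arbitrary: c d)
  case 0 show ?case by (auto intro!: continuous_intros)
next
  case (Suc n)
  have "pd i (\<lambda>x. c * cs k x + d * sn k x) = (\<lambda>x. (d * kap i k) * cs k x + (- (c * kap i k)) * sn k x)" for i
    by (subst has_pd_imp_pd[OF has_pd_add[OF has_pd_cmult[OF has_pd_cs(1)] has_pd_cmult[OF has_pd_cs(2)]]])
      (simp add: fun_eq_iff)
  then have "Ck n (pd i (\<lambda>x. c * cs k x + d * sn k x))" for i using Suc by (simp only:)
  moreover have "(\<lambda>x. c * cs k x + d * sn k x) differentiable_on UNIV"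
    using differentiable_cs[of k] by (intro derivative_intros) auto
  ultimately show ?case by simp
qed

lemma test_function_cs: "test_function L \<gamma> (cs k)" "test_function L \<gamma> (sn k)"
  using periodic_cs[of k] Ck_trig[of _ 1 k 0] Ck_trig[of _ 0 k 1] by (auto simp: test_function_def)

lemma pd_cs: "pd i (cs k) = (\<lambda>x. - kap i k * sn k x)" "pd i (sn k) = (\<lambda>x. kap i k * cs k x)"
  by (rule has_pd_imp_pd[OF has_pd_cs(1)], rule has_pd_imp_pd[OF has_pd_cs(2)])

lemma int_pd_zero: "periodic L \<gamma> h \<Longrightarrow> has_pd i h d \<Longrightarrow> continuous_on UNIV d \<Longrightarrow> (\<integral>x. d x \<partial>M) = 0"
  using integral_pd_periodic_zero[of L \<gamma> h i d] L0 g0 by (simp add: LINT_Omega)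

lemma int_cs: "(\<integral>x. cs k x \<partial>M) = (if k = 0 then area else 0)" and int_sn: "(\<integral>x. sn k x \<partial>M) = 0"
proof -
  have z: "(\<integral>x. cs k x \<partial>M) = 0 \<and> (\<integral>x. sn k x \<partial>M) = 0" if "k \<noteq> 0"
  proof -
    from that have "fst k \<noteq> 0 \<or> snd k \<noteq> 0" by (auto simp: prod_eq_iff)
    then obtain i where i: "kap i k \<noteq> 0" using kap_eq_0 by metis
    have "(\<integral>x. - kap i k * sn k x \<partial>M) = 0" "(\<integral>x. kap i k * cs k x \<partial>M) = 0"
      by (rule int_pd_zero[OF periodic_cs(1) has_pd_cs(1)], intro continuous_intros,
          rule int_pd_zero[OF periodic_cs(2) has_pd_cs(2)], intro continuous_intros)
    then show ?thesis using i by simp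
  qed
  show "(\<integral>x. cs k x \<partial>M) = (if k = 0 then area else 0)" using z by (auto simp: measure_M)
  show "(\<integral>x. sn k x \<partial>M) = 0" using z by (cases "k = 0") auto
qed

lemma cs_prod:
  "cs k x * cs l x = (cs (k - l) x + cs (k + l) x) / 2"
  "sn k x * sn l x = (cs (k - l) x - cs (k + l) x) / 2"
  "sn k x * cs l x = (sn (k + l) x + sn (k - l) x) / 2"
  "cs k x * sn l x = (sn (k + l) x - sn (k - l) x) / 2"
  by (simp_all add: cs_def sn_def cos_add cos_diff sin_add sin_diff)

text \<open>The unnormalised real and (negative) imaginary parts of the Fourier coefficients.  All \<open>k\<close> in \<open>\<int>\<^sup>2\<close> are used, so
  each pair of modes \<open>k\<close>, \<open>- k\<close> occurs twice; this is why the sums below are divided by \<open>area\<close> and not by half of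
  it, and no case distinction for \<open>k = 0\<close> is needed.\<close>

definition A :: "(real^2 \<Rightarrow> real) \<Rightarrow> int \<times> int \<Rightarrow> real" where "A h k = (\<integral>x. cs k x * h x \<partial>M)"
definition B :: "(real^2 \<Rightarrow> real) \<Rightarrow> int \<times> int \<Rightarrow> real" where "B h k = (\<integral>x. sn k x * h x \<partial>M)"

lemma AB_uminus: "A h (- k) = A h k" "B h (- k) = - B h k"
  by (simp_all add: A_def B_def)

lemma B_0 [simp]: "B h 0 = 0" by (simp add: B_def)

lemma AB_integrable: assumes "sq M h" shows "integrable M (\<lambda>x. cs k x * h x)" "integrable M (\<lambda>x. sn k x * h x)"
  using assms by (auto intro: sq_mult_integrable)

lemma AB_add: assumes "sq M g" "sq M h"
  shows "A (\<lambda>x. g x + h x) k = A g k + A h k" "B (\<lambda>x. g x + h x) k = B g k + B h k"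
  using AB_integrable[OF assms(1)] AB_integrable[OF assms(2)] by (simp_all add: A_def B_def distrib_left)

lemma AB_cmult: "A (\<lambda>x. c * h x) k = c * A h k" "B (\<lambda>x. c * h x) k = c * B h k"
  by (simp_all add: A_def B_def mult.left_commute)

lemma AB_minus: "A (\<lambda>x. - h x) k = - A h k" "B (\<lambda>x. - h x) k = - B h k"
  by (simp_all add: A_def B_def)

lemma AB_diff: assumes "sq M g" "sq M h"
  shows "A (\<lambda>x. g x - h x) k = A g k - A h k" "B (\<lambda>x. g x - h x) k = B g k - B h k"
  using AB_integrable[OF assms(1)] AB_integrable[OF assms(2)] by (simp_all add: A_def B_def right_diff_distrib)

lemma AB_zero [simp]: "A (\<lambda>x. 0) k = 0" "B (\<lambda>x. 0) k = 0" by (simp_all add: A_def B_def)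

lemma AB_conv: assumes "conv M hn h" shows "(\<lambda>n. A (hn n) k) \<longlonglongrightarrow> A h k" "(\<lambda>n. B (hn n) k) \<longlonglongrightarrow> B h k"
  unfolding A_def B_def by (intro conv_integral_mult conv_const assms cs_sq)+

lemma int_cs_cs: "(\<integral>x. cs k x * cs l x \<partial>M) = area / 2 * ((if k = l then 1 else 0) + (if k = - l then 1 else 0))"
  and int_sn_sn: "(\<integral>x. sn k x * sn l x \<partial>M) = area / 2 * ((if k = l then 1 else 0) - (if k = - l then 1 else 0))"
  and int_sn_cs: "(\<integral>x. sn k x * cs l x \<partial>M) = 0"
  and int_cs_sn: "(\<integral>x. cs k x * sn l x \<partial>M) = 0"
  unfolding cs_prod using sq_imp_integrable[OF cs_sq(1)] sq_imp_integrable[OF cs_sq(2)]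
  by (simp_all add: int_cs int_sn eq_neg_iff_add_eq_0)

definition K :: "nat \<Rightarrow> (int \<times> int) set" where "K n = {- int n..int n} \<times> {- int n..int n}"

lemma finite_K [simp]: "finite (K n)" by (simp add: K_def)
lemma uminus_K: "- k \<in> K n \<longleftrightarrow> k \<in> K n" by (auto simp: K_def mem_Times_iff)
lemma K_mono: "m \<le> n \<Longrightarrow> K m \<subseteq> K n" by (auto simp: K_def)
lemma in_K: "\<exists>m. k \<in> K m"
  by (intro exI[of _ "nat (max \<bar>fst k\<bar> \<bar>snd k\<bar>)"]) (auto simp: K_def mem_Times_iff)
lemma zero_K [simp]: "0 \<in> K n" by (simp add: K_def zero_prod_def)

lemma finite_subset_K: "finite S \<Longrightarrow> \<exists>m. S \<subseteq> K m"
proof (induction S rule: finite_induct)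
  case (insert k S)
  then obtain m where "S \<subseteq> K m" by blast
  moreover obtain m' where "k \<in> K m'" using in_K by blast
  ultimately have "insert k S \<subseteq> K (max m m')" using K_mono[of m "max m m'"] K_mono[of m' "max m m'"] by auto
  then show ?case by blast
qed simp

definition T :: "nat \<Rightarrow> (int \<times> int \<Rightarrow> real) \<Rightarrow> (int \<times> int \<Rightarrow> real) \<Rightarrow> real^2 \<Rightarrow> real" where
  "T n a b x = (\<Sum>k\<in>K n. a k * cs k x + b k * sn k x) / area"

text \<open>The square partial sum of the Fourier series.\<close>

definition P :: "nat \<Rightarrow> (real^2 \<Rightarrow> real) \<Rightarrow> real^2 \<Rightarrow> real" where "P n h = T n (A h) (B h)"

lemma continuous_T [continuous_intros]: "continuous_on S (T n a b)"
  unfolding T_def[abs_def] using area_pos by (auto intro!: continuous_intros)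

lemma periodic_T: "periodic L \<gamma> (T n a b)"
  using periodic_cs unfolding periodic_def T_def by simp

lemma has_pd_T: "has_pd i (T n a b) (T n (\<lambda>k. kap i k * b k) (\<lambda>k. - kap i k * a k))"
proof -
  have "has_pd i (\<lambda>x. (1 / area) * (\<Sum>k\<in>K n. a k * cs k x + b k * sn k x))
    (\<lambda>x. (1 / area) * (\<Sum>k\<in>K n. a k * (- kap i k * sn k x) + b k * (kap i k * cs k x)))"
    by (intro has_pd_cmult has_pd_sum has_pd_add has_pd_cs)
  moreover have "(\<lambda>x. (1 / area) * (\<Sum>k\<in>K n. a k * (- kap i k * sn k x) + b k * (kap i k * cs k x))) =
      T n (\<lambda>k. kap i k * b k) (\<lambda>k. - kap i k * a k)"
    unfolding T_def fun_eq_iff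
    by (auto intro!: arg_cong[where f = "\<lambda>z. z / area"] sum.cong)
  ultimately show ?thesis by (simp add: T_def[abs_def])
qed

lemma sq_T [simp]: "sq M (T n a b)" by (intro continuous_sq continuous_intros)

lemma T_cong: "(\<And>k. k \<in> K n \<Longrightarrow> a k = a' k) \<Longrightarrow> (\<And>k. k \<in> K n \<Longrightarrow> b k = b' k) \<Longrightarrow> T n a b = T n a' b'"
  by (simp add: T_def fun_eq_iff)

lemma T_lin: "T n (\<lambda>k. c * a k + d * a' k) (\<lambda>k. c * b k + d * b' k) = (\<lambda>x. c * T n a b x + d * T n a' b' x)"
  by (rule ext) (simp add: T_def algebra_simps sum.distrib sum_distrib_left add_divide_distrib sum_divide_distrib)

lemma int_T: assumes "sq M g" shows "(\<integral>x. g x * T n a b x \<partial>M) = (\<Sum>k\<in>K n. a k * A g k + b k * B g k) / area"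
proof -
  have "(\<integral>x. g x * T n a b x \<partial>M) = (\<integral>x. (\<Sum>k\<in>K n. a k * (cs k x * g x) + b k * (sn k x * g x)) / area \<partial>M)"
    by (rule Bochner_Integration.integral_cong) (auto simp: T_def sum_distrib_left algebra_simps)
  also have "\<dots> = (\<Sum>k\<in>K n. a k * A g k + b k * B g k) / area"
    using AB_integrable[OF assms] by (simp add: A_def B_def)
  finally show ?thesis .
qed

text \<open>Only the even part of \<open>a\<close> and the odd part of \<open>b\<close> contribute to the sum, because \<open>k\<close> and \<open>- k\<close> give the same functions up to sign.\<close>

lemma AB_T_gen: "A (T n a b) l = (if l \<in> K n then (a l + a (- l)) / 2 else 0)"
  "B (T n a b) l = (if l \<in> K n then (b l - b (- l)) / 2 else 0)"
proof -
  have d1: "(\<Sum>k\<in>K n. f k * (if k = l then 1 else 0)) = (if l \<in> K n then f l else 0)" for f :: "int \<times> int \<Rightarrow> real"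
    by (simp add: if_distrib cong: if_cong)
  have d2: "(\<Sum>k\<in>K n. f k * (if k = - l then 1 else 0)) = (if l \<in> K n then f (- l) else 0)" for f :: "int \<times> int \<Rightarrow> real"
    by (simp add: if_distrib uminus_K cong: if_cong)
  have Ac: "A (cs l) k = area / 2 * ((if k = l then 1 else 0) + (if k = - l then 1 else 0))" "B (cs l) k = 0"
    "B (sn l) k = area / 2 * ((if k = l then 1 else 0) - (if k = - l then 1 else 0))" "A (sn l) k = 0" for k
    unfolding A_def B_def by (simp_all only: int_cs_cs int_sn_sn int_sn_cs int_cs_sn)
  have "A (T n a b) l = (\<Sum>k\<in>K n. a k * A (cs l) k + b k * B (cs l) k) / area"
    unfolding A_def[of "T n a b"] by (rule int_T) simp
  also have "\<dots> = (\<Sum>k\<in>K n. a k * (if k = l then 1 else 0) + a k * (if k = - l then 1 else 0)) / 2"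
    unfolding Ac using area_pos by (simp add: sum_divide_distrib) (simp add: algebra_simps)
  also have "\<dots> = (if l \<in> K n then (a l + a (- l)) / 2 else 0)" by (simp only: sum.distrib d1 d2) simp
  finally show "A (T n a b) l = (if l \<in> K n then (a l + a (- l)) / 2 else 0)" .
  have "B (T n a b) l = (\<Sum>k\<in>K n. a k * A (sn l) k + b k * B (sn l) k) / area"
    unfolding B_def[of "T n a b"] by (rule int_T) simp
  also have "\<dots> = (\<Sum>k\<in>K n. b k * (if k = l then 1 else 0) - b k * (if k = - l then 1 else 0)) / 2"
    unfolding Ac using area_pos by (simp add: sum_divide_distrib) (simp add: algebra_simps)
  also have "\<dots> = (if l \<in> K n then (b l - b (- l)) / 2 else 0)" by (simp only: sum_subtractf d1 d2) simp
  finally show "B (T n a b) l = (if l \<in> K n then (b l - b (- l)) / 2 else 0)" .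
qed

lemma AB_T:
  assumes "\<And>k. a (- k) = a k" "\<And>k. b (- k) = - b k"
  shows "A (T n a b) l = (if l \<in> K n then a l else 0)" "B (T n a b) l = (if l \<in> K n then b l else 0)"
  by (simp_all add: AB_T_gen assms)

lemma AB_P: "A (P n h) l = (if l \<in> K n then A h l else 0)" "B (P n h) l = (if l \<in> K n then B h l else 0)"
  unfolding P_def by (simp_all add: AB_T AB_uminus)

lemma sq_P [simp]: "sq M (P n h)" by (simp add: P_def)
lemma continuous_P [continuous_intros]: "continuous_on S (P n h)" unfolding P_def by (rule continuous_T)
lemma periodic_P: "periodic L \<gamma> (P n h)" by (simp add: P_def periodic_T)

definition bil :: "nat \<Rightarrow> (real^2 \<Rightarrow> real) \<Rightarrow> (real^2 \<Rightarrow> real) \<Rightarrow> real" where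
  "bil n g h = (\<Sum>k\<in>K n. A g k * A h k + B g k * B h k) / area"

lemma int_P: "sq M g \<Longrightarrow> (\<integral>x. g x * P n h x \<partial>M) = bil n g h"
  unfolding P_def by (simp add: int_T bil_def mult.commute)

lemma int_P_P: "(\<integral>x. P n g x * P n h x \<partial>M) = bil n g h"
  by (simp add: int_P bil_def AB_P cong: sum.cong)

lemma bil_nonneg: "0 \<le> bil n h h"
  using area_pos by (auto simp: bil_def intro!: divide_nonneg_pos sum_nonneg)

lemma nrm_P: "(nrm M (P n h))\<^sup>2 = bil n h h"
  unfolding nrm_power2 using int_P_P[of n h h] by (simp add: power2_eq_square)

lemma nrm_diff_P: assumes "sq M h" shows "(nrm M (\<lambda>x. h x - P n h x))\<^sup>2 = (nrm M h)\<^sup>2 - bil n h h"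
proof -
  have i: "integrable M (\<lambda>x. (h x)\<^sup>2)" "integrable M (\<lambda>x. h x * P n h x)" "integrable M (\<lambda>x. (P n h x)\<^sup>2)"
    using assms by (auto intro: sq_mult_integrable sq_integrable)
  have "(nrm M (\<lambda>x. h x - P n h x))\<^sup>2 = (\<integral>x. ((h x)\<^sup>2 - 2 * (h x * P n h x)) + (P n h x)\<^sup>2 \<partial>M)"
    unfolding nrm_power2
    by (rule Bochner_Integration.integral_cong) (auto simp: power2_eq_square algebra_simps)
  also have "\<dots> = (nrm M h)\<^sup>2 - 2 * bil n h h + (nrm M (P n h))\<^sup>2"
    using i by (simp add: nrm_power2 int_P[OF assms])
  finally show ?thesis by (simp add: nrm_P)
qed

lemma Bessel: "sq M h \<Longrightarrow> bil n h h \<le> (nrm M h)\<^sup>2"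
  using nrm_diff_P[of h n] zero_le_power2[of "nrm M (\<lambda>x. h x - P n h x)"] by linarith

lemma nrm_diff_P_le: "sq M h \<Longrightarrow> nrm M (\<lambda>x. h x - P n h x) \<le> nrm M h"
  using nrm_diff_P[of h n] bil_nonneg[of n h] by (intro power2_le_imp_le[OF _ nrm_ge0]) linarith

lemma P_add: assumes "sq M g" "sq M h" shows "P n (\<lambda>x. g x + h x) = (\<lambda>x. P n g x + P n h x)"
proof -
  have e: "A (\<lambda>x. g x + h x) = (\<lambda>k. 1 * A g k + 1 * A h k)" "B (\<lambda>x. g x + h x) = (\<lambda>k. 1 * B g k + 1 * B h k)"
    by (auto simp: AB_add assms)
  show ?thesis unfolding P_def e T_lin by simp
qed

lemma P_cmult: "P n (\<lambda>x. c * h x) = (\<lambda>x. c * P n h x)"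
proof -
  have e: "A (\<lambda>x. c * h x) = (\<lambda>k. c * A h k + 0 * A h k)" "B (\<lambda>x. c * h x) = (\<lambda>k. c * B h k + 0 * B h k)"
    by (auto simp: AB_cmult)
  show ?thesis unfolding P_def e T_lin by simp
qed

lemma P_diff: assumes "sq M g" "sq M h" shows "P n (\<lambda>x. g x - h x) = (\<lambda>x. P n g x - P n h x)"
proof -
  have e: "A (\<lambda>x. g x - h x) = (\<lambda>k. 1 * A g k + (-1) * A h k)" "B (\<lambda>x. g x - h x) = (\<lambda>k. 1 * B g k + (-1) * B h k)"
    by (auto simp: AB_diff assms)
  show ?thesis unfolding P_def e T_lin by simp
qed

section \<open>Completeness of the trigonometric system\<close>

inductive trigpoly :: "(real^2 \<Rightarrow> real) \<Rightarrow> bool" where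
  cos: "trigpoly (cs k)"
| sin: "trigpoly (sn k)"
| add: "trigpoly f \<Longrightarrow> trigpoly g \<Longrightarrow> trigpoly (\<lambda>x. f x + g x)"
| cmult: "trigpoly f \<Longrightarrow> trigpoly (\<lambda>x. c * f x)"

lemma trigpoly_const: "trigpoly (\<lambda>x. c)"
  using trigpoly.cmult[OF trigpoly.cos[of 0], of c] by simp

lemma trigpoly_diff: "trigpoly f \<Longrightarrow> trigpoly g \<Longrightarrow> trigpoly (\<lambda>x. f x - g x)"
  using trigpoly.add[OF _ trigpoly.cmult[of g "-1"], of f] by simp

lemma trigpoly_continuous: "trigpoly f \<Longrightarrow> continuous_on UNIV f"
  by (induction rule: trigpoly.induct) (auto intro!: continuous_intros)

lemma trigpoly_sq: "trigpoly f \<Longrightarrow> sq M f"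
  by (intro continuous_sq trigpoly_continuous)

lemma trigpoly_mult_cs:
  assumes "trigpoly g" shows "trigpoly (\<lambda>x. cs k x * g x)" "trigpoly (\<lambda>x. sn k x * g x)"
proof -
  have "trigpoly (\<lambda>x. cs k x * g x) \<and> trigpoly (\<lambda>x. sn k x * g x)"
    using assms
  proof (induction rule: trigpoly.induct)
    case (cos l)
    have "trigpoly (\<lambda>x. (1/2) * (cs (k - l) x + cs (k + l) x))" "trigpoly (\<lambda>x. (1/2) * (sn (k + l) x + sn (k - l) x))"
      by (intro trigpoly.intros)+
    then show ?case unfolding cs_prod by simp
  next
    case (sin l)
    have "trigpoly (\<lambda>x. (1/2) * (cs (k - l) x - cs (k + l) x))" "trigpoly (\<lambda>x. (1/2) * (sn (k + l) x - sn (k - l) x))"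
      by (intro trigpoly.intros trigpoly_diff)+
    then show ?case unfolding cs_prod by simp
  next
    case (add f g)
    then show ?case using trigpoly.add by (simp add: distrib_left)
  next
    case (cmult f c)
    then show ?case using trigpoly.cmult[of _ c] by (simp add: mult.left_commute)
  qed
  then show "trigpoly (\<lambda>x. cs k x * g x)" "trigpoly (\<lambda>x. sn k x * g x)" by auto
qed

lemma trigpoly_mult: "trigpoly f \<Longrightarrow> trigpoly g \<Longrightarrow> trigpoly (\<lambda>x. f x * g x)"
proof (induction rule: trigpoly.induct)
  case (add f h)
  then show ?case using trigpoly.add by (simp add: distrib_right)
next
  case (cmult f c)
  then show ?case using trigpoly.cmult[of _ c] by (simp add: mult.assoc)
qed (auto intro: trigpoly_mult_cs)

text \<open>A trigonometric polynomial has finitely many modes, and the partial sums reproduce each of them once it is included.\<close>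

lemma P_trigpoly: "trigpoly q \<Longrightarrow> \<exists>m. \<forall>n\<ge>m. P n q = q"
proof (induction rule: trigpoly.induct)
  case (cos l)
  obtain m where m: "l \<in> K m" using in_K by blast
  have "P n (cs l) = cs l" if "n \<ge> m" for n
  proof
    fix x
    have l: "l \<in> K n" using m K_mono[OF that] by blast
    have "P n (cs l) x = (\<Sum>k\<in>K n. area / 2 * ((if k = l then 1 else 0) + (if k = - l then 1 else 0)) * cs k x) / area"
      unfolding P_def T_def A_def B_def by (simp add: int_cs_cs int_sn_cs)
    also have "\<dots> = (\<Sum>k\<in>K n. (if k = l then cs l x else 0) + (if k = - l then cs l x else 0)) / 2"
      using area_pos unfolding sum_divide_distrib by (intro sum.cong) auto
    also have "\<dots> = cs l x" using l by (simp add: sum.distrib uminus_K)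
    finally show "P n (cs l) x = cs l x" .
  qed
  then show ?case by blast
next
  case (sin l)
  obtain m where m: "l \<in> K m" using in_K by blast
  have "P n (sn l) = sn l" if "n \<ge> m" for n
  proof
    fix x
    have l: "l \<in> K n" using m K_mono[OF that] by blast
    have "P n (sn l) x = (\<Sum>k\<in>K n. area / 2 * ((if k = l then 1 else 0) - (if k = - l then 1 else 0)) * sn k x) / area"
      unfolding P_def T_def A_def B_def by (simp add: int_sn_sn int_cs_sn)
    also have "\<dots> = (\<Sum>k\<in>K n. (if k = l then sn l x else 0) + (if k = - l then sn l x else 0)) / 2"
    proof -
      have "sn l x = 0" if "l = - l" using fun_cong[OF sn_uminus, of l x] that by simp
      then have "area / 2 * ((if k = l then 1 else 0) - (if k = - l then 1 else 0)) * sn k x / area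
          = ((if k = l then sn l x else 0) + (if k = - l then sn l x else 0)) / 2" for k
        using area_pos by (cases "k = l"; cases "k = - l") simp_all
      then show ?thesis unfolding sum_divide_distrib by (simp only:)
    qed
    also have "\<dots> = sn l x" using l by (simp add: sum.distrib uminus_K)
    finally show "P n (sn l) x = sn l x" .
  qed
  then show ?case by blast
next
  case (add f g)
  then obtain m m' where "\<forall>n\<ge>m. P n f = f" "\<forall>n\<ge>m'. P n g = g" by blast
  then show ?case using P_add[OF trigpoly_sq[OF add.hyps(1)] trigpoly_sq[OF add.hyps(2)]]
    by (intro exI[of _ "max m m'"]) auto
next
  case (cmult f c)
  then obtain m where "\<forall>n\<ge>m. P n f = f" by blast
  then show ?case by (intro exI[of _ m]) (simp add: P_cmult)
qed

text \<open>The mean-square closure of the trigonometric polynomials.\<close>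

definition appr :: "(real^2 \<Rightarrow> real) \<Rightarrow> bool" where
  "appr h \<longleftrightarrow> sq M h \<and> (\<forall>e>0. \<exists>q. trigpoly q \<and> nrm M (\<lambda>x. h x - q x) < e)"

lemma appr_sq: "appr h \<Longrightarrow> sq M h" by (simp add: appr_def)

lemma appr_lim: assumes "conv M hn h" "\<And>n. appr (hn n)" shows "appr h"
  unfolding appr_def
proof (intro conjI allI impI)
  note s = convD[OF assms(1)]
  show "sq M h" by (rule s(2))
  fix e :: real assume "e > 0"
  then obtain n where n: "nrm M (\<lambda>x. hn n x - h x) < e / 2"
    using LIMSEQ_D[OF s(3), of "e/2"] by fastforce
  obtain q where q: "trigpoly q" "nrm M (\<lambda>x. hn n x - q x) < e / 2"
    using assms(2)[of n] \<open>e > 0\<close> unfolding appr_def by (meson half_gt_zero)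
  have "nrm M (\<lambda>x. (h x - hn n x) + (hn n x - q x)) \<le> nrm M (\<lambda>x. h x - hn n x) + nrm M (\<lambda>x. hn n x - q x)"
    by (intro nrm_triangle sq_diff s trigpoly_sq q)
  then show "\<exists>q. trigpoly q \<and> nrm M (\<lambda>x. h x - q x) < e"
    using n q nrm_minus_commute[of M h "hn n"] by (intro exI[of _ q]) simp
qed

lemma appr_trigpoly: "trigpoly q \<Longrightarrow> appr q"
  unfolding appr_def by (auto intro!: trigpoly_sq exI[of _ q] simp: nrm_def)

lemma appr_add: assumes "appr g" "appr h" shows "appr (\<lambda>x. g x + h x)"
  unfolding appr_def
proof (intro conjI allI impI sq_add appr_sq assms)
  fix e :: real assume "e > 0"
  obtain q where q: "trigpoly q" "nrm M (\<lambda>x. g x - q x) < e / 2" using assms(1) \<open>e > 0\<close> unfolding appr_def by (meson half_gt_zero)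
  obtain r where r: "trigpoly r" "nrm M (\<lambda>x. h x - r x) < e / 2" using assms(2) \<open>e > 0\<close> unfolding appr_def by (meson half_gt_zero)
  have "nrm M (\<lambda>x. (g x - q x) + (h x - r x)) \<le> nrm M (\<lambda>x. g x - q x) + nrm M (\<lambda>x. h x - r x)"
    by (intro nrm_triangle sq_diff appr_sq assms trigpoly_sq q r)
  then show "\<exists>q. trigpoly q \<and> nrm M (\<lambda>x. g x + h x - q x) < e"
    using q r by (intro exI[of _ "\<lambda>x. q x + r x"]) (auto intro: trigpoly.add simp: algebra_simps)
qed

lemma appr_cmult: assumes "appr h" shows "appr (\<lambda>x. c * h x)"
  unfolding appr_def
proof (intro conjI allI impI sq_cmult appr_sq assms)
  fix e :: real assume "e > 0"
  then have "e / (\<bar>c\<bar> + 1) > 0" by simp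
  then obtain q where q: "trigpoly q" "nrm M (\<lambda>x. h x - q x) < e / (\<bar>c\<bar> + 1)" using assms unfolding appr_def by blast
  have "nrm M (\<lambda>x. c * (h x - q x)) \<le> (\<bar>c\<bar> + 1) * nrm M (\<lambda>x. h x - q x)"
    unfolding nrm_cmult by (intro mult_right_mono) auto
  also have "\<dots> < e" using q(2) by (simp add: field_simps)
  finally show "\<exists>q. trigpoly q \<and> nrm M (\<lambda>x. c * h x - q x) < e"
    using q by (intro exI[of _ "\<lambda>x. c * q x"]) (auto intro: trigpoly.cmult simp: right_diff_distrib)
qed

lemma appr_sum: "(\<And>k. k \<in> J \<Longrightarrow> appr (f k)) \<Longrightarrow> appr (\<lambda>x. \<Sum>k\<in>J. f k x)"
  by (induction J rule: infinite_finite_induct) (auto intro: appr_add appr_trigpoly trigpoly_const)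

lemma appr_cong_AE: assumes "appr g" "h \<in> borel_measurable M" "AE x in M. g x = h x" shows "appr h"
proof (rule appr_lim[OF _ assms(1)])
  have s: "sq M g" "sq M h" using appr_sq[OF assms(1)] sq_AE_cong[OF _ assms(2,3)] by auto
  have "nrm M (\<lambda>x. g x - h x) = nrm M (\<lambda>x. 0)"
    by (rule nrm_AE_cong[OF sq_diff[OF s]]) (use assms(3) in auto)
  then show "conv M (\<lambda>n. g) h" using s by (simp add: conv_def nrm_def)
qed

text \<open>Uniform approximation, which unlike approximation in mean square is stable under products.\<close>

definition uappr :: "(real^2 \<Rightarrow> real) \<Rightarrow> bool" where
  "uappr f \<longleftrightarrow> (\<forall>e>0. \<exists>q. trigpoly q \<and> (\<forall>x. \<bar>f x - q x\<bar> < e))"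

lemma uappr_imp_appr: assumes "uappr f" "f \<in> borel_measurable M" "\<And>x. \<bar>f x\<bar> \<le> C" shows "appr f"
  unfolding appr_def
proof (intro conjI allI impI)
  show s: "sq M f" by (rule bounded_sq[OF assms(2,3)])
  fix e :: real assume "e > 0"
  define d where "d = e / (2 * sqrt area)"
  have "d > 0" using \<open>e > 0\<close> area_pos by (simp add: d_def)
  then obtain q where q: "trigpoly q" "\<And>x. \<bar>f x - q x\<bar> < d" using assms(1) unfolding uappr_def by blast
  have "nrm M (\<lambda>x. f x - q x) \<le> nrm M (\<lambda>x. d)"
  proof (rule nrm_mono)
    show "AE x in M. \<bar>f x - q x\<bar> \<le> \<bar>d\<bar>" using less_imp_le[OF q(2)] \<open>d > 0\<close> by auto
    show "(\<lambda>x. f x - q x) \<in> borel_measurable M" by (rule sq_measurable[OF sq_diff[OF s trigpoly_sq[OF q(1)]]])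
  qed simp
  also have "\<dots> = e / 2" using \<open>e > 0\<close> area_pos by (simp add: nrm_def measure_M real_sqrt_mult d_def)
  finally show "\<exists>q. trigpoly q \<and> nrm M (\<lambda>x. f x - q x) < e" using q \<open>e > 0\<close> by auto
qed

lemma uappr_mult:
  assumes "uappr f" "uappr g" "\<And>x. \<bar>f x\<bar> \<le> 1" "\<And>x. \<bar>g x\<bar> \<le> 1" shows "uappr (\<lambda>x. f x * g x)"
  unfolding uappr_def
proof (intro allI impI)
  fix e :: real assume "e > 0"
  define d where "d = min 1 (e / 3)"
  have d: "d > 0" "d \<le> 1" "3 * d \<le> e" using \<open>e > 0\<close> by (auto simp: d_def)
  obtain q where q: "trigpoly q" "\<And>x. \<bar>f x - q x\<bar> < d" using assms(1) d unfolding uappr_def by blast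
  obtain r where r: "trigpoly r" "\<And>x. \<bar>g x - r x\<bar> < d" using assms(2) d unfolding uappr_def by blast
  have "\<bar>f x * g x - q x * r x\<bar> < e" for x
  proof -
    have "\<bar>f x * g x - q x * r x\<bar> = \<bar>f x * (g x - r x) + (f x - q x) * r x\<bar>" by (simp add: algebra_simps)
    also have "\<dots> \<le> \<bar>f x\<bar> * \<bar>g x - r x\<bar> + \<bar>f x - q x\<bar> * \<bar>r x\<bar>"
      by (metis abs_mult abs_triangle_ineq)
    also have "\<dots> \<le> 1 * \<bar>g x - r x\<bar> + \<bar>f x - q x\<bar> * 2"
      using assms(3)[of x] assms(4)[of x] r(2)[of x] d by (intro add_mono mult_mono) auto
    also have "\<dots> < e"
    proof -
      have "1 * a + b * 2 < e" if "b < d" "a < d" for a b :: real using that d by linarith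
      then show ?thesis using q(2)[of x] r(2)[of x] by blast
    qed
    finally show ?thesis .
  qed
  then show "\<exists>q. trigpoly q \<and> (\<forall>x. \<bar>f x * g x - q x\<bar> < e)" using q r by (blast intro: trigpoly_mult)
qed

text \<open>By the Weierstrass theorem \<open>F\<close> is close to a polynomial on \<open>[-1, 1]\<close>, and a polynomial in a cosine is a
  trigonometric polynomial.\<close>

lemma uappr_cos:
  assumes F: "continuous_on UNIV F"
  shows "uappr (\<lambda>x. F (cos (ph k x - c)))"
  unfolding uappr_def
proof (intro allI impI)
  fix e :: real assume "e > 0"
  have t: "trigpoly (\<lambda>x. cos (ph k x - c))"
  proof -
    have "trigpoly (\<lambda>x. cos c * cs k x + sin c * sn k x)" by (intro trigpoly.intros)
    then show ?thesis by (simp add: cos_diff cs_def sn_def mult.commute)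
  qed
  obtain g where g: "real_polynomial_function g" "\<And>s. s \<in> {-1..1} \<Longrightarrow> \<bar>F s - g s\<bar> < e"
    using Stone_Weierstrass_real_polynomial_function[of "{-1..1::real}" F e] continuous_on_subset[OF F] \<open>e > 0\<close>
    by auto
  have "trigpoly (\<lambda>x. g (cos (ph k x - c)))"
    using g(1)
  proof (induction rule: real_polynomial_function.induct)
    case (linear f)
    then have "f s = f 1 * s" for s using linear_simps(5)[of f s 1] by simp
    then have "(\<lambda>x. f (cos (ph k x - c))) = (\<lambda>x. f 1 * cos (ph k x - c))" by (rule ext)
    then show ?case using trigpoly.cmult[OF t, of "f 1"] by simp
  qed (auto intro: trigpoly_const trigpoly.add trigpoly_mult)
  then show "\<exists>q. trigpoly q \<and> (\<forall>x. \<bar>F (cos (ph k x - c)) - q x\<bar> < e)"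
    using g(2) by (intro exI[of _ "\<lambda>x. g (cos (ph k x - c))"]) auto
qed

text \<open>A continuous approximation, increasingly steep in \<open>n\<close>, of the indicator of \<open>{cos r<..}\<close>; composed with a cosine it approximates the indicator of an arc.\<close>

definition hat :: "nat \<Rightarrow> real \<Rightarrow> real \<Rightarrow> real" where "hat n r s = min 1 (max 0 (real n * (s - cos r)))"

lemma hat_bound: "\<bar>hat n r s\<bar> \<le> 1" by (simp add: hat_def)
lemma continuous_hat: "continuous_on UNIV (hat n r)" unfolding hat_def by (intro continuous_intros)

lemma hat_lim: "(\<lambda>n. hat n r s) \<longlonglongrightarrow> (if s > cos r then 1 else 0)"
proof (cases "s > cos r")
  case True
  obtain n0 :: nat where n0: "1 / (s - cos r) < real n0" using reals_Archimedean2 by blast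
  have "hat n r s = 1" if "n \<ge> n0" for n
  proof -
    have "1 / (s - cos r) \<le> real n" using n0 that by (meson less_le_trans of_nat_le_iff less_imp_le order_trans)
    then show ?thesis using True by (simp add: hat_def field_simps)
  qed
  then have "(\<lambda>n. hat n r s) \<longlonglongrightarrow> 1" by (intro tendsto_eventually eventually_sequentiallyI)
  then show ?thesis using True by simp
next
  case False
  then have "hat n r s = 0" for n by (auto simp: hat_def mult_nonneg_nonpos)
  then show ?thesis using False by simp
qed

lemma cos_gt_iff_arc:
  assumes "0 < r" "r \<le> pi" "0 \<le> c - r" "c + r \<le> 2 * pi" "0 \<le> t" "t \<le> 2 * pi"
  shows "cos (t - c) > cos r \<longleftrightarrow> \<bar>t - c\<bar> < r"
proof (cases "\<bar>t - c\<bar> \<le> pi")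
  case True
  have "cos (t - c) = cos \<bar>t - c\<bar>" by (metis cos_abs_real)
  then show ?thesis using cos_mono_less_eq[of r "\<bar>t - c\<bar>"] True assms by auto
next
  case False
  have "cos (t - c) = cos \<bar>t - c\<bar>" by (metis cos_abs_real)
  also have "\<dots> = cos (2 * pi - \<bar>t - c\<bar>)" by (simp add: cos_diff)
  also have "\<dots> \<le> cos r" using False assms by (intro cos_monotone_0_pi_le) auto
  finally show ?thesis using False assms by auto
qed

lemma AE_box: "AE x in M. x \<in> box 0 (vector [L / \<gamma>, L])"
  unfolding M_def
  by (subst AE_restrict_space_iff) (use AE_not_boundary[of 0 "vector [L / \<gamma>, L]"] in \<open>auto simp: Omega_def\<close>)

text \<open>The indicator of a box inside the rectangle is a product of the indicators of two arcs, one for each variable,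
  and each of these is a limit of functions of a single cosine.\<close>

lemma appr_box: "appr (indicator (box a b))"
proof (cases "box a b \<inter> box 0 (vector [L / \<gamma>, L]) = {}")
  case True
  have "AE x in M. 0 = indicat_real (box a b) x"
    using AE_box by eventually_elim (use True in \<open>auto simp: indicator_def\<close>)
  then show ?thesis by (rule appr_cong_AE[OF appr_trigpoly[OF trigpoly_const[of 0]], rotated]) (auto intro: measurable_M)
next
  case False
  define p q where "p i = max (a$i) 0" and "q i = min (b$i) (vector [L / \<gamma>, L] $ i)" for i :: 2
  have pq: "p 1 < q 1" "p 2 < q 2" using False by (auto simp: p_def q_def mem_box_plane)
  \<comment> \<open>a cosine of the lowest frequency in each variable separates the points of the rectangle up to reflection\<close>
  define k :: "2 \<Rightarrow> int \<times> int" where "k i = (if i = 1 then (1, 0) else (0, 1))" for i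
  define w where "w i = 2 * pi / (vector [L / \<gamma>, L] $ i :: real)" for i :: 2
  have w0: "w i > 0" for i using L0 g0 exhaust_2[of i] by (auto simp: w_def)
  have phk: "ph (k i) x = w i * x$i" for i x
    using exhaust_2[of i] by (auto simp: ph_def k_def kap_def w_def)
  define c r where "c i = w i * (p i + q i) / 2" and "r i = w i * (q i - p i) / 2" for i
  let ?f = "\<lambda>n i x. hat n (r i) (cos (ph (k i) x - c i))"
  have lim: "(\<lambda>n. ?f n i x) \<longlonglongrightarrow> (if p i < x$i \<and> x$i < q i then 1 else 0)"
    if x: "x \<in> Omega L \<gamma>" and pqi: "p i < q i" for i x
  proof -
    have x': "0 \<le> x$i" "x$i \<le> vector [L / \<gamma>, L] $ i" using x exhaust_2[of i] by (auto simp: mem_Omega)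
    have vi: "vector [L / \<gamma>, L] $ i > (0::real)" using L0 g0 exhaust_2[of i] by auto
    have wv: "w i * vector [L / \<gamma>, L] $ i = 2 * pi" using vi by (simp add: w_def)
    have cr: "c i - r i = w i * p i" "c i + r i = w i * q i" by (auto simp: c_def r_def field_simps)
    have "w i * q i \<le> w i * vector [L / \<gamma>, L] $ i" using w0[of i] by (intro mult_left_mono) (auto simp: q_def)
    moreover have p0: "0 \<le> w i * p i" using w0[of i] by (auto simp: p_def)
    moreover have r0: "0 < r i" using w0[of i] pqi by (simp add: r_def)
    moreover have "w i * x$i \<le> w i * vector [L / \<gamma>, L] $ i" using w0[of i] x' by (intro mult_left_mono) auto
    ultimately have "cos (w i * x$i - c i) > cos (r i) \<longleftrightarrow> \<bar>w i * x$i - c i\<bar> < r i"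
      using x' w0[of i] wv cr by (intro cos_gt_iff_arc) auto
    also have "\<dots> \<longleftrightarrow> w i * p i < w i * x$i \<and> w i * x$i < w i * q i" using cr by auto
    also have "\<dots> \<longleftrightarrow> p i < x$i \<and> x$i < q i" using w0[of i] by simp
    finally show ?thesis using hat_lim[of "r i" "cos (ph (k i) x - c i)"] unfolding phk by simp
  qed
  have cont: "continuous_on UNIV (\<lambda>x. ?f n i x)" for n i
    unfolding ph_def by (rule continuous_on_compose2[OF continuous_hat]) (auto intro!: continuous_intros)
  show ?thesis
  proof (rule appr_lim)
    show "appr (\<lambda>x. ?f n 1 x * ?f n 2 x)" for n
    proof (rule uappr_imp_appr[OF uappr_mult])
      show "(\<lambda>x. ?f n 1 x * ?f n 2 x) \<in> borel_measurable M"
        by (intro continuous_measurable continuous_intros cont)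
      show "\<bar>?f n 1 x * ?f n 2 x\<bar> \<le> 1" for x
        unfolding abs_mult using hat_bound[of n] by (intro mult_le_one) auto
    qed (auto intro!: uappr_cos continuous_hat hat_bound)
    show "conv M (\<lambda>n x. ?f n 1 x * ?f n 2 x) (indicator (box a b))"
    proof (rule conv_dominated[where g = "\<lambda>x. 1"])
      show "(\<lambda>x. ?f n 1 x * ?f n 2 x) \<in> borel_measurable M" for n
        by (intro continuous_measurable continuous_intros cont)
      show "AE x in M. \<bar>?f n 1 x * ?f n 2 x\<bar> \<le> 1" for n
        unfolding abs_mult using hat_bound[of n] by (intro AE_I2 mult_le_one) auto
      show "AE x in M. (\<lambda>n. ?f n 1 x * ?f n 2 x) \<longlonglongrightarrow> indicat_real (box a b) x"
        using AE_box
      proof eventually_elim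
        case (elim x)
        then have x: "x \<in> Omega L \<gamma>" using box_subset_cbox unfolding Omega_def by blast
        have "(\<lambda>n. ?f n 1 x * ?f n 2 x) \<longlonglongrightarrow> (if p 1 < x$1 \<and> x$1 < q 1 then 1 else 0) * (if p 2 < x$2 \<and> x$2 < q 2 then 1 else 0)"
          by (intro tendsto_mult lim x pq)
        moreover have "(if p 1 < x$1 \<and> x$1 < q 1 then 1 else 0) * (if p 2 < x$2 \<and> x$2 < q 2 then 1 else 0) = indicat_real (box a b) x"
          using elim by (auto simp: p_def q_def mem_box_plane indicator_def)
        ultimately show ?case by simp
      qed
    qed (auto intro: measurable_M simp: indicator_def)
  qed
qed

text \<open>Boxes are stable under intersection and generate the Borel sets.\<close>

lemma appr_indicator: assumes "S \<in> sets borel" shows "appr (indicator S)"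
proof -
  let ?G = "range (\<lambda>(a, b). box a b :: (real^2) set)"
  have gen: "S \<in> sigma_sets UNIV ?G"
    using assms by (subst (asm) borel_eq_box) simp
  have int: "Int_stable ?G" by (auto simp: Int_stable_def box_Int_box)
  have sub: "?G \<subseteq> Pow UNIV" by simp
  from int sub gen show ?thesis
  proof (induction S rule: sigma_sets_induct_disjoint)
    case (basic S) then show ?case using appr_box by auto
  next
    case empty show ?case using appr_trigpoly[OF trigpoly_const[of 0]] by (simp add: indicator_def[abs_def])
  next
    case (compl S)
    have "appr (\<lambda>x. 1 + (-1) * indicator S x)"
      by (intro appr_add appr_cmult compl appr_trigpoly trigpoly_const)
    moreover have "(\<lambda>x. 1 + (-1) * indicator S x) = indicat_real (UNIV - S)" by (auto simp: indicator_def)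
    ultimately show ?case by simp
  next
    case (union S)
    have m: "S i \<in> sets borel" for i using union(2) by (subst borel_eq_box) auto
    show ?case
    proof (rule appr_lim)
      show "appr (\<lambda>x. \<Sum>i<n. indicator (S i) x)" for n by (intro appr_sum union)
      have e: "(\<Sum>i<n. indicator (S i) x) = indicat_real (\<Union>i<n. S i) x" for n x
      proof -
        have "disjoint_family_on S {..<n}" by (rule disjoint_family_on_mono[OF _ union(1)]) simp
        then show ?thesis by (subst indicator_UN_disjoint) auto
      qed
      show "conv M (\<lambda>n x. \<Sum>i<n. indicator (S i) x) (indicator (\<Union>i. S i))"
        unfolding e
      proof (rule conv_dominated[where g = "\<lambda>x. 1"])
        show "AE x in M. (\<lambda>n. indicat_real (\<Union>i<n. S i) x) \<longlonglongrightarrow> indicat_real (\<Union>i. S i) x"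
          by (intro AE_I2 LIMSEQ_indicator_UN)
        have "(\<Union>i. S i) \<in> sets borel" "(\<Union>i<n. S i) \<in> sets borel" for n using m by auto
        then show "indicat_real (\<Union>i. S i) \<in> borel_measurable M" "indicat_real (\<Union>i<n. S i) \<in> borel_measurable M" for n
          by (intro measurable_M borel_measurable_indicator, simp)+
      qed (auto simp: indicator_def)
    qed
  qed
qed

text \<open>Simple functions are dense.\<close>

theorem sq_imp_appr: assumes h: "sq M h" shows "appr h"
proof -
  obtain F where F: "\<And>i. simple_function M (F i)" "\<And>x. x \<in> space M \<Longrightarrow> (\<lambda>i. F i x) \<longlonglongrightarrow> h x"
    "\<And>i x. x \<in> space M \<Longrightarrow> dist (F i x) 0 \<le> 2 * dist (h x) 0"
    using borel_measurable_implies_sequence_metric[OF sq_measurable[OF h], of 0] by blast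
  show ?thesis
  proof (rule appr_lim)
    show "appr (F i)" for i
    proof -
      let ?s = "\<lambda>x. \<Sum>y \<in> F i ` space M. y * indicator (F i -` {y} \<inter> space M) x"
      have ind: "F i -` {y} \<inter> space M \<in> sets borel" for y
      proof -
        have "F i -` {y} \<inter> space M \<in> sets M" by (rule simple_functionD(2)[OF F(1)])
        then show ?thesis unfolding M_def sets_restrict_space by auto
      qed
      have "appr ?s" by (intro appr_sum appr_cmult appr_indicator ind)
      moreover have "AE x in M. ?s x = F i x"
      proof (rule AE_I2)
        fix x assume "x \<in> space M"
        from simple_function_indicator_representation_banach[OF F(1)[of i] this]
        show "?s x = F i x" by (simp only: real_scaleR_def mult.commute)
      qed
      ultimately show ?thesis by (rule appr_cong_AE[OF _ borel_measurable_simple_function[OF F(1)]])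
    qed
    show "conv M F h"
    proof (rule conv_dominated[where g = "\<lambda>x. 2 * \<bar>h x\<bar>"])
      show "sq M (\<lambda>x. 2 * \<bar>h x\<bar>)" using h by (intro sq_cmult) (auto simp: sq_def)
      show "F n \<in> borel_measurable M" for n by (rule borel_measurable_simple_function[OF F(1)])
    qed (use F h in \<open>auto simp: sq_def\<close>)
  qed
qed

text \<open>A trigonometric polynomial \<open>q\<close> is reproduced by late partial sums, and by Bessel's inequality the remainder
  of the series of \<open>h - q\<close> is at most as large as \<open>h - q\<close>.\<close>

theorem conv_P: assumes h: "sq M h" shows "conv M (\<lambda>n. P n h) h"
  unfolding conv_def
proof (intro conjI allI h sq_P LIMSEQ_I)
  fix e :: real assume "e > 0"
  then obtain q where q: "trigpoly q" "nrm M (\<lambda>x. h x - q x) < e"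
    using sq_imp_appr[OF h] unfolding appr_def by blast
  obtain m where m: "\<And>n. n \<ge> m \<Longrightarrow> P n q = q" using P_trigpoly[OF q(1)] by blast
  have "nrm M (\<lambda>x. P n h x - h x) < e" if "n \<ge> m" for n
  proof -
    have "(\<lambda>x. h x - P n h x) = (\<lambda>x. (h x - q x) - P n (\<lambda>x. h x - q x) x)"
      using P_diff[OF h trigpoly_sq[OF q(1)], of n] m[OF that] by (auto simp: fun_eq_iff)
    then have "nrm M (\<lambda>x. h x - P n h x) \<le> nrm M (\<lambda>x. h x - q x)"
      using nrm_diff_P_le[OF sq_diff[OF h trigpoly_sq[OF q(1)]], of n] by simp
    then show ?thesis using q(2) nrm_minus_commute[of M h "P n h"] by simp
  qed
  then show "\<exists>m. \<forall>n\<ge>m. norm (nrm M (\<lambda>x. P n h x - h x) - 0) < e" by auto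
qed

theorem Parseval:
  assumes "sq M g" "sq M h" shows "(\<lambda>n. bil n g h) \<longlonglongrightarrow> (\<integral>x. g x * h x \<partial>M)"
  using conv_integral_mult[OF conv_const[OF assms(1)] conv_P[OF assms(2)]] by (simp add: int_P assms)

lemma Parseval_nrm: assumes "sq M h" shows "(\<lambda>n. bil n h h) \<longlonglongrightarrow> (nrm M h)\<^sup>2"
  unfolding nrm_power2 using Parseval[OF assms assms] by (simp add: power2_eq_square)

section \<open>Weak derivatives in terms of Fourier coefficients\<close>

declare split_paired_All [simp del]

text \<open>Weak derivatives, rotation, divergence and Laplacian are recorded by their effect on Fourier coefficients:
  differentiation in direction \<open>i\<close> exchanges cosine and sine coefficients and multiplies them by \<open>kap i k\<close>.\<close>

definition fpd :: "2 \<Rightarrow> (real^2 \<Rightarrow> real) \<Rightarrow> (real^2 \<Rightarrow> real) \<Rightarrow> bool" where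
  "fpd i h d \<longleftrightarrow> sq M h \<and> sq M d \<and> (\<forall>k. A d k = kap i k * B h k \<and> B d k = - kap i k * A h k)"

definition frot :: "(real^2 \<Rightarrow> real) \<Rightarrow> (real^2 \<Rightarrow> real) \<Rightarrow> (real^2 \<Rightarrow> real) \<Rightarrow> bool" where
  "frot h1 h2 r \<longleftrightarrow> sq M h1 \<and> sq M h2 \<and> sq M r \<and>
     (\<forall>k. A r k = kap 1 k * B h2 k - kap 2 k * B h1 k \<and> B r k = kap 2 k * A h1 k - kap 1 k * A h2 k)"

definition fdiv0 :: "(real^2 \<Rightarrow> real) \<Rightarrow> (real^2 \<Rightarrow> real) \<Rightarrow> bool" where
  "fdiv0 h1 h2 \<longleftrightarrow> sq M h1 \<and> sq M h2 \<and>
     (\<forall>k. kap 1 k * A h1 k + kap 2 k * A h2 k = 0 \<and> kap 1 k * B h1 k + kap 2 k * B h2 k = 0)"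

definition kk :: "int \<times> int \<Rightarrow> real" where "kk k = (kap 1 k)\<^sup>2 + (kap 2 k)\<^sup>2"

text \<open>Mean zero is included, because a Laplacian does not see the mean and all bounds of a function by its Laplacian need it.\<close>

definition flap :: "(real^2 \<Rightarrow> real) \<Rightarrow> (real^2 \<Rightarrow> real) \<Rightarrow> bool" where
  "flap h l \<longleftrightarrow> sq M h \<and> sq M l \<and> A h 0 = 0 \<and> (\<forall>k. A l k = - kk k * A h k \<and> B l k = - kk k * B h k)"

lemma fpdD: assumes "fpd i h d" shows "sq M h" "sq M d" "A d k = kap i k * B h k" "B d k = - kap i k * A h k"
  using assms by (auto simp: fpd_def)

lemma frotD: assumes "frot h1 h2 r" shows "sq M h1" "sq M h2" "sq M r"
  "A r k = kap 1 k * B h2 k - kap 2 k * B h1 k" "B r k = kap 2 k * A h1 k - kap 1 k * A h2 k"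
  using assms by (auto simp: frot_def)

lemma fdiv0D: assumes "fdiv0 h1 h2" shows "sq M h1" "sq M h2"
  "kap 1 k * A h1 k + kap 2 k * A h2 k = 0" "kap 1 k * B h1 k + kap 2 k * B h2 k = 0"
  using assms by (auto simp: fdiv0_def)

lemma flapD: assumes "flap h l" shows "sq M h" "sq M l" "A h 0 = 0" "A l k = - kk k * A h k" "B l k = - kk k * B h k"
  using assms by (auto simp: flap_def)

lemma frot_cmult: assumes "frot h1 h2 r" shows "frot (\<lambda>x. c * h1 x) (\<lambda>x. c * h2 x) (\<lambda>x. c * r x)"
  unfolding frot_def using frotD(1-3)[OF assms] by (simp add: frotD(4,5)[OF assms] AB_cmult sq_cmult algebra_simps)

lemma frot_diff: assumes "frot g1 g2 q" "frot h1 h2 r" shows "frot (\<lambda>x. g1 x - h1 x) (\<lambda>x. g2 x - h2 x) (\<lambda>x. q x - r x)"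
  unfolding frot_def using frotD(1-3)[OF assms(1)] frotD(1-3)[OF assms(2)]
  by (simp add: frotD(4,5)[OF assms(1)] frotD(4,5)[OF assms(2)] AB_diff sq_diff algebra_simps)

lemma fpd_diff: assumes "fpd i g d" "fpd i h e" shows "fpd i (\<lambda>x. g x - h x) (\<lambda>x. d x - e x)"
  unfolding fpd_def using fpdD(1,2)[OF assms(1)] fpdD(1,2)[OF assms(2)]
  by (simp add: fpdD(3,4)[OF assms(1)] fpdD(3,4)[OF assms(2)] AB_diff sq_diff algebra_simps)

lemma flap_diff: assumes "flap g l" "flap h m" shows "flap (\<lambda>x. g x - h x) (\<lambda>x. l x - m x)"
  unfolding flap_def using flapD(1-3)[OF assms(1)] flapD(1-3)[OF assms(2)]
  by (simp add: flapD(4,5)[OF assms(1)] flapD(4,5)[OF assms(2)] AB_diff sq_diff algebra_simps)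

lemma fdiv0_diff: assumes "fdiv0 g1 g2" "fdiv0 h1 h2" shows "fdiv0 (\<lambda>x. g1 x - h1 x) (\<lambda>x. g2 x - h2 x)"
  unfolding fdiv0_def
proof (intro conjI allI)
  note g = fdiv0D[OF assms(1)] and h = fdiv0D[OF assms(2)]
  show "sq M (\<lambda>x. g1 x - h1 x)" "sq M (\<lambda>x. g2 x - h2 x)" by (intro sq_diff g h)+
  fix k
  show "kap 1 k * A (\<lambda>x. g1 x - h1 x) k + kap 2 k * A (\<lambda>x. g2 x - h2 x) k = 0"
    using g(3)[of k] h(3)[of k] by (simp add: AB_diff g(1,2) h(1,2) right_diff_distrib)
  show "kap 1 k * B (\<lambda>x. g1 x - h1 x) k + kap 2 k * B (\<lambda>x. g2 x - h2 x) k = 0"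
    using g(4)[of k] h(4)[of k] by (simp add: AB_diff g(1,2) h(1,2) right_diff_distrib)
qed

lemma frot_gradient: assumes "fpd 1 p p1" "fpd 2 p p2" shows "frot p1 p2 (\<lambda>x. 0)"
  unfolding frot_def using fpdD(2)[OF assms(1)] fpdD(2)[OF assms(2)]
  by (simp add: fpdD(3,4)[OF assms(1)] fpdD(3,4)[OF assms(2)])

lemma frot_fpd: assumes "fpd 1 u2 a2" "fpd 2 u1 b1" shows "frot u1 u2 (\<lambda>x. a2 x - b1 x)"
  unfolding frot_def using fpdD(1,2)[OF assms(1)] fpdD(1,2)[OF assms(2)]
  by (simp add: fpdD(3,4)[OF assms(1)] fpdD(3,4)[OF assms(2)] AB_diff sq_diff)

text \<open>Since the divergence vanishes, the mixed terms in the derivatives of the rotation combine to the Laplacian of one component of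
  the field.\<close>

lemma fpd_vorticity:
  assumes "frot u1 u2 w" "fdiv0 u1 u2" "flap u1 l1" "flap u2 l2"
  shows "fpd 1 w l2" "fpd 2 w (\<lambda>x. - l1 x)"
proof -
  note r = frotD[OF assms(1)] and d = fdiv0D[OF assms(2)] and l1 = flapD[OF assms(3)] and l2 = flapD[OF assms(4)]
  have e1: "kap 1 k * (kap 2 k * a1 - kap 1 k * a2) = - kk k * a2" if "kap 1 k * a1 + kap 2 k * a2 = 0" for k a1 a2
  proof -
    have "kap 1 k * (kap 2 k * a1 - kap 1 k * a2) = kap 2 k * (kap 1 k * a1 + kap 2 k * a2) - kk k * a2"
      by (simp add: kk_def power2_eq_square algebra_simps)
    then show ?thesis using that by simp
  qed
  have e2: "kap 2 k * (kap 2 k * a1 - kap 1 k * a2) = kk k * a1" if "kap 1 k * a1 + kap 2 k * a2 = 0" for k a1 a2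
  proof -
    have "kap 2 k * (kap 2 k * a1 - kap 1 k * a2) = kk k * a1 - kap 1 k * (kap 1 k * a1 + kap 2 k * a2)"
      by (simp add: kk_def power2_eq_square algebra_simps)
    then show ?thesis using that by simp
  qed
  have "A l2 k = kap 1 k * B w k" "B l2 k = - kap 1 k * A w k" for k
    using e1[OF d(3), of k] e1[OF d(4), of k] by (simp_all add: l2(4,5) r(4,5) algebra_simps)
  then show "fpd 1 w l2" using r(3) l2(2) by (simp add: fpd_def)
  have "A (\<lambda>x. - l1 x) k = kap 2 k * B w k" "B (\<lambda>x. - l1 x) k = - kap 2 k * A w k" for k
    using e2[OF d(3), of k] e2[OF d(4), of k] by (simp_all add: AB_minus l1(4,5) r(4,5) algebra_simps)
  then show "fpd 2 w (\<lambda>x. - l1 x)" using r(3) l1(2) by (simp add: fpd_def sq_minus)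
qed

lemma has_pd_P: assumes "fpd i h d" shows "has_pd i (P n h) (P n d)"
proof -
  have "P n d = T n (\<lambda>k. kap i k * B h k) (\<lambda>k. - kap i k * A h k)"
    unfolding P_def by (rule T_cong) (use fpdD[OF assms] in auto)
  then show ?thesis using has_pd_T[of i n "A h" "B h"] by (simp add: P_def)
qed

lemma has_pd_rot_P:
  assumes "frot h1 h2 r"
  obtains X Y where "has_pd 1 (P n h2) X" "has_pd 2 (P n h1) Y" "continuous_on UNIV X" "continuous_on UNIV Y"
    "\<And>x. X x - Y x = P n r x"
proof
  let ?X = "T n (\<lambda>k. kap 1 k * B h2 k) (\<lambda>k. - kap 1 k * A h2 k)"
  let ?Y = "T n (\<lambda>k. kap 2 k * B h1 k) (\<lambda>k. - kap 2 k * A h1 k)"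
  show "has_pd 1 (P n h2) ?X" "has_pd 2 (P n h1) ?Y" unfolding P_def by (rule has_pd_T)+
  show "continuous_on UNIV ?X" "continuous_on UNIV ?Y" by (rule continuous_T)+
  have e: "A r = (\<lambda>k. 1 * (kap 1 k * B h2 k) + (- 1) * (kap 2 k * B h1 k))"
    "B r = (\<lambda>k. 1 * (- kap 1 k * A h2 k) + (- 1) * (- kap 2 k * A h1 k))"
    using frotD[OF assms] by auto
  show "?X x - ?Y x = P n r x" for x unfolding P_def e T_lin by simp
qed

lemma conv_lipschitz_finite:
  assumes "conv M hn h" and L: "\<And>a b. \<bar>f a - f b\<bar> \<le> C * \<bar>a - b\<bar>"
  shows "conv M (\<lambda>n x. f (hn n x)) (\<lambda>x. f (h x))"
proof -
  have "\<bar>C\<bar>-lipschitz_on UNIV f"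
    unfolding lipschitz_on_def dist_real_def using order_trans[OF L mult_right_mono[OF abs_ge_self]] by auto
  then have "f \<in> borel_measurable borel" by (intro borel_measurable_continuous_onI lipschitz_on_continuous_on)
  then have "conv M (\<lambda>n x. (f (hn n x) - f 0) + f 0) (\<lambda>x. (f (h x) - f 0) + f 0)"
    by (intro conv_add conv_const sq_const conv_lipschitz[OF assms(1), where f = "\<lambda>s. f s - f 0" and K = C]) (use L in auto)
  then show ?thesis by simp
qed

lemma lipschitz_imp_continuous: "(\<And>a b. \<bar>f a - f b\<bar> \<le> C * \<bar>a - b\<bar>) \<Longrightarrow> continuous_on UNIV (f :: real \<Rightarrow> real)"
proof -
  assume L: "\<And>a b. \<bar>f a - f b\<bar> \<le> C * \<bar>a - b\<bar>"
  have "\<bar>C\<bar>-lipschitz_on UNIV f"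
    unfolding lipschitz_on_def dist_real_def using order_trans[OF L mult_right_mono[OF abs_ge_self]] by auto
  then show ?thesis by (rule lipschitz_on_continuous_on)
qed

lemma periodic_compose: "periodic L \<gamma> a \<Longrightarrow> periodic L \<gamma> (\<lambda>x. f (a x))"
  "periodic L \<gamma> a' \<Longrightarrow> periodic L \<gamma> b' \<Longrightarrow> periodic L \<gamma> (\<lambda>x. g (a' x) (b' x))"
  by (simp_all add: periodic_def)

text \<open>Integration by parts in \<open>\<integral> J(\<zeta>) rot h\<close>.  For partial sums everything is smooth.  In the limit the
  factor \<open>J' \<zeta>\<close> is the uniformly bounded one.\<close>

lemma rot_by_parts:
  assumes z: "fpd 1 \<zeta> z1" "fpd 2 \<zeta> z2" and h: "frot h1 h2 r"
    and J: "\<And>s. (J has_real_derivative J' s) (at s)" and J'b: "\<And>s. \<bar>J' s\<bar> \<le> C"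
    and J'L: "\<And>a b. \<bar>J' a - J' b\<bar> \<le> Q * \<bar>a - b\<bar>"
  shows "(\<integral>x. J' (\<zeta> x) * (z1 x * h2 x - z2 x * h1 x) \<partial>M) = - (\<integral>x. J (\<zeta> x) * r x \<partial>M)"
proof -
  note s = fpdD[OF z(1)] fpdD[OF z(2)] frotD[OF h]
  have JL: "\<bar>J a - J b\<bar> \<le> C * \<bar>a - b\<bar>" for a b
  proof -
    have "\<And>x. x \<in> UNIV \<Longrightarrow> norm (J' x) \<le> C" using J'b by simp
    from field_differentiable_bound[of UNIV J J' C a b] J J'b show ?thesis by simp
  qed
  have cJ: "continuous_on UNIV J" "continuous_on UNIV J'"
    using lipschitz_imp_continuous[OF JL] lipschitz_imp_continuous[OF J'L] by auto
  have cc: "continuous_on UNIV (\<lambda>x. J (P n \<zeta> x))" "continuous_on UNIV (\<lambda>x. J' (P n \<zeta> x))" for n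
    by (rule continuous_on_compose2[OF cJ(1)] continuous_on_compose2[OF cJ(2)], rule continuous_P, simp)+
  have fin: "(\<integral>x. (J' (P n \<zeta> x) * P n z1 x) * P n h2 x \<partial>M) - (\<integral>x. (J' (P n \<zeta> x) * P n z2 x) * P n h1 x \<partial>M)
      = - (\<integral>x. J (P n \<zeta> x) * P n r x \<partial>M)" for n
  proof -
    obtain X Y where XY: "has_pd 1 (P n h2) X" "has_pd 2 (P n h1) Y" "continuous_on UNIV X" "continuous_on UNIV Y"
      "\<And>x. X x - Y x = P n r x" using has_pd_rot_P[OF h] by metis
    have p1: "has_pd 1 (\<lambda>x. J (P n \<zeta> x) * P n h2 x) (\<lambda>x. J' (P n \<zeta> x) * P n z1 x * P n h2 x + X x * J (P n \<zeta> x))"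
      by (intro has_pd_mult has_pd_chain J has_pd_P z XY)
    have p2: "has_pd 2 (\<lambda>x. J (P n \<zeta> x) * P n h1 x) (\<lambda>x. J' (P n \<zeta> x) * P n z2 x * P n h1 x + Y x * J (P n \<zeta> x))"
      by (intro has_pd_mult has_pd_chain J has_pd_P z XY)
    have per: "periodic L \<gamma> (\<lambda>x. J (P n \<zeta> x) * P n h2 x)" "periodic L \<gamma> (\<lambda>x. J (P n \<zeta> x) * P n h1 x)"
      by (rule periodic_compose(2)[where g = "\<lambda>a b. J a * b"], rule periodic_P, rule periodic_P)+
    have i1: "(\<integral>x. J' (P n \<zeta> x) * P n z1 x * P n h2 x + X x * J (P n \<zeta> x) \<partial>M) = 0"
      by (rule int_pd_zero[OF per(1) p1]) (intro continuous_intros cc XY)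
    have i2: "(\<integral>x. J' (P n \<zeta> x) * P n z2 x * P n h1 x + Y x * J (P n \<zeta> x) \<partial>M) = 0"
      by (rule int_pd_zero[OF per(2) p2]) (intro continuous_intros cc XY)
    have ig: "integrable M (\<lambda>x. J' (P n \<zeta> x) * P n z1 x * P n h2 x)" "integrable M (\<lambda>x. X x * J (P n \<zeta> x))"
      "integrable M (\<lambda>x. J' (P n \<zeta> x) * P n z2 x * P n h1 x)" "integrable M (\<lambda>x. Y x * J (P n \<zeta> x))"
      by (intro continuous_integrable continuous_intros cc XY)+
    have "(\<integral>x. J (P n \<zeta> x) * P n r x \<partial>M) = (\<integral>x. X x * J (P n \<zeta> x) - Y x * J (P n \<zeta> x) \<partial>M)"
      unfolding XY(5)[symmetric] by (simp add: algebra_simps)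
    then show ?thesis using i1 i2 ig by simp
  qed
  have c1: "conv M (\<lambda>n x. J' (P n \<zeta> x) * P n z x) (\<lambda>x. J' (\<zeta> x) * z x)" if "sq M z" for z
    by (rule conv_bdd_mult[where C = C, OF conv_lipschitz_finite[OF conv_P[OF s(1)] J'L] _ _ conv_P[OF that]]) (use J'b in auto)
  have "(\<lambda>n. (\<integral>x. (J' (P n \<zeta> x) * P n z1 x) * P n h2 x \<partial>M) - (\<integral>x. (J' (P n \<zeta> x) * P n z2 x) * P n h1 x \<partial>M))
      \<longlonglongrightarrow> (\<integral>x. (J' (\<zeta> x) * z1 x) * h2 x \<partial>M) - (\<integral>x. (J' (\<zeta> x) * z2 x) * h1 x \<partial>M)"
    by (intro tendsto_diff conv_integral_mult c1 conv_P s)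
  moreover have "(\<lambda>n. - (\<integral>x. J (P n \<zeta> x) * P n r x \<partial>M)) \<longlonglongrightarrow> - (\<integral>x. J (\<zeta> x) * r x \<partial>M)"
    by (intro tendsto_minus conv_integral_mult conv_P s conv_lipschitz_finite[OF _ JL])
  ultimately have "(\<integral>x. (J' (\<zeta> x) * z1 x) * h2 x \<partial>M) - (\<integral>x. (J' (\<zeta> x) * z2 x) * h1 x \<partial>M) = - (\<integral>x. J (\<zeta> x) * r x \<partial>M)"
    unfolding fin by (rule LIMSEQ_unique)
  moreover have "integrable M (\<lambda>x. (J' (\<zeta> x) * z1 x) * h2 x)" "integrable M (\<lambda>x. (J' (\<zeta> x) * z2 x) * h1 x)"
    by (intro sq_mult_integrable convD(2)[OF c1] s)+
  ultimately show ?thesis by (simp add: right_diff_distrib mult.assoc)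
qed

text \<open>The integrand is \<open>v \<cdot> \<nabla> G(\<zeta>)\<close> with \<open>v\<close> free of divergence.  Bounds on the partial sums of \<open>v\<close>, uniform
  in space and in the number of terms, allow for the passage to the limit in the triple product.\<close>

lemma transport_zero:
  assumes z: "fpd 1 \<zeta> z1" "fpd 2 \<zeta> z2" and v: "fdiv0 v1 v2"
    and vb: "\<And>n x. \<bar>P n v1 x\<bar> \<le> C" "\<And>n x. \<bar>P n v2 x\<bar> \<le> C"
    and G: "\<And>s. (G has_real_derivative H s) (at s)"
    and HL: "\<And>a b. \<bar>H a - H b\<bar> \<le> Q * \<bar>a - b\<bar>"
  shows "(\<integral>x. H (\<zeta> x) * (z1 x * v1 x + z2 x * v2 x) \<partial>M) = 0"
proof -
  note s = fpdD[OF z(1)] fpdD[OF z(2)] fdiv0D[OF v]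
  have cG: "continuous_on UNIV G" using G by (meson DERIV_isCont continuous_at_imp_continuous_on)
  have cH: "continuous_on UNIV H" by (rule lipschitz_imp_continuous[OF HL])
  have cc: "continuous_on UNIV (\<lambda>x. G (P n \<zeta> x))" "continuous_on UNIV (\<lambda>x. H (P n \<zeta> x))" for n
    by (rule continuous_on_compose2[OF cG] continuous_on_compose2[OF cH], rule continuous_P, simp)+
  have fin: "(\<integral>x. H (P n \<zeta> x) * (P n v1 x * P n z1 x) \<partial>M) + (\<integral>x. H (P n \<zeta> x) * (P n v2 x * P n z2 x) \<partial>M) = 0" for n
  proof -
    let ?X = "T n (\<lambda>k. kap 1 k * B v1 k) (\<lambda>k. - kap 1 k * A v1 k)"
    let ?Y = "T n (\<lambda>k. kap 2 k * B v2 k) (\<lambda>k. - kap 2 k * A v2 k)"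
    have d: "?X x + ?Y x = 0" for x
    proof -
      have "1 * ?X x + 1 * ?Y x = T n (\<lambda>k. 1 * (kap 1 k * B v1 k) + 1 * (kap 2 k * B v2 k))
         (\<lambda>k. 1 * (- kap 1 k * A v1 k) + 1 * (- kap 2 k * A v2 k)) x"
        unfolding T_lin by simp
      also have "\<dots> = T n (\<lambda>k. 0) (\<lambda>k. 0) x"
      proof (rule fun_cong[OF T_cong])
        fix k show "1 * (kap 1 k * B v1 k) + 1 * (kap 2 k * B v2 k) = 0" using s(12)[of k] by simp
        show "1 * (- kap 1 k * A v1 k) + 1 * (- kap 2 k * A v2 k) = 0" using s(11)[of k] by simp
      qed
      finally show ?thesis by (simp add: T_def)
    qed
    have p1: "has_pd 1 (\<lambda>x. G (P n \<zeta> x) * P n v1 x) (\<lambda>x. H (P n \<zeta> x) * P n z1 x * P n v1 x + ?X x * G (P n \<zeta> x))"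
      unfolding P_def[of n v1] by (intro has_pd_mult has_pd_chain G has_pd_P z has_pd_T)
    have p2: "has_pd 2 (\<lambda>x. G (P n \<zeta> x) * P n v2 x) (\<lambda>x. H (P n \<zeta> x) * P n z2 x * P n v2 x + ?Y x * G (P n \<zeta> x))"
      unfolding P_def[of n v2] by (intro has_pd_mult has_pd_chain G has_pd_P z has_pd_T)
    have per: "periodic L \<gamma> (\<lambda>x. G (P n \<zeta> x) * P n v1 x)" "periodic L \<gamma> (\<lambda>x. G (P n \<zeta> x) * P n v2 x)"
      by (rule periodic_compose(2)[where g = "\<lambda>a b. G a * b"], rule periodic_P, rule periodic_P)+
    have i1: "(\<integral>x. H (P n \<zeta> x) * P n z1 x * P n v1 x + ?X x * G (P n \<zeta> x) \<partial>M) = 0"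
      by (rule int_pd_zero[OF per(1) p1]) (intro continuous_intros cc)
    have i2: "(\<integral>x. H (P n \<zeta> x) * P n z2 x * P n v2 x + ?Y x * G (P n \<zeta> x) \<partial>M) = 0"
      by (rule int_pd_zero[OF per(2) p2]) (intro continuous_intros cc)
    have ig: "integrable M (\<lambda>x. H (P n \<zeta> x) * P n z1 x * P n v1 x)" "integrable M (\<lambda>x. ?X x * G (P n \<zeta> x))"
      "integrable M (\<lambda>x. H (P n \<zeta> x) * P n z2 x * P n v2 x)" "integrable M (\<lambda>x. ?Y x * G (P n \<zeta> x))"
      by (intro continuous_integrable continuous_intros cc)+
    have "(\<integral>x. ?X x * G (P n \<zeta> x) \<partial>M) + (\<integral>x. ?Y x * G (P n \<zeta> x) \<partial>M) = (\<integral>x. (?X x + ?Y x) * G (P n \<zeta> x) \<partial>M)"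
      using ig by (simp add: distrib_right)
    also have "\<dots> = 0" unfolding d by simp
    finally show ?thesis using i1 i2 ig by (simp add: mult.commute mult.left_commute)
  qed
  have vbA: "AE x in M. \<bar>v1 x\<bar> \<le> C" "AE x in M. \<bar>v2 x\<bar> \<le> C"
    by (rule conv_AE_bound[OF conv_P[OF s(9)]], simp add: vb, rule conv_AE_bound[OF conv_P[OF s(10)]], simp add: vb)
  have c1: "conv M (\<lambda>n x. P n v1 x * P n z1 x) (\<lambda>x. v1 x * z1 x)"
    by (rule conv_bdd_mult[where C = C, OF conv_P[OF s(9)] _ vbA(1) conv_P[OF s(2)]]) (use vb in auto)
  have c2: "conv M (\<lambda>n x. P n v2 x * P n z2 x) (\<lambda>x. v2 x * z2 x)"
    by (rule conv_bdd_mult[where C = C, OF conv_P[OF s(10)] _ vbA(2) conv_P[OF s(6)]]) (use vb in auto)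
  have cH: "conv M (\<lambda>n x. H (P n \<zeta> x)) (\<lambda>x. H (\<zeta> x))" by (rule conv_lipschitz_finite[OF conv_P[OF s(1)] HL])
  have "(\<lambda>n. (\<integral>x. H (P n \<zeta> x) * (P n v1 x * P n z1 x) \<partial>M) + (\<integral>x. H (P n \<zeta> x) * (P n v2 x * P n z2 x) \<partial>M))
    \<longlonglongrightarrow> (\<integral>x. H (\<zeta> x) * (v1 x * z1 x) \<partial>M) + (\<integral>x. H (\<zeta> x) * (v2 x * z2 x) \<partial>M)"
    by (intro tendsto_add conv_integral_mult c1 c2 cH)
  then have "(\<integral>x. H (\<zeta> x) * (v1 x * z1 x) \<partial>M) + (\<integral>x. H (\<zeta> x) * (v2 x * z2 x) \<partial>M) = 0"
    unfolding fin by (simp add: LIMSEQ_const_iff)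
  moreover have "integrable M (\<lambda>x. H (\<zeta> x) * (v1 x * z1 x))" "integrable M (\<lambda>x. H (\<zeta> x) * (v2 x * z2 x))"
    by (intro sq_mult_integrable convD(2)[OF cH] convD(2)[OF c1] convD(2)[OF c2])+
  ultimately show ?thesis by (simp add: distrib_left mult.commute)
qed

text \<open>The field is the gradient of \<open>\<bar>u\<bar>\<^sup>2 / 2\<close>.\<close>

lemma frot_kinetic_gradient:
  assumes u: "fpd 1 u1 a1" "fpd 1 u2 a2" "fpd 2 u1 b1" "fpd 2 u2 b2"
    and ub: "\<And>n x. \<bar>P n u1 x\<bar> \<le> C" "\<And>n x. \<bar>P n u2 x\<bar> \<le> C"
  shows "frot (\<lambda>x. u1 x * a1 x + u2 x * a2 x) (\<lambda>x. u1 x * b1 x + u2 x * b2 x) (\<lambda>x. 0)"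
proof -
  note s = fpdD(1,2)[OF u(1)] fpdD(1,2)[OF u(2)] fpdD(2)[OF u(3)] fpdD(2)[OF u(4)]
  have ubA: "AE x in M. \<bar>u1 x\<bar> \<le> C" "AE x in M. \<bar>u2 x\<bar> \<le> C"
    by (rule conv_AE_bound[OF conv_P[OF s(1)]], simp add: ub, rule conv_AE_bound[OF conv_P[OF s(3)]], simp add: ub)
  have c: "conv M (\<lambda>n x. P n u1 x * P n a x + P n u2 x * P n b x) (\<lambda>x. u1 x * a x + u2 x * b x)" if "sq M a" "sq M b" for a b
    by (intro conv_add conv_bdd_mult[where C = C, OF conv_P[OF s(1)] _ ubA(1) conv_P[OF that(1)]]
        conv_bdd_mult[where C = C, OF conv_P[OF s(3)] _ ubA(2) conv_P[OF that(2)]]) (use ub in auto)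
  define h1 h2 where "h1 n x = P n u1 x * P n a1 x + P n u2 x * P n a2 x"
    and "h2 n x = P n u1 x * P n b1 x + P n u2 x * P n b2 x" for n x
  have ch: "conv M h1 (\<lambda>x. u1 x * a1 x + u2 x * a2 x)" "conv M h2 (\<lambda>x. u1 x * b1 x + u2 x * b2 x)"
    unfolding h1_def[abs_def] h2_def[abs_def] by (intro c s)+
  have fin: "kap 1 k * A (h2 n) k - kap 2 k * A (h1 n) k = 0 \<and> kap 1 k * B (h2 n) k - kap 2 k * B (h1 n) k = 0" for n k
  proof -
    define b where "b x = (1/2) * (P n u1 x * P n u1 x + P n u2 x * P n u2 x)" for x
    have cont: "continuous_on UNIV b" "continuous_on UNIV (h1 n)" "continuous_on UNIV (h2 n)"
      unfolding b_def h1_def h2_def by (intro continuous_intros)+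
    have pb1: "has_pd 1 b (\<lambda>x. (1/2) * ((P n a1 x * P n u1 x + P n a1 x * P n u1 x) + (P n a2 x * P n u2 x + P n a2 x * P n u2 x)))"
      unfolding b_def by (intro has_pd_cmult has_pd_add has_pd_mult has_pd_P u)
    have pb2: "has_pd 2 b (\<lambda>x. (1/2) * ((P n b1 x * P n u1 x + P n b1 x * P n u1 x) + (P n b2 x * P n u2 x + P n b2 x * P n u2 x)))"
      unfolding b_def by (intro has_pd_cmult has_pd_add has_pd_mult has_pd_P u)
    have e: "(\<lambda>x. (1/2) * ((P n a1 x * P n u1 x + P n a1 x * P n u1 x) + (P n a2 x * P n u2 x + P n a2 x * P n u2 x))) = h1 n"
      "(\<lambda>x. (1/2) * ((P n b1 x * P n u1 x + P n b1 x * P n u1 x) + (P n b2 x * P n u2 x + P n b2 x * P n u2 x))) = h2 n"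
      by (simp_all add: fun_eq_iff h1_def h2_def algebra_simps)
    have pb: "has_pd 1 b (h1 n)" "has_pd 2 b (h2 n)" using pb1 pb2 unfolding e by auto
    have per: "periodic L \<gamma> b" unfolding b_def
      by (rule periodic_compose(2)[where g = "\<lambda>p q. (1/2) * (p * p + q * q)"]) (rule periodic_P)+
    have pc: "periodic L \<gamma> (\<lambda>x. cs k x * b x)" "periodic L \<gamma> (\<lambda>x. sn k x * b x)"
      using periodic_cs per by (auto simp: periodic_def)
    note I = continuous_sq[OF cont(1)] continuous_sq[OF cont(2)] continuous_sq[OF cont(3)]
    have q: "(\<integral>x. (- kap i k * sn k x) * b x + h x * cs k x \<partial>M) = 0 \<and> (\<integral>x. (kap i k * cs k x) * b x + h x * sn k x \<partial>M) = 0"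
      if "has_pd i b h" "continuous_on UNIV h" for i h
      by (intro conjI int_pd_zero[OF pc(1) has_pd_mult[OF has_pd_cs(1) that(1)]] int_pd_zero[OF pc(2) has_pd_mult[OF has_pd_cs(2) that(1)]]
          continuous_intros cont that(2))
    have q': "A h k = kap i k * B b k \<and> B h k = - kap i k * A b k" if "has_pd i b h" "continuous_on UNIV h" "sq M h" for i h
      using q[OF that(1,2)] AB_integrable[OF that(3)] AB_integrable[OF I(1)]
      by (simp add: A_def B_def mult.assoc mult.commute[of "h _"])
    show ?thesis using q'[OF pb(1) cont(2) I(2)] q'[OF pb(2) cont(3) I(3)] by simp
  qed
  have "(\<lambda>n. kap 1 k * A (h2 n) k - kap 2 k * A (h1 n) k) \<longlonglongrightarrow>
      kap 1 k * A (\<lambda>x. u1 x * b1 x + u2 x * b2 x) k - kap 2 k * A (\<lambda>x. u1 x * a1 x + u2 x * a2 x) k" for k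
    by (intro tendsto_intros AB_conv ch)
  moreover have "(\<lambda>n. kap 1 k * B (h2 n) k - kap 2 k * B (h1 n) k) \<longlonglongrightarrow>
      kap 1 k * B (\<lambda>x. u1 x * b1 x + u2 x * b2 x) k - kap 2 k * B (\<lambda>x. u1 x * a1 x + u2 x * a2 x) k" for k
    by (intro tendsto_intros AB_conv ch)
  ultimately show ?thesis using fin convD(2)[OF ch(1)] convD(2)[OF ch(2)]
    by (simp add: frot_def LIMSEQ_const_iff)
qed

subsection \<open>The Sobolev embedding\<close>

lemma kk_nonneg: "0 \<le> kk k" by (simp add: kk_def)
lemma kk_pos: "k \<noteq> 0 \<Longrightarrow> 0 < kk k"
  using kap_eq_0[of k] by (auto simp: kk_def sum_power2_gt_zero_iff prod_eq_iff)

lemma sum_inverse_squares_bound: "(\<Sum>i\<in>{- int n..int n}. 1 / (1 + (of_int i)\<^sup>2)) \<le> 5 - 4 / (real n + 1)"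
proof (induction n)
  case (Suc n)
  define m where "m = real n + 1"
  have m: "m \<ge> 1" by (simp add: m_def)
  have "{- int (Suc n)..int (Suc n)} = insert (- int (Suc n)) (insert (int (Suc n)) {- int n..int n})" by auto
  moreover have "(- 1 - real n)\<^sup>2 = (1 + real n)\<^sup>2" by (simp add: power2_eq_square algebra_simps)
  ultimately have "(\<Sum>i\<in>{- int (Suc n)..int (Suc n)}. 1 / (1 + (of_int i)\<^sup>2)) =
      2 * (1 / (1 + m\<^sup>2)) + (\<Sum>i\<in>{- int n..int n}. 1 / (1 + (of_int i)\<^sup>2))"
    by (simp add: m_def add.commute)
  also have "\<dots> \<le> 2 * (1 / (1 + m\<^sup>2)) + (5 - 4 / m)" using Suc by (simp add: m_def)
  also have "2 * (1 / (1 + m\<^sup>2)) \<le> 4 / (m * (m + 1))"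
  proof -
    have "m * 1 \<le> m * m" using m by (intro mult_left_mono) auto
    moreover have "m * (m + 1) = m * m + m * 1" "2 * (1 + m\<^sup>2) = 2 + 2 * (m * m)"
      by (simp_all add: power2_eq_square algebra_simps)
    ultimately have "m * (m + 1) \<le> 2 * (1 + m\<^sup>2)" using zero_le_square[of m] by linarith
    moreover have "0 < 1 + m\<^sup>2" "0 < m * (m + 1)" using m by (auto intro: add_pos_nonneg)
    ultimately show ?thesis by (simp add: divide_le_eq) (simp add: field_simps)
  qed
  also have "4 / (m * (m + 1)) = 4 / m - 4 / (m + 1)" using m by (simp add: field_simps)
  finally show ?case by (simp add: m_def algebra_simps)
qed simp

lemma sum_int_squares_ge_1:
  fixes k :: "int \<times> int" assumes "k \<noteq> 0" shows "1 \<le> (real_of_int (fst k))\<^sup>2 + (of_int (snd k))\<^sup>2"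
proof -
  have "fst k \<noteq> 0 \<or> snd k \<noteq> 0" using assms by (auto simp: prod_eq_iff)
  then have "1 \<le> (fst k)\<^sup>2 + (snd k)\<^sup>2" by (metis int_one_le_iff_zero_less sum_power2_gt_zero_iff)
  then have "real_of_int 1 \<le> of_int ((fst k)\<^sup>2 + (snd k)\<^sup>2)" by (simp only: of_int_le_iff)
  then show ?thesis by simp
qed

lemma kk_coercive: "\<exists>c>0. \<forall>k. c * ((of_int (fst k))\<^sup>2 + (of_int (snd k))\<^sup>2) \<le> kk k"
proof (intro exI conjI allI)
  let ?c = "(2 * pi * min \<gamma> 1 / L)\<^sup>2"
  show "?c > 0" using L0 g0 by simp
  fix k
  define p q :: real where "p = (of_int (fst k))\<^sup>2" and "q = (of_int (snd k))\<^sup>2"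
  have p0: "p \<ge> 0" "q \<ge> 0" by (auto simp: p_def q_def)
  have k1: "(kap 1 k)\<^sup>2 = (2 * pi * \<gamma> / L)\<^sup>2 * p" "(kap 2 k)\<^sup>2 = (2 * pi / L)\<^sup>2 * q"
    by (simp_all add: kap_def p_def q_def power_mult_distrib power_divide)
  have "?c \<le> (2 * pi * \<gamma> / L)\<^sup>2" "?c \<le> (2 * pi / L)\<^sup>2"
    using L0 g0 by (auto intro!: power_mono divide_right_mono)
  then show "?c * ((of_int (fst k))\<^sup>2 + (of_int (snd k))\<^sup>2) \<le> kk k"
    unfolding p_def[symmetric] q_def[symmetric] kk_def k1 distrib_left using p0 by (intro add_mono mult_right_mono) auto
qed

lemma kk_lower: "\<exists>c>0. \<forall>k. k \<noteq> 0 \<longrightarrow> c \<le> kk k"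
proof -
  obtain c where c: "c > 0" "\<And>k. c * ((of_int (fst k))\<^sup>2 + (of_int (snd k))\<^sup>2) \<le> kk k" using kk_coercive by blast
  have "c \<le> kk k" if "k \<noteq> 0" for k
  proof -
    have "c * 1 \<le> c * ((of_int (fst k))\<^sup>2 + (of_int (snd k))\<^sup>2)"
      by (rule mult_left_mono[OF sum_int_squares_ge_1[OF that]]) (use c(1) in simp)
    then show ?thesis using c(2)[of k] by linarith
  qed
  then show ?thesis using c(1) by blast
qed

text \<open>The Laplacian has squared symbol of order \<open>\<bar>k\<bar>\<^sup>4\<close>, which is summable over a lattice in the plane by
  comparison with a product of two one-dimensional sums.\<close>

lemma kk_sum_bound: "\<exists>S. \<forall>n. (\<Sum>k\<in>K n - {0}. 1 / (kk k)\<^sup>2) \<le> S"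
proof -
  obtain c where c0: "c > 0" and c: "\<And>k. c * ((of_int (fst k))\<^sup>2 + (of_int (snd k))\<^sup>2) \<le> kk k" using kk_coercive by blast
  have b: "1 / (kk k)\<^sup>2 \<le> (3 / c\<^sup>2) * (1 / (1 + (of_int (fst k))\<^sup>2) * (1 / (1 + (of_int (snd k))\<^sup>2)))" if "k \<noteq> 0" for k
  proof -
    define p q :: real where "p = (of_int (fst k))\<^sup>2" and "q = (of_int (snd k))\<^sup>2"
    have p0: "p \<ge> 0" "q \<ge> 0" by (auto simp: p_def q_def)
    have pq: "1 \<le> p + q" using sum_int_squares_ge_1[OF that] by (simp add: p_def q_def)
    have "c * (p + q) \<le> kk k" using c by (simp add: p_def q_def)
    moreover have "(1 + p) * (1 + q) \<le> 3 * (p + q)\<^sup>2"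
    proof -
      have "p + q \<le> (p + q)\<^sup>2" using pq by (simp add: power2_eq_square)
      moreover have "p * q \<le> (p + q)\<^sup>2" using p0 by (simp add: power2_eq_square algebra_simps)
      moreover have "(1 + p) * (1 + q) = 1 + (p + q) + p * q" by (simp add: algebra_simps)
      ultimately show ?thesis using pq by linarith
    qed
    moreover have "(c * (p + q))\<^sup>2 \<le> (kk k)\<^sup>2" using calculation(1) c0 p0 by (intro power_mono) auto
    ultimately have "c\<^sup>2 * ((1 + p) * (1 + q)) \<le> 3 * (kk k)\<^sup>2"
      using mult_left_mono[of "(1 + p) * (1 + q)" "3 * (p + q)\<^sup>2" "c\<^sup>2"] by (simp add: power_mult_distrib)
    then show ?thesis
      using c0 p0 kk_pos[OF that] unfolding p_def[symmetric] q_def[symmetric]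
      by (simp add: field_simps add_pos_nonneg)
  qed
  have "(\<Sum>k\<in>K n - {0}. 1 / (kk k)\<^sup>2) \<le> (3 / c\<^sup>2) * 25" for n
  proof -
    let ?f = "\<lambda>i::int. 1 / (1 + (real_of_int i)\<^sup>2)"
    have "(\<Sum>k\<in>K n - {0}. 1 / (kk k)\<^sup>2) \<le> (\<Sum>k\<in>K n - {0}. (3 / c\<^sup>2) * (?f (fst k) * ?f (snd k)))"
      by (intro sum_mono b) auto
    also have "\<dots> \<le> (\<Sum>k\<in>K n. (3 / c\<^sup>2) * (?f (fst k) * ?f (snd k)))"
      by (intro sum_mono2) (auto simp: add_nonneg_nonneg)
    also have "\<dots> = (3 / c\<^sup>2) * ((\<Sum>i\<in>{- int n..int n}. ?f i) * (\<Sum>i\<in>{- int n..int n}. ?f i))"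
    proof -
      have "(\<Sum>k\<in>K n. ?f (fst k) * ?f (snd k)) = (\<Sum>i\<in>{- int n..int n}. \<Sum>j\<in>{- int n..int n}. ?f i * ?f j)"
        unfolding K_def sum.cartesian_product by (simp only: case_prod_beta')
      also have "\<dots> = (\<Sum>i\<in>{- int n..int n}. ?f i) * (\<Sum>i\<in>{- int n..int n}. ?f i)"
        by (rule sum_product[symmetric])
      finally show ?thesis by (simp only: sum_distrib_left[symmetric])
    qed
    also have "\<dots> \<le> (3 / c\<^sup>2) * (5 * 5)"
    proof (intro mult_left_mono mult_mono)
      have "4 / (real n + 1) \<ge> 0" by simp
      then show "(\<Sum>i\<in>{- int n..int n}. ?f i) \<le> 5" "(\<Sum>i\<in>{- int n..int n}. ?f i) \<le> 5"
        using sum_inverse_squares_bound[of n] by linarith+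
    qed (auto intro!: sum_nonneg)
    finally show ?thesis by simp
  qed
  then show ?thesis by blast
qed

text \<open>The coefficients of \<open>h\<close> are those of its Laplacian divided by \<open>kk k\<close>, and the Cauchy--Schwarz
  inequality applies to the series.\<close>

lemma Sobolev_sup:
  obtains C where "C > 0" "\<And>h l n x. flap h l \<Longrightarrow> \<bar>P n h x\<bar> \<le> C * nrm M l"
proof -
  obtain S where S: "\<And>n. (\<Sum>k\<in>K n - {0}. 1 / (kk k)\<^sup>2) \<le> S" using kk_sum_bound by blast
  have S0: "0 \<le> S" using order_trans[OF sum_nonneg S[of 0]] by auto
  define C where "C = sqrt (2 * area) * sqrt S / area + 1"
  have C0: "C > 0" using area_pos S0 by (auto simp: C_def intro!: add_nonneg_pos)
  moreover have "\<bar>P n h x\<bar> \<le> C * nrm M l" if "flap h l" for h l n x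
  proof -
    note f = flapD[OF that]
    let ?a = "\<lambda>k. \<bar>A l k\<bar> + \<bar>B l k\<bar>"
    have "\<bar>P n h x\<bar> \<le> (\<Sum>k\<in>K n. \<bar>A h k * cs k x + B h k * sn k x\<bar>) / area"
      unfolding P_def T_def using area_pos by (simp add: abs_divide divide_right_mono)
    also have "(\<Sum>k\<in>K n. \<bar>A h k * cs k x + B h k * sn k x\<bar>) \<le> (\<Sum>k\<in>K n. \<bar>A h k\<bar> + \<bar>B h k\<bar>)"
    proof (rule sum_mono)
      fix k
      have "\<bar>A h k * cs k x\<bar> \<le> \<bar>A h k\<bar>" "\<bar>B h k * sn k x\<bar> \<le> \<bar>B h k\<bar>"
        unfolding abs_mult using cs_le[of k x] by (auto intro: mult_left_le)
      then show "\<bar>A h k * cs k x + B h k * sn k x\<bar> \<le> \<bar>A h k\<bar> + \<bar>B h k\<bar>" by linarith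
    qed
    also have "(\<Sum>k\<in>K n. \<bar>A h k\<bar> + \<bar>B h k\<bar>) = (\<Sum>k\<in>K n - {0}. \<bar>A h k\<bar> + \<bar>B h k\<bar>)"
      using f(3) by (subst sum.remove[of _ 0]) auto
    also have "\<dots> = (\<Sum>k\<in>K n - {0}. ?a k * (1 / kk k))"
    proof (rule sum.cong[OF refl])
      fix k assume "k \<in> K n - {0}"
      then have "kk k > 0" by (intro kk_pos) auto
      then show "\<bar>A h k\<bar> + \<bar>B h k\<bar> = ?a k * (1 / kk k)" by (simp add: f(4,5) abs_mult field_simps)
    qed
    also have "\<dots> \<le> sqrt (\<Sum>k\<in>K n - {0}. (?a k)\<^sup>2) * sqrt (\<Sum>k\<in>K n - {0}. (1 / kk k)\<^sup>2)"
    proof -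
      have "(\<Sum>k\<in>K n - {0}. ?a k * (1 / kk k))\<^sup>2 \<le> (\<Sum>k\<in>K n - {0}. (?a k)\<^sup>2) * (\<Sum>k\<in>K n - {0}. (1 / kk k)\<^sup>2)"
        by (rule Cauchy_Schwarz_ineq_sum)
      from real_le_rsqrt[OF this] show ?thesis by (simp add: real_sqrt_mult)
    qed
    also have "\<dots> \<le> (sqrt (2 * area) * nrm M l) * sqrt S"
    proof (intro mult_mono)
      have "(\<Sum>k\<in>K n - {0}. (?a k)\<^sup>2) \<le> (\<Sum>k\<in>K n. (?a k)\<^sup>2)" by (intro sum_mono2) auto
      also have "\<dots> \<le> (\<Sum>k\<in>K n. 2 * (A l k * A l k + B l k * B l k))"
      proof (rule sum_mono)
        fix k show "(?a k)\<^sup>2 \<le> 2 * (A l k * A l k + B l k * B l k)"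
          using sum_squares_bound[of "\<bar>A l k\<bar>" "\<bar>B l k\<bar>"] by (simp add: power2_eq_square algebra_simps)
      qed
      also have "\<dots> = 2 * area * bil n l l" using area_pos unfolding bil_def sum_distrib_left[symmetric] by simp
      also have "\<dots> \<le> 2 * area * (nrm M l)\<^sup>2" using Bessel[OF f(2), of n] area_pos by simp
      finally have "sqrt (\<Sum>k\<in>K n - {0}. (?a k)\<^sup>2) \<le> sqrt (2 * area * (nrm M l)\<^sup>2)" by (rule real_sqrt_le_mono)
      then show "sqrt (\<Sum>k\<in>K n - {0}. (?a k)\<^sup>2) \<le> sqrt (2 * area) * nrm M l" by (simp add: real_sqrt_mult)
      show "sqrt (\<Sum>k\<in>K n - {0}. (1 / kk k)\<^sup>2) \<le> sqrt S" using S[of n] by (simp add: power_one_over)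
    qed (use S0 area_pos in \<open>auto intro!: sum_nonneg\<close>)
    finally have "\<bar>P n h x\<bar> \<le> sqrt (2 * area) * nrm M l * sqrt S / area"
      using area_pos by (simp add: divide_right_mono)
    also have "\<dots> \<le> C * nrm M l"
      unfolding C_def by (simp add: distrib_right mult.assoc mult.commute[of "nrm M l"])
    finally show ?thesis .
  qed
  ultimately show thesis using that by blast
qed

text \<open>One Sobolev constant, fixed once for all functions, so that bounds in different places can refer to the same number.\<close>

definition Csob :: real where "Csob = (SOME C. C > 0 \<and> (\<forall>h l n x. flap h l \<longrightarrow> \<bar>P n h x\<bar> \<le> C * nrm M l))"

lemma Csob: "Csob > 0" "flap h l \<Longrightarrow> \<bar>P n h x\<bar> \<le> Csob * nrm M l"
proof -
  have "\<exists>C. C > 0 \<and> (\<forall>h l n x. flap h l \<longrightarrow> \<bar>P n h x\<bar> \<le> C * nrm M l)" using Sobolev_sup by metis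
  from someI_ex[OF this] show "Csob > 0" "flap h l \<Longrightarrow> \<bar>P n h x\<bar> \<le> Csob * nrm M l" unfolding Csob_def by auto
qed

lemma Sobolev_AE: "flap h l \<Longrightarrow> AE x in M. \<bar>h x\<bar> \<le> Csob * nrm M l"
  by (rule conv_AE_bound[OF conv_P]) (auto simp: flapD Csob)

lemma flap_P_diff: assumes "flap h l" shows "flap (\<lambda>x. h x - P m h x) (\<lambda>x. l x - P m l x)"
  unfolding flap_def using flapD(1-3)[OF assms] by (simp add: flapD(4,5)[OF assms] AB_diff AB_P sq_diff)

lemma AE_continuous_bound:
  assumes "continuous_on UNIV g" "AE x in M. \<bar>g x\<bar> \<le> (c::real)" "x \<in> Omega L \<gamma>"
  shows "\<bar>g x\<bar> \<le> c"
proof -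
  let ?B = "box 0 (vector [L / \<gamma>, L]) :: (real^2) set"
  let ?C = "{x. \<bar>g x\<bar> \<le> c}"
  have cl: "closed ?C" by (intro closed_Collect_le continuous_intros assms)
  have sub: "?B \<subseteq> Omega L \<gamma>" unfolding Omega_def by (rule box_subset_cbox)
  have "AE x in lborel. x \<in> Omega L \<gamma> \<longrightarrow> x \<in> ?C"
    using assms(2) unfolding M_def by (subst (asm) AE_restrict_space_iff) auto
  then have "AE x in lebesgue. x \<in> Omega L \<gamma> \<longrightarrow> x \<in> ?C" by (rule AE_completion)
  then have "AE x \<in> ?B in lebesgue. x \<in> ?C" by eventually_elim (use sub in auto)
  then have "?B \<subseteq> ?C" using mem_closed_if_AE_lebesgue_open[OF open_box cl] by blast
  then have "closure ?B \<subseteq> ?C" by (rule closure_minimal[OF _ cl])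
  moreover have "?B \<noteq> {}" using L0 g0 by (auto simp: box_ne_empty Basis_plane inner_axis)
  ultimately show ?thesis using assms(3) by (auto simp: closure_box Omega_def)
qed

text \<open>The embedding is applied to the remainder of the series, whose Laplacian tends to zero in mean square.  The
  resulting bound holds almost everywhere, and at a given point by continuity.\<close>

lemma Sobolev_uniform:
  assumes "flap h l" "continuous_on UNIV h" "x \<in> Omega L \<gamma>"
  shows "(\<lambda>n. P n h x) \<longlonglongrightarrow> h x"
proof (rule LIM_zero_cancel, rule tendsto_rabs_zero_cancel, rule tendsto_sandwich[OF _ _ tendsto_const])
  have "\<bar>h x - P n h x\<bar> \<le> Csob * nrm M (\<lambda>x. l x - P n l x)" for n
    by (rule AE_continuous_bound[OF _ Sobolev_AE[OF flap_P_diff[OF assms(1)]] assms(3)])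
      (intro continuous_intros assms)
  then show "\<forall>\<^sub>F n in sequentially. \<bar>P n h x - h x\<bar> \<le> Csob * nrm M (\<lambda>x. P n l x - l x)"
    by (simp add: nrm_minus_commute[of M l] abs_minus_commute)
  show "(\<lambda>n. Csob * nrm M (\<lambda>x. P n l x - l x)) \<longlonglongrightarrow> 0"
    using tendsto_mult_left[OF convD(3)[OF conv_P[OF flapD(2)[OF assms(1)]]], of Csob] by simp
qed simp

section \<open>The vorticity equation\<close>

text \<open>The pairs \<open>(u1, u2)\<close>, \<open>(a1, a2)\<close>, \<open>(b1, b2)\<close>, \<open>(l1, l2)\<close> stand for a divergence-free field \<open>u\<close> and for
  \<open>\<partial>\<^sub>1 u\<close>, \<open>\<partial>\<^sub>2 u\<close>, \<open>\<Delta> u\<close>.\<close>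

definition vf :: "(real^2 \<Rightarrow> real) \<Rightarrow> (real^2 \<Rightarrow> real) \<Rightarrow> (real^2 \<Rightarrow> real) \<Rightarrow> (real^2 \<Rightarrow> real) \<Rightarrow>
    (real^2 \<Rightarrow> real) \<Rightarrow> (real^2 \<Rightarrow> real) \<Rightarrow> (real^2 \<Rightarrow> real) \<Rightarrow> (real^2 \<Rightarrow> real) \<Rightarrow> bool" where
  "vf u1 u2 a1 a2 b1 b2 l1 l2 \<longleftrightarrow> fpd 1 u1 a1 \<and> fpd 1 u2 a2 \<and> fpd 2 u1 b1 \<and> fpd 2 u2 b2 \<and>
     flap u1 l1 \<and> flap u2 l2 \<and> fdiv0 u1 u2"

lemma vfD: assumes "vf u1 u2 a1 a2 b1 b2 l1 l2"
  shows "fpd 1 u1 a1" "fpd 1 u2 a2" "fpd 2 u1 b1" "fpd 2 u2 b2" "flap u1 l1" "flap u2 l2" "fdiv0 u1 u2"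
    "frot u1 u2 (\<lambda>x. a2 x - b1 x)" "fpd 1 (\<lambda>x. a2 x - b1 x) l2" "fpd 2 (\<lambda>x. a2 x - b1 x) (\<lambda>x. - l1 x)"
    "sq M u1" "sq M u2" "sq M l1" "sq M l2" "sq M (\<lambda>x. a2 x - b1 x)"
proof -
  show v: "fpd 1 u1 a1" "fpd 1 u2 a2" "fpd 2 u1 b1" "fpd 2 u2 b2" "flap u1 l1" "flap u2 l2" "fdiv0 u1 u2"
    using assms by (auto simp: vf_def)
  show r: "frot u1 u2 (\<lambda>x. a2 x - b1 x)" by (rule frot_fpd[OF v(2,3)])
  show "fpd 1 (\<lambda>x. a2 x - b1 x) l2" "fpd 2 (\<lambda>x. a2 x - b1 x) (\<lambda>x. - l1 x)"
    by (rule fpd_vorticity[OF r v(7,5,6)])+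
  show "sq M u1" "sq M u2" "sq M l1" "sq M l2" "sq M (\<lambda>x. a2 x - b1 x)"
    using flapD(1,2)[OF v(5)] flapD(1,2)[OF v(6)] frotD(3)[OF r] by auto
qed

lemma vf_diff: assumes "vf u1 u2 a1 a2 b1 b2 l1 l2" "vf v1 v2 c1 c2 d1 d2 m1 m2"
  shows "vf (\<lambda>x. u1 x - v1 x) (\<lambda>x. u2 x - v2 x) (\<lambda>x. a1 x - c1 x) (\<lambda>x. a2 x - c2 x)
    (\<lambda>x. b1 x - d1 x) (\<lambda>x. b2 x - d2 x) (\<lambda>x. l1 x - m1 x) (\<lambda>x. l2 x - m2 x)"
  unfolding vf_def by (intro conjI fpd_diff flap_diff fdiv0_diff vfD[OF assms(1)] vfD[OF assms(2)])

lemma vf_bounded: assumes "vf u1 u2 a1 a2 b1 b2 l1 l2"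
  shows "\<exists>C. (\<forall>n x. \<bar>P n u1 x\<bar> \<le> C) \<and> (\<forall>n x. \<bar>P n u2 x\<bar> \<le> C) \<and> (AE x in M. \<bar>u1 x\<bar> \<le> C) \<and> (AE x in M. \<bar>u2 x\<bar> \<le> C)"
proof (intro exI conjI allI)
  let ?C = "Csob * nrm M l1 + Csob * nrm M l2"
  have le: "Csob * nrm M l1 \<le> ?C" "Csob * nrm M l2 \<le> ?C" using Csob(1) by simp_all
  note v = vfD[OF assms]
  have b: "\<bar>P n u1 x\<bar> \<le> ?C" "\<bar>P n u2 x\<bar> \<le> ?C" for n x
    using Csob(2)[OF v(5), of n x] Csob(2)[OF v(6), of n x] le by linarith+
  then show "\<bar>P n u1 x\<bar> \<le> ?C" "\<bar>P n u2 x\<bar> \<le> ?C" for n x .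
  show "AE x in M. \<bar>u1 x\<bar> \<le> ?C" by (rule conv_AE_bound[OF conv_P[OF v(11)] AE_I2[OF b(1)]])
  show "AE x in M. \<bar>u2 x\<bar> \<le> ?C" by (rule conv_AE_bound[OF conv_P[OF v(12)] AE_I2[OF b(2)]])
qed

text \<open>The Navier--Stokes equations at one instant, with \<open>(t1, t2)\<close> for the time derivative.  The pressure gradient \<open>(q1, q2)\<close> and the
  force \<open>(f1, f2)\<close> are known only by their rotations \<open>0\<close> and \<open>r\<close>.\<close>

definition nse :: "real \<Rightarrow> real \<Rightarrow> (real^2 \<Rightarrow> real) \<Rightarrow> (real^2 \<Rightarrow> real) \<Rightarrow> (real^2 \<Rightarrow> real) \<Rightarrow> (real^2 \<Rightarrow> real) \<Rightarrow>
    (real^2 \<Rightarrow> real) \<Rightarrow> (real^2 \<Rightarrow> real) \<Rightarrow> (real^2 \<Rightarrow> real) \<Rightarrow> (real^2 \<Rightarrow> real) \<Rightarrow> (real^2 \<Rightarrow> real) \<Rightarrow> (real^2 \<Rightarrow> real) \<Rightarrow>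
    (real^2 \<Rightarrow> real) \<Rightarrow> bool" where
  "nse \<nu> \<mu> t1 t2 u1 u2 a1 a2 b1 b2 l1 l2 r \<longleftrightarrow> vf u1 u2 a1 a2 b1 b2 l1 l2 \<and> sq M t1 \<and> sq M t2 \<and>
    (\<exists>q1 q2 f1 f2. frot q1 q2 (\<lambda>x. 0) \<and> frot f1 f2 r \<and>
      (AE x in M. t1 x + (u1 x * a1 x + u2 x * b1 x) = \<nu> * l1 x - \<mu> * u1 x - q1 x + f1 x \<and>
                  t2 x + (u1 x * a2 x + u2 x * b2 x) = \<nu> * l2 x - \<mu> * u2 x - q2 x + f2 x))"

text \<open>The convective term \<open>(u \<cdot> \<nabla>) u\<close> differs from \<open>\<omega> (- u\<^sup>2, u\<^sup>1)\<close> by the gradient of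
  \<open>\<bar>u\<bar>\<^sup>2 / 2\<close>, which joins the pressure in a field that matters only through its rotation.\<close>

lemma nse_rotational:
  assumes "nse \<nu> \<mu> t1 t2 u1 u2 a1 a2 b1 b2 l1 l2 r"
  shows "\<exists>h1 h2. frot h1 h2 (\<lambda>x. r x - \<mu> * (a2 x - b1 x)) \<and>
    (AE x in M. t1 x = (a2 x - b1 x) * u2 x + \<nu> * l1 x + h1 x \<and> t2 x = - (a2 x - b1 x) * u1 x + \<nu> * l2 x + h2 x)"
proof -
  have v0: "vf u1 u2 a1 a2 b1 b2 l1 l2" using assms by (simp add: nse_def)
  note v = vfD[OF v0]
  obtain q1 q2 f1 f2 where qf: "frot q1 q2 (\<lambda>x. 0)" "frot f1 f2 r"
    "AE x in M. t1 x + (u1 x * a1 x + u2 x * b1 x) = \<nu> * l1 x - \<mu> * u1 x - q1 x + f1 x \<and>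
       t2 x + (u1 x * a2 x + u2 x * b2 x) = \<nu> * l2 x - \<mu> * u2 x - q2 x + f2 x"
    using assms unfolding nse_def by blast
  obtain C where C: "\<And>n x. \<bar>P n u1 x\<bar> \<le> C" "\<And>n x. \<bar>P n u2 x\<bar> \<le> C" "AE x in M. \<bar>u1 x\<bar> \<le> C" "AE x in M. \<bar>u2 x\<bar> \<le> C"
    using vf_bounded[OF v0] by blast
  let ?h1 = "\<lambda>x. ((f1 x - q1 x) - \<mu> * u1 x) - (u1 x * a1 x + u2 x * a2 x)"
  let ?h2 = "\<lambda>x. ((f2 x - q2 x) - \<mu> * u2 x) - (u1 x * b1 x + u2 x * b2 x)"
  show ?thesis
  proof (intro exI conjI)
    have "frot ?h1 ?h2 (\<lambda>x. ((r x - 0) - \<mu> * (a2 x - b1 x)) - 0)"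
      by (intro frot_diff frot_cmult qf v frot_kinetic_gradient[OF v(1-4) C(1,2)])
    then show "frot ?h1 ?h2 (\<lambda>x. r x - \<mu> * (a2 x - b1 x))" by simp
    show "AE x in M. t1 x = (a2 x - b1 x) * u2 x + \<nu> * l1 x + ?h1 x \<and> t2 x = - (a2 x - b1 x) * u1 x + \<nu> * l2 x + ?h2 x"
      using qf(3) by eventually_elim (simp add: algebra_simps)
  qed
qed

lemma nseD: assumes "nse \<nu> \<mu> t1 t2 u1 u2 a1 a2 b1 b2 l1 l2 r"
  shows "vf u1 u2 a1 a2 b1 b2 l1 l2" "sq M t1" "sq M t2" "sq M r"
proof -
  show "vf u1 u2 a1 a2 b1 b2 l1 l2" "sq M t1" "sq M t2" using assms unfolding nse_def by blast+
  obtain f1 f2 where "frot f1 f2 r" using assms unfolding nse_def by blast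
  then show "sq M r" by (rule frotD(3))
qed

text \<open>The equation is paired with \<open>- J'(\<omega>) \<Delta>u\<close>, the rotated gradient of \<open>J(\<omega>)\<close>.  Integration by parts
  turns force and damping into those of the vorticity equation, and the convective term becomes a transport of \<open>G(\<omega>)\<close>.\<close>

lemma vorticity_balance:
  assumes n: "nse \<nu> \<mu> t1 t2 u1 u2 a1 a2 b1 b2 l1 l2 r"
  defines "w \<equiv> \<lambda>x. a2 x - b1 x"
  assumes J: "\<And>s. (J has_real_derivative J' s) (at s)" and J'b: "\<And>s. \<bar>J' s\<bar> \<le> C"
    and J'L: "\<And>a b. \<bar>J' a - J' b\<bar> \<le> Q * \<bar>a - b\<bar>"
    and G: "\<And>s. (G has_real_derivative J' s * s) (at s)"
    and HL: "\<And>a b. \<bar>J' a * a - J' b * b\<bar> \<le> Q' * \<bar>a - b\<bar>"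
  shows "- (\<integral>x. J' (w x) * (l1 x * t1 x + l2 x * t2 x) \<partial>M) =
     (\<integral>x. J (w x) * (r x - \<mu> * w x) \<partial>M) - \<nu> * (\<integral>x. J' (w x) * ((l1 x)\<^sup>2 + (l2 x)\<^sup>2) \<partial>M)"
proof -
  note v = vfD[OF nseD(1)[OF n], folded w_def]
  obtain h1 h2 where h: "frot h1 h2 (\<lambda>x. r x - \<mu> * w x)"
    "AE x in M. t1 x = w x * u2 x + \<nu> * l1 x + h1 x \<and> t2 x = - w x * u1 x + \<nu> * l2 x + h2 x"
    using nse_rotational[OF n] unfolding w_def by blast
  obtain B where B: "\<And>n x. \<bar>P n u1 x\<bar> \<le> B" "\<And>n x. \<bar>P n u2 x\<bar> \<le> B" "AE x in M. \<bar>u1 x\<bar> \<le> B" "AE x in M. \<bar>u2 x\<bar> \<le> B"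
    using vf_bounded[OF nseD(1)[OF n]] by blast
  have i1: "(\<integral>x. J' (w x) * (l2 x * h2 x - (- l1 x) * h1 x) \<partial>M) = - (\<integral>x. J (w x) * (r x - \<mu> * w x) \<partial>M)"
    by (rule rot_by_parts[OF v(9,10) h(1) J J'b J'L])
  have i2: "(\<integral>x. (J' (w x) * w x) * (l2 x * u1 x + (- l1 x) * u2 x) \<partial>M) = 0"
    by (rule transport_zero[OF v(9,10,7) B(1,2) G HL])
  have cJ': "continuous_on UNIV J'" by (rule lipschitz_imp_continuous[OF J'L])
  have mJ: "(\<lambda>x. J' (w x)) \<in> borel_measurable M"
    using measurable_compose[OF sq_measurable[OF v(15)] borel_measurable_continuous_onI[OF cJ']] .
  have sJ: "sq M (\<lambda>x. J' (w x) * g x)" if "sq M g" for g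
    by (rule sq_bdd_mult[OF that mJ]) (use J'b in auto)
  have sH: "sq M (\<lambda>x. J' (w x) * w x)" by (rule sJ[OF v(15)])
  have su: "sq M (\<lambda>x. u1 x * l2 x)" "sq M (\<lambda>x. u2 x * l1 x)"
    by (rule sq_bdd_mult[OF v(14) sq_measurable[OF v(11)] B(3)], rule sq_bdd_mult[OF v(13) sq_measurable[OF v(12)] B(4)])
  note h' = frotD(1,2)[OF h(1)]
  have ig: "integrable M (\<lambda>x. (J' (w x) * l2 x) * h2 x)" "integrable M (\<lambda>x. (J' (w x) * l1 x) * h1 x)"
    "integrable M (\<lambda>x. (J' (w x) * w x) * (u1 x * l2 x))" "integrable M (\<lambda>x. (J' (w x) * w x) * (u2 x * l1 x))"
    "integrable M (\<lambda>x. (J' (w x) * l1 x) * l1 x)" "integrable M (\<lambda>x. (J' (w x) * l2 x) * l2 x)"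
    by (intro sq_mult_integrable sJ sH su h' v)+
  have i3: "integrable M (\<lambda>x. J' (w x) * (l2 x * h2 x - (- l1 x) * h1 x))"
    using Bochner_Integration.integrable_add[OF ig(1,2)] by (simp add: algebra_simps)
  have i4: "integrable M (\<lambda>x. (J' (w x) * w x) * (l2 x * u1 x + (- l1 x) * u2 x))"
    using Bochner_Integration.integrable_diff[OF ig(3,4)] by (simp add: algebra_simps)
  have i5: "integrable M (\<lambda>x. J' (w x) * ((l1 x)\<^sup>2 + (l2 x)\<^sup>2))"
    using Bochner_Integration.integrable_add[OF ig(5,6)] by (simp add: algebra_simps power2_eq_square)
  have m: "(\<lambda>x. J' (w x) * (l1 x * t1 x + l2 x * t2 x)) \<in> borel_measurable M"
    using mJ sq_measurable[OF v(13)] sq_measurable[OF v(14)] nseD(2,3)[OF n] by (auto dest!: sq_measurable)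
  have "(\<integral>x. J' (w x) * (l1 x * t1 x + l2 x * t2 x) \<partial>M) =
     (\<integral>x. (J' (w x) * (l2 x * h2 x - (- l1 x) * h1 x) - (J' (w x) * w x) * (l2 x * u1 x + (- l1 x) * u2 x))
        + \<nu> * (J' (w x) * ((l1 x)\<^sup>2 + (l2 x)\<^sup>2)) \<partial>M)"
  proof (rule integral_cong_AE[OF m])
    show "AE x in M. J' (w x) * (l1 x * t1 x + l2 x * t2 x) =
      (J' (w x) * (l2 x * h2 x - (- l1 x) * h1 x) - (J' (w x) * w x) * (l2 x * u1 x + (- l1 x) * u2 x))
        + \<nu> * (J' (w x) * ((l1 x)\<^sup>2 + (l2 x)\<^sup>2))"
      using h(2)
    proof eventually_elim
      case (elim x)
      then have t: "t1 x = w x * u2 x + \<nu> * l1 x + h1 x" "t2 x = - w x * u1 x + \<nu> * l2 x + h2 x" by auto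
      show ?case unfolding t by (simp add: algebra_simps power2_eq_square)
    qed
  qed (use i3 i4 i5 in auto)
  also have "\<dots> = - (\<integral>x. J (w x) * (r x - \<mu> * w x) \<partial>M) + \<nu> * (\<integral>x. J' (w x) * ((l1 x)\<^sup>2 + (l2 x)\<^sup>2) \<partial>M)"
    using i3 i4 i5 i1 i2 by simp
  finally show ?thesis by simp
qed

text \<open>The same pairing for the difference of two solutions with \<open>J s = s\<close>.  The convective terms differ by
  \<open>\<omega> w\<^sup>\<bottom> + z v\<^sup>\<bottom>\<close>; the second part transports \<open>z\<^sup>2 / 2\<close> along \<open>v\<close> and integrates to zero.\<close>

lemma difference_balance:
  assumes n: "nse \<nu> \<mu> t1 t2 u1 u2 a1 a2 b1 b2 l1 l2 r" and n': "nse \<nu> \<mu> s1 s2 v1 v2 c1 c2 d1 d2 m1 m2 q"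
  defines "\<omega> \<equiv> \<lambda>x. a2 x - b1 x" and "z \<equiv> \<lambda>x. (a2 x - c2 x) - (b1 x - d1 x)"
    and "w1 \<equiv> \<lambda>x. u1 x - v1 x" and "w2 \<equiv> \<lambda>x. u2 x - v2 x" and "k1 \<equiv> \<lambda>x. l1 x - m1 x" and "k2 \<equiv> \<lambda>x. l2 x - m2 x"
  shows "- (\<integral>x. k1 x * (t1 x - s1 x) + k2 x * (t2 x - s2 x) \<partial>M) =
     (\<integral>x. z x * (r x - q x - \<mu> * z x) \<partial>M) - \<nu> * ((nrm M k1)\<^sup>2 + (nrm M k2)\<^sup>2)
     + (\<integral>x. \<omega> x * (k2 x * w1 x - k1 x * w2 x) \<partial>M)"
    and "integrable M (\<lambda>x. \<omega> x * (k2 x * w1 x - k1 x * w2 x))"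
proof -
  note u = vfD[OF nseD(1)[OF n], folded \<omega>_def] and v = vfD[OF nseD(1)[OF n']]
  note w = vfD[OF vf_diff[OF nseD(1)[OF n] nseD(1)[OF n']], folded z_def w1_def w2_def k1_def k2_def]
  obtain h1 h2 where h: "frot h1 h2 (\<lambda>x. r x - \<mu> * \<omega> x)"
    "AE x in M. t1 x = \<omega> x * u2 x + \<nu> * l1 x + h1 x \<and> t2 x = - \<omega> x * u1 x + \<nu> * l2 x + h2 x"
    using nse_rotational[OF n] unfolding \<omega>_def by blast
  obtain g1 g2 where g: "frot g1 g2 (\<lambda>x. q x - \<mu> * (c2 x - d1 x))"
    "AE x in M. s1 x = (c2 x - d1 x) * v2 x + \<nu> * m1 x + g1 x \<and> s2 x = - (c2 x - d1 x) * v1 x + \<nu> * m2 x + g2 x"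
    using nse_rotational[OF n'] by blast
  obtain B where B: "\<And>n x. \<bar>P n v1 x\<bar> \<le> B" "\<And>n x. \<bar>P n v2 x\<bar> \<le> B" "AE x in M. \<bar>v1 x\<bar> \<le> B" "AE x in M. \<bar>v2 x\<bar> \<le> B"
    using vf_bounded[OF nseD(1)[OF n']] by blast
  obtain W where "\<And>n x. \<bar>P n w1 x\<bar> \<le> W" "\<And>n x. \<bar>P n w2 x\<bar> \<le> W" and W: "AE x in M. \<bar>w1 x\<bar> \<le> W" "AE x in M. \<bar>w2 x\<bar> \<le> W"
    using vf_bounded[OF vf_diff[OF nseD(1)[OF n] nseD(1)[OF n']]] unfolding w1_def w2_def by blast
  have f: "frot (\<lambda>x. h1 x - g1 x) (\<lambda>x. h2 x - g2 x) (\<lambda>x. (r x - \<mu> * \<omega> x) - (q x - \<mu> * (c2 x - d1 x)))"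
    by (rule frot_diff[OF h(1) g(1)])
  have e: "(\<lambda>x. (r x - \<mu> * \<omega> x) - (q x - \<mu> * (c2 x - d1 x))) = (\<lambda>x. r x - q x - \<mu> * z x)"
    by (auto simp: \<omega>_def z_def algebra_simps)
  have f: "frot (\<lambda>x. h1 x - g1 x) (\<lambda>x. h2 x - g2 x) (\<lambda>x. r x - q x - \<mu> * z x)"
    using f unfolding e .
  have pz: "fpd 1 z k2" "fpd 2 z (\<lambda>x. - k1 x)"
    using vfD(9,10)[OF vf_diff[OF nseD(1)[OF n] nseD(1)[OF n']]] unfolding z_def k1_def k2_def .
  have i1: "(\<integral>x. (1::real) * (k2 x * (h2 x - g2 x) - (- k1 x) * (h1 x - g1 x)) \<partial>M) = - (\<integral>x. z x * (r x - q x - \<mu> * z x) \<partial>M)"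
    by (rule rot_by_parts[OF pz f, where J = "\<lambda>s. s" and J' = "\<lambda>s. 1" and C = 1 and Q = 0]) auto
  have i2: "(\<integral>x. z x * (k2 x * v1 x + (- k1 x) * v2 x) \<partial>M) = 0"
    by (rule transport_zero[OF pz v(7) B(1,2), where G = "\<lambda>s. s\<^sup>2 / 2" and H = "\<lambda>s. s" and Q = 1]) (auto intro!: derivative_eq_intros)
  have sv: "sq M (\<lambda>x. v1 x * k2 x)" "sq M (\<lambda>x. v2 x * k1 x)" "sq M (\<lambda>x. w1 x * k2 x)" "sq M (\<lambda>x. w2 x * k1 x)"
    by (rule sq_bdd_mult[OF w(14) sq_measurable[OF v(11)] B(3)], rule sq_bdd_mult[OF w(13) sq_measurable[OF v(12)] B(4)],
        rule sq_bdd_mult[OF w(14) sq_measurable[OF w(11)] W(1)], rule sq_bdd_mult[OF w(13) sq_measurable[OF w(12)] W(2)])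
  note h' = frotD(1,2)[OF f]
  have ig: "integrable M (\<lambda>x. k2 x * (h2 x - g2 x))" "integrable M (\<lambda>x. k1 x * (h1 x - g1 x))"
    "integrable M (\<lambda>x. z x * (v1 x * k2 x))" "integrable M (\<lambda>x. z x * (v2 x * k1 x))"
    "integrable M (\<lambda>x. \<omega> x * (w1 x * k2 x))" "integrable M (\<lambda>x. \<omega> x * (w2 x * k1 x))"
    by (intro sq_mult_integrable sv h' w u)+
  have i3: "integrable M (\<lambda>x. (1::real) * (k2 x * (h2 x - g2 x) - (- k1 x) * (h1 x - g1 x)))"
    using Bochner_Integration.integrable_add[OF ig(1,2)] by (simp add: algebra_simps)
  have i4: "integrable M (\<lambda>x. z x * (k2 x * v1 x + (- k1 x) * v2 x))"
    using Bochner_Integration.integrable_diff[OF ig(3,4)] by (simp add: algebra_simps)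
  show i5: "integrable M (\<lambda>x. \<omega> x * (k2 x * w1 x - k1 x * w2 x))"
    using Bochner_Integration.integrable_diff[OF ig(5,6)] by (simp add: algebra_simps)
  have i6: "integrable M (\<lambda>x. (k1 x)\<^sup>2)" "integrable M (\<lambda>x. (k2 x)\<^sup>2)" using w(13,14) by (auto simp: sq_def)
  have m: "(\<lambda>x. k1 x * (t1 x - s1 x) + k2 x * (t2 x - s2 x)) \<in> borel_measurable M"
    using sq_measurable[OF w(13)] sq_measurable[OF w(14)] nseD(2,3)[OF n] nseD(2,3)[OF n'] by (auto dest!: sq_measurable)
  have "(\<integral>x. k1 x * (t1 x - s1 x) + k2 x * (t2 x - s2 x) \<partial>M) =
     (\<integral>x. (1 * (k2 x * (h2 x - g2 x) - (- k1 x) * (h1 x - g1 x)) - z x * (k2 x * v1 x + (- k1 x) * v2 x))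
        + (\<nu> * ((k1 x)\<^sup>2 + (k2 x)\<^sup>2) - \<omega> x * (k2 x * w1 x - k1 x * w2 x)) \<partial>M)"
  proof (rule integral_cong_AE[OF m])
    show "AE x in M. k1 x * (t1 x - s1 x) + k2 x * (t2 x - s2 x) =
      (1 * (k2 x * (h2 x - g2 x) - (- k1 x) * (h1 x - g1 x)) - z x * (k2 x * v1 x + (- k1 x) * v2 x))
        + (\<nu> * ((k1 x)\<^sup>2 + (k2 x)\<^sup>2) - \<omega> x * (k2 x * w1 x - k1 x * w2 x))"
      using h(2) g(2)
    proof eventually_elim
      case (elim x)
      then have t: "t1 x = \<omega> x * u2 x + \<nu> * l1 x + h1 x" "t2 x = - \<omega> x * u1 x + \<nu> * l2 x + h2 x"
        "s1 x = (\<omega> x - z x) * v2 x + \<nu> * m1 x + g1 x" "s2 x = - (\<omega> x - z x) * v1 x + \<nu> * m2 x + g2 x"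
        by (auto simp: \<omega>_def z_def)
      show ?case unfolding t k1_def k2_def w1_def w2_def by (simp add: algebra_simps power2_eq_square)
    qed
  qed (use i3 i4 i5 i6 in auto)
  also have "\<dots> = (- (\<integral>x. z x * (r x - q x - \<mu> * z x) \<partial>M) - 0) +
      (\<nu> * ((nrm M k1)\<^sup>2 + (nrm M k2)\<^sup>2) - (\<integral>x. \<omega> x * (k2 x * w1 x - k1 x * w2 x) \<partial>M))"
    unfolding i1[symmetric] i2[symmetric] nrm_power2 using i3 i4 i5 i6 by simp
  finally show "- (\<integral>x. k1 x * (t1 x - s1 x) + k2 x * (t2 x - s2 x) \<partial>M) =
     (\<integral>x. z x * (r x - q x - \<mu> * z x) \<partial>M) - \<nu> * ((nrm M k1)\<^sup>2 + (nrm M k2)\<^sup>2)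
     + (\<integral>x. \<omega> x * (k2 x * w1 x - k1 x * w2 x) \<partial>M)" by simp
qed

text \<open>Where \<open>\<bar>\<omega>\<bar> \<le> m\<close> the Cauchy--Schwarz inequality suffices.  The excess is only small in mean square, so
  there \<open>w\<close> is estimated by its supremum.\<close>

lemma trilinear_bound:
  assumes w: "flap w1 k1" "flap w2 k2" and om: "sq M \<omega>" and m: "0 \<le> m"
    and int: "integrable M (\<lambda>x. \<omega> x * (k2 x * w1 x - k1 x * w2 x))"
  defines "D \<equiv> sqrt ((nrm M k1)\<^sup>2 + (nrm M k2)\<^sup>2)" and "W \<equiv> sqrt ((nrm M w1)\<^sup>2 + (nrm M w2)\<^sup>2)"
  shows "\<bar>\<integral>x. \<omega> x * (k2 x * w1 x - k1 x * w2 x) \<partial>M\<bar> \<le>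
    m * W * D + 2 * Csob * nrm M (\<lambda>x. max 0 (\<bar>\<omega> x\<bar> - m)) * D\<^sup>2"
proof -
  note f = flapD(1,2)[OF w(1)] flapD(1,2)[OF w(2)]
  note [measurable] = sq_measurable[OF f(1)] sq_measurable[OF f(2)] sq_measurable[OF f(3)] sq_measurable[OF f(4)] sq_measurable[OF om]
  define k where "k x = sqrt ((k1 x)\<^sup>2 + (k2 x)\<^sup>2)" for x
  define w where "w x = sqrt ((w1 x)\<^sup>2 + (w2 x)\<^sup>2)" for x
  define e where "e x = max 0 (\<bar>\<omega> x\<bar> - m)" for x
  have sk: "sq M k" "sq M w" unfolding k_def[abs_def] w_def[abs_def] using f by (auto simp: sq_def)
  have nk: "nrm M k = D" "nrm M w = W"
    unfolding nrm_def k_def w_def D_def W_def using f by (auto simp: sq_def)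
  have se: "sq M e" unfolding e_def[abs_def] by (rule sq_bound[OF om, where C = 1]) (use m in auto)
  have DD: "nrm M k1 \<le> D" "nrm M k2 \<le> D" by (auto simp: D_def intro: real_le_rsqrt)
  have wb: "AE x in M. \<bar>w x\<bar> \<le> 2 * Csob * D"
    using Sobolev_AE[OF w(1)] Sobolev_AE[OF w(2)]
  proof eventually_elim
    case (elim x)
    have "\<bar>w1 x\<bar> \<le> Csob * D" "\<bar>w2 x\<bar> \<le> Csob * D"
      using elim DD Csob(1) by (meson mult_left_mono less_imp_le order_trans)+
    moreover have "w x \<le> \<bar>w1 x\<bar> + \<bar>w2 x\<bar>" unfolding w_def by (rule sqrt_sum_squares_le_sum_abs)
    moreover have "0 \<le> w x" by (simp add: w_def)
    ultimately show ?case by linarith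
  qed
  have sw: "sq M (\<lambda>x. w x * k x)" by (rule sq_bdd_mult[OF sk(1) sq_measurable[OF sk(2)] wb])
  have nw: "nrm M (\<lambda>x. w x * k x) \<le> 2 * Csob * D * D"
    using nrm_bdd_mult[OF sk(1) sq_measurable[OF sk(2)] wb] nk Csob(1) by (simp add: D_def)
  have "\<bar>\<integral>x. \<omega> x * (k2 x * w1 x - k1 x * w2 x) \<partial>M\<bar> \<le> (\<integral>x. \<bar>\<omega> x * (k2 x * w1 x - k1 x * w2 x)\<bar> \<partial>M)"
    by (rule integral_abs_bound)
  also have "\<dots> \<le> (\<integral>x. m * (w x * k x) + e x * (w x * k x) \<partial>M)"
  proof (rule integral_mono)
    show "integrable M (\<lambda>x. \<bar>\<omega> x * (k2 x * w1 x - k1 x * w2 x)\<bar>)" using int by simp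
    show "integrable M (\<lambda>x. m * (w x * k x) + e x * (w x * k x))"
      by (intro Bochner_Integration.integrable_add integrable_mult_right sq_mult_integrable sk se sw)
    fix x
    have "\<bar>k2 x * w1 x - k1 x * w2 x\<bar> \<le> w x * k x"
    proof -
      have "(k2 x * w1 x - k1 x * w2 x)\<^sup>2 + (k1 x * w1 x + k2 x * w2 x)\<^sup>2 = ((w1 x)\<^sup>2 + (w2 x)\<^sup>2) * ((k1 x)\<^sup>2 + (k2 x)\<^sup>2)"
        by (simp add: power2_eq_square algebra_simps)
      then have "(k2 x * w1 x - k1 x * w2 x)\<^sup>2 \<le> ((w1 x)\<^sup>2 + (w2 x)\<^sup>2) * ((k1 x)\<^sup>2 + (k2 x)\<^sup>2)"
        by (metis le_add_same_cancel1 zero_le_power2)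
      then have "\<bar>k2 x * w1 x - k1 x * w2 x\<bar>\<^sup>2 \<le> ((w1 x)\<^sup>2 + (w2 x)\<^sup>2) * ((k1 x)\<^sup>2 + (k2 x)\<^sup>2)" by simp
      from real_le_rsqrt[OF this] show ?thesis unfolding k_def w_def by (simp add: real_sqrt_mult)
    qed
    then have "\<bar>\<omega> x\<bar> * \<bar>k2 x * w1 x - k1 x * w2 x\<bar> \<le> (m + e x) * (w x * k x)"
      by (intro mult_mono) (use m in \<open>auto simp: e_def\<close>)
    then show "\<bar>\<omega> x * (k2 x * w1 x - k1 x * w2 x)\<bar> \<le> m * (w x * k x) + e x * (w x * k x)"
      by (simp add: abs_mult distrib_right)
  qed
  also have "\<dots> = m * (\<integral>x. w x * k x \<partial>M) + (\<integral>x. e x * (w x * k x) \<partial>M)"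
    using sq_mult_integrable[OF sk(2,1)] sq_mult_integrable[OF se sw] by simp
  also have "\<dots> \<le> m * (W * D) + nrm M e * (2 * Csob * D * D)"
  proof (intro add_mono mult_left_mono m)
    show "(\<integral>x. w x * k x \<partial>M) \<le> W * D" using Cauchy_Schwarz_integral[OF sk(2,1)] nk by simp
    have "(\<integral>x. e x * (w x * k x) \<partial>M) \<le> nrm M e * nrm M (\<lambda>x. w x * k x)"
      using Cauchy_Schwarz_integral[OF se sw] by simp
    also have "\<dots> \<le> nrm M e * (2 * Csob * D * D)" using nw by (intro mult_left_mono) auto
    finally show "(\<integral>x. e x * (w x * k x) \<partial>M) \<le> nrm M e * (2 * Csob * D * D)" .
  qed
  finally show ?thesis by (simp add: e_def[abs_def] power2_eq_square mult.assoc mult.left_commute)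
qed

section \<open>Functionals of the vorticity as functions of time\<close>

text \<open>At a fixed point a trigonometric polynomial with absolutely continuous coefficients is absolutely continuous in
  time, so the chain rule applies there; the order of integration is then exchanged.\<close>

lemma chain_T:
  fixes a b a' b' :: "real \<Rightarrow> int \<times> int \<Rightarrow> real"
  assumes st: "s \<le> t"
    and ai: "\<And>k. set_integrable lborel {s..t} (\<lambda>r. a' r k)" "\<And>k. set_integrable lborel {s..t} (\<lambda>r. b' r k)"
    and ay: "\<And>k r. r \<in> {s..t} \<Longrightarrow> a r k = a s k + (LINT q:{s..r}|lborel. a' q k)"
      "\<And>k r. r \<in> {s..t} \<Longrightarrow> b r k = b s k + (LINT q:{s..r}|lborel. b' q k)"
    and j: "\<And>y. (j has_real_derivative J y) (at y)" and JL: "\<And>x y. \<bar>J x - J y\<bar> \<le> Q * \<bar>x - y\<bar>"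
  shows "set_integrable lborel {s..t} (\<lambda>r. \<integral>x. J (T n (a r) (b r) x) * T n (a' r) (b' r) x \<partial>M)"
    and "(\<integral>x. j (T n (a t) (b t) x) \<partial>M) - (\<integral>x. j (T n (a s) (b s) x) \<partial>M) =
      (LINT r:{s..t}|lborel. \<integral>x. J (T n (a r) (b r) x) * T n (a' r) (b' r) x \<partial>M)"
proof -
  interpret pr: pair_sigma_finite "lborel :: real measure" M
    by (intro pair_sigma_finite.intro lborel.sigma_finite_measure_axioms fm.sigma_finite_measure_axioms)
  have cJ: "continuous_on UNIV J" by (rule lipschitz_imp_continuous[OF JL])
  have cj: "continuous_on UNIV j" using j by (meson DERIV_isCont continuous_at_imp_continuous_on)
  have [measurable]: "J \<in> borel_measurable borel" by (rule borel_measurable_continuous_onI[OF cJ])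
  have aT: "set_integrable lborel {s..t} (\<lambda>r. T n (a' r) (b' r) x)" for x
  proof -
    have "integrable lborel (\<lambda>r. (\<Sum>k\<in>K n. (indicator {s..t} r *\<^sub>R a' r k) * cs k x + (indicator {s..t} r *\<^sub>R b' r k) * sn k x) / area)"
      using ai unfolding set_integrable_def by (intro integrable_divide Bochner_Integration.integrable_sum Bochner_Integration.integrable_add integrable_mult_left) auto
    then show ?thesis unfolding set_integrable_def T_def
      by (simp add: sum_distrib_left algebra_simps)
  qed
  have yT: "T n (a r) (b r) x = T n (a s) (b s) x + (LINT q:{s..r}|lborel. T n (a' q) (b' q) x)" if r: "r \<in> {s..t}" for r x
  proof -
    have i: "integrable lborel (\<lambda>q. indicator {s..r} q *\<^sub>R a' q k)" "integrable lborel (\<lambda>q. indicator {s..r} q *\<^sub>R b' q k)" for k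
      using set_integrable_subset[OF ai(1), of "{s..r}"] set_integrable_subset[OF ai(2), of "{s..r}"] r
      unfolding set_integrable_def by auto
    have "(LINT q:{s..r}|lborel. T n (a' q) (b' q) x) =
      (\<integral>q. (\<Sum>k\<in>K n. (indicator {s..r} q *\<^sub>R a' q k) * cs k x + (indicator {s..r} q *\<^sub>R b' q k) * sn k x) / area \<partial>lborel)"
      unfolding set_lebesgue_integral_def T_def
      by (rule Bochner_Integration.integral_cong) (auto simp: sum_distrib_left algebra_simps)
    also have "\<dots> = (\<Sum>k\<in>K n. (LINT q:{s..r}|lborel. a' q k) * cs k x + (LINT q:{s..r}|lborel. b' q k) * sn k x) / area"
      unfolding set_lebesgue_integral_def using i by simp
    also have "\<dots> = T n (a r) (b r) x - T n (a s) (b s) x"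
      unfolding T_def diff_divide_distrib[symmetric] sum_subtractf[symmetric] ay(1)[OF r] ay(2)[OF r]
      by (intro arg_cong[where f = "\<lambda>z. z / area"] sum.cong) (auto simp: algebra_simps)
    finally show ?thesis by simp
  qed
  define a0 where "a0 r k = indicator {s..t} r *\<^sub>R a r k" for r k
  define b0 where "b0 r k = indicator {s..t} r *\<^sub>R b r k" for r k
  define a1 where "a1 r k = indicator {s..t} r *\<^sub>R a' r k" for r k
  define b1 where "b1 r k = indicator {s..t} r *\<^sub>R b' r k" for r k
  have ca: "continuous_on {s..t} (\<lambda>r. a r k)" for k
    by (rule continuous_on_eq[of _ "\<lambda>r. a s k + (LINT q:{s..r}|lborel. a' q k)"])
      (intro continuous_intros set_integral_continuous ai, rule ay(1)[symmetric])
  have cb: "continuous_on {s..t} (\<lambda>r. b r k)" for k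
    by (rule continuous_on_eq[of _ "\<lambda>r. b s k + (LINT q:{s..r}|lborel. b' q k)"])
      (intro continuous_intros set_integral_continuous ai, rule ay(2)[symmetric])
  have [measurable]: "(\<lambda>r. a0 r k) \<in> borel_measurable borel" "(\<lambda>r. b0 r k) \<in> borel_measurable borel" for k
    unfolding a0_def b0_def by (intro borel_measurable_continuous_on_indicator ca cb, simp)+
  have i1: "integrable lborel (\<lambda>r. a1 r k)" "integrable lborel (\<lambda>r. b1 r k)" for k
    using ai unfolding a1_def b1_def set_integrable_def by auto
  have [measurable]: "(\<lambda>r. a1 r k) \<in> borel_measurable borel" "(\<lambda>r. b1 r k) \<in> borel_measurable borel" for k
    using borel_measurable_integrable[OF i1(1)[of k]] borel_measurable_integrable[OF i1(2)[of k]] by auto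
  have bd: "\<exists>B. \<forall>r. \<bar>indicator {s..t} r *\<^sub>R f r\<bar> \<le> B" if "continuous_on {s..t} f" for f :: "real \<Rightarrow> real"
  proof -
    have "bounded (f ` {s..t})" by (rule compact_imp_bounded[OF compact_continuous_image[OF that]]) simp
    then obtain B where B: "\<forall>z\<in>f ` {s..t}. \<bar>z\<bar> \<le> B" unfolding bounded_iff by auto
    have "\<bar>indicator {s..t} r *\<^sub>R f r\<bar> \<le> max 0 B" for r
      using B by (cases "r \<in> {s..t}") (auto simp: indicator_def le_max_iff_disj)
    then show ?thesis by blast
  qed
  obtain Ba where Ba: "\<And>r k. \<bar>a0 r k\<bar> \<le> Ba k" using bd[OF ca] unfolding a0_def by metis
  obtain Bb where Bb: "\<And>r k. \<bar>b0 r k\<bar> \<le> Bb k" using bd[OF cb] unfolding b0_def by metis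
  have Tb: "\<bar>T n p q x\<bar> \<le> (\<Sum>k\<in>K n. \<bar>p k\<bar> + \<bar>q k\<bar>) / area" for p q x
  proof -
    have "\<bar>T n p q x\<bar> = \<bar>\<Sum>k\<in>K n. p k * cs k x + q k * sn k x\<bar> / area" using area_pos by (simp add: T_def abs_divide)
    also have "\<dots> \<le> (\<Sum>k\<in>K n. \<bar>p k\<bar> + \<bar>q k\<bar>) / area"
    proof (intro divide_right_mono order_trans[OF sum_abs] sum_mono)
      fix k
      have "\<bar>p k * cs k x\<bar> \<le> \<bar>p k\<bar>" "\<bar>q k * sn k x\<bar> \<le> \<bar>q k\<bar>"
        unfolding abs_mult using cs_le[of k x] by (auto intro: mult_left_le)
      then show "\<bar>p k * cs k x + q k * sn k x\<bar> \<le> \<bar>p k\<bar> + \<bar>q k\<bar>" by linarith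
    qed (use area_pos in auto)
    finally show ?thesis .
  qed
  define B1 where "B1 = (\<Sum>k\<in>K n. Ba k + Bb k) / area"
  define CJ where "CJ = \<bar>J 0\<bar> + \<bar>Q\<bar> * B1"
  define D where "D r = (\<Sum>k\<in>K n. \<bar>a1 r k\<bar> + \<bar>b1 r k\<bar>) / area" for r
  have JB: "\<bar>J (T n (a0 r) (b0 r) x)\<bar> \<le> CJ" for r x
  proof -
    have "\<bar>T n (a0 r) (b0 r) x\<bar> \<le> B1"
      unfolding B1_def using area_pos by (intro order_trans[OF Tb] divide_right_mono sum_mono add_mono Ba Bb) auto
    then have "\<bar>Q\<bar> * \<bar>T n (a0 r) (b0 r) x\<bar> \<le> \<bar>Q\<bar> * B1" by (intro mult_left_mono) auto
    moreover have "Q * \<bar>T n (a0 r) (b0 r) x\<bar> \<le> \<bar>Q\<bar> * \<bar>T n (a0 r) (b0 r) x\<bar>" by (intro mult_right_mono) auto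
    ultimately show ?thesis using JL[of "T n (a0 r) (b0 r) x" 0] unfolding CJ_def by simp linarith
  qed
  have CJ0: "0 \<le> CJ" using order_trans[OF abs_ge_zero JB] .
  have Di: "integrable lborel D" unfolding D_def
    using i1 by (intro integrable_divide Bochner_Integration.integrable_sum Bochner_Integration.integrable_add integrable_abs) auto
  define F where "F r x = J (T n (a0 r) (b0 r) x) * T n (a1 r) (b1 r) x" for r x
  have Fe: "F r x = indicator {s..t} r *\<^sub>R (J (T n (a r) (b r) x) * T n (a' r) (b' r) x)" for r x
  proof (cases "r \<in> {s..t}")
    case True
    then have "a0 r = a r" "b0 r = b r" "a1 r = a' r" "b1 r = b' r" by (auto simp: a0_def b0_def a1_def b1_def)
    then show ?thesis using True by (simp add: F_def)
  next
    case False
    then have "a1 r = (\<lambda>k. 0)" "b1 r = (\<lambda>k. 0)" by (auto simp: a1_def b1_def)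
    then show ?thesis using False by (simp add: F_def T_def)
  qed
  have Fm: "case_prod F \<in> borel_measurable (lborel \<Otimes>\<^sub>M M)"
    unfolding F_def[abs_def] T_def by measurable
  have Fb: "\<bar>F r x\<bar> \<le> CJ * D r" for r x
    unfolding F_def D_def abs_mult by (intro mult_mono JB Tb CJ0) auto
  have Fi: "integrable (lborel \<Otimes>\<^sub>M M) (case_prod F)"
  proof (rule pr.Fubini_integrable[OF Fm])
    have ix: "integrable M (\<lambda>x. F r x)" for r
    proof (rule fm.integrable_const_bound[where B = "CJ * D r"])
      show "(\<lambda>x. F r x) \<in> borel_measurable M" using measurable_compose[OF measurable_Pair1' Fm, of r] by simp
    qed (use Fb in auto)
    then show "AE r in lborel. integrable M (\<lambda>x. case_prod F (r, x))" by simp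
    show "integrable lborel (\<lambda>r. \<integral>x. norm (case_prod F (r, x)) \<partial>M)"
    proof (rule Bochner_Integration.integrable_bound[OF integrable_mult_right[OF Di, of "CJ * area"]])
      show "(\<lambda>r. \<integral>x. norm (case_prod F (r, x)) \<partial>M) \<in> borel_measurable lborel"
        using Fm by (intro fm.borel_measurable_lebesgue_integral) (simp add: case_prod_beta')
      show "AE r in lborel. norm (\<integral>x. norm (case_prod F (r, x)) \<partial>M) \<le> norm (CJ * area * D r)"
      proof (rule AE_I2)
        fix r
        have "(\<integral>x. norm (F r x) \<partial>M) \<le> (\<integral>x. CJ * D r \<partial>M)"
          using ix[of r] Fb[of r] by (intro integral_mono) auto
        also have "\<dots> = CJ * area * D r" by (simp add: measure_M)
        finally have "(\<integral>x. norm (F r x) \<partial>M) \<le> CJ * area * D r" .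
        moreover have "0 \<le> (\<integral>x. norm (F r x) \<partial>M)" by simp
        ultimately show "norm (\<integral>x. norm (case_prod F (r, x)) \<partial>M) \<le> norm (CJ * area * D r)"
          by simp
      qed
    qed
  qed
  have Fx: "(\<integral>x. F r x \<partial>M) = indicator {s..t} r *\<^sub>R (\<integral>x. J (T n (a r) (b r) x) * T n (a' r) (b' r) x \<partial>M)" for r
    unfolding Fe by (rule integral_scaleR_right)
  show "set_integrable lborel {s..t} (\<lambda>r. \<integral>x. J (T n (a r) (b r) x) * T n (a' r) (b' r) x \<partial>M)"
    using pr.integrable_fst[OF Fi] unfolding Fx set_integrable_def .
  have Fr: "(\<integral>r. F r x \<partial>lborel) = j (T n (a t) (b t) x) - j (T n (a s) (b s) x)" for x
    unfolding Fe set_lebesgue_integral_def[symmetric]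
    by (rule chain_rule_indefinite_integral[OF st aT yT j JL, symmetric])
  have cjT: "integrable M (\<lambda>x. j (T n p q x))" for p q
    by (intro continuous_integrable continuous_on_compose2[OF cj continuous_T]) auto
  have "(\<integral>x. j (T n (a t) (b t) x) \<partial>M) - (\<integral>x. j (T n (a s) (b s) x) \<partial>M) = (\<integral>x. (\<integral>r. F r x \<partial>lborel) \<partial>M)"
    unfolding Fr using cjT by simp
  also have "\<dots> = (\<integral>r. (\<integral>x. F r x \<partial>M) \<partial>lborel)" by (rule pr.Fubini_integral[OF Fi])
  finally show "(\<integral>x. j (T n (a t) (b t) x) \<partial>M) - (\<integral>x. j (T n (a s) (b s) x) \<partial>M) =
      (LINT r:{s..t}|lborel. \<integral>x. J (T n (a r) (b r) x) * T n (a' r) (b' r) x \<partial>M)"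
    unfolding Fx set_lebesgue_integral_def .
qed

lemma fpd_P: "fpd i h d \<Longrightarrow> fpd i (P n h) (P n d)"
  unfolding fpd_def by (simp add: AB_P)

lemma P_minus: "P n (\<lambda>x. - h x) = (\<lambda>x. - P n h x)"
  using P_cmult[of n "-1" h] by simp

lemma nrm_P_le: "sq M h \<Longrightarrow> nrm M (P n h) \<le> nrm M h"
  using Bessel[of h n] by (intro power2_le_imp_le[OF _ nrm_ge0]) (simp add: nrm_P)

lemma AE_positive_exists: assumes "AE r in lborel. 0 < r \<longrightarrow> Q r" shows "\<exists>r>0::real. Q r"
proof (rule ccontr)
  assume "\<not> ?thesis"
  then have "AE r in lborel. r \<notin> {0<..<1::real}" using assms by (auto elim: AE_mp)
  then have "{0<..<1::real} \<in> null_sets lborel" by (subst AE_iff_null_sets) auto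
  then have "emeasure lborel {0<..<1::real} = 0" by blast
  then show False by simp
qed

text \<open>The coefficients that the rotation of \<open>(h1, h2)\<close> would have.  They exist for every square-integrable field, also when
  its rotation is not square integrable.\<close>

definition rotA :: "(real^2 \<Rightarrow> real) \<Rightarrow> (real^2 \<Rightarrow> real) \<Rightarrow> int \<times> int \<Rightarrow> real" where
  "rotA h1 h2 k = kap 1 k * B h2 k - kap 2 k * B h1 k"
definition rotB :: "(real^2 \<Rightarrow> real) \<Rightarrow> (real^2 \<Rightarrow> real) \<Rightarrow> int \<times> int \<Rightarrow> real" where
  "rotB h1 h2 k = kap 2 k * A h1 k - kap 1 k * A h2 k"

lemma rot_uminus: "rotA h1 h2 (- k) = rotA h1 h2 k" "rotB h1 h2 (- k) = - rotB h1 h2 k"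
  by (simp_all add: rotA_def rotB_def AB_uminus)

lemma frot_T: "frot (P n h1) (P n h2) (T n (rotA h1 h2) (rotB h1 h2))"
  unfolding frot_def by (simp add: AB_T rot_uminus AB_P) (simp add: rotA_def rotB_def)

lemma frot_T_eq_P: assumes "frot h1 h2 r" shows "T n (rotA h1 h2) (rotB h1 h2) = P n r"
  unfolding P_def by (rule T_cong) (simp_all add: rotA_def rotB_def frotD(4,5)[OF assms])

lemma rot_P_by_parts:
  assumes z: "fpd 1 \<zeta> l2" "fpd 2 \<zeta> (\<lambda>x. - l1 x)"
    and J: "\<And>s. (J has_real_derivative J' s) (at s)" and J'b: "\<And>s. \<bar>J' s\<bar> \<le> C"
    and J'L: "\<And>a b. \<bar>J' a - J' b\<bar> \<le> Q * \<bar>a - b\<bar>"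
  shows "(\<integral>x. J (P n \<zeta> x) * T n (rotA h1 h2) (rotB h1 h2) x \<partial>M) =
    - (\<integral>x. (J' (P n \<zeta> x) * P n l1 x) * P n h1 x \<partial>M) - (\<integral>x. (J' (P n \<zeta> x) * P n l2 x) * P n h2 x \<partial>M)"
proof -
  have cJ': "continuous_on UNIV J'" by (rule lipschitz_imp_continuous[OF J'L])
  have cc: "continuous_on UNIV (\<lambda>x. J' (P n \<zeta> x))"
    by (rule continuous_on_compose2[OF cJ'], rule continuous_P, simp)
  have i: "integrable M (\<lambda>x. (J' (P n \<zeta> x) * P n l1 x) * P n h1 x)" "integrable M (\<lambda>x. (J' (P n \<zeta> x) * P n l2 x) * P n h2 x)"
    by (intro continuous_integrable continuous_intros cc)+
  have "(\<integral>x. J (P n \<zeta> x) * T n (rotA h1 h2) (rotB h1 h2) x \<partial>M) =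
    - (\<integral>x. J' (P n \<zeta> x) * (P n l2 x * P n h2 x - P n (\<lambda>x. - l1 x) x * P n h1 x) \<partial>M)"
    using rot_by_parts[OF fpd_P[OF z(1)] fpd_P[OF z(2)] frot_T[of n h1 h2] J J'b J'L, of n] by simp
  also have "(\<integral>x. J' (P n \<zeta> x) * (P n l2 x * P n h2 x - P n (\<lambda>x. - l1 x) x * P n h1 x) \<partial>M) =
    (\<integral>x. (J' (P n \<zeta> x) * P n l1 x) * P n h1 x + (J' (P n \<zeta> x) * P n l2 x) * P n h2 x \<partial>M)"
    unfolding P_minus by (rule Bochner_Integration.integral_cong) (auto simp: algebra_simps)
  finally show ?thesis using i by simp
qed

text \<open>The vorticity of \<open>w t\<close> is square integrable only for almost every \<open>t\<close>.  Therefore \<open>Y\<close>, which extends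
  \<open>t \<mapsto> \<integral> j (rot w)\<close> to all positive times, is obtained as a limit of the same functional of the partial sums.  For these
  the chain rule is available, and integration by parts moves the derivative from the time derivative of the vorticity
  onto \<open>J\<close>, so that the rate is dominated by the norms of \<open>\<Delta>w\<close> and \<open>\<partial>\<^sub>t w\<close> whatever the number of terms.\<close>

theorem time_identity:
  fixes w1 w2 t1 t2 l1 l2 z :: "real \<Rightarrow> real^2 \<Rightarrow> real" and j J J' :: "real \<Rightarrow> real"
  assumes ti: "\<And>k s t. 0 < s \<Longrightarrow> s \<le> t \<Longrightarrow> set_integrable lborel {s..t} (\<lambda>r. A (t1 r) k)"
      "\<And>k s t. 0 < s \<Longrightarrow> s \<le> t \<Longrightarrow> set_integrable lborel {s..t} (\<lambda>r. A (t2 r) k)"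
      "\<And>k s t. 0 < s \<Longrightarrow> s \<le> t \<Longrightarrow> set_integrable lborel {s..t} (\<lambda>r. B (t1 r) k)"
      "\<And>k s t. 0 < s \<Longrightarrow> s \<le> t \<Longrightarrow> set_integrable lborel {s..t} (\<lambda>r. B (t2 r) k)"
    and ty: "\<And>k s t. 0 < s \<Longrightarrow> s \<le> t \<Longrightarrow> A (w1 t) k - A (w1 s) k = (LINT r:{s..t}|lborel. A (t1 r) k)"
      "\<And>k s t. 0 < s \<Longrightarrow> s \<le> t \<Longrightarrow> A (w2 t) k - A (w2 s) k = (LINT r:{s..t}|lborel. A (t2 r) k)"
      "\<And>k s t. 0 < s \<Longrightarrow> s \<le> t \<Longrightarrow> B (w1 t) k - B (w1 s) k = (LINT r:{s..t}|lborel. B (t1 r) k)"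
      "\<And>k s t. 0 < s \<Longrightarrow> s \<le> t \<Longrightarrow> B (w2 t) k - B (w2 s) k = (LINT r:{s..t}|lborel. B (t2 r) k)"
    and good: "AE r in lborel. 0 < r \<longrightarrow> frot (w1 r) (w2 r) (z r) \<and> fpd 1 (z r) (l2 r) \<and> fpd 2 (z r) (\<lambda>x. - l1 r x) \<and>
        sq M (l1 r) \<and> sq M (t1 r) \<and> sq M (t2 r)"
    and dom: "\<And>s t. 0 < s \<Longrightarrow> s \<le> t \<Longrightarrow> set_integrable lborel {s..t}
        (\<lambda>r. (nrm M (l1 r))\<^sup>2 + (nrm M (l2 r))\<^sup>2 + (nrm M (t1 r))\<^sup>2 + (nrm M (t2 r))\<^sup>2)"
    and j: "\<And>s. (j has_real_derivative J s) (at s)" and j0: "j 0 = 0" "J 0 = 0"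
    and J: "\<And>s. (J has_real_derivative J' s) (at s)" and J'b: "\<And>s. \<bar>J' s\<bar> \<le> C"
    and J'L: "\<And>a b. \<bar>J' a - J' b\<bar> \<le> Q * \<bar>a - b\<bar>"
  shows "\<exists>Y I. (\<forall>s t. 0 < s \<longrightarrow> s \<le> t \<longrightarrow> set_integrable lborel {s..t} I \<and> Y t - Y s = (LINT r:{s..t}|lborel. I r)) \<and>
    (AE r in lborel. 0 < r \<longrightarrow> I r = - (\<integral>x. J' (z r x) * (l1 r x * t1 r x + l2 r x * t2 r x) \<partial>M)) \<and>
    (\<forall>t>0. (\<lambda>n. \<integral>x. j (T n (rotA (w1 t) (w2 t)) (rotB (w1 t) (w2 t)) x) \<partial>M) \<longlonglongrightarrow> Y t) \<and>
    (AE r in lborel. 0 < r \<longrightarrow> Y r = (\<integral>x. j (z r x) \<partial>M))"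
proof -
  have C0: "0 \<le> C" using order_trans[OF abs_ge_zero J'b] .
  have JL: "\<bar>J a - J b\<bar> \<le> C * \<bar>a - b\<bar>" for a b
  proof -
    have "\<And>x. x \<in> UNIV \<Longrightarrow> norm (J' x) \<le> C" using J'b by simp
    from field_differentiable_bound[of UNIV J J' C a b] J J'b show ?thesis by simp
  qed
  have jL: "\<bar>j a - j b\<bar> \<le> C * (\<bar>a\<bar> + \<bar>b\<bar>) * \<bar>a - b\<bar>" for a b
  proof -
    have "norm (j a - j b) \<le> (C * (\<bar>a\<bar> + \<bar>b\<bar>)) * norm (a - b)"
    proof (rule field_differentiable_bound[where S = "cball 0 (\<bar>a\<bar> + \<bar>b\<bar>)" and f' = J])
      fix s :: real assume "s \<in> cball 0 (\<bar>a\<bar> + \<bar>b\<bar>)"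
      then have "C * \<bar>s\<bar> \<le> C * (\<bar>a\<bar> + \<bar>b\<bar>)" using C0 by (intro mult_left_mono) auto
      then show "norm (J s) \<le> C * (\<bar>a\<bar> + \<bar>b\<bar>)" using JL[of s 0] j0 by simp
    qed (use j in \<open>auto intro: has_field_derivative_at_within\<close>)
    then show ?thesis by simp
  qed
  have jm: "j \<in> borel_measurable borel"
    by (intro borel_measurable_continuous_onI) (use j in \<open>meson DERIV_isCont continuous_at_imp_continuous_on\<close>)
  define In where "In n r = (\<integral>x. J (T n (rotA (w1 r) (w2 r)) (rotB (w1 r) (w2 r)) x) * T n (rotA (t1 r) (t2 r)) (rotB (t1 r) (t2 r)) x \<partial>M)" for n r
  define Yn where "Yn n t = (\<integral>x. j (T n (rotA (w1 t) (w2 t)) (rotB (w1 t) (w2 t)) x) \<partial>M)" for n t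
  define I where "I r = lim (\<lambda>n. In n r)" for r
  define I0 where "I0 r = - (\<integral>x. J' (z r x) * (l1 r x * t1 r x + l2 r x * t2 r x) \<partial>M)" for r
  have chain: "set_integrable lborel {s..t} (In n) \<and> Yn n t - Yn n s = (LINT r:{s..t}|lborel. In n r)" if st: "0 < s" "s \<le> t" for n s t
  proof -
    have sub: "set_integrable lborel {s..r} f" if "set_integrable lborel {s..t} f" "r \<in> {s..t}" for f :: "real \<Rightarrow> real" and r
      by (rule set_integrable_subset[OF that(1)]) (use that(2) in auto)
    have iA: "set_integrable lborel {s..t} (\<lambda>r. rotA (t1 r) (t2 r) k)" "set_integrable lborel {s..t} (\<lambda>r. rotB (t1 r) (t2 r) k)" for k
      unfolding rotA_def rotB_def by (intro set_integral_diff(1) set_integrable_mult_right ti[OF st])+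
    have yA: "rotA (w1 r) (w2 r) k = rotA (w1 s) (w2 s) k + (LINT q:{s..r}|lborel. rotA (t1 q) (t2 q) k)" if r: "r \<in> {s..t}" for r k
    proof -
      have "(LINT q:{s..r}|lborel. rotA (t1 q) (t2 q) k) = kap 1 k * (LINT q:{s..r}|lborel. B (t2 q) k) - kap 2 k * (LINT q:{s..r}|lborel. B (t1 q) k)"
        unfolding rotA_def by (subst set_integral_diff(2)) (auto intro!: set_integrable_mult_right sub[OF ti(3)[OF st] r] sub[OF ti(4)[OF st] r])
      then show ?thesis using ty(3,4)[of s r k] st r by (simp add: rotA_def algebra_simps)
    qed
    have yB: "rotB (w1 r) (w2 r) k = rotB (w1 s) (w2 s) k + (LINT q:{s..r}|lborel. rotB (t1 q) (t2 q) k)" if r: "r \<in> {s..t}" for r k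
    proof -
      have "(LINT q:{s..r}|lborel. rotB (t1 q) (t2 q) k) = kap 2 k * (LINT q:{s..r}|lborel. A (t1 q) k) - kap 1 k * (LINT q:{s..r}|lborel. A (t2 q) k)"
        unfolding rotB_def by (subst set_integral_diff(2)) (auto intro!: set_integrable_mult_right sub[OF ti(1)[OF st] r] sub[OF ti(2)[OF st] r])
      then show ?thesis using ty(1,2)[of s r k] st r by (simp add: rotB_def algebra_simps)
    qed
    show ?thesis unfolding In_def Yn_def
      using chain_T[where a = "\<lambda>r. rotA (w1 r) (w2 r)" and b = "\<lambda>r. rotB (w1 r) (w2 r)" and a' = "\<lambda>r. rotA (t1 r) (t2 r)"
          and b' = "\<lambda>r. rotB (t1 r) (t2 r)" and j = j and J = J and Q = C and n = n, OF st(2) iA yA yB j JL] by blast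
  qed
  have at: "(\<lambda>n. In n r) \<longlonglongrightarrow> I0 r \<and> (\<forall>n. \<bar>In n r\<bar> \<le> C * ((nrm M (l1 r))\<^sup>2 + (nrm M (l2 r))\<^sup>2 + (nrm M (t1 r))\<^sup>2 + (nrm M (t2 r))\<^sup>2))
      \<and> (\<lambda>n. Yn n r) \<longlonglongrightarrow> (\<integral>x. j (z r x) \<partial>M)"
    if g: "frot (w1 r) (w2 r) (z r)" "fpd 1 (z r) (l2 r)" "fpd 2 (z r) (\<lambda>x. - l1 r x)" "sq M (l1 r)" "sq M (t1 r)" "sq M (t2 r)" for r
  proof (intro conjI allI)
    note s = fpdD(1,2)[OF g(2)] g(4-6)
    have cJ: "conv M (\<lambda>n x. J' (P n (z r) x) * P n l x) (\<lambda>x. J' (z r x) * l x)" if "sq M l" for l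
      by (rule conv_bdd_mult[where C = C, OF conv_lipschitz_finite[OF conv_P[OF s(1)] J'L] _ _ conv_P[OF that]]) (use J'b in auto)
    have In_eq: "In n r = - (\<integral>x. (J' (P n (z r) x) * P n (l1 r) x) * P n (t1 r) x \<partial>M) - (\<integral>x. (J' (P n (z r) x) * P n (l2 r) x) * P n (t2 r) x \<partial>M)" for n
      unfolding In_def frot_T_eq_P[OF g(1)] by (rule rot_P_by_parts[OF g(2,3) J J'b J'L])
    have ii: "integrable M (\<lambda>x. (J' (z r x) * l1 r x) * t1 r x)" "integrable M (\<lambda>x. (J' (z r x) * l2 r x) * t2 r x)"
      by (intro sq_mult_integrable convD(2)[OF cJ] s)+
    have "(\<lambda>n. In n r) \<longlonglongrightarrow> - (\<integral>x. (J' (z r x) * l1 r x) * t1 r x \<partial>M) - (\<integral>x. (J' (z r x) * l2 r x) * t2 r x \<partial>M)"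
      unfolding In_eq by (intro tendsto_diff tendsto_minus conv_integral_mult cJ conv_P s)
    also have "- (\<integral>x. (J' (z r x) * l1 r x) * t1 r x \<partial>M) - (\<integral>x. (J' (z r x) * l2 r x) * t2 r x \<partial>M) = I0 r"
      unfolding I0_def using ii by (simp add: distrib_left mult.assoc)
    finally show "(\<lambda>n. In n r) \<longlonglongrightarrow> I0 r" .
    have b: "\<bar>\<integral>x. (J' (P n (z r) x) * P n l x) * P n t x \<partial>M\<bar> \<le> C * ((nrm M l)\<^sup>2 + (nrm M t)\<^sup>2)" if l: "sq M l" "sq M t" for n l t
    proof -
      have m: "(\<lambda>x. J' (P n (z r) x)) \<in> borel_measurable M"
        by (intro continuous_measurable continuous_on_compose2[OF lipschitz_imp_continuous[OF J'L] continuous_P]) auto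
      have sJ: "sq M (\<lambda>x. J' (P n (z r) x) * P n l x)" by (rule convD(1)[OF cJ[OF l(1)]])
      have "\<bar>\<integral>x. (J' (P n (z r) x) * P n l x) * P n t x \<partial>M\<bar> \<le> nrm M (\<lambda>x. J' (P n (z r) x) * P n l x) * nrm M (P n t)"
        by (rule Cauchy_Schwarz_integral[OF sJ sq_P])
      also have "\<dots> \<le> (C * nrm M l) * nrm M t"
      proof (intro mult_mono nrm_P_le l)
        have "nrm M (\<lambda>x. J' (P n (z r) x) * P n l x) \<le> \<bar>C\<bar> * nrm M (P n l)"
          by (rule nrm_bdd_mult[OF sq_P m]) (use J'b in auto)
        also have "\<dots> \<le> C * nrm M l" using C0 nrm_P_le[OF l(1)] by (simp add: mult_left_mono)
        finally show "nrm M (\<lambda>x. J' (P n (z r) x) * P n l x) \<le> C * nrm M l" .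
      qed (use C0 in auto)
      also have "\<dots> \<le> C * ((nrm M l)\<^sup>2 + (nrm M t)\<^sup>2)"
      proof -
        have "nrm M l * nrm M t \<le> 2 * nrm M l * nrm M t" by simp
        also have "\<dots> \<le> (nrm M l)\<^sup>2 + (nrm M t)\<^sup>2" by (rule sum_squares_bound)
        finally have "C * (nrm M l * nrm M t) \<le> C * ((nrm M l)\<^sup>2 + (nrm M t)\<^sup>2)" using C0 by (rule mult_left_mono)
        then show ?thesis by (simp add: mult.assoc)
      qed
      finally show ?thesis .
    qed
    show "\<bar>In n r\<bar> \<le> C * ((nrm M (l1 r))\<^sup>2 + (nrm M (l2 r))\<^sup>2 + (nrm M (t1 r))\<^sup>2 + (nrm M (t2 r))\<^sup>2)" for n
      unfolding In_eq using b[OF s(3,4), of n] b[OF s(2,5), of n] by (simp add: distrib_left)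
    show "(\<lambda>n. Yn n r) \<longlonglongrightarrow> (\<integral>x. j (z r x) \<partial>M)"
      unfolding Yn_def frot_T_eq_P[OF g(1)] by (rule quadratic_growth_tendsto(1)[OF conv_P[OF s(1)] jL j0(1) jm])
  qed
  have atAE: "AE r in lborel. 0 < r \<longrightarrow> (\<lambda>n. In n r) \<longlonglongrightarrow> I0 r \<and>
      (\<forall>n. \<bar>In n r\<bar> \<le> C * ((nrm M (l1 r))\<^sup>2 + (nrm M (l2 r))\<^sup>2 + (nrm M (t1 r))\<^sup>2 + (nrm M (t2 r))\<^sup>2))
      \<and> (\<lambda>n. Yn n r) \<longlonglongrightarrow> (\<integral>x. j (z r x) \<partial>M)"
    using good
  proof eventually_elim
    case (elim r)
    show ?case
    proof (rule impI, rule at)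
    qed (use elim in auto)
  qed
  have II: "set_integrable lborel {s..t} I \<and> (\<lambda>n. LINT r:{s..t}|lborel. In n r) \<longlonglongrightarrow> (LINT r:{s..t}|lborel. I r)"
    if st: "0 < s" "s \<le> t" for s t
  proof -
    let ?w = "\<lambda>r. C * (indicator {s..t} r *\<^sub>R ((nrm M (l1 r))\<^sup>2 + (nrm M (l2 r))\<^sup>2 + (nrm M (t1 r))\<^sup>2 + (nrm M (t2 r))\<^sup>2))"
    have m: "(\<lambda>r. indicator {s..t} r *\<^sub>R In n r) \<in> borel_measurable lborel" for n
      using chain[OF st, of n] unfolding set_integrable_def by auto
    have e: "(\<lambda>r. indicator {s..t} r *\<^sub>R I r) = (\<lambda>r. lim (\<lambda>n. indicator {s..t} r *\<^sub>R In n r))"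
      by (auto simp: I_def indicator_def fun_eq_iff)
    have mI: "(\<lambda>r. indicator {s..t} r *\<^sub>R I r) \<in> borel_measurable lborel"
      unfolding e by (rule borel_measurable_lim_metric[OF m])
    have w: "integrable lborel ?w" using dom[OF st] unfolding set_integrable_def by (rule integrable_mult_right)
    have l: "AE r in lborel. (\<lambda>n. indicator {s..t} r *\<^sub>R In n r) \<longlonglongrightarrow> indicator {s..t} r *\<^sub>R I r"
      using atAE
    proof eventually_elim
      case (elim r)
      show ?case
      proof (cases "r \<in> {s..t}")
        case True
        then have "(\<lambda>n. In n r) \<longlonglongrightarrow> I0 r" using elim st by auto
        then have "(\<lambda>n. In n r) \<longlonglongrightarrow> I r" unfolding I_def using limI by metis
        then show ?thesis using True by simp
      qed simp
    qed
    have bd: "AE r in lborel. norm (indicator {s..t} r *\<^sub>R In n r) \<le> ?w r" for n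
      using atAE
    proof eventually_elim
      case (elim r)
      then show ?case using st by (cases "r \<in> {s..t}") auto
    qed
    show ?thesis
      unfolding set_integrable_def set_lebesgue_integral_def
      using integrable_dominated_convergence[OF mI m w l bd] integral_dominated_convergence[OF mI m w l bd] by blast
  qed
  obtain r0 where r0: "0 < r0" "(\<lambda>n. Yn n r0) \<longlonglongrightarrow> (\<integral>x. j (z r0 x) \<partial>M)"
    using AE_positive_exists[OF atAE] by blast
  \<comment> \<open>convergence at one time \<open>r0\<close> spreads to all times, because the increments converge\<close>
  define Y where "Y t = lim (\<lambda>n. Yn n t)" for t
  have Yl: "(\<lambda>n. Yn n t) \<longlonglongrightarrow> Y t" if t: "0 < t" for t
  proof -
    have "\<exists>l. (\<lambda>n. Yn n t) \<longlonglongrightarrow> l"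
    proof (cases "r0 \<le> t")
      case True
      have "(\<lambda>n. Yn n r0 + (LINT r:{r0..t}|lborel. In n r)) \<longlonglongrightarrow> (\<integral>x. j (z r0 x) \<partial>M) + (LINT r:{r0..t}|lborel. I r)"
        using II[OF r0(1) True] by (intro tendsto_add r0(2)) auto
      moreover have "Yn n r0 + (LINT r:{r0..t}|lborel. In n r) = Yn n t" for n using chain[OF r0(1) True, of n] by linarith
      ultimately show ?thesis by auto
    next
      case False
      then have le: "t \<le> r0" by simp
      have "(\<lambda>n. Yn n r0 - (LINT r:{t..r0}|lborel. In n r)) \<longlonglongrightarrow> (\<integral>x. j (z r0 x) \<partial>M) - (LINT r:{t..r0}|lborel. I r)"
        using II[OF t le] by (intro tendsto_diff r0(2)) auto
      moreover have "Yn n r0 - (LINT r:{t..r0}|lborel. In n r) = Yn n t" for n using chain[OF t le, of n] by linarith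
      ultimately show ?thesis by auto
    qed
    then show ?thesis unfolding Y_def using limI by metis
  qed
  show ?thesis
  proof (rule exI[of _ Y], rule exI[of _ I], intro conjI allI impI)
    fix s t :: real assume st: "0 < s" "s \<le> t"
    show "set_integrable lborel {s..t} I" using II[OF st] by simp
    have "(\<lambda>n. Yn n t - Yn n s) \<longlonglongrightarrow> Y t - Y s" using st by (intro tendsto_diff Yl) auto
    moreover have "(\<lambda>n. Yn n t - Yn n s) \<longlonglongrightarrow> (LINT r:{s..t}|lborel. I r)" using II[OF st] chain[OF st] by simp
    ultimately show "Y t - Y s = (LINT r:{s..t}|lborel. I r)" by (rule LIMSEQ_unique)
  next
    show "AE r in lborel. 0 < r \<longrightarrow> I r = - (\<integral>x. J' (z r x) * (l1 r x * t1 r x + l2 r x * t2 r x) \<partial>M)"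
      using atAE unfolding I_def I0_def[symmetric] by eventually_elim (auto dest: limI)
    show "AE r in lborel. 0 < r \<longrightarrow> Y r = (\<integral>x. j (z r x) \<partial>M)"
      using atAE unfolding Y_def by eventually_elim (auto dest: limI)
  next
    fix t :: real assume "0 < t"
    then show "(\<lambda>n. \<integral>x. j (T n (rotA (w1 t) (w2 t)) (rotB (w1 t) (w2 t)) x) \<partial>M) \<longlonglongrightarrow> Y t"
      using Yl[of t] unfolding Yn_def by simp
  qed
qed

section \<open>Solutions in terms of Fourier coefficients\<close>

lemma integrable_vec2:
  fixes f :: "'b \<Rightarrow> real^2"
  assumes "integrable N (\<lambda>x. f x $ 1)" "integrable N (\<lambda>x. f x $ 2)" shows "integrable N f"
proof -
  have "integrable N (\<lambda>x. (f x $ 1) *\<^sub>R axis 1 1 + (f x $ 2) *\<^sub>R (axis 2 1 :: real^2))"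
    using assms by (intro Bochner_Integration.integrable_add integrable_scaleR_left)
  moreover have "(\<lambda>x. (f x $ 1) *\<^sub>R axis 1 1 + (f x $ 2) *\<^sub>R (axis 2 1 :: real^2)) = f"
    by (auto simp: fun_eq_iff vec_eq_iff forall_2 axis_def)
  ultimately show ?thesis by simp
qed

lemma integral_nth: "integrable N f \<Longrightarrow> (\<integral>x. f x \<partial>N) $ i = (\<integral>x. f x $ i \<partial>N)" for f :: "'b \<Rightarrow> real^2"
  by (rule integral_bounded_linear[OF bounded_linear_vec_nth, symmetric])

lemma measurable_nth: "f \<in> borel_measurable N \<Longrightarrow> (\<lambda>x. f x $ i) \<in> borel_measurable N" for f :: "'b \<Rightarrow> real^2"
  by (rule measurable_compose[OF _ borel_measurable_continuous_onI[OF linear_continuous_on[OF bounded_linear_vec_nth]]])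

lemma nth_sq_le: "(x $ i)\<^sup>2 \<le> (norm (x::real^2))\<^sup>2"
  using power_mono[OF component_le_norm_cart[of x i] abs_ge_zero, of 2] by simp

lemma L2_per_sq: fixes h :: "real^2 \<Rightarrow> real^2" assumes "L2_per L \<gamma> h" shows "sq M (\<lambda>x. h x $ i)"
proof (rule sqI)
  show m: "(\<lambda>x. h x $ i) \<in> borel_measurable M" using assms by (intro measurable_nth measurable_M) (auto simp: L2_per_def)
  have "integrable M (\<lambda>x. (norm (h x))\<^sup>2)" using assms by (simp add: L2_per_def integrable_Omega)
  then show "integrable M (\<lambda>x. (h x $ i)\<^sup>2)"
    by (rule Bochner_Integration.integrable_bound) (use m nth_sq_le in auto)
qed

lemma L2_per_sq_real: fixes h :: "real^2 \<Rightarrow> real" assumes "L2_per L \<gamma> h" shows "sq M h"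
  using assms by (intro sqI measurable_M) (auto simp: L2_per_def integrable_Omega)

lemma cs_vec_integrable: fixes h :: "real^2 \<Rightarrow> real^2" assumes "L2_per L \<gamma> h"
  shows "integrable M (\<lambda>x. cs k x *\<^sub>R h x)" "integrable M (\<lambda>x. sn k x *\<^sub>R h x)"
  by (rule integrable_vec2; simp; rule AB_integrable[OF L2_per_sq[OF assms]])+

text \<open>The trigonometric functions serve as test functions.\<close>

lemma weak_pd_fpd: fixes h d :: "real^2 \<Rightarrow> real^2" assumes "has_weak_pd L \<gamma> i h d" shows "fpd i (\<lambda>x. h x $ c) (\<lambda>x. d x $ c)"
proof -
  have h: "L2_per L \<gamma> h" "L2_per L \<gamma> d" using assms by (auto simp: has_weak_pd_def)
  have w: "(\<integral>x. \<phi> x *\<^sub>R d x \<partial>M) = - (\<integral>x. pd i \<phi> x *\<^sub>R h x \<partial>M)" if "test_function L \<gamma> \<phi>" for \<phi>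
    using assms that unfolding has_weak_pd_def LINT_Omega by blast
  have s: "(\<integral>x. (a * f x) *\<^sub>R h x \<partial>M) = a *\<^sub>R (\<integral>x. f x *\<^sub>R h x \<partial>M)" for a f
    by (simp only: scaleR_scaleR[symmetric] integral_scaleR_right)
  have "(\<integral>x. cs k x *\<^sub>R d x \<partial>M) = kap i k *\<^sub>R (\<integral>x. sn k x *\<^sub>R h x \<partial>M)"
    "(\<integral>x. sn k x *\<^sub>R d x \<partial>M) = - kap i k *\<^sub>R (\<integral>x. cs k x *\<^sub>R h x \<partial>M)" for k
    using w[OF test_function_cs(1)[of k]] w[OF test_function_cs(2)[of k]] unfolding pd_cs s by auto
  then have "(\<integral>x. cs k x *\<^sub>R d x \<partial>M) $ c = (kap i k *\<^sub>R (\<integral>x. sn k x *\<^sub>R h x \<partial>M)) $ c"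
    "(\<integral>x. sn k x *\<^sub>R d x \<partial>M) $ c = (- kap i k *\<^sub>R (\<integral>x. cs k x *\<^sub>R h x \<partial>M)) $ c" for k
    by metis+
  then have "A (\<lambda>x. d x $ c) k = kap i k * B (\<lambda>x. h x $ c) k" "B (\<lambda>x. d x $ c) k = - kap i k * A (\<lambda>x. h x $ c) k" for k
    by (simp_all add: A_def B_def integral_nth[OF cs_vec_integrable(1)] integral_nth[OF cs_vec_integrable(2)] h)
  then show ?thesis using L2_per_sq[OF h(1)] L2_per_sq[OF h(2)] by (simp add: fpd_def)
qed

lemma weak_pd_fpd_real: fixes h d :: "real^2 \<Rightarrow> real" assumes "has_weak_pd L \<gamma> i h d" shows "fpd i h d"
proof -
  have h: "L2_per L \<gamma> h" "L2_per L \<gamma> d" using assms by (auto simp: has_weak_pd_def)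
  have w: "(\<integral>x. \<phi> x * d x \<partial>M) = - (\<integral>x. pd i \<phi> x * h x \<partial>M)" if "test_function L \<gamma> \<phi>" for \<phi>
    using assms that unfolding has_weak_pd_def LINT_Omega by simp
  have "A d k = kap i k * B h k" "B d k = - kap i k * A h k" for k
    using w[OF test_function_cs(1)[of k]] w[OF test_function_cs(2)[of k]] unfolding pd_cs
    by (simp_all add: A_def B_def mult.assoc)
  then show ?thesis using L2_per_sq_real[OF h(1)] L2_per_sq_real[OF h(2)] by (simp add: fpd_def)
qed

lemma H_spaceD: assumes "h \<in> H_space L \<gamma>"
  shows "sq M (\<lambda>x. h x $ i)" "A (\<lambda>x. h x $ i) 0 = 0" "fdiv0 (\<lambda>x. h x $ 1) (\<lambda>x. h x $ 2)"
proof -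
  have h: "L2_per L \<gamma> h" "mean_zero L \<gamma> h" "weak_div_free L \<gamma> h" using assms by (auto simp: H_space_def)
  show s: "sq M (\<lambda>x. h x $ i)" for i by (rule L2_per_sq[OF h(1)])
  have "integrable M h" using cs_vec_integrable(1)[OF h(1), of 0] by simp
  then show "A (\<lambda>x. h x $ i) 0 = 0"
    using h(2) integral_nth[of M h i] by (simp add: A_def mean_zero_def LINT_Omega)
  have w: "(\<integral>x. h x $ 1 * pd 1 \<phi> x + h x $ 2 * pd 2 \<phi> x \<partial>M) = 0" if "test_function L \<gamma> \<phi>" for \<phi>
    using h(3) that unfolding weak_div_free_def LINT_Omega sum_2 by blast
  have e1: "(\<lambda>x. h x $ 1 * (- kap 1 k * sn k x) + h x $ 2 * (- kap 2 k * sn k x)) =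
      (\<lambda>x. - (kap 1 k * (sn k x * h x $ 1) + kap 2 k * (sn k x * h x $ 2)))" for k by (auto simp: algebra_simps)
  have e2: "(\<lambda>x. h x $ 1 * (kap 1 k * cs k x) + h x $ 2 * (kap 2 k * cs k x)) =
      (\<lambda>x. kap 1 k * (cs k x * h x $ 1) + kap 2 k * (cs k x * h x $ 2))" for k by (auto simp: algebra_simps)
  have "kap 1 k * A (\<lambda>x. h x $ 1) k + kap 2 k * A (\<lambda>x. h x $ 2) k = 0"
    "kap 1 k * B (\<lambda>x. h x $ 1) k + kap 2 k * B (\<lambda>x. h x $ 2) k = 0" for k
    using w[OF test_function_cs(1)[of k]] w[OF test_function_cs(2)[of k]] AB_integrable[OF s]
    unfolding pd_cs e1 e2 by (simp_all add: A_def B_def)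
  then show "fdiv0 (\<lambda>x. h x $ 1) (\<lambda>x. h x $ 2)" using s by (simp add: fdiv0_def)
qed

lemma weak_laplacian_flap: fixes h l :: "real^2 \<Rightarrow> real^2"
  assumes "has_weak_laplacian L \<gamma> h l" "A (\<lambda>x. h x $ c) 0 = 0" shows "flap (\<lambda>x. h x $ c) (\<lambda>x. l x $ c)"
proof -
  obtain d dd where d: "\<And>i. has_weak_pd L \<gamma> i h (d i)" "\<And>i j. has_weak_pd L \<gamma> j (d i) (dd i j)" "l = (\<lambda>x. \<Sum>i\<in>UNIV. dd i i x)"
    using assms(1) unfolding has_weak_laplacian_def by blast
  note f = weak_pd_fpd[OF d(1), of _ c] and ff = weak_pd_fpd[OF d(2), of _ _ c]
  have l: "(\<lambda>x. l x $ c) = (\<lambda>x. dd 1 1 x $ c + dd 2 2 x $ c)" unfolding d(3) sum_2 by simp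
  show ?thesis
    unfolding flap_def l
    using fpdD(1)[OF f[of 1]] fpdD(2)[OF ff[of 1 1]] fpdD(2)[OF ff[of 2 2]] assms(2)
    by (simp add: AB_add sq_add fpdD(3,4)[OF ff] fpdD(3,4)[OF f] kk_def power2_eq_square algebra_simps)
qed

lemma weak_rot_frot:
  assumes "has_weak_rot L \<gamma> h r" "L2_per L \<gamma> h" "sq M r" shows "frot (\<lambda>x. h x $ 1) (\<lambda>x. h x $ 2) r"
proof -
  have w: "(\<integral>x. \<phi> x * r x \<partial>M) = - (\<integral>x. pd 1 \<phi> x * h x $ 2 - pd 2 \<phi> x * h x $ 1 \<partial>M)" if "test_function L \<gamma> \<phi>" for \<phi>
    using assms(1) that unfolding has_weak_rot_def LINT_Omega by blast
  note s = L2_per_sq[OF assms(2)]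
  have e1: "(\<lambda>x. (- kap 1 k * sn k x) * h x $ 2 - (- kap 2 k * sn k x) * h x $ 1) =
      (\<lambda>x. kap 2 k * (sn k x * h x $ 1) - kap 1 k * (sn k x * h x $ 2))" for k by (auto simp: algebra_simps)
  have e2: "(\<lambda>x. (kap 1 k * cs k x) * h x $ 2 - (kap 2 k * cs k x) * h x $ 1) =
      (\<lambda>x. kap 1 k * (cs k x * h x $ 2) - kap 2 k * (cs k x * h x $ 1))" for k by (auto simp: algebra_simps)
  have "A r k = kap 1 k * B (\<lambda>x. h x $ 2) k - kap 2 k * B (\<lambda>x. h x $ 1) k"
    "B r k = kap 2 k * A (\<lambda>x. h x $ 1) k - kap 1 k * A (\<lambda>x. h x $ 2) k" for k
    using w[OF test_function_cs(1)[of k]] w[OF test_function_cs(2)[of k]] AB_integrable[OF s]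
    unfolding pd_cs e1 e2 by (simp_all add: A_def B_def)
  then show ?thesis using s assms(3) by (simp add: frot_def)
qed

subsection \<open>Time-dependent fields\<close>

lemma L2_loc_diff:
  fixes g h :: "real \<Rightarrow> real^2 \<Rightarrow> real^2"
  assumes "L2_loc L \<gamma> J g" "L2_loc L \<gamma> J h" shows "L2_loc L \<gamma> J (\<lambda>t x. g t x - h t x)"
  unfolding L2_loc_def
proof (intro conjI allI impI)
  let ?g = "\<lambda>z. indicator (J \<times> UNIV) z *\<^sub>R g (fst z) (snd z)" and ?h = "\<lambda>z. indicator (J \<times> UNIV) z *\<^sub>R h (fst z) (snd z)"
  have [measurable]: "?g \<in> borel_measurable borel" "?h \<in> borel_measurable borel"
    using assms by (auto simp: L2_loc_def set_borel_measurable_def)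
  have "(\<lambda>z. indicator (J \<times> UNIV) z *\<^sub>R (g (fst z) (snd z) - h (fst z) (snd z))) = (\<lambda>z. ?g z - ?h z)"
    by (auto simp: scaleR_right_diff_distrib)
  moreover have "(\<lambda>z. ?g z - ?h z) \<in> borel_measurable borel" by measurable
  ultimately show "set_borel_measurable lborel (J \<times> UNIV) (\<lambda>z. g (fst z) (snd z) - h (fst z) (snd z))"
    by (simp add: set_borel_measurable_def)
  fix a b assume ab: "{a..b} \<subseteq> J"
  let ?I = "\<lambda>z. indicator ({a..b} \<times> Omega L \<gamma>) z :: real"
  have Im: "?I \<in> borel_measurable borel" by (intro borel_measurable_indicator borel_Times) auto
  have i: "integrable lborel (\<lambda>z. ?I z *\<^sub>R (norm (g (fst z) (snd z)))\<^sup>2)" "integrable lborel (\<lambda>z. ?I z *\<^sub>R (norm (h (fst z) (snd z)))\<^sup>2)"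
    using assms ab by (auto simp: L2_loc_def set_integrable_def)
  show "set_integrable lborel ({a..b} \<times> Omega L \<gamma>) (\<lambda>z. (norm (g (fst z) (snd z) - h (fst z) (snd z)))\<^sup>2)"
    unfolding set_integrable_def
  proof (rule Bochner_Integration.integrable_bound[of _ "\<lambda>z. 2 * (?I z *\<^sub>R (norm (g (fst z) (snd z)))\<^sup>2) + 2 * (?I z *\<^sub>R (norm (h (fst z) (snd z)))\<^sup>2)"])
    have e: "(\<lambda>z. ?I z *\<^sub>R (norm (g (fst z) (snd z) - h (fst z) (snd z)))\<^sup>2) = (\<lambda>z. ?I z *\<^sub>R (norm (?g z - ?h z))\<^sup>2)"
      using ab by (auto simp: indicator_def fun_eq_iff)
    have "(\<lambda>z. ?I z *\<^sub>R (norm (?g z - ?h z))\<^sup>2) \<in> borel_measurable borel" using Im by measurable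
    then show "(\<lambda>z. ?I z *\<^sub>R (norm (g (fst z) (snd z) - h (fst z) (snd z)))\<^sup>2) \<in> borel_measurable lborel"
      unfolding e by simp
    have n: "(norm (p - q))\<^sup>2 \<le> 2 * (norm p)\<^sup>2 + 2 * (norm q)\<^sup>2" for p q :: "real^2"
    proof -
      have "(norm (p - q))\<^sup>2 \<le> (norm p + norm q)\<^sup>2" by (intro power_mono norm_triangle_ineq4) auto
      also have "\<dots> \<le> 2 * (norm p)\<^sup>2 + 2 * (norm q)\<^sup>2" using sum_squares_bound[of "norm p" "norm q"] by (simp add: power2_sum)
      finally show ?thesis .
    qed
    show "AE z in lborel. norm (?I z *\<^sub>R (norm (g (fst z) (snd z) - h (fst z) (snd z)))\<^sup>2) \<le>
        norm (2 * (?I z *\<^sub>R (norm (g (fst z) (snd z)))\<^sup>2) + 2 * (?I z *\<^sub>R (norm (h (fst z) (snd z)))\<^sup>2))"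
      using n by (intro AE_I2) (auto simp: indicator_def)
  qed (use i in auto)
qed

context
  fixes h :: "real \<Rightarrow> real^2 \<Rightarrow> real^2" and s t :: real
  assumes hl: "L2_loc L \<gamma> {0<..} h" and st: "0 < s" "s \<le> t"
begin

lemma L2_loc_prod_integrable:
  shows "\<phi> \<in> borel_measurable borel \<Longrightarrow> (\<And>x. \<bar>\<phi> x\<bar> \<le> 1) \<Longrightarrow>
      integrable (lborel \<Otimes>\<^sub>M lborel) (\<lambda>(r, x). indicator {s..t} r *\<^sub>R (indicator (Omega L \<gamma>) x *\<^sub>R (\<phi> x * h r x $ i)))"
    and "integrable (lborel \<Otimes>\<^sub>M lborel) (\<lambda>(r, x). indicator {s..t} r *\<^sub>R (indicator (Omega L \<gamma>) x *\<^sub>R (h r x $ i)\<^sup>2))"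
proof -
  let ?h = "\<lambda>z. indicator ({0<..} \<times> UNIV) z *\<^sub>R h (fst z) (snd z)"
  let ?I = "\<lambda>z. indicator ({s..t} \<times> Omega L \<gamma>) z :: real"
  have "?h \<in> borel_measurable borel" using hl by (auto simp: L2_loc_def set_borel_measurable_def)
  then have hm: "(\<lambda>z. ?h z $ i) \<in> borel_measurable borel" by (rule measurable_nth)
  have Im: "?I \<in> borel_measurable borel" by (intro borel_measurable_indicator borel_Times) auto
  have "{s..t} \<subseteq> {0<..}" using st by auto
  then have i: "integrable lborel (\<lambda>z. ?I z *\<^sub>R (norm (h (fst z) (snd z)))\<^sup>2)"
    using hl by (auto simp: L2_loc_def set_integrable_def)
  have i1: "integrable lborel ?I"
  proof -
    have "emeasure (lborel \<Otimes>\<^sub>M lborel) ({s..t} \<times> Omega L \<gamma>) < \<infinity>"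
      using st emeasure_Omega by (subst lborel.emeasure_pair_measure_Times) (auto simp: ennreal_mult_less_top)
    then show ?thesis unfolding lborel_prod by (intro integrable_real_indicator borel_Times[THEN sets_lborel[THEN equalityD2, THEN subsetD]]) auto
  qed
  show "integrable (lborel \<Otimes>\<^sub>M lborel) (\<lambda>(r, x). indicator {s..t} r *\<^sub>R (indicator (Omega L \<gamma>) x *\<^sub>R (\<phi> x * h r x $ i)))"
    if \<phi>m: "\<phi> \<in> borel_measurable borel" and b: "\<And>x. \<bar>\<phi> x\<bar> \<le> 1" for \<phi>
  proof -
    have e: "(\<lambda>(r, x). indicator {s..t} r *\<^sub>R (indicator (Omega L \<gamma>) x *\<^sub>R (\<phi> x * h r x $ i))) = (\<lambda>z. ?I z * (\<phi> (snd z) * ?h z $ i))"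
      using st by (auto simp: indicator_def fun_eq_iff)
    show ?thesis unfolding e lborel_prod
    proof (rule Bochner_Integration.integrable_bound[OF Bochner_Integration.integrable_add[OF i i1]])
      have "(\<lambda>z. \<phi> (snd z)) \<in> borel_measurable borel"
        by (rule measurable_compose[OF borel_measurable_continuous_onI \<phi>m]) (intro continuous_intros)
      then have "(\<lambda>z. ?I z * (\<phi> (snd z) * ?h z $ i)) \<in> borel_measurable borel"
        by (rule borel_measurable_times[OF Im borel_measurable_times[OF _ hm]])
      then show "(\<lambda>z. ?I z * (\<phi> (snd z) * ?h z $ i)) \<in> borel_measurable lborel" by simp
      have n: "\<bar>\<phi> x * p $ i\<bar> \<le> (norm p)\<^sup>2 + 1" for x and p :: "real^2"
      proof -
        have "\<bar>\<phi> x * p $ i\<bar> \<le> 1 * norm p" unfolding abs_mult by (intro mult_mono b component_le_norm_cart) auto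
        moreover have "2 * norm p * 1 \<le> (norm p)\<^sup>2 + 1\<^sup>2" by (rule sum_squares_bound)
        moreover have "0 \<le> norm p" by simp
        ultimately show ?thesis by simp
      qed
      show "AE z in lborel. norm (?I z * (\<phi> (snd z) * ?h z $ i)) \<le> norm (?I z *\<^sub>R (norm (h (fst z) (snd z)))\<^sup>2 + ?I z)"
      proof (rule AE_I2)
        fix z show "norm (?I z * (\<phi> (snd z) * ?h z $ i)) \<le> norm (?I z *\<^sub>R (norm (h (fst z) (snd z)))\<^sup>2 + ?I z)"
          using n[of "snd z" "h (fst z) (snd z)"] st by (cases "z \<in> {s..t} \<times> Omega L \<gamma>") auto
      qed
    qed
  qed
  have e: "(\<lambda>(r, x). indicator {s..t} r *\<^sub>R (indicator (Omega L \<gamma>) x *\<^sub>R (h r x $ i)\<^sup>2)) = (\<lambda>z. ?I z * (?h z $ i)\<^sup>2)"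
    using st by (auto simp: indicator_def fun_eq_iff)
  show "integrable (lborel \<Otimes>\<^sub>M lborel) (\<lambda>(r, x). indicator {s..t} r *\<^sub>R (indicator (Omega L \<gamma>) x *\<^sub>R (h r x $ i)\<^sup>2))"
    unfolding e lborel_prod
  proof (rule Bochner_Integration.integrable_bound[OF i])
    have "(\<lambda>z. ?I z * (?h z $ i)\<^sup>2) \<in> borel_measurable borel"
      by (rule borel_measurable_times[OF Im borel_measurable_power[OF hm]])
    then show "(\<lambda>z. ?I z * (?h z $ i)\<^sup>2) \<in> borel_measurable lborel" by simp
    show "AE z in lborel. norm (?I z * (?h z $ i)\<^sup>2) \<le> norm (?I z *\<^sub>R (norm (h (fst z) (snd z)))\<^sup>2)"
    proof (rule AE_I2)
      fix z show "norm (?I z * (?h z $ i)\<^sup>2) \<le> norm (?I z *\<^sub>R (norm (h (fst z) (snd z)))\<^sup>2)"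
        using nth_sq_le[of "h (fst z) (snd z)" i] st by (cases "z \<in> {s..t} \<times> Omega L \<gamma>") auto
    qed
  qed
qed

lemma inner_Omega: "(\<integral>x. indicator {s..t} r *\<^sub>R (indicator (Omega L \<gamma>) x *\<^sub>R g x) \<partial>lborel) = indicator {s..t} r *\<^sub>R (\<integral>x. g x \<partial>M)" for g :: "real^2 \<Rightarrow> real"
  unfolding LINT_Omega[symmetric] set_lebesgue_integral_def by (rule integral_scaleR_right)

lemma L2_loc_nrm: "set_integrable lborel {s..t} (\<lambda>r. (nrm M (\<lambda>x. h r x $ i))\<^sup>2)"
  using lborel_pair.integrable_fst[OF L2_loc_prod_integrable(2)[of i]]
  unfolding inner_Omega set_integrable_def nrm_power2 .

lemma L2_loc_coef:
  assumes "\<phi> \<in> borel_measurable borel" "\<And>x. \<bar>\<phi> x\<bar> \<le> 1"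
  shows "set_integrable lborel {s..t} (\<lambda>r. \<integral>x. \<phi> x * h r x $ i \<partial>M)"
  using lborel_pair.integrable_fst[OF L2_loc_prod_integrable(1)[OF assms, of i]]
  unfolding inner_Omega set_integrable_def .

text \<open>Fubini: a pointwise indefinite integral in time becomes one for every Fourier coefficient.\<close>

lemma L2_loc_evolve:
  assumes \<phi>: "\<phi> \<in> borel_measurable borel" "\<And>x. \<bar>\<phi> x\<bar> \<le> 1"
    and u: "AE x in lborel. u x - v x = (LINT r:{s..t}|lborel. h r x)" and uv: "sq M (\<lambda>x. u x $ i)" "sq M (\<lambda>x. v x $ i)"
  shows "(\<integral>x. \<phi> x * u x $ i \<partial>M) - (\<integral>x. \<phi> x * v x $ i \<partial>M) = (LINT r:{s..t}|lborel. \<integral>x. \<phi> x * h r x $ i \<partial>M)"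
proof -
  let ?F = "\<lambda>r x. indicator {s..t} r *\<^sub>R (indicator (Omega L \<gamma>) x *\<^sub>R (\<phi> x * h r x $ i))"
  have ix: "AE x in lborel. \<forall>i. x \<in> Omega L \<gamma> \<longrightarrow> integrable lborel (\<lambda>r. indicator {s..t} r *\<^sub>R (h r x $ i))"
  proof -
    have a: "AE x in lborel. x \<in> Omega L \<gamma> \<longrightarrow> integrable lborel (\<lambda>r. indicator {s..t} r *\<^sub>R (h r x $ i))" for i
    proof -
      have "integrable (lborel \<Otimes>\<^sub>M lborel) (\<lambda>(r, x). indicator {s..t} r *\<^sub>R (indicator (Omega L \<gamma>) x *\<^sub>R (1 * h r x $ i)))"
        by (rule L2_loc_prod_integrable(1)) auto
      from lborel_pair.AE_integrable_fst'[OF lborel_pair.integrable_product_swap[OF this]]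
      show ?thesis by eventually_elim auto
    qed
    show ?thesis using a[of 1] a[of 2] by eventually_elim (auto simp: forall_2)
  qed
  have sm: "sq M \<phi>" by (rule bounded_sq[OF measurable_M[OF \<phi>(1)] \<phi>(2)])
  have "(\<integral>x. \<phi> x * u x $ i \<partial>M) - (\<integral>x. \<phi> x * v x $ i \<partial>M) = (\<integral>x. \<phi> x * (u x - v x) $ i \<partial>M)"
    using sq_mult_integrable[OF sm uv(1)] sq_mult_integrable[OF sm uv(2)] by (simp add: right_diff_distrib)
  also have "\<dots> = (\<integral>x. indicator (Omega L \<gamma>) x *\<^sub>R (\<phi> x * (u x - v x) $ i) \<partial>lborel)"
    unfolding LINT_Omega[symmetric] set_lebesgue_integral_def ..
  also have "\<dots> = (\<integral>x. (\<integral>r. ?F r x \<partial>lborel) \<partial>lborel)"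
  proof (rule integral_cong_AE)
    have "(\<lambda>x. \<phi> x * (u x - v x) $ i) \<in> borel_measurable M"
      using sq_measurable[OF sm] sq_measurable[OF uv(1)] sq_measurable[OF uv(2)] by simp
    then show "(\<lambda>x. indicator (Omega L \<gamma>) x *\<^sub>R (\<phi> x * (u x - v x) $ i)) \<in> borel_measurable lborel"
      unfolding M_def by (subst (asm) borel_measurable_restrict_space_iff) auto
    show "(\<lambda>x. \<integral>r. ?F r x \<partial>lborel) \<in> borel_measurable lborel"
      using lborel_pair.integrable_snd[OF L2_loc_prod_integrable(1)[OF \<phi>, of i]] by (rule borel_measurable_integrable)
    show "AE x in lborel. indicator (Omega L \<gamma>) x *\<^sub>R (\<phi> x * (u x - v x) $ i) = (\<integral>r. ?F r x \<partial>lborel)"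
      using u ix
    proof eventually_elim
      case (elim x)
      show ?case
      proof (cases "x \<in> Omega L \<gamma>")
        case True
        then have ii: "integrable lborel (\<lambda>r. indicator {s..t} r *\<^sub>R h r x)" using elim(2) by (intro integrable_vec2) auto
        have "(u x - v x) $ i = (\<integral>r. (indicator {s..t} r *\<^sub>R h r x) $ i \<partial>lborel)"
          unfolding elim(1) set_lebesgue_integral_def by (rule integral_nth[OF ii])
        moreover have "(\<integral>r. ?F r x \<partial>lborel) = (\<integral>r. \<phi> x * (indicator {s..t} r *\<^sub>R h r x) $ i \<partial>lborel)"
          using True by (intro Bochner_Integration.integral_cong) auto
        ultimately show ?thesis using True by simp
      qed simp
    qed
  qed
  also have "\<dots> = (\<integral>r. (\<integral>x. ?F r x \<partial>lborel) \<partial>lborel)"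
    using lborel_pair.Fubini_integral[of "\<lambda>r x. ?F r x"] L2_loc_prod_integrable(1)[OF \<phi>, of i] by simp
  also have "\<dots> = (LINT r:{s..t}|lborel. \<integral>x. \<phi> x * h r x $ i \<partial>M)"
    unfolding inner_Omega set_lebesgue_integral_def ..
  finally show ?thesis .
qed

end

text \<open>What the estimates use of a solution.  Pressure and initial value have disappeared, and the force is
  represented by its rotation \<open>r\<close>.\<close>

definition evolution :: "real \<Rightarrow> real \<Rightarrow> (real \<Rightarrow> real^2 \<Rightarrow> real^2) \<Rightarrow> (real \<Rightarrow> real^2 \<Rightarrow> real^2) \<Rightarrow> (real \<Rightarrow> 2 \<Rightarrow> real^2 \<Rightarrow> real^2) \<Rightarrow>
    (real \<Rightarrow> real^2 \<Rightarrow> real^2) \<Rightarrow> (real \<Rightarrow> real^2 \<Rightarrow> real) \<Rightarrow> bool" where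
  "evolution \<nu> \<mu> u ut du lap r \<longleftrightarrow> (\<forall>t\<ge>0. u t \<in> H_space L \<gamma>) \<and> L2_loc L \<gamma> {0<..} ut \<and> L2_loc L \<gamma> {0<..} lap \<and>
     (\<forall>s t. 0 < s \<and> s \<le> t \<longrightarrow> (AE x in lborel. u t x - u s x = (LINT q:{s..t}|lborel. ut q x))) \<and>
     (AE t in lborel. 0 < t \<longrightarrow> sq M (r t) \<longrightarrow>
        nse \<nu> \<mu> (\<lambda>x. ut t x $ 1) (\<lambda>x. ut t x $ 2) (\<lambda>x. u t x $ 1) (\<lambda>x. u t x $ 2) (\<lambda>x. du t 1 x $ 1) (\<lambda>x. du t 1 x $ 2)
          (\<lambda>x. du t 2 x $ 1) (\<lambda>x. du t 2 x $ 2) (\<lambda>x. lap t x $ 1) (\<lambda>x. lap t x $ 2) (r t)) \<and>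
     (AE t in lborel. 0 < t \<longrightarrow> vf (\<lambda>x. u t x $ 1) (\<lambda>x. u t x $ 2) (\<lambda>x. du t 1 x $ 1) (\<lambda>x. du t 1 x $ 2)
          (\<lambda>x. du t 2 x $ 1) (\<lambda>x. du t 2 x $ 2) (\<lambda>x. lap t x $ 1) (\<lambda>x. lap t x $ 2) \<and>
          sq M (\<lambda>x. ut t x $ 1) \<and> sq M (\<lambda>x. ut t x $ 2))"

lemma ns_solution_evolution:
  assumes ns: "ns_solution L \<gamma> \<nu> \<mu> f u0 u p" and f: "forcing L \<gamma> f" and r: "\<And>t. 0 \<le> t \<Longrightarrow> has_weak_rot L \<gamma> (f t) (rf t)"
  shows "\<exists>ut du lap. evolution \<nu> \<mu> u ut du lap rf"
proof -
  have uH: "\<And>t. 0 \<le> t \<Longrightarrow> u t \<in> H_space L \<gamma>" using ns by (simp add: ns_solution_def)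
  have fH: "\<And>t. 0 \<le> t \<Longrightarrow> f t \<in> H_space L \<gamma>" using f by (simp add: forcing_def)
  obtain ut du lap dp where
    loc: "L2_loc L \<gamma> {0<..} ut" "L2_loc L \<gamma> {0<..} lap" and
    good: "AE t in lborel. 0 < t \<longrightarrow> L2_per L \<gamma> (ut t) \<and> (\<forall>i. has_weak_pd L \<gamma> i (u t) (du i t)) \<and> has_weak_laplacian L \<gamma> (u t) (lap t) \<and>
           mean_zero L \<gamma> (p t) \<and> (\<forall>i. has_weak_pd L \<gamma> i (p t) (dp i t))" and
    ev: "\<And>s t. 0 < s \<and> s \<le> t \<Longrightarrow> AE x in lborel. u t x - u s x = (LINT r:{s..t}|lborel. ut r x)" and
    eq: "AE t in lborel. 0 < t \<longrightarrow> (AE x in lborel. ut t x + (\<Sum>i\<in>UNIV. (u t x $ i) *\<^sub>R du i t x) =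
                \<nu> *\<^sub>R lap t x - \<mu> *\<^sub>R u t x - (\<chi> i. dp i t x) + f t x)"
    using ns unfolding ns_solution_def by blast
  have v: "vf (\<lambda>x. u t x $ 1) (\<lambda>x. u t x $ 2) (\<lambda>x. du 1 t x $ 1) (\<lambda>x. du 1 t x $ 2) (\<lambda>x. du 2 t x $ 1) (\<lambda>x. du 2 t x $ 2) (\<lambda>x. lap t x $ 1) (\<lambda>x. lap t x $ 2)"
    if "0 < t" "\<forall>i. has_weak_pd L \<gamma> i (u t) (du i t)" "has_weak_laplacian L \<gamma> (u t) (lap t)" for t
  proof -
    have H: "u t \<in> H_space L \<gamma>" using uH[of t] that(1) by simp
    show ?thesis unfolding vf_def
      by (intro conjI weak_pd_fpd that(2)[rule_format] weak_laplacian_flap[OF that(3)] H_spaceD[OF H])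
  qed
  have mAE: "AE x in M. Q x" if "AE x in lborel. Q x" for Q
    unfolding M_def using that by (subst AE_restrict_space_iff) (auto elim: AE_mp)
  have "evolution \<nu> \<mu> u ut (\<lambda>t i. du i t) lap rf"
    unfolding evolution_def
  proof (intro conjI allI impI uH loc ev)
    show "AE t in lborel. 0 < t \<longrightarrow> vf (\<lambda>x. u t x $ 1) (\<lambda>x. u t x $ 2) (\<lambda>x. du 1 t x $ 1) (\<lambda>x. du 1 t x $ 2)
          (\<lambda>x. du 2 t x $ 1) (\<lambda>x. du 2 t x $ 2) (\<lambda>x. lap t x $ 1) (\<lambda>x. lap t x $ 2) \<and>
          sq M (\<lambda>x. ut t x $ 1) \<and> sq M (\<lambda>x. ut t x $ 2)"
      using good by eventually_elim (blast intro: v L2_per_sq)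
    show "AE t in lborel. 0 < t \<longrightarrow> sq M (rf t) \<longrightarrow>
        nse \<nu> \<mu> (\<lambda>x. ut t x $ 1) (\<lambda>x. ut t x $ 2) (\<lambda>x. u t x $ 1) (\<lambda>x. u t x $ 2) (\<lambda>x. du 1 t x $ 1) (\<lambda>x. du 1 t x $ 2)
          (\<lambda>x. du 2 t x $ 1) (\<lambda>x. du 2 t x $ 2) (\<lambda>x. lap t x $ 1) (\<lambda>x. lap t x $ 2) (rf t)"
      using good eq
    proof eventually_elim
      case (elim t)
      show ?case
      proof (intro impI)
        assume t: "0 < t" and sr: "sq M (rf t)"
        have g: "L2_per L \<gamma> (ut t)" "\<forall>i. has_weak_pd L \<gamma> i (u t) (du i t)" "has_weak_laplacian L \<gamma> (u t) (lap t)" "\<forall>i. has_weak_pd L \<gamma> i (p t) (dp i t)"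
          using elim(1) t by blast+
        have fr: "frot (\<lambda>x. f t x $ 1) (\<lambda>x. f t x $ 2) (rf t)"
          by (rule weak_rot_frot[OF r _ sr]) (use fH[of t] t in \<open>auto simp: H_space_def\<close>)
        have pr: "frot (dp 1 t) (dp 2 t) (\<lambda>x. 0)"
          by (rule frot_gradient[of "p t"]) (intro weak_pd_fpd_real g(4)[rule_format])+
        have "AE x in lborel. ut t x $ 1 + (u t x $ 1 * du 1 t x $ 1 + u t x $ 2 * du 2 t x $ 1) = \<nu> * lap t x $ 1 - \<mu> * u t x $ 1 - dp 1 t x + f t x $ 1 \<and>
            ut t x $ 2 + (u t x $ 1 * du 1 t x $ 2 + u t x $ 2 * du 2 t x $ 2) = \<nu> * lap t x $ 2 - \<mu> * u t x $ 2 - dp 2 t x + f t x $ 2"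
          using elim(2)[rule_format, OF t]
        proof eventually_elim
          case (elim x)
          from arg_cong[OF elim, of "\<lambda>y. y $ 1"] arg_cong[OF elim, of "\<lambda>y. y $ 2"] show ?case by (simp add: sum_2)
        qed
        then show "nse \<nu> \<mu> (\<lambda>x. ut t x $ 1) (\<lambda>x. ut t x $ 2) (\<lambda>x. u t x $ 1) (\<lambda>x. u t x $ 2) (\<lambda>x. du 1 t x $ 1) (\<lambda>x. du 1 t x $ 2)
          (\<lambda>x. du 2 t x $ 1) (\<lambda>x. du 2 t x $ 2) (\<lambda>x. lap t x $ 1) (\<lambda>x. lap t x $ 2) (rf t)"
          unfolding nse_def using v[OF t g(2,3)] L2_per_sq[OF g(1)] pr fr mAE by blast
      qed
    qed
  qed auto
  then show ?thesis by blast
qed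

end

section \<open>Decay of large vorticity\<close>

text \<open>Extension by zero to the negative half-axis; it preserves differentiability if value and slope vanish at \<open>0\<close>.\<close>

definition cutoff :: "(real \<Rightarrow> real) \<Rightarrow> real \<Rightarrow> real" where "cutoff g x = (if x \<le> 0 then 0 else g x)"

lemma DERIV_cutoff:
  assumes g: "\<And>x. 0 \<le> x \<Longrightarrow> (g has_real_derivative g' x) (at x)" and "g 0 = 0" "g' 0 = 0"
  shows "(cutoff g has_real_derivative cutoff g' x) (at x)"
proof (cases x "0::real" rule: linorder_cases)
  case less
  have "((\<lambda>x. 0) has_real_derivative 0) (at x)" by simp
  moreover have "\<forall>\<^sub>F y in nhds x. 0 = cutoff g y"
    using eventually_nhds_in_open[of "{..<0}" x] less by (auto elim!: eventually_mono simp: cutoff_def)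
  ultimately have "(cutoff g has_real_derivative 0) (at x)" by (rule DERIV_cong_ev[THEN iffD1, OF refl _ refl, rotated])
  then show ?thesis using less by (simp add: cutoff_def)
next
  case greater
  have "\<forall>\<^sub>F y in nhds x. g y = cutoff g y"
    using eventually_nhds_in_open[of "{0<..}" x] greater by (auto elim!: eventually_mono simp: cutoff_def)
  then have "(cutoff g has_real_derivative g' x) (at x)" using g[of x] greater by (simp add: DERIV_cong_ev[OF refl _ refl])
  then show ?thesis using greater by (simp add: cutoff_def)
next
  case equal
  have "((\<lambda>h. (g (0 + h) - g 0) / h) \<longlongrightarrow> 0) (at 0)" using g[of 0] assms(3) by (simp add: DERIV_def)
  then have l: "((\<lambda>h. \<bar>g h / h\<bar>) \<longlongrightarrow> 0) (at 0)" using assms(2) tendsto_rabs_zero by fastforce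
  have "((\<lambda>h. (cutoff g (0 + h) - cutoff g 0) / h) \<longlongrightarrow> 0) (at 0)"
  proof (rule Lim_null_comparison[OF always_eventually l], rule allI)
    fix h show "norm ((cutoff g (0 + h) - cutoff g 0) / h) \<le> \<bar>g h / h\<bar>"
      by (cases "h \<le> 0") (simp_all add: cutoff_def divide_nonneg_nonpos)
  qed
  then show ?thesis using equal by (simp add: DERIV_def cutoff_def)
qed

text \<open>The function \<open>x\<^sup>3 / (1 + x)\<close> on the positive half-axis, with its first two derivatives.  Like \<open>x\<^sup>2\<close> it
  grows quadratically and is convex, but its second derivative has no jump at \<open>0\<close>, as the integrations by parts require.\<close>

definition th0 :: "real \<Rightarrow> real" where "th0 = cutoff (\<lambda>x. x\<^sup>2 - x + 1 - 1 / (1 + x))"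
definition th1 :: "real \<Rightarrow> real" where "th1 = cutoff (\<lambda>x. 2 * x - 1 + 1 / (1 + x)\<^sup>2)"
definition th2 :: "real \<Rightarrow> real" where "th2 = cutoff (\<lambda>x. 2 - 2 / (1 + x)^3)"

lemma DERIV_th0: "(th0 has_real_derivative th1 x) (at x)"
  unfolding th0_def th1_def
  by (rule DERIV_cutoff) (auto intro!: derivative_eq_intros simp: power2_eq_square field_simps)

lemma DERIV_th1: "(th1 has_real_derivative th2 x) (at x)"
  unfolding th1_def th2_def
proof (rule DERIV_cutoff)
  fix x :: real assume x: "0 \<le> x"
  have "((\<lambda>x. 2 * x - 1 + inverse ((1 + x)\<^sup>2)) has_real_derivative 2 - (2 * (1 + x)) / ((1 + x)\<^sup>2)\<^sup>2) (at x)"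
  proof -
    have "(2 + 2 * x) * inverse (1 + x) = 2" using x by (simp add: field_simps)
    then show ?thesis using x by (auto intro!: derivative_eq_intros simp: divide_inverse power2_eq_square)
  qed
  moreover have "(2 * (1 + x)) / ((1 + x)\<^sup>2)\<^sup>2 = 2 / (1 + x)^3"
  proof -
    have "(2 * q) / (q\<^sup>2)\<^sup>2 = 2 / q^3" if "q > 0" for q :: real
      using that by (simp add: power2_eq_square power3_eq_cube field_simps)
    from this[of "1 + x"] x show ?thesis by (simp only: add_pos_nonneg zero_less_one)
  qed
  ultimately show "((\<lambda>x. 2 * x - 1 + 1 / (1 + x)\<^sup>2) has_real_derivative 2 - 2 / (1 + x) ^ 3) (at x)"
    by (simp add: inverse_eq_divide)
qed auto

lemma th0_eq: "0 \<le> x \<Longrightarrow> th0 x = x^3 / (1 + x)"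
  by (cases "x = 0") (auto simp: th0_def cutoff_def field_simps power2_eq_square power3_eq_cube)

lemma th0_nonpos [simp]: "x \<le> 0 \<Longrightarrow> th0 x = 0" and th1_nonpos [simp]: "x \<le> 0 \<Longrightarrow> th1 x = 0" and th2_nonpos [simp]: "x \<le> 0 \<Longrightarrow> th2 x = 0"
  by (auto simp: th0_def th1_def th2_def cutoff_def)

lemma th0_nonneg: "0 \<le> th0 x"
  by (cases "0 \<le> x") (auto simp: th0_eq)

lemma th1_eq: assumes "0 \<le> x" shows "th1 x = (3 * x\<^sup>2 + 2 * x^3) / (1 + x)\<^sup>2"
proof -
  define q where "q = 1 + x"
  have q: "q > 0" "x = q - 1" using assms by (auto simp: q_def)
  have "2 * x - 1 + 1 / q\<^sup>2 = (3 * x\<^sup>2 + 2 * x^3) / q\<^sup>2"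
    using q(1) unfolding q(2) by (simp add: field_simps power2_eq_square power3_eq_cube)
  then show ?thesis using assms by (cases "x = 0") (auto simp: th1_def cutoff_def q_def)
qed

lemma th1_nonneg: "0 \<le> th1 x"
  by (cases "0 \<le> x") (auto simp: th1_eq)

lemma th0_le: "th0 x \<le> x * th1 x"
proof (cases "0 \<le> x")
  case True
  have "x * th1 x - th0 x = (2 * x^3 + x^4) / (1 + x)\<^sup>2"
  proof -
    define q where "q = 1 + x"
    have q: "q > 0" "x = q - 1" using True by (auto simp: q_def)
    have "x * ((3 * x\<^sup>2 + 2 * x^3) / q\<^sup>2) - x^3 / q = (2 * x^3 + x^4) / q\<^sup>2"
      using q(1) unfolding q(2) by (simp add: field_simps power2_eq_square power3_eq_cube power4_eq_xxxx)
    then show ?thesis using True by (simp add: th0_eq th1_eq q_def)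
  qed
  moreover have "0 \<le> (2 * x^3 + x^4) / (1 + x)\<^sup>2" using True by simp
  ultimately show ?thesis by linarith
qed simp

text \<open>Near \<open>0\<close> the function is cubic, so it controls the square only away from \<open>0\<close>.\<close>

lemma th0_lower: assumes "0 < e" "e \<le> x" shows "x\<^sup>2 \<le> (1 + 1 / e) * th0 x"
proof -
  have x: "0 < x" using assms by linarith
  have "1 + x \<le> (1 + 1 / e) * x" using assms by (simp add: field_simps)
  then have "x\<^sup>2 * (1 + x) \<le> x\<^sup>2 * ((1 + 1 / e) * x)" by (intro mult_left_mono) auto
  then show ?thesis using x by (simp add: th0_eq field_simps power2_eq_square power3_eq_cube)
qed

lemma th2_eq: "th2 x = 2 - 2 * (1 / (1 + max 0 x))^3"
  by (auto simp: th2_def cutoff_def max_def power_one_over)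

lemma inverse_shift_bounds: fixes x y :: real
  shows "0 < 1 / (1 + max 0 x)" "1 / (1 + max 0 x) \<le> 1" "\<bar>1 / (1 + max 0 x) - 1 / (1 + max 0 y)\<bar> \<le> \<bar>x - y\<bar>"
proof -
  show "0 < 1 / (1 + max 0 x)" "1 / (1 + max 0 x) \<le> 1" by auto
  define a b where "a = max 0 x" and "b = max 0 y"
  have ab: "0 \<le> a" "0 \<le> b" "\<bar>a - b\<bar> \<le> \<bar>x - y\<bar>" by (auto simp: a_def b_def)
  have "1 / (1 + a) - 1 / (1 + b) = (b - a) / ((1 + a) * (1 + b))" using ab by (simp add: field_simps)
  then have "\<bar>1 / (1 + a) - 1 / (1 + b)\<bar> = \<bar>a - b\<bar> / ((1 + a) * (1 + b))" using ab by (simp add: abs_divide abs_mult)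
  also have "\<dots> \<le> \<bar>a - b\<bar> / 1"
  proof (rule divide_left_mono)
    have "1 * 1 \<le> (1 + a) * (1 + b)" using ab by (intro mult_mono) auto
    then show "1 \<le> (1 + a) * (1 + b)" by simp
  qed (use ab in auto)
  finally show "\<bar>1 / (1 + max 0 x) - 1 / (1 + max 0 y)\<bar> \<le> \<bar>x - y\<bar>" using ab by (simp add: a_def b_def)
qed

lemma power_lipschitz01: fixes p q :: real
  assumes "0 \<le> p" "p \<le> 1" "0 \<le> q" "q \<le> 1"
  shows "\<bar>p\<^sup>2 - q\<^sup>2\<bar> \<le> 2 * \<bar>p - q\<bar>" "\<bar>p^3 - q^3\<bar> \<le> 3 * \<bar>p - q\<bar>"
proof -
  have "\<bar>p\<^sup>2 - q\<^sup>2\<bar> = (p + q) * \<bar>p - q\<bar>" unfolding square_diff_square_factored[folded power2_eq_square] power2_eq_square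
    using assms by (simp add: square_diff_square_factored abs_mult)
  also have "\<dots> \<le> 2 * \<bar>p - q\<bar>" using assms by (intro mult_right_mono) auto
  finally show "\<bar>p\<^sup>2 - q\<^sup>2\<bar> \<le> 2 * \<bar>p - q\<bar>" .
  have "p^3 - q^3 = (p\<^sup>2 + p * q + q\<^sup>2) * (p - q)" by (simp add: power2_eq_square power3_eq_cube algebra_simps)
  then have "\<bar>p^3 - q^3\<bar> = (p\<^sup>2 + p * q + q\<^sup>2) * \<bar>p - q\<bar>" using assms by (simp add: abs_mult)
  also have "\<dots> \<le> 3 * \<bar>p - q\<bar>"
  proof (rule mult_right_mono)
    have "p\<^sup>2 \<le> 1" "q\<^sup>2 \<le> 1" "p * q \<le> 1" using assms by (auto simp: power_le_one mult_le_one)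
    then show "p\<^sup>2 + p * q + q\<^sup>2 \<le> 3" by linarith
  qed simp
  finally show "\<bar>p^3 - q^3\<bar> \<le> 3 * \<bar>p - q\<bar>" .
qed

lemma th2_bounds: "0 \<le> th2 x" "th2 x \<le> 2"
  unfolding th2_eq using inverse_shift_bounds(1,2)[of x] by (auto intro: power_le_one)

lemma th2_lipschitz: "\<bar>th2 x - th2 y\<bar> \<le> 6 * \<bar>x - y\<bar>"
proof -
  let ?p = "1 / (1 + max 0 x)" and ?q = "1 / (1 + max 0 y)"
  have "\<bar>?p^3 - ?q^3\<bar> \<le> 3 * \<bar>?p - ?q\<bar>" using inverse_shift_bounds(1,2)[of x] inverse_shift_bounds(1,2)[of y] by (intro power_lipschitz01) auto
  moreover have "\<bar>2 - 2 * p - (2 - 2 * q)\<bar> \<le> 6 * d" if "\<bar>p - q\<bar> \<le> 3 * c" "c \<le> d" for p q c d :: real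
    using that by linarith
  ultimately show ?thesis unfolding th2_eq using inverse_shift_bounds(3)[of x y] by blast
qed

lemma shifted_th2_lipschitz:
  assumes "0 \<le> m" shows "\<bar>th2 (a - m) * a - th2 (b - m) * b\<bar> \<le> (6 * m + 12) * \<bar>a - b\<bar>"
proof -
  define p where "p x = max 0 (x - m)" for x
  define q where "q x = 1 / (1 + p x)" for x
  have e: "th2 (x - m) * x = m * th2 (x - m) + (2 * p x - 2 * (q x)\<^sup>2 + 2 * (q x)^3)" for x
  proof (cases "x \<le> m")
    case True then show ?thesis by (simp add: p_def q_def)
  next
    case False
    define y where "y = x - m"
    have y: "y > 0" "x = m + y" "p x = y" using False by (auto simp: y_def p_def)
    have "th2 y * y = 2 * y - 2 * (1 / (1 + y))\<^sup>2 + 2 * (1 / (1 + y))^3"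
    proof -
      define r where "r = 1 + y"
      have r: "r > 0" "y = r - 1" using y(1) by (auto simp: r_def)
      have "(2 - 2 * (1 / r)^3) * (r - 1) = 2 * (r - 1) - 2 * (1 / r)\<^sup>2 + 2 * (1 / r)^3"
        using r(1) by (simp add: field_simps power2_eq_square power3_eq_cube)
      then show ?thesis unfolding th2_eq using y(1) r by simp
    qed
    then show ?thesis unfolding q_def y(3) unfolding y_def[symmetric] using y(2) by (simp add: distrib_left mult.commute)
  qed
  have q: "0 < q x" "q x \<le> 1" "\<bar>q x - q y\<bar> \<le> \<bar>x - y\<bar>" for x y
    using inverse_shift_bounds(1,2)[of "x - m"] inverse_shift_bounds(3)[of "x - m" "y - m"] unfolding q_def p_def by auto
  have "\<bar>(q a)\<^sup>2 - (q b)\<^sup>2\<bar> \<le> 2 * \<bar>q a - q b\<bar>" "\<bar>(q a)^3 - (q b)^3\<bar> \<le> 3 * \<bar>q a - q b\<bar>"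
    using q(1,2)[of a] q(1,2)[of b] by (auto intro!: power_lipschitz01)
  then have q23: "\<bar>(q a)\<^sup>2 - (q b)\<^sup>2\<bar> \<le> 2 * \<bar>a - b\<bar>" "\<bar>(q a)^3 - (q b)^3\<bar> \<le> 3 * \<bar>a - b\<bar>"
    using order_trans[OF _ mult_left_mono[OF q(3)[of a b]]] by auto
  have pp: "\<bar>p a - p b\<bar> \<le> \<bar>a - b\<bar>" by (auto simp: p_def)
  have mm: "\<bar>m * (th2 (a - m) - th2 (b - m))\<bar> \<le> m * (6 * \<bar>a - b\<bar>)"
    unfolding abs_mult using th2_lipschitz[of "a - m" "b - m"] assms by (auto intro!: mult_left_mono)
  have eq: "th2 (a - m) * a - th2 (b - m) * b = m * (th2 (a - m) - th2 (b - m)) + 2 * (p a - p b)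
      - 2 * ((q a)\<^sup>2 - (q b)\<^sup>2) + 2 * ((q a)^3 - (q b)^3)"
    unfolding e by (simp add: algebra_simps)
  have bnd: "\<bar>X + 2 * P - 2 * R + 2 * S\<bar> \<le> m * (6 * d) + 12 * d"
    if "\<bar>X\<bar> \<le> m * (6 * d)" "\<bar>P\<bar> \<le> d" "\<bar>R\<bar> \<le> 2 * d" "\<bar>S\<bar> \<le> 3 * d" for X P R S d :: real
    using that by linarith
  have "\<bar>th2 (a - m) * a - th2 (b - m) * b\<bar> \<le> m * (6 * \<bar>a - b\<bar>) + 12 * \<bar>a - b\<bar>"
    unfolding eq by (rule bnd[OF mm pp q23])
  also have "\<dots> = (6 * m + 12) * \<bar>a - b\<bar>" by (simp add: algebra_simps)
  finally show ?thesis .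
qed

text \<open>Penalizes the distance of \<open>s\<close> from \<open>[-m, m]\<close>, on which it vanishes.\<close>

definition tj :: "real \<Rightarrow> real \<Rightarrow> real" where "tj m s = th0 (s - m) + th0 (- s - m)"
definition tJ :: "real \<Rightarrow> real \<Rightarrow> real" where "tJ m s = th1 (s - m) - th1 (- s - m)"
definition tK :: "real \<Rightarrow> real \<Rightarrow> real" where "tK m s = th2 (s - m) + th2 (- s - m)"

lemma DERIV_tj: "(tj m has_real_derivative tJ m s) (at s)"
  unfolding tj_def[abs_def] tJ_def by (auto intro!: derivative_eq_intros DERIV_chain2[OF DERIV_th0])

lemma DERIV_tJ: "(tJ m has_real_derivative tK m s) (at s)"
  unfolding tJ_def[abs_def] tK_def by (auto intro!: derivative_eq_intros DERIV_chain2[OF DERIV_th1])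

lemma tK_bounds: "0 \<le> tK m s" "\<bar>tK m s\<bar> \<le> 4"
  unfolding tK_def using th2_bounds[of "s - m"] th2_bounds[of "- s - m"] by auto

lemma tK_lipschitz: "\<bar>tK m a - tK m b\<bar> \<le> 12 * \<bar>a - b\<bar>"
proof -
  have e: "\<bar>a - m - (b - m)\<bar> = \<bar>a - b\<bar>" "\<bar>- a - m - (- b - m)\<bar> = \<bar>a - b\<bar>" by auto
  show ?thesis
    unfolding tK_def using th2_lipschitz[of "a - m" "b - m"] th2_lipschitz[of "- a - m" "- b - m"] unfolding e by linarith
qed

lemma tK_times_lipschitz: assumes "0 \<le> m" shows "\<bar>tK m a * a - tK m b * b\<bar> \<le> (2 * (6 * m + 12)) * \<bar>a - b\<bar>"
proof -
  have "\<bar>- a - - b\<bar> = \<bar>a - b\<bar>" by linarith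
  then have "\<bar>th2 (- a - m) * a - th2 (- b - m) * b\<bar> \<le> (6 * m + 12) * \<bar>a - b\<bar>"
    using shifted_th2_lipschitz[OF assms, of "- a" "- b"] by (simp add: abs_minus_commute)
  moreover have "\<bar>th2 (a - m) * a - th2 (b - m) * b\<bar> \<le> (6 * m + 12) * \<bar>a - b\<bar>" by (rule shifted_th2_lipschitz[OF assms])
  moreover have "tK m a * a - tK m b * b = (th2 (a - m) * a - th2 (b - m) * b) + (th2 (- a - m) * a - th2 (- b - m) * b)"
    by (simp add: tK_def algebra_simps)
  ultimately show ?thesis by linarith
qed

lemma DERIV_tG: "((\<lambda>s. tJ m s * s - tj m s) has_real_derivative tK m s * s) (at s)"
  by (auto intro!: derivative_eq_intros DERIV_tj DERIV_tJ)

lemma tj_0: "0 \<le> m \<Longrightarrow> tj m 0 = 0" "0 \<le> m \<Longrightarrow> tJ m 0 = 0"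
  by (auto simp: tj_def tJ_def)

lemma tj_nonneg: "0 \<le> tj m s" unfolding tj_def using th0_nonneg by (simp add: add_nonneg_nonneg)

lemma tJ_lipschitz: "\<bar>tJ m a - tJ m b\<bar> \<le> 4 * \<bar>a - b\<bar>"
proof -
  have "\<And>x. x \<in> UNIV \<Longrightarrow> norm (tK m x) \<le> 4" using tK_bounds(2) by simp
  from field_differentiable_bound[of UNIV "tJ m" "tK m" 4 a b] DERIV_tJ this show ?thesis by simp
qed

lemma tj_increment:
  assumes m: "0 \<le> m" shows "\<bar>tj m a - tj m b\<bar> \<le> 4 * (\<bar>a\<bar> + \<bar>b\<bar>) * \<bar>a - b\<bar>"
proof -
  have "norm (tj m a - tj m b) \<le> (4 * (\<bar>a\<bar> + \<bar>b\<bar>)) * norm (a - b)"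
  proof (rule field_differentiable_bound[where S = "cball 0 (\<bar>a\<bar> + \<bar>b\<bar>)" and f' = "tJ m"])
    fix s :: real assume "s \<in> cball 0 (\<bar>a\<bar> + \<bar>b\<bar>)"
    then show "norm (tJ m s) \<le> 4 * (\<bar>a\<bar> + \<bar>b\<bar>)" using tJ_lipschitz[of m s 0] tj_0(2)[OF m] by simp
  qed (use DERIV_tj in \<open>auto intro: has_field_derivative_at_within\<close>)
  then show ?thesis by simp
qed

text \<open>Outside \<open>[-m, m]\<close> the damping \<open>\<mu> s\<close> exceeds the force \<open>r\<close> by at least \<open>\<mu>\<close> times the excess
  of \<open>\<bar>s\<bar>\<close> over \<open>m\<close>, and \<open>th0 x \<le> x * th1 x\<close>.\<close>

lemma tj_damping:
  assumes "0 \<le> \<mu>" "0 \<le> m" "\<bar>r\<bar> \<le> \<mu> * m" shows "tJ m s * (r - \<mu> * s) \<le> - \<mu> * tj m s"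
proof -
  have a: "th1 (s - m) * (r - \<mu> * s) \<le> - \<mu> * th0 (s - m)"
  proof -
    have "r - \<mu> * s \<le> - (\<mu> * (s - m))" using assms(3) by (simp add: right_diff_distrib)
    then have "th1 (s - m) * (r - \<mu> * s) \<le> th1 (s - m) * - (\<mu> * (s - m))" by (rule mult_left_mono[OF _ th1_nonneg])
    also have "\<dots> = - \<mu> * ((s - m) * th1 (s - m))" by simp
    also have "\<dots> \<le> - \<mu> * th0 (s - m)" using th0_le[of "s - m"] assms(1) by (simp add: mult_left_mono)
    finally show ?thesis .
  qed
  have b: "- th1 (- s - m) * (r - \<mu> * s) \<le> - \<mu> * th0 (- s - m)"
  proof -
    have "\<mu> * s - r \<le> - (\<mu> * (- s - m))" using assms(3) by (simp add: right_diff_distrib)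
    then have "th1 (- s - m) * (\<mu> * s - r) \<le> th1 (- s - m) * - (\<mu> * (- s - m))" by (rule mult_left_mono[OF _ th1_nonneg])
    also have "\<dots> = - \<mu> * ((- s - m) * th1 (- s - m))" by simp
    also have "\<dots> \<le> - \<mu> * th0 (- s - m)" using th0_le[of "- s - m"] assms(1) by (simp add: mult_left_mono)
    finally show ?thesis by (simp add: right_diff_distrib)
  qed
  show ?thesis using a b by (simp add: tJ_def tj_def left_diff_distrib distrib_left)
qed

lemma excess_le_tj:
  assumes "0 \<le> m" "0 < e" shows "(max 0 (\<bar>s\<bar> - (m + e)))\<^sup>2 \<le> (1 + 1 / e) * tj m s"
proof (cases "\<bar>s\<bar> \<le> m + e")
  case True
  then have "max 0 (\<bar>s\<bar> - (m + e)) = 0" by simp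
  moreover have "0 \<le> (1 + 1 / e) * tj m s" using assms tj_nonneg[of m s] by (intro mult_nonneg_nonneg) auto
  ultimately show ?thesis by (simp del: max.absorb1)
next
  case False
  have t: "th0 (\<bar>s\<bar> - m) \<le> tj m s" using th0_nonneg[of "s - m"] th0_nonneg[of "- s - m"] by (cases "0 \<le> s") (auto simp: tj_def)
  have "(max 0 (\<bar>s\<bar> - (m + e)))\<^sup>2 \<le> (\<bar>s\<bar> - m)\<^sup>2" using False assms by (intro power_mono) auto
  also have "\<dots> \<le> (1 + 1 / e) * th0 (\<bar>s\<bar> - m)" using False assms by (intro th0_lower) auto
  also have "\<dots> \<le> (1 + 1 / e) * tj m s" using t assms by (intro mult_left_mono) auto
  finally show ?thesis .
qed

context cell begin

lemma evolution_coefs: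
  assumes e: "evolution \<nu> \<mu> u ut du lap r" and st: "0 < s" "s \<le> t"
  shows "set_integrable lborel {s..t} (\<lambda>r. A (\<lambda>x. ut r x $ i) k)" "set_integrable lborel {s..t} (\<lambda>r. B (\<lambda>x. ut r x $ i) k)"
    "A (\<lambda>x. u t x $ i) k - A (\<lambda>x. u s x $ i) k = (LINT r:{s..t}|lborel. A (\<lambda>x. ut r x $ i) k)"
    "B (\<lambda>x. u t x $ i) k - B (\<lambda>x. u s x $ i) k = (LINT r:{s..t}|lborel. B (\<lambda>x. ut r x $ i) k)"
    "set_integrable lborel {s..t} (\<lambda>r. (nrm M (\<lambda>x. ut r x $ i))\<^sup>2)" "set_integrable lborel {s..t} (\<lambda>r. (nrm M (\<lambda>x. lap r x $ i))\<^sup>2)"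
proof -
  have l: "L2_loc L \<gamma> {0<..} ut" "L2_loc L \<gamma> {0<..} lap" using e by (auto simp: evolution_def)
  have sq: "sq M (\<lambda>x. u t x $ i)" "sq M (\<lambda>x. u s x $ i)" using e st by (auto simp: evolution_def intro!: H_spaceD)
  have ev: "AE x in lborel. u t x - u s x = (LINT r:{s..t}|lborel. ut r x)" using e st by (auto simp: evolution_def)
  show "set_integrable lborel {s..t} (\<lambda>r. A (\<lambda>x. ut r x $ i) k)" "set_integrable lborel {s..t} (\<lambda>r. B (\<lambda>x. ut r x $ i) k)"
    unfolding A_def B_def by (intro L2_loc_coef[OF l(1) st] cs_measurable' cs_le)+
  show "A (\<lambda>x. u t x $ i) k - A (\<lambda>x. u s x $ i) k = (LINT r:{s..t}|lborel. A (\<lambda>x. ut r x $ i) k)"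
    "B (\<lambda>x. u t x $ i) k - B (\<lambda>x. u s x $ i) k = (LINT r:{s..t}|lborel. B (\<lambda>x. ut r x $ i) k)"
    unfolding A_def B_def by (intro L2_loc_evolve[OF l(1) st _ _ ev sq] cs_measurable' cs_le)+
  show "set_integrable lborel {s..t} (\<lambda>r. (nrm M (\<lambda>x. ut r x $ i))\<^sup>2)" "set_integrable lborel {s..t} (\<lambda>r. (nrm M (\<lambda>x. lap r x $ i))\<^sup>2)"
    by (rule L2_loc_nrm[OF l(1) st], rule L2_loc_nrm[OF l(2) st])
qed

definition vort :: "(real \<Rightarrow> 2 \<Rightarrow> real^2 \<Rightarrow> real^2) \<Rightarrow> real \<Rightarrow> real^2 \<Rightarrow> real" where
  "vort du t x = du t 1 x $ 2 - du t 2 x $ 1"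

lemma sq_tJ: assumes "sq M f" shows "sq M (\<lambda>x. tJ m (f x))"
  using convD(2)[OF conv_lipschitz_finite[OF conv_const[OF assms] tJ_lipschitz]] .

lemma integrable_tj: assumes "0 \<le> m" "sq M f" shows "integrable M (\<lambda>x. tj m (f x))"
  by (rule quadratic_growth_tendsto(2)[OF conv_const[OF assms(2)] tj_increment[OF assms(1)] tj_0(1)[OF assms(1)]])
    (intro borel_measurable_continuous_onI, meson DERIV_tj DERIV_isCont continuous_at_imp_continuous_on)

text \<open>An integrated maximum principle.  By convexity viscosity only lowers \<open>\<integral> tj m \<omega>\<close>, transport leaves it unchanged,
  and damping makes it decay.  The slack \<open>d\<close> pays for the weakness of \<open>tj\<close> near \<open>m\<close>.\<close>

lemma excess_decay:
  assumes e: "evolution \<nu> \<mu> u ut du lap r" and \<mu>: "0 < \<mu>" and \<nu>: "0 \<le> \<nu>" and m: "0 \<le> m" and d: "0 < d"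
    and rb: "\<forall>\<^sub>F t in at_top. sq M (r t) \<and> (AE x in M. \<bar>r t x\<bar> \<le> \<mu> * m)"
  shows "\<exists>Y. (Y \<longlongrightarrow> 0) at_top \<and> (AE t in lborel. 0 < t \<longrightarrow> (nrm M (\<lambda>x. max 0 (\<bar>vort du t x\<bar> - (m + d))))\<^sup>2 \<le> Y t)"
proof -
  note ec = evolution_coefs[OF e]
  have gAE: "AE t in lborel. 0 < t \<longrightarrow> vf (\<lambda>x. u t x $ 1) (\<lambda>x. u t x $ 2) (\<lambda>x. du t 1 x $ 1) (\<lambda>x. du t 1 x $ 2)
          (\<lambda>x. du t 2 x $ 1) (\<lambda>x. du t 2 x $ 2) (\<lambda>x. lap t x $ 1) (\<lambda>x. lap t x $ 2) \<and>
          sq M (\<lambda>x. ut t x $ 1) \<and> sq M (\<lambda>x. ut t x $ 2)" using e by (simp add: evolution_def)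
  have nAE: "AE t in lborel. 0 < t \<longrightarrow> sq M (r t) \<longrightarrow>
        nse \<nu> \<mu> (\<lambda>x. ut t x $ 1) (\<lambda>x. ut t x $ 2) (\<lambda>x. u t x $ 1) (\<lambda>x. u t x $ 2) (\<lambda>x. du t 1 x $ 1) (\<lambda>x. du t 1 x $ 2)
          (\<lambda>x. du t 2 x $ 1) (\<lambda>x. du t 2 x $ 2) (\<lambda>x. lap t x $ 1) (\<lambda>x. lap t x $ 2) (r t)" using e by (simp add: evolution_def)
  have good: "AE t in lborel. 0 < t \<longrightarrow> frot (\<lambda>x. u t x $ 1) (\<lambda>x. u t x $ 2) (vort du t) \<and> fpd 1 (vort du t) (\<lambda>x. lap t x $ 2) \<and>
      fpd 2 (vort du t) (\<lambda>x. - lap t x $ 1) \<and> sq M (\<lambda>x. lap t x $ 1) \<and> sq M (\<lambda>x. ut t x $ 1) \<and> sq M (\<lambda>x. ut t x $ 2)"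
    using gAE
  proof eventually_elim
    case (elim t)
    show ?case
    proof
      assume "0 < t"
      with elim have v: "vf (\<lambda>x. u t x $ 1) (\<lambda>x. u t x $ 2) (\<lambda>x. du t 1 x $ 1) (\<lambda>x. du t 1 x $ 2)
          (\<lambda>x. du t 2 x $ 1) (\<lambda>x. du t 2 x $ 2) (\<lambda>x. lap t x $ 1) (\<lambda>x. lap t x $ 2)"
        and s: "sq M (\<lambda>x. ut t x $ 1)" "sq M (\<lambda>x. ut t x $ 2)" by blast+
      show "frot (\<lambda>x. u t x $ 1) (\<lambda>x. u t x $ 2) (vort du t) \<and> fpd 1 (vort du t) (\<lambda>x. lap t x $ 2) \<and>
      fpd 2 (vort du t) (\<lambda>x. - lap t x $ 1) \<and> sq M (\<lambda>x. lap t x $ 1) \<and> sq M (\<lambda>x. ut t x $ 1) \<and> sq M (\<lambda>x. ut t x $ 2)"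
        unfolding vort_def[abs_def] using vfD(8-10,13)[OF v] s by (intro conjI)
    qed
  qed
  have dom: "set_integrable lborel {s..t} (\<lambda>q. (nrm M (\<lambda>x. lap q x $ 1))\<^sup>2 + (nrm M (\<lambda>x. lap q x $ 2))\<^sup>2
      + (nrm M (\<lambda>x. ut q x $ 1))\<^sup>2 + (nrm M (\<lambda>x. ut q x $ 2))\<^sup>2)" if "0 < s" "s \<le> t" for s t
    by (intro set_integral_add(1) ec(5)[OF that] ec(6)[OF that])
  obtain Y I where Y: "\<And>s t. 0 < s \<Longrightarrow> s \<le> t \<Longrightarrow> set_integrable lborel {s..t} I \<and> Y t - Y s = (LINT r:{s..t}|lborel. I r)"
    "AE t in lborel. 0 < t \<longrightarrow> I t = - (\<integral>x. tK m (vort du t x) * (lap t x $ 1 * ut t x $ 1 + lap t x $ 2 * ut t x $ 2) \<partial>M)"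
    "\<And>t. 0 < t \<Longrightarrow> (\<lambda>n. \<integral>x. tj m (T n (rotA (\<lambda>x. u t x $ 1) (\<lambda>x. u t x $ 2)) (rotB (\<lambda>x. u t x $ 1) (\<lambda>x. u t x $ 2)) x) \<partial>M) \<longlonglongrightarrow> Y t"
    "AE t in lborel. 0 < t \<longrightarrow> Y t = (\<integral>x. tj m (vort du t x) \<partial>M)"
    using time_identity[where ?w1.0 = "\<lambda>t x. u t x $ 1" and ?w2.0 = "\<lambda>t x. u t x $ 2" and ?t1.0 = "\<lambda>t x. ut t x $ 1" and ?t2.0 = "\<lambda>t x. ut t x $ 2"
        and ?l1.0 = "\<lambda>t x. lap t x $ 1" and ?l2.0 = "\<lambda>t x. lap t x $ 2" and z = "vort du" and j = "tj m" and J = "tJ m" and J' = "tK m" and C = 4 and Q = 12,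
        OF ec(1) ec(1) ec(2) ec(2) ec(3) ec(3) ec(4) ec(4) good dom DERIV_tj tj_0(1)[OF m] tj_0(2)[OF m] DERIV_tJ tK_bounds(2) tK_lipschitz]
    by blast
  have Y0: "0 \<le> Y t" if "0 < t" for t
    by (rule LIMSEQ_le_const[OF Y(3)[OF that]]) (intro exI[of _ 0] allI impI Bochner_Integration.integral_nonneg tj_nonneg)
  obtain T0 where T0: "\<And>t. T0 \<le> t \<Longrightarrow> sq M (r t) \<and> (AE x in M. \<bar>r t x\<bar> \<le> \<mu> * m)"
    using rb unfolding eventually_at_top_linorder by blast
  have Ile: "AE t in lborel. max 1 T0 \<le> t \<longrightarrow> I t \<le> - \<mu> * Y t"
    using gAE nAE Y(2,4)
  proof eventually_elim
    case (elim t)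
    show ?case
    proof
      assume "max 1 T0 \<le> t"
      then have t: "0 < t" "sq M (r t)" "AE x in M. \<bar>r t x\<bar> \<le> \<mu> * m" using T0[of t] by auto
      have n: "nse \<nu> \<mu> (\<lambda>x. ut t x $ 1) (\<lambda>x. ut t x $ 2) (\<lambda>x. u t x $ 1) (\<lambda>x. u t x $ 2) (\<lambda>x. du t 1 x $ 1) (\<lambda>x. du t 1 x $ 2)
          (\<lambda>x. du t 2 x $ 1) (\<lambda>x. du t 2 x $ 2) (\<lambda>x. lap t x $ 1) (\<lambda>x. lap t x $ 2) (r t)" using elim(2) t by blast
      have so: "sq M (vort du t)" unfolding vort_def[abs_def] by (rule vfD(15)[OF nseD(1)[OF n]])
      have "I t = (\<integral>x. tJ m (vort du t x) * (r t x - \<mu> * vort du t x) \<partial>M) - \<nu> * (\<integral>x. tK m (vort du t x) * ((lap t x $ 1)\<^sup>2 + (lap t x $ 2)\<^sup>2) \<partial>M)"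
        using elim(3) t(1) vorticity_balance[OF n DERIV_tJ tK_bounds(2) tK_lipschitz DERIV_tG tK_times_lipschitz[OF m]]
        unfolding vort_def by simp
      also have "\<dots> \<le> (\<integral>x. tJ m (vort du t x) * (r t x - \<mu> * vort du t x) \<partial>M)"
        using \<nu> tK_bounds(1) by (simp add: integral_nonneg)
      also have "\<dots> \<le> (\<integral>x. - \<mu> * tj m (vort du t x) \<partial>M)"
      proof (rule integral_mono_AE)
        show "integrable M (\<lambda>x. tJ m (vort du t x) * (r t x - \<mu> * vort du t x))"
          by (intro sq_mult_integrable sq_tJ sq_diff sq_cmult so t)
        show "integrable M (\<lambda>x. - \<mu> * tj m (vort du t x))" using integrable_tj[OF m so] by simp
        show "AE x in M. tJ m (vort du t x) * (r t x - \<mu> * vort du t x) \<le> - \<mu> * tj m (vort du t x)"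
          using t(3) by eventually_elim (use \<mu> m in \<open>auto intro!: tj_damping[simplified]\<close>)
      qed
      also have "\<dots> = - \<mu> * Y t" using elim(4) t(1) by simp
      finally show "I t \<le> - \<mu> * Y t" .
    qed
  qed
  have lim: "(Y \<longlongrightarrow> 0) at_top"
  proof (rule decay_of_differential_inequality[where I = I and \<mu> = \<mu>])
    fix e :: real assume "0 < e"
    show "\<exists>T>0. AE t in lborel. T \<le> t \<longrightarrow> I t \<le> - \<mu> * Y t + e"
      by (rule exI[of _ "max 1 T0"]) (use Ile \<open>0 < e\<close> in \<open>auto elim!: AE_mp\<close>)
  qed (use Y(1) Y0 \<mu> in auto)
  have "AE t in lborel. 0 < t \<longrightarrow> (nrm M (\<lambda>x. max 0 (\<bar>vort du t x\<bar> - (m + d))))\<^sup>2 \<le> (1 + 1 / d) * Y t"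
    using gAE Y(4)
  proof eventually_elim
    case (elim t)
    show ?case
    proof
      assume t: "0 < t"
      have v: "vf (\<lambda>x. u t x $ 1) (\<lambda>x. u t x $ 2) (\<lambda>x. du t 1 x $ 1) (\<lambda>x. du t 1 x $ 2)
          (\<lambda>x. du t 2 x $ 1) (\<lambda>x. du t 2 x $ 2) (\<lambda>x. lap t x $ 1) (\<lambda>x. lap t x $ 2)" using elim(1) t by blast
      have so: "sq M (vort du t)" unfolding vort_def[abs_def] by (rule vfD(15)[OF v])
      note [measurable] = sq_measurable[OF so]
      have se: "sq M (\<lambda>x. max 0 (\<bar>vort du t x\<bar> - (m + d)))"
        by (rule sq_bound[OF so, where C = 1]) (use m d in auto)
      have ij: "integrable M (\<lambda>x. tj m (vort du t x))" by (rule integrable_tj[OF m so])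
      have "(nrm M (\<lambda>x. max 0 (\<bar>vort du t x\<bar> - (m + d))))\<^sup>2 \<le> (\<integral>x. (1 + 1 / d) * tj m (vort du t x) \<partial>M)"
        unfolding nrm_power2
        by (rule integral_mono[OF sq_integrable[OF se] integrable_mult_right[OF ij] excess_le_tj[OF m d]])
      then show "(nrm M (\<lambda>x. max 0 (\<bar>vort du t x\<bar> - (m + d))))\<^sup>2 \<le> (1 + 1 / d) * Y t" using elim(2) t by simp
    qed
  qed
  moreover have "((\<lambda>t. (1 + 1 / d) * Y t) \<longlongrightarrow> 0) at_top" using tendsto_mult_left[OF lim] by force
  ultimately show ?thesis by blast
qed

section \<open>A criterion for determining functionals\<close>

lemma L2_norm_eq: fixes h :: "real^2 \<Rightarrow> real^2" assumes "\<And>i. sq M (\<lambda>x. h x $ i)" shows "L2_norm L \<gamma> h = sqrt ((nrm M (\<lambda>x. h x $ 1))\<^sup>2 + (nrm M (\<lambda>x. h x $ 2))\<^sup>2)"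
proof -
  have "(norm (h x))\<^sup>2 = (h x $ 1)\<^sup>2 + (h x $ 2)\<^sup>2" for x
    by (simp add: power2_norm_eq_inner inner_vec_def sum_2) (simp add: power2_eq_square)
  then show ?thesis unfolding L2_norm_def LINT_Omega nrm_power2
    using sq_integrable[OF assms] by simp
qed

lemma int_T_square: assumes "\<And>k. a (- k) = a k" "\<And>k. b (- k) = - b k"
  shows "(\<integral>x. (T n a b x)\<^sup>2 \<partial>M) = (\<Sum>k\<in>K n. (a k)\<^sup>2 + (b k)\<^sup>2) / area"
proof -
  have "(\<integral>x. T n a b x * T n a b x \<partial>M) = (\<Sum>k\<in>K n. a k * A (T n a b) k + b k * B (T n a b) k) / area"
    by (rule int_T) simp
  also have "\<dots> = (\<Sum>k\<in>K n. (a k)\<^sup>2 + (b k)\<^sup>2) / area"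
    by (intro arg_cong[where f = "\<lambda>z. z / area"] sum.cong) (auto simp: AB_T[where a = a and b = b, OF assms] power2_eq_square)
  finally show ?thesis by (simp add: power2_eq_square)
qed

text \<open>Lagrange's identity for two plane vectors, one summand of which vanishes.\<close>

lemma Lagrange_div_free: assumes "p * a + q * b = (0::real)" shows "(p * b - q * a)\<^sup>2 = (p\<^sup>2 + q\<^sup>2) * (a\<^sup>2 + b\<^sup>2)"
proof -
  have "(p * b - q * a)\<^sup>2 + (p * a + q * b)\<^sup>2 = (p\<^sup>2 + q\<^sup>2) * (a\<^sup>2 + b\<^sup>2)" by (simp add: power2_eq_square algebra_simps)
  then show ?thesis using assms by simp
qed

text \<open>Poincare's inequality: for a divergence-free field each squared coefficient of the rotation is \<open>kk k\<close> times that of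
  the field.  The limit \<open>Y\<close> replaces the norm of the rotation, which need not exist at the given time.\<close>

lemma energy_le_enstrophy:
  assumes "fdiv0 w1 w2" "A w1 0 = 0" "A w2 0 = 0" "0 < c" "\<And>k. k \<noteq> 0 \<Longrightarrow> c \<le> kk k"
    and Y: "(\<lambda>n. \<integral>x. (T n (rotA w1 w2) (rotB w1 w2) x)\<^sup>2 \<partial>M) \<longlonglongrightarrow> Y"
  shows "c * ((nrm M w1)\<^sup>2 + (nrm M w2)\<^sup>2) \<le> Y"
proof (rule LIMSEQ_le[OF _ Y])
  note d = fdiv0D[OF assms(1)]
  show "(\<lambda>n. c * (bil n w1 w1 + bil n w2 w2)) \<longlonglongrightarrow> c * ((nrm M w1)\<^sup>2 + (nrm M w2)\<^sup>2)"
    by (intro tendsto_intros Parseval_nrm d)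
  have "c * (bil n w1 w1 + bil n w2 w2) \<le> (\<integral>x. (T n (rotA w1 w2) (rotB w1 w2) x)\<^sup>2 \<partial>M)" for n
  proof -
    have "c * (bil n w1 w1 + bil n w2 w2) = (\<Sum>k\<in>K n. c * (((A w1 k)\<^sup>2 + (A w2 k)\<^sup>2) + ((B w1 k)\<^sup>2 + (B w2 k)\<^sup>2))) / area"
      unfolding bil_def add_divide_distrib[symmetric] sum.distrib[symmetric] times_divide_eq_right sum_distrib_left
      by (simp add: power2_eq_square algebra_simps)
    also have "\<dots> \<le> (\<Sum>k\<in>K n. (rotA w1 w2 k)\<^sup>2 + (rotB w1 w2 k)\<^sup>2) / area"
    proof (intro divide_right_mono sum_mono)
      fix k
      show "c * (((A w1 k)\<^sup>2 + (A w2 k)\<^sup>2) + ((B w1 k)\<^sup>2 + (B w2 k)\<^sup>2)) \<le> (rotA w1 w2 k)\<^sup>2 + (rotB w1 w2 k)\<^sup>2"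
      proof (cases "k = 0")
        case True then show ?thesis using assms(2,3) by simp
      next
        case False
        have "(rotA w1 w2 k)\<^sup>2 = kk k * ((B w1 k)\<^sup>2 + (B w2 k)\<^sup>2)"
          unfolding rotA_def kk_def by (rule Lagrange_div_free[OF d(4)])
        moreover have "(rotB w1 w2 k)\<^sup>2 = kk k * ((A w1 k)\<^sup>2 + (A w2 k)\<^sup>2)"
          unfolding rotB_def kk_def using Lagrange_div_free[OF d(3)[of k]] by (simp add: power2_commute)
        moreover have "c * (((A w1 k)\<^sup>2 + (A w2 k)\<^sup>2) + ((B w1 k)\<^sup>2 + (B w2 k)\<^sup>2)) \<le> kk k * (((A w1 k)\<^sup>2 + (A w2 k)\<^sup>2) + ((B w1 k)\<^sup>2 + (B w2 k)\<^sup>2))"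
          using assms(5)[OF False] by (intro mult_right_mono) auto
        ultimately show ?thesis by (simp add: distrib_left)
      qed
    qed (use area_pos in auto)
    also have "\<dots> = (\<integral>x. (T n (rotA w1 w2) (rotB w1 w2) x)\<^sup>2 \<partial>M)"
      by (rule int_T_square[symmetric]) (simp_all add: rot_uminus)
    finally show ?thesis .
  qed
  then show "\<exists>N. \<forall>n\<ge>N. c * (bil n w1 w1 + bil n w2 w2) \<le> (\<integral>x. (T n (rotA w1 w2) (rotB w1 w2) x)\<^sup>2 \<partial>M)" by blast
qed

text \<open>The part \<open>m c D\<^sup>2\<close> of the viscous term absorbs the main part of \<open>tri\<close>, half of the rest absorbs the excess
  \<open>E\<close>, and the other half and the damping absorb the two remaining mixed terms by Young's inequality.\<close>

lemma absorb_into_dissipation: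
  fixes \<nu> \<mu> m c D W E S z e a tri :: real
  assumes "0 \<le> m" "0 < \<mu>" "0 < \<kappa>" "\<kappa> = \<nu> - m * c" "0 \<le> D" "W \<le> c * D + S" "0 \<le> E" "E \<le> \<kappa> / 2"
    and "tri \<le> m * W * D + E * D\<^sup>2"
  shows "2 * ((z * e - \<mu> * z\<^sup>2) - \<nu> * D\<^sup>2 + tri) \<le> - \<mu> * z\<^sup>2 + (e\<^sup>2 / \<mu> + m\<^sup>2 * S\<^sup>2 / \<kappa>)"
proof -
  have "m * W * D \<le> m * (c * D + S) * D" using assms by (intro mult_right_mono mult_left_mono) auto
  moreover have "E * D\<^sup>2 \<le> \<kappa> / 2 * D\<^sup>2" using assms by (intro mult_right_mono) auto
  moreover have "m * (c * D + S) * D = m * c * D\<^sup>2 + m * S * D" "\<nu> * D\<^sup>2 = \<kappa> * D\<^sup>2 + m * c * D\<^sup>2" "\<kappa> / 2 * D\<^sup>2 = \<kappa> * D\<^sup>2 / 2"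
    unfolding assms(4) by (simp_all add: algebra_simps power2_eq_square)
  ultimately have 1: "tri - \<nu> * D\<^sup>2 \<le> m * S * D - \<kappa> * D\<^sup>2 / 2"
    using assms(9) by linarith
  have "0 \<le> (\<kappa> * D - m * S)\<^sup>2 / \<kappa>" using assms by simp
  also have "(\<kappa> * D - m * S)\<^sup>2 / \<kappa> = \<kappa> * D\<^sup>2 - 2 * (m * S * D) + m\<^sup>2 * S\<^sup>2 / \<kappa>"
    using assms(3) by (simp add: field_simps power2_eq_square)
  finally have 2: "2 * (m * S * D) - \<kappa> * D\<^sup>2 \<le> m\<^sup>2 * S\<^sup>2 / \<kappa>" by linarith
  have "0 \<le> (\<mu> * z - e)\<^sup>2 / \<mu>" using assms by simp
  also have "(\<mu> * z - e)\<^sup>2 / \<mu> = \<mu> * z\<^sup>2 - 2 * (z * e) + e\<^sup>2 / \<mu>"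
    using assms(2) by (simp add: field_simps power2_eq_square)
  finally have 3: "2 * (z * e) \<le> \<mu> * z\<^sup>2 + e\<^sup>2 / \<mu>" by linarith
  show ?thesis using 1 2 3 by (simp add: algebra_simps)
qed

text \<open>The enstrophy \<open>y\<close> of the difference satisfies \<open>y' \<le> - \<mu> y + o(1)\<close> as soon as the excess of the vorticity over
  \<open>m + d\<close> has become small against the gap between \<open>(m + d) c\<close> and \<open>\<nu>\<close>, and it dominates the energy.\<close>

theorem difference_decay:
  assumes e: "evolution \<nu> \<mu> u ut du lap rf" and e': "evolution \<nu> \<mu> v vt dv lav rg"
    and \<mu>: "0 < \<mu>" and \<nu>: "0 < \<nu>" and c: "0 \<le> c" and m: "0 \<le> m" "0 < d" "(m + d) * c < \<nu>"
    and rf: "\<forall>\<^sub>F t in at_top. sq M (rf t) \<and> (AE x in M. \<bar>rf t x\<bar> \<le> \<mu> * m)"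
    and rg: "\<forall>\<^sub>F t in at_top. sq M (rg t)"
    and dr: "((\<lambda>t. nrm M (\<lambda>x. rf t x - rg t x)) \<longlongrightarrow> 0) at_top"
    and S: "(S \<longlongrightarrow> 0) at_top"
    and W: "\<forall>\<^sub>F t in at_top. \<forall>k1 k2. flap (\<lambda>x. u t x $ 1 - v t x $ 1) k1 \<longrightarrow> flap (\<lambda>x. u t x $ 2 - v t x $ 2) k2 \<longrightarrow>
        sqrt ((nrm M (\<lambda>x. u t x $ 1 - v t x $ 1))\<^sup>2 + (nrm M (\<lambda>x. u t x $ 2 - v t x $ 2))\<^sup>2) \<le> c * sqrt ((nrm M k1)\<^sup>2 + (nrm M k2)\<^sup>2) + S t"
  shows "((\<lambda>t. L2_norm L \<gamma> (\<lambda>x. u t x - v t x)) \<longlongrightarrow> 0) at_top"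
proof -
  note ec = evolution_coefs[OF e] and ec' = evolution_coefs[OF e']
  have uH: "\<And>t. 0 \<le> t \<Longrightarrow> u t \<in> H_space L \<gamma>" "\<And>t. 0 \<le> t \<Longrightarrow> v t \<in> H_space L \<gamma>" using e e' by (auto simp: evolution_def)
  have us: "sq M (\<lambda>x. u t x $ i)" "sq M (\<lambda>x. v t x $ i)" if "0 < t" for t i
    using that by (auto intro!: H_spaceD(1) uH)
  define w where "w i t x = u t x $ i - v t x $ i" for i t x
  define s where "s i t x = ut t x $ i - vt t x $ i" for i t x
  define l where "l i t x = lap t x $ i - lav t x $ i" for i t x
  define z where "z t x = (du t 1 x $ 2 - dv t 1 x $ 2) - (du t 2 x $ 1 - dv t 2 x $ 1)" for t x
  let ?vf = "\<lambda>u du lap ut t. vf (\<lambda>x. u t x $ 1) (\<lambda>x. u t x $ 2) (\<lambda>x. du t 1 x $ 1) (\<lambda>x. du t 1 x $ 2)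
          (\<lambda>x. du t 2 x $ 1) (\<lambda>x. du t 2 x $ 2) (\<lambda>x. lap t x $ 1) (\<lambda>x. lap t x $ 2) \<and> sq M (\<lambda>x. ut t x $ 1) \<and> sq M (\<lambda>x. ut t x $ 2)"
  let ?ns = "\<lambda>u du lap ut r t. nse \<nu> \<mu> (\<lambda>x. ut t x $ 1) (\<lambda>x. ut t x $ 2) (\<lambda>x. u t x $ 1) (\<lambda>x. u t x $ 2) (\<lambda>x. du t 1 x $ 1) (\<lambda>x. du t 1 x $ 2)
          (\<lambda>x. du t 2 x $ 1) (\<lambda>x. du t 2 x $ 2) (\<lambda>x. lap t x $ 1) (\<lambda>x. lap t x $ 2) (r t)"
  have gAE: "AE t in lborel. 0 < t \<longrightarrow> ?vf u du lap ut t" "AE t in lborel. 0 < t \<longrightarrow> ?vf v dv lav vt t"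
    using e e' by (simp_all add: evolution_def)
  have nAE: "AE t in lborel. 0 < t \<longrightarrow> sq M (rf t) \<longrightarrow> ?ns u du lap ut rf t" "AE t in lborel. 0 < t \<longrightarrow> sq M (rg t) \<longrightarrow> ?ns v dv lav vt rg t"
    using e e' by (simp_all add: evolution_def)
  have st: "AE t in lborel. 0 < t \<longrightarrow> (\<forall>i. sq M (\<lambda>x. ut t x $ i) \<and> sq M (\<lambda>x. vt t x $ i))"
    using gAE by eventually_elim (simp add: forall_2)
  have good: "AE t in lborel. 0 < t \<longrightarrow> frot (w 1 t) (w 2 t) (z t) \<and> fpd 1 (z t) (l 2 t) \<and> fpd 2 (z t) (\<lambda>x. - l 1 t x) \<and>
      sq M (l 1 t) \<and> sq M (s 1 t) \<and> sq M (s 2 t)"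
    using gAE
  proof eventually_elim
    case (elim t)
    show ?case
    proof
      assume "0 < t"
      with elim have a: "?vf u du lap ut t" and b: "?vf v dv lav vt t" by blast+
      note vv = vfD[OF vf_diff[OF a[THEN conjunct1] b[THEN conjunct1]]]
      have ss: "sq M (s 1 t)" "sq M (s 2 t)" using a b unfolding s_def[abs_def] by (auto intro!: sq_diff)
      show "frot (w 1 t) (w 2 t) (z t) \<and> fpd 1 (z t) (l 2 t) \<and> fpd 2 (z t) (\<lambda>x. - l 1 t x) \<and> sq M (l 1 t) \<and> sq M (s 1 t) \<and> sq M (s 2 t)"
        using vv(8-10,13) ss unfolding w_def[abs_def] z_def[abs_def] l_def[abs_def] by (intro conjI)
    qed
  qed
  have dc: "set_integrable lborel {p..q} (\<lambda>r. A (s i r) k) \<and> A (w i q) k - A (w i p) k = (LINT r:{p..q}|lborel. A (s i r) k)"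
    "set_integrable lborel {p..q} (\<lambda>r. B (s i r) k) \<and> B (w i q) k - B (w i p) k = (LINT r:{p..q}|lborel. B (s i r) k)"
    if pq: "0 < p" "p \<le> q" for p q i k
  proof -
    let ?D = "\<lambda>C r. C (\<lambda>x. ut r x $ i) k - C (\<lambda>x. vt r x $ i) k"
    have wA: "A (w i t) k = A (\<lambda>x. u t x $ i) k - A (\<lambda>x. v t x $ i) k" "B (w i t) k = B (\<lambda>x. u t x $ i) k - B (\<lambda>x. v t x $ i) k" if "0 < t" for t
      unfolding w_def[abs_def] by (intro AB_diff us that)+
    have iD: "set_integrable lborel {p..q} (\<lambda>r. ?D A r)" "set_integrable lborel {p..q} (\<lambda>r. ?D B r)"
      by (intro set_integral_diff(1) ec(1)[OF pq] ec'(1)[OF pq], intro set_integral_diff(1) ec(2)[OF pq] ec'(2)[OF pq])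
    have iL: "(LINT r:{p..q}|lborel. ?D A r) = A (w i q) k - A (w i p) k" "(LINT r:{p..q}|lborel. ?D B r) = B (w i q) k - B (w i p) k"
      using set_integral_diff(2)[OF ec(1)[OF pq, of i k] ec'(1)[OF pq, of i k]] set_integral_diff(2)[OF ec(2)[OF pq, of i k] ec'(2)[OF pq, of i k]]
        ec(3,4)[OF pq, of i k] ec'(3,4)[OF pq, of i k] wA[of p] wA[of q] pq by simp_all
    have eq: "AE r in lborel. indicator {p..q} r *\<^sub>R ?D A r = indicator {p..q} r *\<^sub>R A (s i r) k"
      "AE r in lborel. indicator {p..q} r *\<^sub>R ?D B r = indicator {p..q} r *\<^sub>R B (s i r) k"
      using st by (eventually_elim, use pq in \<open>auto simp: indicator_def s_def[abs_def] AB_diff\<close>)+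
    have sm: "s i = (\<lambda>t x. (ut t x - vt t x) $ i)" by (auto simp: s_def fun_eq_iff)
    have loc: "L2_loc L \<gamma> {0<..} (\<lambda>t x. ut t x - vt t x)" using e e' by (intro L2_loc_diff) (auto simp: evolution_def)
    have iA: "set_integrable lborel {p..q} (\<lambda>r. A (s i r) k)" "set_integrable lborel {p..q} (\<lambda>r. B (s i r) k)"
      unfolding A_def B_def sm by (intro L2_loc_coef[OF loc pq] cs_measurable' cs_le)+
    have "(LINT r:{p..q}|lborel. ?D A r) = (LINT r:{p..q}|lborel. A (s i r) k)" "(LINT r:{p..q}|lborel. ?D B r) = (LINT r:{p..q}|lborel. B (s i r) k)"
      unfolding set_lebesgue_integral_def using iD iA eq unfolding set_integrable_def by (auto intro!: integral_cong_AE)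
    then show "set_integrable lborel {p..q} (\<lambda>r. A (s i r) k) \<and> A (w i q) k - A (w i p) k = (LINT r:{p..q}|lborel. A (s i r) k)"
      "set_integrable lborel {p..q} (\<lambda>r. B (s i r) k) \<and> B (w i q) k - B (w i p) k = (LINT r:{p..q}|lborel. B (s i r) k)"
      using iA iL by auto
  qed
  have dom: "set_integrable lborel {p..q} (\<lambda>r. (nrm M (l 1 r))\<^sup>2 + (nrm M (l 2 r))\<^sup>2 + (nrm M (s 1 r))\<^sup>2 + (nrm M (s 2 r))\<^sup>2)"
    if pq: "0 < p" "p \<le> q" for p q
  proof -
    have sm: "s = (\<lambda>i t x. (ut t x - vt t x) $ i)" "l = (\<lambda>i t x. (lap t x - lav t x) $ i)" by (auto simp: s_def l_def fun_eq_iff)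
    have loc: "L2_loc L \<gamma> {0<..} (\<lambda>t x. ut t x - vt t x)" "L2_loc L \<gamma> {0<..} (\<lambda>t x. lap t x - lav t x)"
      using e e' by (auto intro!: L2_loc_diff simp: evolution_def)
    show ?thesis unfolding sm by (intro set_integral_add(1) L2_loc_nrm[OF loc(1) pq] L2_loc_nrm[OF loc(2) pq])
  qed
  have dj: "((\<lambda>s. s\<^sup>2) has_real_derivative 2 * s) (at s)" "((\<lambda>s. 2 * s) has_real_derivative 2) (at s)" for s :: real
    by (auto intro!: derivative_eq_intros)
  have b2: "\<bar>2\<bar> \<le> (2::real)" "\<bar>2 - 2\<bar> \<le> 0 * \<bar>p - q\<bar>" for p q :: real by auto
  have z0: "(0::real)\<^sup>2 = 0" "2 * (0::real) = 0" by auto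
  obtain Y I where Y: "\<And>s t. 0 < s \<Longrightarrow> s \<le> t \<Longrightarrow> set_integrable lborel {s..t} I \<and> Y t - Y s = (LINT r:{s..t}|lborel. I r)"
    "AE t in lborel. 0 < t \<longrightarrow> I t = - (\<integral>x. 2 * (l 1 t x * s 1 t x + l 2 t x * s 2 t x) \<partial>M)"
    "\<And>t. 0 < t \<Longrightarrow> (\<lambda>n. \<integral>x. (T n (rotA (w 1 t) (w 2 t)) (rotB (w 1 t) (w 2 t)) x)\<^sup>2 \<partial>M) \<longlonglongrightarrow> Y t"
    "AE t in lborel. 0 < t \<longrightarrow> Y t = (\<integral>x. (z t x)\<^sup>2 \<partial>M)"
    using time_identity[where ?w1.0 = "w 1" and ?w2.0 = "w 2" and ?t1.0 = "s 1" and ?t2.0 = "s 2" and ?l1.0 = "l 1" and ?l2.0 = "l 2" and z = z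
        and j = "\<lambda>s. s\<^sup>2" and J = "\<lambda>s. 2 * s" and J' = "\<lambda>s. 2" and C = 2 and Q = 0,
        OF dc(1)[THEN conjunct1] dc(1)[THEN conjunct1] dc(2)[THEN conjunct1] dc(2)[THEN conjunct1]
          dc(1)[THEN conjunct2] dc(1)[THEN conjunct2] dc(2)[THEN conjunct2] dc(2)[THEN conjunct2] good dom dj(1) z0 dj(2) b2]
    by blast
  define \<kappa> where "\<kappa> = \<nu> - (m + d) * c"
  have \<kappa>: "0 < \<kappa>" using m by (simp add: \<kappa>_def)
  obtain X where X: "(X \<longlongrightarrow> 0) at_top" "AE t in lborel. 0 < t \<longrightarrow> (nrm M (\<lambda>x. max 0 (\<bar>vort du t x\<bar> - (m + d))))\<^sup>2 \<le> X t"
    using excess_decay[OF e \<mu> less_imp_le[OF \<nu>] m(1,2) rf] by blast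
  \<comment> \<open>what Young's inequality leaves of the forces and of \<open>S\<close>, with \<open>\<kappa>\<close> the viscosity that the main nonlinear term does not use up\<close>
  define \<epsilon> where "\<epsilon> t = (nrm M (\<lambda>x. rf t x - rg t x))\<^sup>2 / \<mu> + (m + d)\<^sup>2 * (S t)\<^sup>2 / \<kappa>" for t
  have \<epsilon>0: "(\<epsilon> \<longlongrightarrow> 0) at_top"
  proof -
    have "(\<epsilon> \<longlongrightarrow> 0\<^sup>2 / \<mu> + (m + d)\<^sup>2 * 0\<^sup>2 / \<kappa>) at_top" unfolding \<epsilon>_def[abs_def] using \<mu> \<kappa> by (intro tendsto_intros dr S) auto
    then show ?thesis by simp
  qed
  \<comment> \<open>from then on the excess of the vorticity costs at most half of \<open>\<kappa>\<close>\<close>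
  have Xs: "\<forall>\<^sub>F t in at_top. X t < (\<kappa> / (4 * Csob))\<^sup>2"
    using order_tendstoD(2)[OF X(1)] \<kappa> Csob(1) by auto
  have main: "\<exists>T>0. AE t in lborel. T \<le> t \<longrightarrow> I t \<le> - \<mu> * Y t + e0" if "0 < e0" for e0
  proof -
    have "\<forall>\<^sub>F t in at_top. \<epsilon> t < e0" using order_tendstoD(2)[OF \<epsilon>0 that] .
    with rf rg W Xs eventually_gt_at_top[of "0::real"]
    have "\<forall>\<^sub>F t in at_top. sq M (rf t) \<and> sq M (rg t) \<and> X t < (\<kappa> / (4 * Csob))\<^sup>2 \<and> \<epsilon> t < e0 \<and> 0 < t \<and>
      (\<forall>k1 k2. flap (\<lambda>x. u t x $ 1 - v t x $ 1) k1 \<longrightarrow> flap (\<lambda>x. u t x $ 2 - v t x $ 2) k2 \<longrightarrow>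
        sqrt ((nrm M (\<lambda>x. u t x $ 1 - v t x $ 1))\<^sup>2 + (nrm M (\<lambda>x. u t x $ 2 - v t x $ 2))\<^sup>2) \<le> c * sqrt ((nrm M k1)\<^sup>2 + (nrm M k2)\<^sup>2) + S t)"
      by eventually_elim blast
    then obtain T0 where T0: "\<And>t. T0 \<le> t \<Longrightarrow> sq M (rf t) \<and> sq M (rg t) \<and> X t < (\<kappa> / (4 * Csob))\<^sup>2 \<and> \<epsilon> t < e0 \<and> 0 < t \<and>
      (\<forall>k1 k2. flap (\<lambda>x. u t x $ 1 - v t x $ 1) k1 \<longrightarrow> flap (\<lambda>x. u t x $ 2 - v t x $ 2) k2 \<longrightarrow>
        sqrt ((nrm M (\<lambda>x. u t x $ 1 - v t x $ 1))\<^sup>2 + (nrm M (\<lambda>x. u t x $ 2 - v t x $ 2))\<^sup>2) \<le> c * sqrt ((nrm M k1)\<^sup>2 + (nrm M k2)\<^sup>2) + S t)"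
      unfolding eventually_at_top_linorder by blast
    have "AE t in lborel. max 1 T0 \<le> t \<longrightarrow> I t \<le> - \<mu> * Y t + e0"
      using nAE Y(2,4) X(2)
    proof eventually_elim
      case (elim t)
      show ?case
      proof
        assume "max 1 T0 \<le> t"
        then have t: "0 < t" "sq M (rf t)" "sq M (rg t)" "X t < (\<kappa> / (4 * Csob))\<^sup>2" "\<epsilon> t < e0"
          and Wt: "\<And>k1 k2. flap (w 1 t) k1 \<Longrightarrow> flap (w 2 t) k2 \<Longrightarrow>
            sqrt ((nrm M (w 1 t))\<^sup>2 + (nrm M (w 2 t))\<^sup>2) \<le> c * sqrt ((nrm M k1)\<^sup>2 + (nrm M k2)\<^sup>2) + S t"
          using T0[of t] unfolding w_def[abs_def] by auto
        have n: "?ns u du lap ut rf t" and n': "?ns v dv lav vt rg t" using elim(1,2) t by blast+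
        note vv = vfD[OF vf_diff[OF nseD(1)[OF n] nseD(1)[OF n']]]
        have f: "flap (w 1 t) (l 1 t)" "flap (w 2 t) (l 2 t)" using vv(5,6) unfolding w_def[abs_def] l_def[abs_def] .
        have sz: "sq M (z t)" using vv(15) unfolding z_def[abs_def] .
        have so: "sq M (vort du t)" unfolding vort_def[abs_def] by (rule vfD(15)[OF nseD(1)[OF n]])
        define D where "D = sqrt ((nrm M (l 1 t))\<^sup>2 + (nrm M (l 2 t))\<^sup>2)"
        define Wv where "Wv = sqrt ((nrm M (w 1 t))\<^sup>2 + (nrm M (w 2 t))\<^sup>2)"
        define E where "E = 2 * Csob * nrm M (\<lambda>x. max 0 (\<bar>vort du t x\<bar> - (m + d)))"
        define tri where "tri = (\<integral>x. vort du t x * (l 2 t x * w 1 t x - l 1 t x * w 2 t x) \<partial>M)"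
        have bal: "- (\<integral>x. l 1 t x * s 1 t x + l 2 t x * s 2 t x \<partial>M) =
            (\<integral>x. z t x * (rf t x - rg t x - \<mu> * z t x) \<partial>M) - \<nu> * ((nrm M (l 1 t))\<^sup>2 + (nrm M (l 2 t))\<^sup>2) + tri"
          using difference_balance(1)[OF n n'] unfolding tri_def vort_def l_def[abs_def] w_def[abs_def] s_def[abs_def] z_def[abs_def] .
        have int: "integrable M (\<lambda>x. vort du t x * (l 2 t x * w 1 t x - l 1 t x * w 2 t x))"
          using difference_balance(2)[OF n n'] unfolding vort_def l_def[abs_def] w_def[abs_def] .
        have tri: "tri \<le> (m + d) * Wv * D + E * D\<^sup>2"
          using trilinear_bound[OF f so _ int, of "m + d"] m unfolding tri_def Wv_def D_def E_def by auto
        have En: "nrm M (\<lambda>x. max 0 (\<bar>vort du t x\<bar> - (m + d))) \<le> \<kappa> / (4 * Csob)"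
        proof (rule power2_le_imp_le)
          have "(nrm M (\<lambda>x. max 0 (\<bar>vort du t x\<bar> - (m + d))))\<^sup>2 \<le> X t" using elim(5) t(1) by blast
          then show "(nrm M (\<lambda>x. max 0 (\<bar>vort du t x\<bar> - (m + d))))\<^sup>2 \<le> (\<kappa> / (4 * Csob))\<^sup>2" using t(4) by linarith
          show "0 \<le> \<kappa> / (4 * Csob)" using \<kappa> Csob(1) by simp
        qed
        have E: "0 \<le> E" "E \<le> \<kappa> / 2"
        proof -
          show "0 \<le> E" using Csob(1) by (simp add: E_def)
          have "E \<le> 2 * Csob * (\<kappa> / (4 * Csob))" unfolding E_def using En Csob(1) by (intro mult_left_mono) auto
          also have "\<dots> = \<kappa> / 2" using Csob(1) by simp
          finally show "E \<le> \<kappa> / 2" .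
        qed
        have "(\<integral>x. z t x * (rf t x - rg t x - \<mu> * z t x) \<partial>M) = (\<integral>x. z t x * (rf t x - rg t x) - \<mu> * (z t x)\<^sup>2 \<partial>M)"
          by (rule Bochner_Integration.integral_cong) (auto simp: power2_eq_square algebra_simps)
        also have "\<dots> = (\<integral>x. z t x * (rf t x - rg t x) \<partial>M) - \<mu> * (nrm M (z t))\<^sup>2"
          using sq_mult_integrable[OF sz sq_diff[OF t(2,3)]] sq_integrable[OF sz] by (simp add: nrm_power2)
        also have "\<dots> \<le> nrm M (z t) * nrm M (\<lambda>x. rf t x - rg t x) - \<mu> * (nrm M (z t))\<^sup>2"
          using Cauchy_Schwarz_integral[OF sz sq_diff[OF t(2,3)]] by simp
        finally have zz: "(\<integral>x. z t x * (rf t x - rg t x - \<mu> * z t x) \<partial>M) \<le> nrm M (z t) * nrm M (\<lambda>x. rf t x - rg t x) - \<mu> * (nrm M (z t))\<^sup>2" .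
        have DD: "(nrm M (l 1 t))\<^sup>2 + (nrm M (l 2 t))\<^sup>2 = D\<^sup>2" by (simp add: D_def)
        have "I t = 2 * (- (\<integral>x. l 1 t x * s 1 t x + l 2 t x * s 2 t x \<partial>M))"
          using elim(3)[THEN mp, OF t(1)] unfolding integral_mult_right_zero by simp
        also have "\<dots> \<le> 2 * ((nrm M (z t) * nrm M (\<lambda>x. rf t x - rg t x) - \<mu> * (nrm M (z t))\<^sup>2) - \<nu> * D\<^sup>2 + tri)"
          unfolding bal DD using zz by simp
        also have "\<dots> \<le> - \<mu> * (nrm M (z t))\<^sup>2 + ((nrm M (\<lambda>x. rf t x - rg t x))\<^sup>2 / \<mu> + (m + d)\<^sup>2 * (S t)\<^sup>2 / \<kappa>)"
          by (rule absorb_into_dissipation[OF _ \<mu> \<kappa> \<kappa>_def _ _ E tri]) (use m Wt[OF f] in \<open>auto simp: D_def Wv_def\<close>)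
        also have "\<dots> \<le> - \<mu> * Y t + e0" using elim(4) t(1,5) by (simp add: \<epsilon>_def nrm_power2)
        finally show "I t \<le> - \<mu> * Y t + e0" .
      qed
    qed
    then show ?thesis by (intro exI[of _ "max 1 T0"]) auto
  qed
  have Y0: "0 \<le> Y t" if "0 < t" for t
    by (rule LIMSEQ_le_const[OF Y(3)[OF that]]) (intro exI[of _ 0] allI impI Bochner_Integration.integral_nonneg, simp)
  have lim: "(Y \<longlongrightarrow> 0) at_top"
    by (rule decay_of_differential_inequality[where I = I and \<mu> = \<mu>, OF \<mu> Y0 _ _ main]) (use Y(1) in auto)
  obtain c0 where c0: "0 < c0" "\<And>k. k \<noteq> 0 \<Longrightarrow> c0 \<le> kk k" using kk_lower by blast
  have le: "L2_norm L \<gamma> (\<lambda>x. u t x - v t x) \<le> sqrt (Y t / c0)" if t: "0 < t" for t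
  proof -
    have H: "u t \<in> H_space L \<gamma>" "v t \<in> H_space L \<gamma>" using uH t by auto
    have "fdiv0 (w 1 t) (w 2 t)" unfolding w_def[abs_def] by (intro fdiv0_diff H_spaceD(3) H)
    moreover have "A (w i t) 0 = 0" for i unfolding w_def[abs_def] using H_spaceD(2)[OF H(1)] H_spaceD(2)[OF H(2)] AB_diff(1)[OF us[OF t]] by simp
    ultimately have "c0 * ((nrm M (w 1 t))\<^sup>2 + (nrm M (w 2 t))\<^sup>2) \<le> Y t"
      by (intro energy_le_enstrophy[OF _ _ _ c0 Y(3)[OF t]])
    then have "(nrm M (w 1 t))\<^sup>2 + (nrm M (w 2 t))\<^sup>2 \<le> Y t / c0" using c0(1) by (simp add: field_simps)
    moreover have "L2_norm L \<gamma> (\<lambda>x. u t x - v t x) = sqrt ((nrm M (w 1 t))\<^sup>2 + (nrm M (w 2 t))\<^sup>2)"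
      using L2_norm_eq[of "\<lambda>x. u t x - v t x"] sq_diff[OF us[OF t]] by (simp add: w_def[abs_def])
    ultimately show ?thesis by simp
  qed
  show ?thesis
  proof (rule tendsto_sandwich[OF _ _ tendsto_const])
    show "((\<lambda>t. sqrt (Y t / c0)) \<longlongrightarrow> 0) at_top"
      using tendsto_real_sqrt[OF tendsto_divide[OF lim tendsto_const[of c0]]] c0(1) by simp
    show "\<forall>\<^sub>F t in at_top. L2_norm L \<gamma> (\<lambda>x. u t x - v t x) \<le> sqrt (Y t / c0)"
      using eventually_gt_at_top[of 0] by eventually_elim (rule le)
    show "\<forall>\<^sub>F t in at_top. 0 \<le> L2_norm L \<gamma> (\<lambda>x. u t x - v t x)"
      unfolding L2_norm_def LINT_Omega by (intro always_eventually) simp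
  qed
qed

lemma Linf_AE: assumes "Linf_norm L \<gamma> h < ereal c" shows "AE x in M. \<bar>h x\<bar> \<le> c"
proof -
  have "AE x in M. ereal \<bar>h x\<bar> \<le> Linf_norm L \<gamma> h"
    unfolding M_def Linf_norm_def by (rule esssup_AE)
  then show ?thesis using assms
    by (auto elim!: eventually_mono intro: order_trans less_imp_le)
      (metis ereal_less_eq(3) less_imp_le order_trans)
qed

lemma AE_bounded_sq: assumes "h \<in> borel_measurable M" "AE x in M. \<bar>h x\<bar> \<le> c" shows "sq M h"
  by (rule sq_bound[OF sq_const[of 1] assms(1), where C = c]) (use assms(2) in simp)

text \<open>A level \<open>m\<close> slightly above \<open>F / \<mu>\<close> still satisfies \<open>c m < \<nu>\<close> and eventually dominates the forces.
  The maximum with \<open>0\<close> covers a negative \<open>F\<close>.\<close>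

theorem determining_criterion:
  assumes sp: "solution_pair L \<gamma> \<nu> \<mu> F u v" and \<nu>: "0 < \<nu>" and \<mu>: "0 < \<mu>" and c: "0 \<le> c" "c * (max F 0 / \<mu>) < \<nu>"
    and S: "(S \<longlongrightarrow> 0) at_top"
    and W: "(\<forall>t\<ge>0. u t \<in> H_space L \<gamma> \<and> v t \<in> H_space L \<gamma>) \<Longrightarrow> \<forall>\<^sub>F t in at_top. \<forall>k1 k2. flap (\<lambda>x. u t x $ 1 - v t x $ 1) k1 \<longrightarrow> flap (\<lambda>x. u t x $ 2 - v t x $ 2) k2 \<longrightarrow>
        sqrt ((nrm M (\<lambda>x. u t x $ 1 - v t x $ 1))\<^sup>2 + (nrm M (\<lambda>x. u t x $ 2 - v t x $ 2))\<^sup>2) \<le> c * sqrt ((nrm M k1)\<^sup>2 + (nrm M k2)\<^sup>2) + S t"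
  shows "((\<lambda>t. L2_norm L \<gamma> (\<lambda>x. u t x - v t x)) \<longlongrightarrow> 0) at_top"
proof -
  obtain f g rf rg u0 v0 p q where
    fg: "forcing L \<gamma> f" "forcing L \<gamma> g" "ns_solution L \<gamma> \<nu> \<mu> f u0 u p" "ns_solution L \<gamma> \<nu> \<mu> g v0 v q" and
    rot: "\<And>t. 0 \<le> t \<Longrightarrow> has_weak_rot L \<gamma> (f t) (rf t)" "\<And>t. 0 \<le> t \<Longrightarrow> has_weak_rot L \<gamma> (g t) (rg t)" and
    lim: "Limsup at_top (\<lambda>t. Linf_norm L \<gamma> (rf t)) = ereal F" "((\<lambda>t. Linf_norm L \<gamma> (\<lambda>x. rf t x - rg t x)) \<longlongrightarrow> 0) at_top"
    using sp unfolding solution_pair_def by blast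
  obtain ut du lap where e: "evolution \<nu> \<mu> u ut du lap rf" using ns_solution_evolution[OF fg(3,1) rot(1)] by blast
  obtain vt dv lav where e': "evolution \<nu> \<mu> v vt dv lav rg" using ns_solution_evolution[OF fg(4,2) rot(2)] by blast
  define a where "a = max F 0 / \<mu>"
  define \<eta> where "\<eta> = (\<nu> - c * a) / (2 * (c + 1))"
  have a0: "0 \<le> a" using \<mu> by (simp add: a_def)
  have \<eta>0: "0 < \<eta>" using c by (simp add: \<eta>_def a_def)
  have ce: "(a + \<eta>) * c < \<nu>"
  proof -
    have "c * \<eta> \<le> (c + 1) * \<eta>" using \<eta>0 by (intro mult_right_mono) auto
    also have "(c + 1) * \<eta> = (\<nu> - c * a) / 2"
    proof -
      have h: "q * (y / (2 * q)) = y / 2" if "0 < q" for q y :: real using that by simp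
      show ?thesis unfolding \<eta>_def by (rule h) (use c(1) in simp)
    qed
    also have "\<dots> < \<nu> - c * a"
    proof -
      have h: "y / 2 < y" if "0 < y" for y :: real using that by simp
      show ?thesis by (rule h) (use c(2) in \<open>simp only: a_def diff_gt_0_iff_gt\<close>)
    qed
    finally show ?thesis by (simp add: algebra_simps)
  qed
  have Fm: "F < \<mu> * (a + \<eta> / 2)"
  proof -
    have "F \<le> \<mu> * a" using \<mu> by (simp add: a_def)
    also have "\<mu> * a < \<mu> * (a + \<eta> / 2)" using \<mu> \<eta>0 by (intro mult_strict_left_mono) auto
    finally show ?thesis .
  qed
  have meas: "rf t \<in> borel_measurable M" "rg t \<in> borel_measurable M" if "0 \<le> t" for t
    using rot[OF that] by (auto simp: has_weak_rot_def intro: measurable_M)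
  have rfb: "\<forall>\<^sub>F t in at_top. sq M (rf t) \<and> (AE x in M. \<bar>rf t x\<bar> \<le> \<mu> * (a + \<eta> / 2))"
  proof -
    have "Limsup at_top (\<lambda>t. Linf_norm L \<gamma> (rf t)) < ereal (\<mu> * (a + \<eta> / 2))" using lim(1) Fm by simp
    from Limsup_lessD[OF this] eventually_ge_at_top[of 0] show ?thesis
    proof eventually_elim
      case (elim t)
      from Linf_AE[OF elim(1)] show ?case using AE_bounded_sq[OF meas(1)[OF elim(2)]] by blast
    qed
  qed
  have db: "\<forall>\<^sub>F t in at_top. AE x in M. \<bar>rf t x - rg t x\<bar> \<le> b" if "0 < b" for b
  proof -
    have "\<forall>\<^sub>F t in at_top. Linf_norm L \<gamma> (\<lambda>x. rf t x - rg t x) < ereal b" using that by (intro order_tendstoD(2)[OF lim(2)]) simp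
    then show ?thesis by eventually_elim (rule Linf_AE)
  qed
  have rgb: "\<forall>\<^sub>F t in at_top. sq M (rg t)"
    using rfb db[of 1, OF zero_less_one] eventually_ge_at_top[of 0]
  proof eventually_elim
    case (elim t)
    have sd: "sq M (\<lambda>x. rf t x - rg t x)"
      by (rule AE_bounded_sq[OF _ elim(2)]) (use meas[OF elim(3)] in simp)
    have "sq M (\<lambda>x. rf t x - (rf t x - rg t x))" by (rule sq_diff[OF _ sd]) (use elim(1) in blast)
    then show ?case by simp
  qed
  have dr: "((\<lambda>t. nrm M (\<lambda>x. rf t x - rg t x)) \<longlongrightarrow> 0) at_top"
  proof (rule tendstoI)
    fix b :: real assume "0 < b"
    define b' where "b' = b / (2 * sqrt area)"
    have b': "0 < b'" using \<open>0 < b\<close> area_pos by (simp add: b'_def)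
    show "\<forall>\<^sub>F t in at_top. dist (nrm M (\<lambda>x. rf t x - rg t x)) 0 < b"
      using db[OF b'] eventually_ge_at_top[of 0]
    proof eventually_elim
      case (elim t)
      have "nrm M (\<lambda>x. rf t x - rg t x) \<le> nrm M (\<lambda>x. b')"
        by (rule nrm_mono) (use meas[OF elim(2)] elim(1) b' in auto)
      also have "\<dots> = b / 2" using \<open>0 < b\<close> area_pos by (simp add: nrm_def measure_M real_sqrt_mult b'_def)
      finally show ?case using \<open>0 < b\<close> by (simp add: dist_real_def)
    qed
  qed
  have H: "\<forall>t\<ge>0. u t \<in> H_space L \<gamma> \<and> v t \<in> H_space L \<gamma>" using e e' by (simp add: evolution_def)
  show ?thesis
    by (rule difference_decay[where m = "a + \<eta> / 2" and d = "\<eta> / 2", OF e e' \<mu> \<nu> c(1) _ _ _ rfb rgb dr S W[OF H]])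
      (use a0 \<eta>0 ce in \<open>auto simp: algebra_simps\<close>)
qed

section \<open>Determining modes\<close>

text \<open>Square integrability of both components.\<close>

definition lv :: "(real^2 \<Rightarrow> real^2) \<Rightarrow> bool" where "lv h \<longleftrightarrow> (\<forall>i. sq M (\<lambda>x. h x $ i))"

lemma lvD: "lv h \<Longrightarrow> sq M (\<lambda>x. h x $ i)" by (simp add: lv_def)

lemma lv_add: "lv g \<Longrightarrow> lv h \<Longrightarrow> lv (\<lambda>x. g x + h x)" by (simp add: lv_def sq_add)
lemma lv_diff: "lv g \<Longrightarrow> lv h \<Longrightarrow> lv (\<lambda>x. g x - h x)" by (simp add: lv_def sq_diff)
lemma lv_scale: "lv h \<Longrightarrow> lv (\<lambda>x. c *\<^sub>R h x)" by (simp add: lv_def sq_cmult)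
lemma lv_zero: "lv (\<lambda>x. 0)" by (simp add: lv_def)
lemma lv_sum: "(\<And>j. j \<in> I \<Longrightarrow> lv (h j)) \<Longrightarrow> lv (\<lambda>x. \<Sum>j\<in>I. h j x)"
  by (induction I rule: infinite_finite_induct) (auto intro: lv_add lv_zero)

lemma H_space_lv: "h \<in> H_space L \<gamma> \<Longrightarrow> lv h" by (simp add: lv_def H_spaceD)

abbreviation ip :: "(real^2 \<Rightarrow> real^2) \<Rightarrow> (real^2 \<Rightarrow> real^2) \<Rightarrow> real" where "ip \<equiv> L2_inner L \<gamma>"

lemma ip_eq: assumes "lv g" "lv h" shows "ip g h = (\<integral>x. g x $ 1 * h x $ 1 \<partial>M) + (\<integral>x. g x $ 2 * h x $ 2 \<partial>M)"
  unfolding L2_inner_def LINT_Omega inner_vec_def sum_2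
  using sq_mult_integrable[OF lvD[OF assms(1)] lvD[OF assms(2)]] by simp

lemma ip_commute: "ip g h = ip h g" by (simp add: L2_inner_def inner_commute)

lemma ip_add: assumes "lv f" "lv g" "lv h" shows "ip (\<lambda>x. f x + g x) h = ip f h + ip g h"
  using sq_mult_integrable[OF lvD[OF assms(1)] lvD[OF assms(3)]] sq_mult_integrable[OF lvD[OF assms(2)] lvD[OF assms(3)]]
  by (simp add: ip_eq assms lv_add distrib_right)

lemma ip_diff: assumes "lv f" "lv g" "lv h" shows "ip (\<lambda>x. f x - g x) h = ip f h - ip g h"
  using sq_mult_integrable[OF lvD[OF assms(1)] lvD[OF assms(3)]] sq_mult_integrable[OF lvD[OF assms(2)] lvD[OF assms(3)]]
  by (simp add: ip_eq assms lv_diff left_diff_distrib)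

lemma ip_scale: assumes "lv g" "lv h" shows "ip (\<lambda>x. c *\<^sub>R g x) h = c * ip g h"
  by (simp add: ip_eq assms lv_scale distrib_left mult.assoc)

lemma ip_zero: "ip (\<lambda>x. 0) h = 0" by (simp add: L2_inner_def set_lebesgue_integral_def)

lemma ip_sum: assumes "\<And>j. j \<in> I \<Longrightarrow> lv (g j)" "lv h" shows "ip (\<lambda>x. \<Sum>j\<in>I. g j x) h = (\<Sum>j\<in>I. ip (g j) h)"
  using assms(1)
proof (induction I rule: infinite_finite_induct)
  case (insert j I)
  have "ip (\<lambda>x. g j x + (\<Sum>j\<in>I. g j x)) h = ip (g j) h + ip (\<lambda>x. \<Sum>j\<in>I. g j x) h"
    by (intro ip_add lv_sum assms(2)) (use insert.prems in auto)
  then show ?case using insert by simp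
qed (auto simp: ip_zero)

lemma L2_norm_ip: assumes "lv h" shows "(L2_norm L \<gamma> h)\<^sup>2 = ip h h"
  using L2_norm_eq[OF lvD[OF assms]] by (simp add: ip_eq assms nrm_power2) (simp add: power2_eq_square)

lemma ip_null: assumes "lv g" "lv h" "L2_norm L \<gamma> g = 0" shows "ip g h = 0"
proof -
  have "nrm M (\<lambda>x. g x $ 1) = 0 \<and> nrm M (\<lambda>x. g x $ 2) = 0"
    using assms(3) unfolding L2_norm_eq[OF lvD[OF assms(1)]] by (simp add: sum_power2_eq_zero_iff)
  then have "(\<integral>x. g x $ 1 * h x $ 1 \<partial>M) = 0" "(\<integral>x. g x $ 2 * h x $ 2 \<partial>M) = 0"
    using Cauchy_Schwarz_integral[OF lvD[OF assms(1)] lvD[OF assms(2)], of 1 1] Cauchy_Schwarz_integral[OF lvD[OF assms(1)] lvD[OF assms(2)], of 2 2] by simp_all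
  then show ?thesis by (simp add: ip_eq assms)
qed

subsection \<open>Divergence-free fields\<close>

lemma L2_perI: assumes "periodic L \<gamma> h" "h \<in> borel_measurable borel" "lv h" shows "L2_per L \<gamma> h"
proof -
  have e: "(\<lambda>x. (norm (h x))\<^sup>2) = (\<lambda>x. (h x $ 1)\<^sup>2 + (h x $ 2)\<^sup>2)"
    unfolding power2_norm_eq_inner inner_vec_def sum_2 by (rule ext) (simp add: power2_eq_square)
  have "integrable M (\<lambda>x. (norm (h x))\<^sup>2)" unfolding e
    by (intro Bochner_Integration.integrable_add sq_integrable lvD assms)
  then show ?thesis using assms by (simp add: L2_per_def integrable_Omega)
qed

lemma test_pd: assumes "test_function L \<gamma> \<phi>" shows "has_pd i \<phi> (pd i \<phi>)" "continuous_on UNIV (pd i \<phi>)" "continuous_on UNIV \<phi>"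
proof -
  have C: "\<And>n. Ck n \<phi>" "periodic L \<gamma> \<phi>" using assms by (auto simp: test_function_def)
  show "continuous_on UNIV (pd i \<phi>)" using C(1)[of "Suc 0"] by simp
  show "continuous_on UNIV \<phi>" using C(1)[of 0] by simp
  have d: "\<phi> differentiable_on UNIV" using C(1)[of "Suc 0"] by simp
  show "has_pd i \<phi> (pd i \<phi>)" unfolding has_pd_def
  proof
    fix x
    have "\<phi> differentiable at (x + 0 *\<^sub>R axis i 1)" using d by (simp add: differentiable_on_def)
    then have "(\<lambda>s. \<phi> (x + s *\<^sub>R axis i 1)) differentiable at 0"
      by (rule differentiable_compose) (auto intro!: derivative_intros)
    then show "((\<lambda>s. \<phi> (x + s *\<^sub>R axis i 1)) has_real_derivative pd i \<phi> x) (at 0)"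
      unfolding pd_def by (simp add: DERIV_deriv_iff_real_differentiable)
  qed
qed

lemma weak_div_free_iff: assumes "lv h"
  shows "weak_div_free L \<gamma> h \<longleftrightarrow> (\<forall>\<phi>. test_function L \<gamma> \<phi> \<longrightarrow> (\<integral>x. h x $ 1 * pd 1 \<phi> x \<partial>M) + (\<integral>x. h x $ 2 * pd 2 \<phi> x \<partial>M) = 0)"
proof -
  have "(LINT x:Omega L \<gamma>|lborel. \<Sum>i\<in>UNIV. h x $ i * pd i \<phi> x) = (\<integral>x. h x $ 1 * pd 1 \<phi> x \<partial>M) + (\<integral>x. h x $ 2 * pd 2 \<phi> x \<partial>M)"
    if "test_function L \<gamma> \<phi>" for \<phi>
    unfolding LINT_Omega sum_2
    by (intro Bochner_Integration.integral_add sq_mult_integrable lvD[OF assms] continuous_sq test_pd[OF that])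
  then show ?thesis by (auto simp: weak_div_free_def)
qed

text \<open>Componentwise, so that closure under linear operations follows from that of integrals.\<close>

lemma H_space_iff: "h \<in> H_space L \<gamma> \<longleftrightarrow> periodic L \<gamma> h \<and> h \<in> borel_measurable borel \<and> lv h \<and>
   (\<integral>x. h x $ 1 \<partial>M) = 0 \<and> (\<integral>x. h x $ 2 \<partial>M) = 0 \<and>
   (\<forall>\<phi>. test_function L \<gamma> \<phi> \<longrightarrow> (\<integral>x. h x $ 1 * pd 1 \<phi> x \<partial>M) + (\<integral>x. h x $ 2 * pd 2 \<phi> x \<partial>M) = 0)" (is "_ \<longleftrightarrow> ?R")
proof
  assume h: "h \<in> H_space L \<gamma>"
  have l: "lv h" by (rule H_space_lv[OF h])
  have "(\<integral>x. h x $ i \<partial>M) = 0" for i using H_spaceD(2)[OF h, of i] by (simp add: A_def)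
  then show ?R using h l weak_div_free_iff[OF l] by (simp add: H_space_def L2_per_def)
next
  assume r: ?R
  then have l: "lv h" by blast
  have "integrable M h" by (intro integrable_vec2 sq_imp_integrable lvD l)
  then have "integral\<^sup>L M h $ i = (\<integral>x. h x $ i \<partial>M)" for i by (rule integral_nth)
  then have "mean_zero L \<gamma> h" using r by (simp add: mean_zero_def LINT_Omega vec_eq_iff forall_2)
  then show "h \<in> H_space L \<gamma>" using r L2_perI[of h] weak_div_free_iff[OF l] by (simp add: H_space_def)
qed

lemma H_space_scale: assumes "h \<in> H_space L \<gamma>" shows "(\<lambda>x. c *\<^sub>R h x) \<in> H_space L \<gamma>"
proof -
  note r = assms[unfolded H_space_iff]
  have d: "c * (\<integral>x. h x $ 1 * pd 1 \<phi> x \<partial>M) + c * (\<integral>x. h x $ 2 * pd 2 \<phi> x \<partial>M) = 0" if "test_function L \<gamma> \<phi>" for \<phi>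
    using r that by (simp add: distrib_left[symmetric])
  show ?thesis unfolding H_space_iff using r d by (auto simp: periodic_def lv_scale mult.assoc)
qed

lemma H_space_add: assumes "g \<in> H_space L \<gamma>" "h \<in> H_space L \<gamma>" shows "(\<lambda>x. g x + h x) \<in> H_space L \<gamma>"
proof -
  note r = assms(1)[unfolded H_space_iff] and r' = assms(2)[unfolded H_space_iff]
  have l: "lv g" "lv h" using r r' by auto
  have d: "(\<integral>x. (g x $ 1 + h x $ 1) * pd 1 \<phi> x \<partial>M) + (\<integral>x. (g x $ 2 + h x $ 2) * pd 2 \<phi> x \<partial>M) = 0" if t: "test_function L \<gamma> \<phi>" for \<phi>
  proof -
    have i: "integrable M (\<lambda>x. g x $ j * pd j \<phi> x)" "integrable M (\<lambda>x. h x $ j * pd j \<phi> x)" for j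
      by (intro sq_mult_integrable lvD l continuous_sq test_pd[OF t])+
    have "(\<integral>x. g x $ 1 * pd 1 \<phi> x \<partial>M) + (\<integral>x. g x $ 2 * pd 2 \<phi> x \<partial>M) = 0"
      "(\<integral>x. h x $ 1 * pd 1 \<phi> x \<partial>M) + (\<integral>x. h x $ 2 * pd 2 \<phi> x \<partial>M) = 0" using r r' t by auto
    then show ?thesis using i by (simp add: distrib_right)
  qed
  show ?thesis unfolding H_space_iff
    using r r' d sq_imp_integrable[OF lvD[OF l(1)]] sq_imp_integrable[OF lvD[OF l(2)]] by (auto simp: periodic_def lv_add)
qed

lemma H_space_zero: "(\<lambda>x. 0) \<in> H_space L \<gamma>"
  unfolding H_space_iff by (simp add: periodic_def lv_zero)

lemma H_space_diff: "g \<in> H_space L \<gamma> \<Longrightarrow> h \<in> H_space L \<gamma> \<Longrightarrow> (\<lambda>x. g x - h x) \<in> H_space L \<gamma>"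
  using H_space_add[OF _ H_space_scale[of h "-1"], of g] by simp

lemma H_space_sum: "(\<And>j. j \<in> I \<Longrightarrow> h j \<in> H_space L \<gamma>) \<Longrightarrow> (\<lambda>x. \<Sum>j\<in>I. h j x) \<in> H_space L \<gamma>"
  by (induction I rule: infinite_finite_induct) (auto intro: H_space_add H_space_zero)

text \<open>The trigonometric fields \<open>(- \<partial>\<^sub>2 \<phi>, \<partial>\<^sub>1 \<phi>)\<close> for \<open>\<phi> = sn k\<close> and, up to sign, \<open>\<phi> = cs k\<close>.\<close>

definition Ec :: "int \<times> int \<Rightarrow> real^2 \<Rightarrow> real^2" where "Ec k x = vector [- kap 2 k * cs k x, kap 1 k * cs k x]"
definition Es :: "int \<times> int \<Rightarrow> real^2 \<Rightarrow> real^2" where "Es k x = vector [- kap 2 k * sn k x, kap 1 k * sn k x]"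

lemma E_nth [simp]: "Ec k x $ 1 = - kap 2 k * cs k x" "Ec k x $ 2 = kap 1 k * cs k x"
  "Es k x $ 1 = - kap 2 k * sn k x" "Es k x $ 2 = kap 1 k * sn k x"
  by (simp_all add: Ec_def Es_def)

lemma lv_E: "lv (Ec k)" "lv (Es k)"
  unfolding lv_def forall_2 by (auto intro!: sq_cmult[of _ _ "- kap 2 k", simplified] sq_cmult sq_minus)

lemma E_measurable: "Ec k \<in> borel_measurable borel" "Es k \<in> borel_measurable borel"
proof -
  have "Ec k = (\<lambda>x. vec2 (- kap 2 k * cs k x, kap 1 k * cs k x))" "Es k = (\<lambda>x. vec2 (- kap 2 k * sn k x, kap 1 k * sn k x))"
    by (auto simp: Ec_def Es_def vec2_def)
  then show "Ec k \<in> borel_measurable borel" "Es k \<in> borel_measurable borel" by simp_all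
qed

lemma E_in_H: assumes "k \<noteq> 0" shows "Ec k \<in> H_space L \<gamma>" "Es k \<in> H_space L \<gamma>"
proof -
  have per: "periodic L \<gamma> (Ec k)" "periodic L \<gamma> (Es k)" using periodic_cs by (auto simp: periodic_def Ec_def Es_def)
  have d: "(\<integral>x. cs k x * pd i \<phi> x \<partial>M) = kap i k * (\<integral>x. sn k x * \<phi> x \<partial>M)" "(\<integral>x. sn k x * pd i \<phi> x \<partial>M) = - kap i k * (\<integral>x. cs k x * \<phi> x \<partial>M)"
    if t: "test_function L \<gamma> \<phi>" for \<phi> i
  proof -
    have p: "periodic L \<gamma> \<phi>" using t by (simp add: test_function_def)
    have per: "periodic L \<gamma> (\<lambda>x. cs k x * \<phi> x)" "periodic L \<gamma> (\<lambda>x. sn k x * \<phi> x)"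
      using p periodic_cs by (auto simp: periodic_def)
    note c = test_pd(2)[OF t, of i] test_pd(3)[OF t]
    have "(\<integral>x. (- kap i k * sn k x) * \<phi> x + pd i \<phi> x * cs k x \<partial>M) = 0"
      by (rule int_pd_zero[OF per(1) has_pd_mult[OF has_pd_cs(1) test_pd(1)[OF t]]]) (intro continuous_intros c)
    moreover have "(\<integral>x. (kap i k * cs k x) * \<phi> x + pd i \<phi> x * sn k x \<partial>M) = 0"
      by (rule int_pd_zero[OF per(2) has_pd_mult[OF has_pd_cs(2) test_pd(1)[OF t]]]) (intro continuous_intros c)
    moreover have "integrable M (\<lambda>x. sn k x * \<phi> x)" "integrable M (\<lambda>x. cs k x * \<phi> x)" "integrable M (\<lambda>x. pd i \<phi> x * cs k x)" "integrable M (\<lambda>x. pd i \<phi> x * sn k x)"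
      by (intro continuous_integrable continuous_intros c)+
    ultimately show "(\<integral>x. cs k x * pd i \<phi> x \<partial>M) = kap i k * (\<integral>x. sn k x * \<phi> x \<partial>M)" "(\<integral>x. sn k x * pd i \<phi> x \<partial>M) = - kap i k * (\<integral>x. cs k x * \<phi> x \<partial>M)"
      by (simp_all add: mult.assoc mult.commute[of "pd i \<phi> _"])
  qed
  show "Ec k \<in> H_space L \<gamma>" "Es k \<in> H_space L \<gamma>"
    unfolding H_space_iff using per E_measurable lv_E assms by (simp_all add: int_cs int_sn mult.assoc d)
qed

lemma ip_E: assumes "lv h" shows "ip (Ec k) h = - rotB (\<lambda>x. h x $ 1) (\<lambda>x. h x $ 2) k" "ip (Es k) h = rotA (\<lambda>x. h x $ 1) (\<lambda>x. h x $ 2) k"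
  by (simp_all add: ip_eq lv_E assms rotA_def rotB_def A_def B_def mult.assoc)

lemma ip_EE: assumes "k \<noteq> 0" shows "ip (Ec k) (Ec k) + ip (Es k) (Es k) = kk k * area"
proof -
  have i: "integrable M (\<lambda>x. cs k x * cs k x)" "integrable M (\<lambda>x. sn k x * sn k x)" by (intro sq_mult_integrable cs_sq)+
  have s: "(\<integral>x. cs k x * cs k x \<partial>M) + (\<integral>x. sn k x * sn k x \<partial>M) = area" by (simp add: int_cs_cs int_sn_sn)
  have r: "(\<integral>x. (c * f x) * (c * f x) \<partial>M) = c\<^sup>2 * (\<integral>x. f x * f x \<partial>M)" for c and f :: "real^2 \<Rightarrow> real"
  proof -
    have "(c * f x) * (c * f x) = c\<^sup>2 * (f x * f x)" for x by (simp add: power2_eq_square)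
    then show ?thesis by (simp only: integral_mult_right_zero)
  qed
  have c: "ip (Ec k) (Ec k) = kk k * (\<integral>x. cs k x * cs k x \<partial>M)" "ip (Es k) (Es k) = kk k * (\<integral>x. sn k x * sn k x \<partial>M)"
    using r[of "- kap 2 k" "cs k"] r[of "- kap 2 k" "sn k"] r[of "kap 1 k" "cs k"] r[of "kap 1 k" "sn k"]
    by (simp_all only: ip_eq lv_E E_nth kk_def distrib_right power2_minus add.commute)
  show ?thesis unfolding c distrib_left[symmetric] s ..
qed

lemma energy_rot: assumes "fdiv0 w1 w2" "k \<noteq> 0"
  shows "(A w1 k)\<^sup>2 + (A w2 k)\<^sup>2 + (B w1 k)\<^sup>2 + (B w2 k)\<^sup>2 = ((rotA w1 w2 k)\<^sup>2 + (rotB w1 w2 k)\<^sup>2) / kk k"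
proof -
  note d = fdiv0D[OF assms(1)]
  have "(rotA w1 w2 k)\<^sup>2 = kk k * ((B w1 k)\<^sup>2 + (B w2 k)\<^sup>2)"
    unfolding rotA_def kk_def by (rule Lagrange_div_free[OF d(4)])
  moreover have "(rotB w1 w2 k)\<^sup>2 = kk k * ((A w1 k)\<^sup>2 + (A w2 k)\<^sup>2)"
    unfolding rotB_def kk_def using Lagrange_div_free[OF d(3)[of k]] by (simp add: power2_commute)
  ultimately show ?thesis using kk_pos[OF assms(2)] by (simp add: field_simps)
qed

subsection \<open>Stokes eigenfunctions\<close>

text \<open>Testing the eigenvalue equation with a trigonometric field multiplies its coefficient by \<open>kk k\<close> on one side and by \<open>e\<close> on
  the other.\<close>

lemma eigen_rot_zero:
  assumes "stokes_op L \<gamma> w (\<lambda>x. e *\<^sub>R w x)" "k \<noteq> 0" "kk k \<noteq> e"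
  shows "rotA (\<lambda>x. w x $ 1) (\<lambda>x. w x $ 2) k = 0" "rotB (\<lambda>x. w x $ 1) (\<lambda>x. w x $ 2) k = 0"
proof -
  have wH: "w \<in> H_space L \<gamma>" using assms(1) by (simp add: stokes_op_def)
  obtain l where l: "has_weak_laplacian L \<gamma> w l" and p: "is_leray_projection L \<gamma> (\<lambda>x. - l x) (\<lambda>x. e *\<^sub>R w x)"
    using assms(1) by (auto simp: stokes_op_def)
  have f: "flap (\<lambda>x. w x $ c) (\<lambda>x. l x $ c)" for c by (rule weak_laplacian_flap[OF l H_spaceD(2)[OF wH]])
  have ll: "lv l" "lv w" using flapD(1,2)[OF f] by (auto simp: lv_def)
  have r: "rotA (\<lambda>x. l x $ 1) (\<lambda>x. l x $ 2) k = - kk k * rotA (\<lambda>x. w x $ 1) (\<lambda>x. w x $ 2) k"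
    "rotB (\<lambda>x. l x $ 1) (\<lambda>x. l x $ 2) k = - kk k * rotB (\<lambda>x. w x $ 1) (\<lambda>x. w x $ 2) k"
    by (simp_all add: rotA_def rotB_def flapD(4,5)[OF f] algebra_simps)
  have z: "ip (\<lambda>x. (-1) *\<^sub>R l x - e *\<^sub>R w x) z = 0" if "z \<in> H_space L \<gamma>" for z
    using p that by (simp add: is_leray_projection_def)
  have "ip (\<lambda>x. (-1) *\<^sub>R l x - e *\<^sub>R w x) E = - ip E l - e * ip E w" if "lv E" for E
    using ip_diff[OF lv_scale[OF ll(1), of "-1"] lv_scale[OF ll(2), of e] that] ip_scale[OF ll(1) that, of "-1"] ip_scale[OF ll(2) that, of e]
    by (simp add: ip_commute[of E])
  from this[OF lv_E(1)[of k]] this[OF lv_E(2)[of k]] z[OF E_in_H(1)[OF assms(2)]] z[OF E_in_H(2)[OF assms(2)]]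
  have "kk k * rotA (\<lambda>x. w x $ 1) (\<lambda>x. w x $ 2) k = e * rotA (\<lambda>x. w x $ 1) (\<lambda>x. w x $ 2) k"
    "kk k * rotB (\<lambda>x. w x $ 1) (\<lambda>x. w x $ 2) k = e * rotB (\<lambda>x. w x $ 1) (\<lambda>x. w x $ 2) k"
    unfolding ip_E[OF ll(1)] ip_E[OF ll(2)] r by linarith+
  then show "rotA (\<lambda>x. w x $ 1) (\<lambda>x. w x $ 2) k = 0" "rotB (\<lambda>x. w x $ 1) (\<lambda>x. w x $ 2) k = 0" using assms(3) by auto
qed

lemma orthonormal_coef:
  assumes "\<And>j. j \<in> I \<Longrightarrow> lv (w j)" "finite I" "\<And>i j. i \<in> I \<Longrightarrow> j \<in> I \<Longrightarrow> ip (w i) (w j) = (if i = j then 1 else 0)" "i \<in> I"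
  shows "ip (\<lambda>x. \<Sum>j\<in>I. c j *\<^sub>R w j x) (w i) = c i"
proof -
  have "ip (\<lambda>x. \<Sum>j\<in>I. c j *\<^sub>R w j x) (w i) = (\<Sum>j\<in>I. ip (\<lambda>x. c j *\<^sub>R w j x) (w i))"
    by (intro ip_sum lv_scale assms)
  also have "\<dots> = (\<Sum>j\<in>I. c j * (if j = i then 1 else 0))"
    by (intro sum.cong refl) (simp add: ip_scale assms)
  also have "\<dots> = c i" using assms(2,4) by (simp add: if_distrib cong: if_cong)
  finally show ?thesis .
qed

lemma Bessel_orthonormal:
  assumes "\<And>j. j \<in> I \<Longrightarrow> lv (w j)" "finite I" "\<And>i j. i \<in> I \<Longrightarrow> j \<in> I \<Longrightarrow> ip (w i) (w j) = (if i = j then 1 else 0)" "lv h"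
  shows "(\<Sum>j\<in>I. (ip h (w j))\<^sup>2) \<le> ip h h"
proof -
  define q where "q x = (\<Sum>j\<in>I. ip h (w j) *\<^sub>R w j x)" for x
  have lq: "lv q" unfolding q_def[abs_def] by (intro lv_sum lv_scale assms)
  have c: "ip q (w i) = ip h (w i)" if "i \<in> I" for i unfolding q_def[abs_def] by (rule orthonormal_coef[OF assms(1-3) that])
  have qg: "ip q g = (\<Sum>j\<in>I. ip h (w j) * ip (w j) g)" if "lv g" for g
  proof -
    have "ip q g = (\<Sum>j\<in>I. ip (\<lambda>x. ip h (w j) *\<^sub>R w j x) g)" unfolding q_def[abs_def] by (intro ip_sum lv_scale assms that)
    then show ?thesis using that by (simp add: ip_scale assms)
  qed
  have qh: "ip q h = (\<Sum>j\<in>I. (ip h (w j))\<^sup>2)" using qg[OF assms(4)] by (simp add: power2_eq_square ip_commute)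
  have qq: "ip q q = (\<Sum>j\<in>I. (ip h (w j))\<^sup>2)"
    using qg[OF lq] c by (simp add: power2_eq_square ip_commute[of "w _" q])
  have "0 \<le> (L2_norm L \<gamma> (\<lambda>x. h x - q x))\<^sup>2" by simp
  also have "\<dots> = ip (\<lambda>x. h x - q x) (\<lambda>x. h x - q x)" by (rule L2_norm_ip[OF lv_diff[OF assms(4) lq]])
  also have "\<dots> = ip h h - ip q h - (ip q h - ip q q)"
    using ip_diff[OF assms(4) lq lv_diff[OF assms(4) lq]] ip_diff[OF assms(4) lq assms(4)] ip_diff[OF assms(4) lq lq]
      ip_commute[of h "\<lambda>x. h x - q x"] ip_commute[of q "\<lambda>x. h x - q x"] ip_commute[of h q] by linarith
  finally show ?thesis using qh qq by linarith
qed

lemma kk_scaled: "kk k = (2 * pi / L)\<^sup>2 * ((\<gamma> * of_int (fst k))\<^sup>2 + (of_int (snd k))\<^sup>2)"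
  by (simp add: kk_def kap_def power_mult_distrib power_divide distrib_left)

lemma abs_le_floor: "\<bar>real_of_int i\<bar> \<le> x \<Longrightarrow> i \<in> {- \<lfloor>x\<rfloor>..\<lfloor>x\<rfloor>}"
  by (auto simp: le_floor_iff abs_le_iff) linarith

text \<open>The wave vectors in question lie in a rectangle of half-sides \<open>R / \<gamma>\<close> and \<open>R\<close> in \<open>\<int>\<^sup>2\<close>.  The terms linear in \<open>R\<close> of
  its number of points are absorbed by the quadratic one with \<open>4 R \<le> 4 R\<^sup>2 + 1\<close> and its constant into \<open>2 / \<gamma>\<close>.\<close>

lemma count_modes:
  assumes "\<gamma> \<le> 1" "0 \<le> \<Lambda>"
  shows "finite {k. k \<noteq> 0 \<and> kk k \<le> \<Lambda>}" "real (card {k. k \<noteq> 0 \<and> kk k \<le> \<Lambda>}) \<le> 2 / \<gamma> + 2 / pi\<^sup>2 * (\<Lambda> * area)"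
proof -
  define R where "R = L * sqrt \<Lambda> / (2 * pi)"
  have R0: "0 \<le> R" using L0 assms by (simp add: R_def)
  have R2: "\<Lambda> = (2 * pi / L)\<^sup>2 * R\<^sup>2" using L0 assms by (simp add: R_def power_mult_distrib power_divide)
  let ?S = "{k. k \<noteq> 0 \<and> kk k \<le> \<Lambda>}"
  let ?B = "{- \<lfloor>R / \<gamma>\<rfloor>..\<lfloor>R / \<gamma>\<rfloor>} \<times> {- \<lfloor>R\<rfloor>..\<lfloor>R\<rfloor>} :: (int \<times> int) set"
  have sub: "?S \<subseteq> ?B - {0}"
  proof
    fix k assume k: "k \<in> ?S"
    have "(2 * pi / L)\<^sup>2 * ((\<gamma> * of_int (fst k))\<^sup>2 + (of_int (snd k))\<^sup>2) \<le> (2 * pi / L)\<^sup>2 * R\<^sup>2"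
      using k R2 kk_scaled[of k] by simp
    then have le: "(\<gamma> * of_int (fst k))\<^sup>2 + (of_int (snd k))\<^sup>2 \<le> R\<^sup>2" using L0 by simp
    have "(\<gamma> * of_int (fst k))\<^sup>2 \<le> R\<^sup>2" "(real_of_int (snd k))\<^sup>2 \<le> R\<^sup>2"
      using le zero_le_power2[of "\<gamma> * of_int (fst k)"] zero_le_power2[of "real_of_int (snd k)"] by linarith+
    then have "\<bar>\<gamma> * of_int (fst k)\<bar> \<le> R" "\<bar>real_of_int (snd k)\<bar> \<le> R"
      using R0 abs_le_square_iff[of "\<gamma> * of_int (fst k)" R] abs_le_square_iff[of "real_of_int (snd k)" R] by auto
    moreover then have "\<bar>real_of_int (fst k)\<bar> \<le> R / \<gamma>" using g0 by (simp add: abs_mult field_simps)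
    ultimately have "fst k \<in> {- \<lfloor>R / \<gamma>\<rfloor>..\<lfloor>R / \<gamma>\<rfloor>}" "snd k \<in> {- \<lfloor>R\<rfloor>..\<lfloor>R\<rfloor>}" by (blast intro: abs_le_floor)+
    then show "k \<in> ?B - {0}" using k by (simp add: mem_Times_iff)
  qed
  have fB: "finite ?B" by simp
  show "finite ?S" by (rule finite_subset[OF sub]) simp
  have fl: "0 \<le> \<lfloor>R / \<gamma>\<rfloor>" "0 \<le> \<lfloor>R\<rfloor>" using R0 g0 by auto
  have "card ?S \<le> card (?B - {0})" by (rule card_mono[OF _ sub]) simp
  also have "card (?B - {0}) = card ?B - 1" using fl by (subst card_Diff_singleton) (auto simp: zero_prod_def)
  finally have "real (card ?S) \<le> real (card ?B) - 1"
  proof -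
    assume a: "card ?S \<le> card ?B - 1"
    have "0 \<in> ?B" using fl by (auto simp: zero_prod_def)
    then have "1 \<le> card ?B" using fB by (metis One_nat_def Suc_leI card_gt_0_iff empty_iff)
    then show ?thesis using a by linarith
  qed
  also have "real (card ?B) = (2 * of_int \<lfloor>R / \<gamma>\<rfloor> + 1) * (2 * of_int \<lfloor>R\<rfloor> + 1)"
    using fl by (simp add: card_cartesian_product)
  also have "\<dots> \<le> (2 * (R / \<gamma>) + 1) * (2 * R + 1)"
    using fl by (intro mult_mono add_right_mono mult_left_mono) auto
  finally have "real (card ?S) \<le> (2 * (R / \<gamma>) + 1) * (2 * R + 1) - 1" by simp
  also have "\<dots> = 4 * R\<^sup>2 / \<gamma> + 2 * R / \<gamma> + 2 * R" by (simp add: power2_eq_square algebra_simps add_divide_distrib)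
  also have "\<dots> \<le> 4 * R\<^sup>2 / \<gamma> + 2 * R / \<gamma> + 2 * R / \<gamma>"
  proof -
    have "2 * R * \<gamma> \<le> 2 * R * 1" using assms R0 by (intro mult_left_mono) auto
    then have "2 * R \<le> 2 * R / \<gamma>" using g0 by (simp add: field_simps)
    then show ?thesis by simp
  qed
  also have "\<dots> = (4 * R\<^sup>2 + 4 * R) / \<gamma>" by (simp add: add_divide_distrib)
  also have "\<dots> \<le> (8 * R\<^sup>2 + 2) / \<gamma>"
  proof (rule divide_right_mono)
    have "0 \<le> (2 * R - 1)\<^sup>2" by simp
    then show "4 * R\<^sup>2 + 4 * R \<le> 8 * R\<^sup>2 + 2" by (simp add: power2_eq_square algebra_simps)
  qed (use g0 in simp)
  also have "\<dots> = 2 / \<gamma> + 2 / pi\<^sup>2 * (\<Lambda> * area)"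
    unfolding R2 area_def using L0 by (simp add: power_mult_distrib power_divide add_divide_distrib)
  finally show "real (card ?S) \<le> 2 / \<gamma> + 2 / pi\<^sup>2 * (\<Lambda> * area)" .
qed

context
  fixes ev :: "nat \<Rightarrow> real" and w :: "nat \<Rightarrow> real^2 \<Rightarrow> real^2"
  assumes es: "stokes_eigensystem L \<gamma> ev w"
begin

lemma es_op: "1 \<le> j \<Longrightarrow> stokes_op L \<gamma> (w j) (\<lambda>x. ev j *\<^sub>R w j x)" using es by (simp add: stokes_eigensystem_def)
lemma es_mono: "1 \<le> i \<Longrightarrow> i \<le> j \<Longrightarrow> ev i \<le> ev j" using es by (simp add: stokes_eigensystem_def)
lemma es_orth: "1 \<le> i \<Longrightarrow> 1 \<le> j \<Longrightarrow> ip (w i) (w j) = (if i = j then 1 else 0)" using es by (simp add: stokes_eigensystem_def)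
lemma es_complete: "h \<in> H_space L \<gamma> \<Longrightarrow> (\<And>j. 1 \<le> j \<Longrightarrow> ip h (w j) = 0) \<Longrightarrow> L2_norm L \<gamma> h = 0" using es by (simp add: stokes_eigensystem_def)
lemma es_H: "1 \<le> j \<Longrightarrow> w j \<in> H_space L \<gamma>" using es_op by (simp add: stokes_op_def)
lemma es_lv: "1 \<le> j \<Longrightarrow> lv (w j)" by (rule H_space_lv[OF es_H])

abbreviation rA where "rA j k \<equiv> rotA (\<lambda>x. w j x $ 1) (\<lambda>x. w j x $ 2) k"
abbreviation rB where "rB j k \<equiv> rotB (\<lambda>x. w j x $ 1) (\<lambda>x. w j x $ 2) k"

text \<open>Only modes with \<open>kk k\<close> equal to the eigenvalue contribute to an eigenfunction.\<close>

lemma eigen_energy: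
  assumes j: "1 \<le> j" and S: "finite S" "{k. k \<noteq> 0 \<and> kk k = ev j} \<subseteq> S" "0 \<notin> S"
  shows "1 = (\<Sum>k\<in>S. ((rA j k)\<^sup>2 + (rB j k)\<^sup>2) / kk k) / area"
proof -
  note H = es_H[OF j] and z = eigen_rot_zero[OF es_op[OF j]]
  have d: "fdiv0 (\<lambda>x. w j x $ 1) (\<lambda>x. w j x $ 2)" by (rule H_spaceD(3)[OF H])
  note s = fdiv0D(1,2)[OF d]
  let ?e = "\<lambda>k. (A (\<lambda>x. w j x $ 1) k)\<^sup>2 + (A (\<lambda>x. w j x $ 2) k)\<^sup>2 + (B (\<lambda>x. w j x $ 1) k)\<^sup>2 + (B (\<lambda>x. w j x $ 2) k)\<^sup>2"
  obtain m where m: "S \<subseteq> K m" using finite_subset_K[OF S(1)] by blast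
  have b: "bil n (\<lambda>x. w j x $ 1) (\<lambda>x. w j x $ 1) + bil n (\<lambda>x. w j x $ 2) (\<lambda>x. w j x $ 2) = (\<Sum>k\<in>S. ((rA j k)\<^sup>2 + (rB j k)\<^sup>2) / kk k) / area"
    if "m \<le> n" for n
  proof -
    have "bil n (\<lambda>x. w j x $ 1) (\<lambda>x. w j x $ 1) + bil n (\<lambda>x. w j x $ 2) (\<lambda>x. w j x $ 2) = (\<Sum>k\<in>K n. ?e k) / area"
      unfolding bil_def add_divide_distrib[symmetric] sum.distrib[symmetric]
      by (intro arg_cong[where f = "\<lambda>z. z / area"] sum.cong) (auto simp: power2_eq_square)
    also have "(\<Sum>k\<in>K n. ?e k) = (\<Sum>k\<in>S. ?e k)"
    proof (rule sum.mono_neutral_right)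
      show "S \<subseteq> K n" using m K_mono[OF that] by blast
      show "\<forall>k\<in>K n - S. ?e k = 0"
      proof
        fix k assume k: "k \<in> K n - S"
        show "?e k = 0"
        proof (cases "k = 0")
          case True then show ?thesis using H_spaceD(2)[OF H] by simp
        next
          case False
          then have "kk k \<noteq> ev j" using k S(2) by blast
          then show ?thesis unfolding energy_rot[OF d False] using z[OF False] by simp
        qed
      qed
    qed simp
    also have "\<dots> = (\<Sum>k\<in>S. ((rA j k)\<^sup>2 + (rB j k)\<^sup>2) / kk k)"
      by (rule sum.cong[OF refl energy_rot[OF d]]) (use S(3) in auto)
    finally show ?thesis .
  qed
  have "(\<lambda>n. bil n (\<lambda>x. w j x $ 1) (\<lambda>x. w j x $ 1) + bil n (\<lambda>x. w j x $ 2) (\<lambda>x. w j x $ 2)) \<longlonglongrightarrow> (nrm M (\<lambda>x. w j x $ 1))\<^sup>2 + (nrm M (\<lambda>x. w j x $ 2))\<^sup>2"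
    by (intro tendsto_add Parseval_nrm s)
  moreover have "(\<lambda>n. bil n (\<lambda>x. w j x $ 1) (\<lambda>x. w j x $ 1) + bil n (\<lambda>x. w j x $ 2) (\<lambda>x. w j x $ 2)) \<longlonglongrightarrow> (\<Sum>k\<in>S. ((rA j k)\<^sup>2 + (rB j k)\<^sup>2) / kk k) / area"
    by (rule tendsto_eventually, rule eventually_sequentiallyI[of m], rule b)
  ultimately have "(nrm M (\<lambda>x. w j x $ 1))\<^sup>2 + (nrm M (\<lambda>x. w j x $ 2))\<^sup>2 = (\<Sum>k\<in>S. ((rA j k)\<^sup>2 + (rB j k)\<^sup>2) / kk k) / area"
    by (rule LIMSEQ_unique)
  moreover have "(nrm M (\<lambda>x. w j x $ 1))\<^sup>2 + (nrm M (\<lambda>x. w j x $ 2))\<^sup>2 = ip (w j) (w j)"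
    by (simp add: ip_eq es_lv[OF j] nrm_power2) (simp add: power2_eq_square)
  ultimately show ?thesis using es_orth[OF j j] by simp
qed

lemma eigenvalue_pos: assumes "1 \<le> j" shows "0 < ev j"
proof (rule ccontr)
  assume "\<not> 0 < ev j"
  then have "{k. k \<noteq> 0 \<and> kk k = ev j} \<subseteq> {}" using kk_pos by force
  from eigen_energy[OF assms _ this] show False by simp
qed

text \<open>The first \<open>n + 1\<close> eigenfunctions are orthonormal in the span of the trigonometric fields with \<open>kk k\<close> at most the
  last eigenvalue, so there are at least \<open>n + 1\<close> of those fields.  The dimension count takes the form of a double sum,
  estimated by Bessel's inequality in the other order.\<close>

lemma eigenvalue_lower:
  assumes "\<gamma> \<le> 1" shows "real n + 1 \<le> 2 / \<gamma> + 2 / pi\<^sup>2 * (ev (n + 1) * area)"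
proof -
  define \<Lambda> where "\<Lambda> = ev (n + 1)"
  have L0': "0 \<le> \<Lambda>" using eigenvalue_pos[of "n + 1"] by (simp add: \<Lambda>_def)
  define S where "S = {k. k \<noteq> 0 \<and> kk k \<le> \<Lambda>}"
  note cnt = count_modes[OF assms L0', folded S_def]
  have S0: "0 \<notin> S" by (simp add: S_def)
  let ?I = "{1..n+1}"
  have one: "1 = (\<Sum>k\<in>S. ((rA j k)\<^sup>2 + (rB j k)\<^sup>2) / kk k) / area" if j: "j \<in> ?I" for j
    by (rule eigen_energy[OF _ cnt(1) _ S0]) (use j es_mono[of j "n + 1"] in \<open>auto simp: S_def \<Lambda>_def\<close>)
  have "real n + 1 = (\<Sum>j\<in>?I. 1)" by simp
  also have "\<dots> = (\<Sum>j\<in>?I. (\<Sum>k\<in>S. ((rA j k)\<^sup>2 + (rB j k)\<^sup>2) / kk k) / area)" by (rule sum.cong[OF refl one])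
  also have "\<dots> = (\<Sum>k\<in>S. (\<Sum>j\<in>?I. (rA j k)\<^sup>2 + (rB j k)\<^sup>2) / kk k) / area"
    unfolding sum_divide_distrib by (rule sum.swap)
  also have "\<dots> \<le> (\<Sum>k\<in>S. area) / area"
  proof (intro divide_right_mono sum_mono)
    fix k assume k: "k \<in> S"
    then have k0: "k \<noteq> 0" by (simp add: S_def)
    have "(\<Sum>j\<in>?I. (ip (Ec k) (w j))\<^sup>2) \<le> ip (Ec k) (Ec k)" "(\<Sum>j\<in>?I. (ip (Es k) (w j))\<^sup>2) \<le> ip (Es k) (Es k)"
      by (rule Bessel_orthonormal; auto intro: es_lv lv_E simp: es_orth)+
    then have "(\<Sum>j\<in>?I. (rB j k)\<^sup>2) + (\<Sum>j\<in>?I. (rA j k)\<^sup>2) \<le> kk k * area"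
      using ip_EE[OF k0] by (simp add: ip_E es_lv)
    then show "(\<Sum>j\<in>?I. (rA j k)\<^sup>2 + (rB j k)\<^sup>2) / kk k \<le> area"
      using kk_pos[OF k0] by (simp add: sum.distrib field_simps)
  qed (use area_pos in simp)
  also have "\<dots> = real (card S)" using area_pos by simp
  finally show ?thesis using cnt(2) by (simp add: \<Lambda>_def)
qed

text \<open>A trigonometric field with \<open>kk k\<close> below the eigenvalue of number \<open>n + 1\<close> is orthogonal to all later eigenfunctions;
  by completeness it lies in the span of the first \<open>n\<close>.\<close>

lemma E_expand:
  assumes "k \<noteq> 0" "kk k < ev (n + 1)" "E = Ec k \<or> E = Es k" "lv h"
  shows "ip E h = (\<Sum>j=1..n. ip E (w j) * ip (w j) h)"
proof -
  have EH: "E \<in> H_space L \<gamma>" using assms(3) E_in_H[OF assms(1)] by auto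
  define q where "q x = (\<Sum>j=1..n. ip E (w j) *\<^sub>R w j x)" for x
  have qH: "q \<in> H_space L \<gamma>" unfolding q_def[abs_def] by (intro H_space_sum H_space_scale es_H) auto
  note l = H_space_lv[OF EH] H_space_lv[OF qH]
  have qg: "ip q g = (\<Sum>j=1..n. ip E (w j) * ip (w j) g)" if "lv g" for g
  proof -
    have "ip q g = (\<Sum>j=1..n. ip (\<lambda>x. ip E (w j) *\<^sub>R w j x) g)" unfolding q_def[abs_def] by (intro ip_sum lv_scale es_lv that) auto
    then show ?thesis using that by (simp add: ip_scale es_lv)
  qed
  have "L2_norm L \<gamma> (\<lambda>x. E x - q x) = 0"
  proof (rule es_complete[OF H_space_diff[OF EH qH]])
    fix i :: nat assume i: "1 \<le> i"
    have "ip q (w i) = ip E (w i)"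
    proof (cases "i \<le> n")
      case True
      then show ?thesis unfolding q_def[abs_def]
        by (intro orthonormal_coef) (use i in \<open>auto intro: es_lv simp: es_orth\<close>)
    next
      case False
      have "ev (n + 1) \<le> ev i" using False by (intro es_mono) auto
      then have "kk k \<noteq> ev i" using assms(2) by simp
      then have "ip E (w i) = 0" using assms(3) eigen_rot_zero[OF es_op[OF i] assms(1)] by (auto simp: ip_E es_lv[OF i])
      moreover have "ip q (w i) = 0" unfolding qg[OF es_lv[OF i]] using False i by (intro sum.neutral) (auto simp: es_orth)
      ultimately show ?thesis by simp
    qed
    then show "ip (\<lambda>x. E x - q x) (w i) = 0" using ip_diff[OF l es_lv[OF i]] by simp
  qed
  then have "ip (\<lambda>x. E x - q x) h = 0" by (rule ip_null[OF lv_diff[OF l] assms(4)])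
  then show ?thesis using ip_diff[OF l assms(4)] qg[OF assms(4)] by simp
qed

lemma modes_proj_eq: assumes "lv h"
  shows "modes_proj L \<gamma> w n h = (\<lambda>x. \<Sum>j=1..n. ip h (w j) *\<^sub>R w j x)"
  unfolding modes_proj_def
proof (rule the_equality)
  have oc: "ip (\<lambda>x. \<Sum>j=1..n. c j *\<^sub>R w j x) (w i) = c i" if "i \<in> {1..n}" for c i
    by (rule orthonormal_coef) (use that in \<open>auto intro: es_lv simp: es_orth\<close>)
  have lq: "lv (\<lambda>x. \<Sum>j=1..n. c j *\<^sub>R w j x)" for c by (intro lv_sum lv_scale es_lv) auto
  have r: "ip (\<lambda>x. h x - (\<Sum>j=1..n. c j *\<^sub>R w j x)) (w i) = ip h (w i) - c i" if "i \<in> {1..n}" for c i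
    using ip_diff[OF assms lq es_lv, of i c] oc[OF that, of c] that by simp
  show "(\<exists>c. (\<lambda>x. \<Sum>j=1..n. ip h (w j) *\<^sub>R w j x) = (\<lambda>x. \<Sum>j=1..n. c j *\<^sub>R w j x)) \<and>
      (\<forall>j\<in>{1..n}. ip (\<lambda>x. h x - (\<Sum>j=1..n. ip h (w j) *\<^sub>R w j x)) (w j) = 0)"
    using r by auto
  fix q assume q: "(\<exists>c. q = (\<lambda>x. \<Sum>j=1..n. c j *\<^sub>R w j x)) \<and> (\<forall>j\<in>{1..n}. ip (\<lambda>x. h x - q x) (w j) = 0)"
  then obtain c where c: "q = (\<lambda>x. \<Sum>j=1..n. c j *\<^sub>R w j x)" by blast
  have "c i = ip h (w i)" if "i \<in> {1..n}" for i using q that r[OF that, of c] unfolding c by simp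
  then show "q = (\<lambda>x. \<Sum>j=1..n. ip h (w j) *\<^sub>R w j x)" unfolding c by (intro ext sum.cong) auto
qed

lemma coef_le_modes_proj: assumes "lv h" "i \<in> {1..n}" shows "\<bar>ip (w i) h\<bar> \<le> L2_norm L \<gamma> (modes_proj L \<gamma> w n h)"
proof -
  let ?q = "\<lambda>x. \<Sum>j=1..n. ip h (w j) *\<^sub>R w j x"
  have lq: "lv ?q" by (intro lv_sum lv_scale es_lv) auto
  have oc: "ip ?q (w i) = ip h (w i)"
    by (rule orthonormal_coef) (use assms(2) in \<open>auto intro: es_lv simp: es_orth\<close>)
  have "(\<Sum>j\<in>{i}. (ip ?q (w j))\<^sup>2) \<le> ip ?q ?q"
    by (rule Bessel_orthonormal) (use assms(2) lq in \<open>auto intro: es_lv simp: es_orth\<close>)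
  then have "(ip (w i) h)\<^sup>2 \<le> (L2_norm L \<gamma> ?q)\<^sup>2" unfolding L2_norm_ip[OF lq] using oc by (simp add: ip_commute[of "w i" h])
  moreover have "0 \<le> L2_norm L \<gamma> ?q" unfolding L2_norm_def LINT_Omega by simp
  ultimately show ?thesis unfolding modes_proj_eq[OF assms(1)] using abs_le_square_iff[of "ip (w i) h" "L2_norm L \<gamma> ?q"] by simp
qed

text \<open>With \<open>\<Lambda>\<close> the eigenvalue of number \<open>n + 1\<close>, the coefficients of \<open>w\<close> with \<open>kk k < \<Lambda>\<close> are finitely many and
  tend to zero with the projection, while the others are at most \<open>1 / \<Lambda>\<close> times those of \<open>\<Delta>w\<close>.\<close>

lemma modes_determining:
  assumes \<gamma>1: "\<gamma> \<le> 1" and \<nu>: "0 < \<nu>" and \<mu>: "0 < \<mu>" and n: "real n + 1 > 2 / \<gamma> + 2 / pi\<^sup>2 * (F * area / (\<mu> * \<nu>))"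
  shows "determining_modes L \<gamma> \<nu> \<mu> F w n"
  unfolding determining_modes_def
proof (intro allI impI)
  fix u v assume sp: "solution_pair L \<gamma> \<nu> \<mu> F u v"
    and pr: "((\<lambda>t. L2_norm L \<gamma> (modes_proj L \<gamma> w n (\<lambda>x. u t x - v t x))) \<longlongrightarrow> 0) at_top"
  define \<Lambda> where "\<Lambda> = ev (n + 1)"
  have \<Lambda>0: "0 < \<Lambda>" unfolding \<Lambda>_def by (rule eigenvalue_pos) simp
  have "2 / pi\<^sup>2 * (F * area / (\<mu> * \<nu>)) < 2 / pi\<^sup>2 * (\<Lambda> * area)"
    using n eigenvalue_lower[OF \<gamma>1, of n] unfolding \<Lambda>_def by linarith
  then have "F * area / (\<mu> * \<nu>) < \<Lambda> * area" by (rule mult_left_less_imp_less) simp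
  then have "F / (\<mu> * \<nu>) * area < \<Lambda> * area" by simp
  then have FL: "F / (\<mu> * \<nu>) < \<Lambda>" using area_pos by (simp only: mult_less_cancel_right_pos)
  have c: "(1 / \<Lambda>) * (max F 0 / \<mu>) < \<nu>"
  proof (cases "0 \<le> F")
    case True
    then show ?thesis using FL \<mu> \<nu> \<Lambda>0 by (simp add: max_def field_simps)
  qed (use \<nu> in simp)
  define S where "S = {k. k \<noteq> 0 \<and> kk k < \<Lambda>}"
  have finS: "finite S" by (rule finite_subset[OF _ count_modes(1)[OF \<gamma>1 less_imp_le[OF \<Lambda>0]]]) (auto simp: S_def)
  let ?w = "\<lambda>i t x. u t x $ i - v t x $ i"
  define q where "q t = (\<Sum>k\<in>S. ((rotA (?w 1 t) (?w 2 t) k)\<^sup>2 + (rotB (?w 1 t) (?w 2 t) k)\<^sup>2) / kk k) / area" for t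
  have lim1: "((\<lambda>t. rotA (?w 1 t) (?w 2 t) k) \<longlongrightarrow> 0) at_top" "((\<lambda>t. rotB (?w 1 t) (?w 2 t) k) \<longlongrightarrow> 0) at_top"
    if H: "\<forall>t\<ge>0. u t \<in> H_space L \<gamma> \<and> v t \<in> H_space L \<gamma>" and k: "k \<in> S" for k
  proof -
    have kS: "k \<noteq> 0" "kk k < ev (n + 1)" using k by (auto simp: S_def \<Lambda>_def)
    have l: "lv (\<lambda>x. u t x - v t x)" if "0 \<le> t" for t using H that by (intro lv_diff H_space_lv) auto
    have E0: "((\<lambda>t. ip E (\<lambda>x. u t x - v t x)) \<longlongrightarrow> 0) at_top" if E: "E = Ec k \<or> E = Es k" for E
    proof (rule Lim_null_comparison)
      show "\<forall>\<^sub>F t in at_top. norm (ip E (\<lambda>x. u t x - v t x)) \<le> (\<Sum>j=1..n. \<bar>ip E (w j)\<bar> * L2_norm L \<gamma> (modes_proj L \<gamma> w n (\<lambda>x. u t x - v t x)))"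
        using eventually_ge_at_top[of 0]
      proof eventually_elim
        case (elim t)
        show ?case unfolding E_expand[OF kS E l[OF elim]] real_norm_def
          by (intro order_trans[OF sum_abs] sum_mono) (auto simp: abs_mult intro!: mult_left_mono coef_le_modes_proj l elim)
      qed
      have "((\<lambda>t. \<Sum>j=1..n. \<bar>ip E (w j)\<bar> * L2_norm L \<gamma> (modes_proj L \<gamma> w n (\<lambda>x. u t x - v t x))) \<longlongrightarrow> (\<Sum>j=1..n. \<bar>ip E (w j)\<bar> * 0)) at_top"
        by (intro tendsto_intros pr)
      then show "((\<lambda>t. \<Sum>j=1..n. \<bar>ip E (w j)\<bar> * L2_norm L \<gamma> (modes_proj L \<gamma> w n (\<lambda>x. u t x - v t x))) \<longlongrightarrow> 0) at_top" by simp
    qed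
    have ev1: "\<forall>\<^sub>F t in at_top. ip (Es k) (\<lambda>x. u t x - v t x) = rotA (?w 1 t) (?w 2 t) k"
      "\<forall>\<^sub>F t in at_top. - ip (Ec k) (\<lambda>x. u t x - v t x) = rotB (?w 1 t) (?w 2 t) k"
      using eventually_ge_at_top[of 0] by (eventually_elim, simp add: ip_E l)+
    show "((\<lambda>t. rotA (?w 1 t) (?w 2 t) k) \<longlongrightarrow> 0) at_top" using Lim_transform_eventually[OF E0 ev1(1)] by simp
    have "((\<lambda>t. - ip (Ec k) (\<lambda>x. u t x - v t x)) \<longlongrightarrow> - 0) at_top" by (intro tendsto_minus E0) simp
    then show "((\<lambda>t. rotB (?w 1 t) (?w 2 t) k) \<longlongrightarrow> 0) at_top" using Lim_transform_eventually[OF _ ev1(2)] by simp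
  qed
  have H: "\<forall>t\<ge>0. u t \<in> H_space L \<gamma> \<and> v t \<in> H_space L \<gamma>"
    using sp unfolding solution_pair_def ns_solution_def by blast
  have q0: "((\<lambda>t. sqrt (q t)) \<longlongrightarrow> 0) at_top"
  proof -
    have "(q \<longlongrightarrow> (\<Sum>k\<in>S. (0\<^sup>2 + 0\<^sup>2) / kk k) / area) at_top"
      unfolding q_def[abs_def] by (intro tendsto_intros lim1[OF H]) (use area_pos kk_pos in \<open>force simp: S_def\<close>)+
    then show ?thesis using tendsto_real_sqrt by fastforce
  qed
  show "((\<lambda>t. L2_norm L \<gamma> (\<lambda>x. u t x - v t x)) \<longlongrightarrow> 0) at_top"
  proof (rule determining_criterion[OF sp \<nu> \<mu> _ c q0])
    show "0 \<le> 1 / \<Lambda>" using \<Lambda>0 by simp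
    show "\<forall>\<^sub>F t in at_top. \<forall>k1 k2. flap (?w 1 t) k1 \<longrightarrow> flap (?w 2 t) k2 \<longrightarrow>
        sqrt ((nrm M (?w 1 t))\<^sup>2 + (nrm M (?w 2 t))\<^sup>2) \<le> 1 / \<Lambda> * sqrt ((nrm M k1)\<^sup>2 + (nrm M k2)\<^sup>2) + sqrt (q t)"
      using eventually_ge_at_top[of 0]
    proof eventually_elim
      case (elim t)
      have d: "fdiv0 (?w 1 t) (?w 2 t)" using H elim by (intro fdiv0_diff H_spaceD(3)) auto
      note s = fdiv0D(1,2)[OF d]
      obtain m0 where m0: "S \<subseteq> K m0" using finite_subset_K[OF finS] by blast
      show ?case
      proof (intro allI impI)
        fix k1 k2 assume f: "flap (?w 1 t) k1" "flap (?w 2 t) k2"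
        let ?e = "\<lambda>k. (A (?w 1 t) k)\<^sup>2 + (A (?w 2 t) k)\<^sup>2 + (B (?w 1 t) k)\<^sup>2 + (B (?w 2 t) k)\<^sup>2"
        let ?g = "\<lambda>k. (A k1 k)\<^sup>2 + (A k2 k)\<^sup>2 + (B k1 k)\<^sup>2 + (B k2 k)\<^sup>2"
        have be: "bil n' a a + bil n' b b = (\<Sum>k\<in>K n'. (A a k)\<^sup>2 + (A b k)\<^sup>2 + (B a k)\<^sup>2 + (B b k)\<^sup>2) / area" for n' a b
          unfolding bil_def add_divide_distrib[symmetric] sum.distrib[symmetric]
          by (intro arg_cong[where f = "\<lambda>z. z / area"] sum.cong) (auto simp: power2_eq_square)
        have g: "?g k = (kk k)\<^sup>2 * ?e k" for k
          by (simp add: flapD(4,5)[OF f(1)] flapD(4,5)[OF f(2)] power_mult_distrib distrib_left)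
        have step: "bil n' (?w 1 t) (?w 1 t) + bil n' (?w 2 t) (?w 2 t) \<le> q t + (1 / \<Lambda>\<^sup>2) * (bil n' k1 k1 + bil n' k2 k2)" if "m0 \<le> n'" for n'
        proof -
          have sub: "S \<subseteq> K n'" using m0 K_mono[OF that] by blast
          have e1: "(\<Sum>k\<in>K n'. ?e k) = (\<Sum>k\<in>S. ?e k) + (\<Sum>k\<in>K n' - S. ?e k)" using sum.subset_diff[OF sub, of ?e] by simp
          have e2: "(\<Sum>k\<in>S. ?e k) = q t * area"
            unfolding q_def using area_pos by (simp add: S_def) (rule sum.cong[OF refl energy_rot[OF d]], simp)
          have e3: "(\<Sum>k\<in>K n' - S. ?e k) \<le> (\<Sum>k\<in>K n' - S. (1 / \<Lambda>\<^sup>2) * ?g k)"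
          proof (rule sum_mono)
            fix k assume k: "k \<in> K n' - S"
            show "?e k \<le> (1 / \<Lambda>\<^sup>2) * ?g k"
            proof (cases "k = 0")
              case True then show ?thesis using flapD(3)[OF f(1)] flapD(3)[OF f(2)] by simp
            next
              case False
              then have "\<Lambda> \<le> kk k" using k by (simp add: S_def)
              then have "\<Lambda>\<^sup>2 \<le> (kk k)\<^sup>2" using \<Lambda>0 by (intro power_mono) auto
              then have "\<Lambda>\<^sup>2 * ?e k \<le> (kk k)\<^sup>2 * ?e k" by (intro mult_right_mono) auto
              then show ?thesis unfolding g using \<Lambda>0 by (simp add: field_simps)
            qed
          qed
          have e4: "(\<Sum>k\<in>K n' - S. (1 / \<Lambda>\<^sup>2) * ?g k) \<le> (\<Sum>k\<in>K n'. (1 / \<Lambda>\<^sup>2) * ?g k)"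
          proof (rule sum_mono2)
            show "0 \<le> (1 / \<Lambda>\<^sup>2) * ?g k" for k by simp
          qed (simp, blast)
          have "(\<Sum>k\<in>K n'. ?e k) \<le> q t * area + (1 / \<Lambda>\<^sup>2) * (\<Sum>k\<in>K n'. ?g k)"
            using e1 e2 e3 e4 unfolding sum_distrib_left by linarith
          then have "(\<Sum>k\<in>K n'. ?e k) / area \<le> (q t * area + (1 / \<Lambda>\<^sup>2) * (\<Sum>k\<in>K n'. ?g k)) / area"
            using area_pos by (intro divide_right_mono) auto
          then show ?thesis unfolding be using area_pos by (simp add: add_divide_distrib)
        qed
        have "(nrm M (?w 1 t))\<^sup>2 + (nrm M (?w 2 t))\<^sup>2 \<le> q t + (1 / \<Lambda>\<^sup>2) * ((nrm M k1)\<^sup>2 + (nrm M k2)\<^sup>2)"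
        proof (rule LIMSEQ_le)
          show "(\<lambda>n. bil n (?w 1 t) (?w 1 t) + bil n (?w 2 t) (?w 2 t)) \<longlonglongrightarrow> (nrm M (?w 1 t))\<^sup>2 + (nrm M (?w 2 t))\<^sup>2"
            by (intro tendsto_add Parseval_nrm s)
          show "(\<lambda>n. q t + (1 / \<Lambda>\<^sup>2) * (bil n k1 k1 + bil n k2 k2)) \<longlonglongrightarrow> q t + (1 / \<Lambda>\<^sup>2) * ((nrm M k1)\<^sup>2 + (nrm M k2)\<^sup>2)"
            by (intro tendsto_intros Parseval_nrm flapD(2)[OF f(1)] flapD(2)[OF f(2)])
        qed (use step in blast)
        then have "sqrt ((nrm M (?w 1 t))\<^sup>2 + (nrm M (?w 2 t))\<^sup>2) \<le> sqrt (q t + (1 / \<Lambda>\<^sup>2) * ((nrm M k1)\<^sup>2 + (nrm M k2)\<^sup>2))" by simp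
        also have "\<dots> \<le> sqrt (q t) + sqrt ((1 / \<Lambda>\<^sup>2) * ((nrm M k1)\<^sup>2 + (nrm M k2)\<^sup>2))"
        proof (rule sqrt_add_le_add_sqrt)
          show "0 \<le> q t" unfolding q_def using area_pos kk_nonneg by (intro divide_nonneg_pos sum_nonneg divide_nonneg_nonneg) auto
        qed auto
        also have "sqrt ((1 / \<Lambda>\<^sup>2) * ((nrm M k1)\<^sup>2 + (nrm M k2)\<^sup>2)) = 1 / \<Lambda> * sqrt ((nrm M k1)\<^sup>2 + (nrm M k2)\<^sup>2)"
          using \<Lambda>0 by (simp add: real_sqrt_divide)
        finally show "sqrt ((nrm M (?w 1 t))\<^sup>2 + (nrm M (?w 2 t))\<^sup>2) \<le> 1 / \<Lambda> * sqrt ((nrm M k1)\<^sup>2 + (nrm M k2)\<^sup>2) + sqrt (q t)" by simp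
      qed
    qed
  qed
qed

end
end

section \<open>Determining nodes\<close>

lemma continuous_integrable_Icc:
  fixes f :: "real \<Rightarrow> real" assumes "continuous_on UNIV f" shows "set_integrable lborel {a..b} f"
  unfolding set_integrable_def
  by (rule borel_integrable_compact) (auto intro: continuous_on_subset[OF assms])

lemma continuous_integrable_cbox:
  fixes f :: "real^2 \<Rightarrow> real" assumes "continuous_on UNIV f" shows "set_integrable lborel (cbox a b) f"
  unfolding set_integrable_def
  by (rule borel_integrable_compact) (auto intro: continuous_on_subset[OF assms])

lemma Cauchy_Schwarz_Icc:
  fixes d :: "real \<Rightarrow> real"
  assumes "continuous_on UNIV d" "s \<le> t"
  shows "(LINT r:{s..t}|lborel. d r)\<^sup>2 \<le> (t - s) * (LINT r:{s..t}|lborel. (d r)\<^sup>2)"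
proof -
  have i1: "integrable lborel (\<lambda>r. indicator {s..t} r :: real)"
    using continuous_integrable_Icc[of "\<lambda>_. 1" s t] by (simp add: set_integrable_def)
  have i2: "set_integrable lborel {s..t} (\<lambda>r. (d r)\<^sup>2)" "set_integrable lborel {s..t} d"
    by (intro continuous_integrable_Icc continuous_intros assms)+
  have e1: "(indicator {s..t} r :: real)\<^sup>2 = indicator {s..t} r" for r by (simp add: indicator_def)
  have e2: "(indicator {s..t} r * d r)\<^sup>2 = indicator {s..t} r *\<^sub>R (d r)\<^sup>2" for r by (simp add: indicator_def)
  have s1: "sq lborel (\<lambda>r. indicator {s..t} r :: real)" using i1 by (simp add: sq_def e1)
  have s2: "sq lborel (\<lambda>r. indicator {s..t} r * d r)"
    using i2 borel_measurable_integrable[of lborel "\<lambda>r. indicator {s..t} r * d r"] unfolding sq_def e2 set_integrable_def by simp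
  have "\<bar>\<integral>r. indicator {s..t} r * (indicator {s..t} r * d r) \<partial>lborel\<bar> \<le> nrm lborel (indicator {s..t}) * nrm lborel (\<lambda>r. indicator {s..t} r * d r)"
    by (rule Cauchy_Schwarz_integral[OF s1 s2])
  then have "(\<integral>r. indicator {s..t} r * (indicator {s..t} r * d r) \<partial>lborel)\<^sup>2 \<le> (nrm lborel (indicator {s..t}))\<^sup>2 * (nrm lborel (\<lambda>r. indicator {s..t} r * d r))\<^sup>2"
    unfolding power_mult_distrib[symmetric] by (rule abs_le_square_iff[THEN iffD1, OF order_trans[OF _ abs_ge_self]])
  moreover have "(\<integral>r. indicator {s..t} r * (indicator {s..t} r * d r) \<partial>lborel) = (LINT r:{s..t}|lborel. d r)"
    unfolding set_lebesgue_integral_def by (rule Bochner_Integration.integral_cong) (auto simp: indicator_def)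
  moreover have "(nrm lborel (indicator {s..t}))\<^sup>2 = t - s" using assms(2) by (simp add: nrm_power2 e1)
  moreover have "(nrm lborel (\<lambda>r. indicator {s..t} r * d r))\<^sup>2 = (LINT r:{s..t}|lborel. (d r)\<^sup>2)"
    by (simp only: nrm_power2 e2 set_lebesgue_integral_def)
  ultimately show ?thesis by simp
qed

lemma set_integral_mono_subset:
  fixes f :: "real \<Rightarrow> real"
  assumes "continuous_on UNIV f" "\<And>r. 0 \<le> f r" "a \<le> s" "t \<le> b"
  shows "(LINT r:{s..t}|lborel. f r) \<le> (LINT r:{a..b}|lborel. f r)"
  unfolding set_lebesgue_integral_def
  by (rule integral_mono) (use continuous_integrable_Icc[OF assms(1)] assms in \<open>auto simp: set_integrable_def indicator_def\<close>)

text \<open>The fundamental theorem of calculus on a coordinate line and the Cauchy--Schwarz inequality.\<close>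

lemma line_increment_sq:
  assumes "has_pd i h d" "continuous_on UNIV d" "s \<in> {a..b}" "t \<in> {a..b}"
  shows "(h (x + t *\<^sub>R axis i 1) - h (x + s *\<^sub>R axis i 1))\<^sup>2 \<le> (b - a) * (LINT r:{a..b}|lborel. (d (x + r *\<^sub>R axis i 1))\<^sup>2)"
proof -
  have c: "continuous_on UNIV (\<lambda>r. d (x + r *\<^sub>R axis i 1))"
    by (rule continuous_on_compose2[OF assms(2)]) (auto intro!: continuous_intros)
  have *: "(h (x + t *\<^sub>R axis i 1) - h (x + s *\<^sub>R axis i 1))\<^sup>2 \<le> (b - a) * (LINT r:{a..b}|lborel. (d (x + r *\<^sub>R axis i 1))\<^sup>2)"
    if "a \<le> s" "s \<le> t" "t \<le> b" for s t
  proof -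
    have "(h (x + t *\<^sub>R axis i 1) - h (x + s *\<^sub>R axis i 1))\<^sup>2 \<le> (t - s) * (LINT r:{s..t}|lborel. (d (x + r *\<^sub>R axis i 1))\<^sup>2)"
      unfolding integral_pd_line[OF assms(1,2) that(2), symmetric] by (rule Cauchy_Schwarz_Icc[OF c that(2)])
    also have "\<dots> \<le> (b - a) * (LINT r:{a..b}|lborel. (d (x + r *\<^sub>R axis i 1))\<^sup>2)"
    proof (rule mult_mono)
      show "(LINT r:{s..t}|lborel. (d (x + r *\<^sub>R axis i 1))\<^sup>2) \<le> (LINT r:{a..b}|lborel. (d (x + r *\<^sub>R axis i 1))\<^sup>2)"
        by (rule set_integral_mono_subset) (use that in \<open>auto intro!: continuous_intros c\<close>)
      show "0 \<le> (LINT r:{s..t}|lborel. (d (x + r *\<^sub>R axis i 1))\<^sup>2)"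
        unfolding set_lebesgue_integral_def by (rule Bochner_Integration.integral_nonneg) (auto simp: indicator_def)
    qed (use that in auto)
    finally show ?thesis .
  qed
  show ?thesis
  proof (cases "s \<le> t")
    case True then show ?thesis using * assms(3,4) by auto
  next
    case False
    then show ?thesis using *[of t s] assms(3,4) by (auto simp: power2_commute)
  qed
qed

lemma continuous_vec2_snd: "continuous_on UNIV (\<lambda>s. vec2 (x, s))"
  by (rule continuous_on_compose2[OF continuous_on_vec2[of UNIV]]) (auto intro!: continuous_intros)

text \<open>The path from the node to \<open>(x, y)\<close> is vertical and then horizontal.  The vertical part runs along the line of the node,
  where only \<open>h12\<close> gives control of \<open>h2\<close>: it compares \<open>h2\<close> there with its values on the line through \<open>(x, y)\<close>.\<close>

lemma square_node_pointwise:
  assumes d: "has_pd 1 h h1" "has_pd 2 h h2" "has_pd 1 h2 h12"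
    and c: "continuous_on UNIV h" "continuous_on UNIV h1" "continuous_on UNIV h2" "continuous_on UNIV h12"
    and l: "0 \<le> l" and z: "x \<in> {a..a+l}" "x0 \<in> {a..a+l}" "y \<in> {b..b+l}" "y0 \<in> {b..b+l}"
  shows "(h (vec2 (x, y)))\<^sup>2 \<le> 2 * (h (vec2 (x0, y0)))\<^sup>2 + 6 * l * (LINT s:{a..a+l}|lborel. (h1 (vec2 (s, y)))\<^sup>2)
    + 6 * l * (LINT s:{b..b+l}|lborel. (h2 (vec2 (x, s)))\<^sup>2)
    + 6 * l\<^sup>2 * (LINT s:{b..b+l}|lborel. LINT r:{a..a+l}|lborel. (h12 (vec2 (r, s)))\<^sup>2)"
proof -
  let ?X = "LINT s:{a..a+l}|lborel. (h1 (vec2 (s, y)))\<^sup>2"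
  let ?Y = "LINT s:{b..b+l}|lborel. (h2 (vec2 (x, s)))\<^sup>2"
  let ?V = "\<lambda>s. LINT r:{a..a+l}|lborel. (h12 (vec2 (r, s)))\<^sup>2"
  let ?Z = "LINT s:{b..b+l}|lborel. ?V s"
  have c2: "continuous_on UNIV (\<lambda>s. h2 (vec2 (x, s)))" for x
    by (rule continuous_on_compose2[OF c(3) continuous_vec2_snd]) simp
  have 1: "(h (vec2 (x, y)) - h (vec2 (x0, y)))\<^sup>2 \<le> l * ?X"
    using line_increment_sq[OF d(1) c(2), of x0 a "a + l" x "vec2 (0, y)"] z by (simp add: vec2_line(1)[symmetric])
  have 2: "(h (vec2 (x0, y)) - h (vec2 (x0, y0)))\<^sup>2 \<le> l * (LINT s:{b..b+l}|lborel. (h2 (vec2 (x0, s)))\<^sup>2)"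
    using line_increment_sq[OF d(2) c(3), of y0 b "b + l" y "vec2 (x0, 0)"] z by (simp add: vec2_line(2)[symmetric])
  have 3: "(h2 (vec2 (x0, s)) - h2 (vec2 (x, s)))\<^sup>2 \<le> l * ?V s" for s
    using line_increment_sq[OF d(3) c(4), of x a "a + l" x0 "vec2 (0, s)"] z by (simp add: vec2_line(1)[symmetric])
  have V: "set_integrable lborel {b..b+l} ?V"
    using integral_cbox_iterated(4)[of "\<lambda>z. (h12 z)\<^sup>2" "vec2 (a, b)" "vec2 (a + l, b + l)"] c(4)
    by (simp add: continuous_intros)
  have i: "set_integrable lborel {b..b+l} (\<lambda>s. (h2 (vec2 (x, s)))\<^sup>2)" for x
    by (intro continuous_integrable_Icc continuous_intros c2)
  have sqr: "p\<^sup>2 \<le> 2 * q\<^sup>2 + 2 * w" if "(p - q)\<^sup>2 \<le> w" for p q w :: real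
  proof -
    have "0 \<le> (p - 2 * q)\<^sup>2" by simp
    then show ?thesis using that by (simp add: power2_eq_square algebra_simps)
  qed
  have "(LINT s:{b..b+l}|lborel. (h2 (vec2 (x0, s)))\<^sup>2) \<le> (LINT s:{b..b+l}|lborel. 2 * (h2 (vec2 (x, s)))\<^sup>2 + 2 * (l * ?V s))"
    by (rule set_integral_mono) (use i V sqr[OF 3] in auto)
  also have "\<dots> = 2 * ?Y + 2 * (l * ?Z)" using i V by (simp add: set_integral_add)
  finally have "l * (LINT s:{b..b+l}|lborel. (h2 (vec2 (x0, s)))\<^sup>2) \<le> l * (2 * ?Y + 2 * (l * ?Z))" using l by (rule mult_left_mono)
  with 2 have 4: "(h (vec2 (x0, y)) - h (vec2 (x0, y0)))\<^sup>2 \<le> l * (2 * ?Y + 2 * (l * ?Z))" by linarith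
  \<comment> \<open>split with weights 2, 6, 3, so that all three derivative terms get the same factor\<close>
  have gen: "p\<^sup>2 \<le> 2 * r\<^sup>2 + 6 * (p - q)\<^sup>2 + 3 * (q - r)\<^sup>2" for p q r :: real
  proof -
    have "0 \<le> (p - 2 * r)\<^sup>2 + (2 * (p - q) - (q - r))\<^sup>2" by simp
    then show ?thesis by (simp add: power2_eq_square algebra_simps)
  qed
  have "(h (vec2 (x, y)))\<^sup>2 \<le> 2 * (h (vec2 (x0, y0)))\<^sup>2 + 6 * (l * ?X) + 3 * (l * (2 * ?Y + 2 * (l * ?Z)))"
    using gen[of "h (vec2 (x, y))" "h (vec2 (x0, y0))" "h (vec2 (x0, y))"] 1 4 by linarith
  then show ?thesis by (simp add: algebra_simps power2_eq_square)
qed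

text \<open>A Poincare inequality on a square, from the pointwise bound by integration over the square.\<close>

lemma square_node_bound:
  assumes d: "has_pd 1 h h1" "has_pd 2 h h2" "has_pd 1 h2 h12"
    and c: "continuous_on UNIV h" "continuous_on UNIV h1" "continuous_on UNIV h2" "continuous_on UNIV h12"
    and l: "0 \<le> l" and Q: "Q = cbox c (c + vector [l, l])" and p: "p \<in> Q"
  shows "(LINT z:Q|lborel. (h z)\<^sup>2) \<le> 2 * l\<^sup>2 * (h p)\<^sup>2 + 6 * l\<^sup>2 * (LINT z:Q|lborel. (h1 z)\<^sup>2)
     + 6 * l\<^sup>2 * (LINT z:Q|lborel. (h2 z)\<^sup>2) + 6 * l ^ 4 * (LINT z:Q|lborel. (h12 z)\<^sup>2)"
proof -
  let ?a = "c $ 1" and ?b = "c $ 2"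
  have b: "(c + vector [l, l]) $ 1 = ?a + l" "(c + vector [l, l]) $ 2 = ?b + l" by simp_all
  have it: "(LINT z:Q|lborel. (f z)\<^sup>2) = (LINT x:{?a..?a+l}|lborel. LINT y:{?b..?b+l}|lborel. (f (vec2 (x, y)))\<^sup>2)"
    "(LINT z:Q|lborel. (f z)\<^sup>2) = (LINT y:{?b..?b+l}|lborel. LINT x:{?a..?a+l}|lborel. (f (vec2 (x, y)))\<^sup>2)"
    "set_integrable lborel {?a..?a+l} (\<lambda>x. LINT y:{?b..?b+l}|lborel. (f (vec2 (x, y)))\<^sup>2)"
    "set_integrable lborel {?b..?b+l} (\<lambda>y. LINT x:{?a..?a+l}|lborel. (f (vec2 (x, y)))\<^sup>2)"
    if "continuous_on UNIV f" for f :: "real^2 \<Rightarrow> real"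
    using integral_cbox_iterated[of "\<lambda>z. (f z)\<^sup>2" c "c + vector [l, l]"] that unfolding b Q by (simp_all add: continuous_intros)
  have pp: "p = vec2 (p $ 1, p $ 2)" by (simp add: vec_eq_iff forall_2)
  have p': "p $ 1 \<in> {?a..?a+l}" "p $ 2 \<in> {?b..?b+l}" using p unfolding Q mem_cbox_plane b by auto
  define X where "X y = (LINT s:{?a..?a+l}|lborel. (h1 (vec2 (s, y)))\<^sup>2)" for y
  define Y where "Y x = (LINT s:{?b..?b+l}|lborel. (h2 (vec2 (x, s)))\<^sup>2)" for x
  define Z where "Z = (LINT s:{?b..?b+l}|lborel. LINT r:{?a..?a+l}|lborel. (h12 (vec2 (r, s)))\<^sup>2)"
  have I1: "(LINT y:{?b..?b+l}|lborel. X y) = (LINT z:Q|lborel. (h1 z)\<^sup>2)" and X: "set_integrable lborel {?b..?b+l} X"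
    using it(2,4)[OF c(2)] by (simp_all add: X_def[abs_def])
  have I2: "(LINT x:{?a..?a+l}|lborel. Y x) = (LINT z:Q|lborel. (h2 z)\<^sup>2)" and Y: "set_integrable lborel {?a..?a+l} Y"
    using it(1,3)[OF c(3)] by (simp_all add: Y_def[abs_def])
  have I12: "Z = (LINT z:Q|lborel. (h12 z)\<^sup>2)" using it(2)[OF c(4)] by (simp add: Z_def)
  have k: "set_integrable lborel {u..u+l} (\<lambda>x. k)" "(LINT x:{u..u+l}|lborel. k) = l * k" for u k :: real
    using l by (auto intro: continuous_integrable_Icc simp: set_lebesgue_integral_def)
  have pt: "(h (vec2 (x, y)))\<^sup>2 \<le> 2 * (h p)\<^sup>2 + 6 * l * X y + 6 * l * Y x + 6 * l\<^sup>2 * Z" if "x \<in> {?a..?a+l}" "y \<in> {?b..?b+l}" for x y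
    unfolding X_def Y_def Z_def by (subst pp) (rule square_node_pointwise[OF d c l that(1) p'(1) that(2) p'(2)])
  have inner: "(LINT y:{?b..?b+l}|lborel. (h (vec2 (x, y)))\<^sup>2) \<le> l * (2 * (h p)\<^sup>2 + 6 * l * Y x + 6 * l\<^sup>2 * Z) + 6 * l * (LINT z:Q|lborel. (h1 z)\<^sup>2)"
    if x: "x \<in> {?a..?a+l}" for x
  proof -
    have c2: "continuous_on UNIV (\<lambda>y. h (vec2 (x, y)))"
      by (rule continuous_on_compose2[OF c(1) continuous_vec2_snd]) simp
    have "(LINT y:{?b..?b+l}|lborel. (h (vec2 (x, y)))\<^sup>2) \<le> (LINT y:{?b..?b+l}|lborel. (2 * (h p)\<^sup>2 + 6 * l * Y x + 6 * l\<^sup>2 * Z) + (6 * l) * X y)"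
    proof (rule set_integral_mono)
      show "set_integrable lborel {?b..?b+l} (\<lambda>y. (h (vec2 (x, y)))\<^sup>2)" by (intro continuous_integrable_Icc continuous_intros c2)
      show "set_integrable lborel {?b..?b+l} (\<lambda>y. (2 * (h p)\<^sup>2 + 6 * l * Y x + 6 * l\<^sup>2 * Z) + (6 * l) * X y)"
        by (rule set_integral_add(1)[OF k(1)]) (simp add: X)
    qed (use pt[OF x] in \<open>simp add: add_ac\<close>)
    also have "\<dots> = l * (2 * (h p)\<^sup>2 + 6 * l * Y x + 6 * l\<^sup>2 * Z) + 6 * l * (LINT z:Q|lborel. (h1 z)\<^sup>2)"
      by (subst set_integral_add(2)[OF k(1)]) (simp_all add: X k(2) I1)
    finally show ?thesis .
  qed
  let ?C = "l * (2 * (h p)\<^sup>2 + 6 * l\<^sup>2 * Z) + 6 * l * (LINT z:Q|lborel. (h1 z)\<^sup>2)"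
  have "(LINT z:Q|lborel. (h z)\<^sup>2) \<le> (LINT x:{?a..?a+l}|lborel. ?C + (6 * l\<^sup>2) * Y x)"
    unfolding it(1)[OF c(1)]
  proof (rule set_integral_mono)
    show "set_integrable lborel {?a..?a+l} (\<lambda>x. LINT y:{?b..?b+l}|lborel. (h (vec2 (x, y)))\<^sup>2)" by (rule it(3)[OF c(1)])
    show "set_integrable lborel {?a..?a+l} (\<lambda>x. ?C + (6 * l\<^sup>2) * Y x)"
      by (rule set_integral_add(1)[OF k(1)]) (simp add: Y)
    fix x assume "x \<in> {?a..?a+l}"
    from inner[OF this] show "(LINT y:{?b..?b+l}|lborel. (h (vec2 (x, y)))\<^sup>2) \<le> ?C + (6 * l\<^sup>2) * Y x"
      by (simp add: algebra_simps power2_eq_square)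
  qed
  also have "\<dots> = l * ?C + 6 * l\<^sup>2 * (LINT z:Q|lborel. (h2 z)\<^sup>2)"
    by (subst set_integral_add(2)[OF k(1)]) (simp_all add: Y k(2) I2)
  also have "\<dots> = 2 * l\<^sup>2 * (h p)\<^sup>2 + 6 * l\<^sup>2 * (LINT z:Q|lborel. (h1 z)\<^sup>2)
     + 6 * l\<^sup>2 * (LINT z:Q|lborel. (h2 z)\<^sup>2) + 6 * l ^ 4 * (LINT z:Q|lborel. (h12 z)\<^sup>2)"
    unfolding I12 by (simp add: algebra_simps power2_eq_square power4_eq_xxxx)
  finally show ?thesis .
qed

lemma square_measure:
  assumes "0 \<le> l" shows "measure lborel (cbox c (c + vector [l, l]) :: (real^2) set) = l\<^sup>2"
proof -
  have "measure lborel (cbox c (c + vector [l, l]) :: (real^2) set) = (\<Prod>b\<in>Basis. vector [l, l] \<bullet> (b :: real^2))"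
    by (subst measure_lborel_cbox_eq) (use assms in \<open>auto simp: Basis_plane inner_axis algebra_simps\<close>)
  also have "\<dots> = l\<^sup>2"
    unfolding Basis_plane by (subst prod.insert) (auto simp: inner_axis axis_eq_axis power2_eq_square)
  finally show ?thesis .
qed

text \<open>Almost every point lies in no boundary of a tile, hence in at most one tile.\<close>

lemma tiling_integral:
  fixes g :: "real^2 \<Rightarrow> real"
  assumes fin: "finite I" and Q: "\<And>j. j \<in> I \<Longrightarrow> \<exists>a b. Q j = cbox a b"
    and disj: "\<And>i j. i \<in> I \<Longrightarrow> j \<in> I \<Longrightarrow> i \<noteq> j \<Longrightarrow> interior (Q i) \<inter> interior (Q j) = {}"
    and g: "continuous_on UNIV g"
  shows "(LINT z:(\<Union>j\<in>I. Q j)|lborel. g z) = (\<Sum>j\<in>I. LINT z:Q j|lborel. g z)"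
proof -
  have ae: "AE x in lborel. \<forall>j\<in>I. x \<in> Q j \<longrightarrow> x \<in> interior (Q j)"
  proof (rule AE_finite_allI[OF fin])
    fix j assume "j \<in> I"
    then obtain a b where "Q j = cbox a b" using Q by blast
    then show "AE x in lborel. x \<in> Q j \<longrightarrow> x \<in> interior (Q j)" using AE_not_boundary[of a b] by simp
  qed
  have s: "Q j \<in> sets lborel" "set_integrable lborel (Q j) g" if "j \<in> I" for j
    using Q[OF that] continuous_integrable_cbox[OF g] by auto
  have "(LINT z:(\<Union>j\<in>I. Q j)|lborel. g z) = (\<integral>z. (\<Sum>j\<in>I. indicator (Q j) z *\<^sub>R g z) \<partial>lborel)"
    unfolding set_lebesgue_integral_def
  proof (rule integral_cong_AE)
    have "(\<Union>j\<in>I. Q j) \<in> sets lborel" using s(1) fin by (intro sets.finite_UN) auto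
    then show "(\<lambda>z. indicator (\<Union>j\<in>I. Q j) z *\<^sub>R g z) \<in> borel_measurable lborel"
      using borel_measurable_continuous_onI[OF g] by (intro borel_measurable_scaleR borel_measurable_indicator) auto
    show "(\<lambda>z. \<Sum>j\<in>I. indicator (Q j) z *\<^sub>R g z) \<in> borel_measurable lborel"
      by (rule borel_measurable_integrable, rule Bochner_Integration.integrable_sum) (use s(2) in \<open>simp add: set_integrable_def\<close>)
    show "AE z in lborel. indicator (\<Union>j\<in>I. Q j) z *\<^sub>R g z = (\<Sum>j\<in>I. indicator (Q j) z *\<^sub>R g z)"
      using ae
    proof eventually_elim
      case (elim z)
      show ?case
      proof (cases "\<exists>i\<in>I. z \<in> Q i")
        case True
        then obtain i where i: "i \<in> I" "z \<in> Q i" by blast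
        have "z \<notin> Q j" if "j \<in> I - {i}" for j using that elim i disj[of i j] by auto
        then have "(\<Sum>j\<in>I. indicator (Q j) z *\<^sub>R g z) = (\<Sum>j\<in>{i}. indicator (Q j) z *\<^sub>R g z)"
          using i fin by (intro sum.mono_neutral_right) auto
        then show ?thesis using i by (auto simp: indicator_def)
      next
        case False
        then show ?thesis by (auto simp: indicator_def intro!: sum.neutral[symmetric])
      qed
    qed
  qed
  also have "\<dots> = (\<Sum>j\<in>I. LINT z:Q j|lborel. g z)"
    unfolding set_lebesgue_integral_def
    by (rule Bochner_Integration.integral_sum) (use s(2) in \<open>simp add: set_integrable_def\<close>)
  finally show ?thesis .
qed

context cell begin

lemma square_tiling_integral:
  assumes "square_tiling (Omega L \<gamma>) N Q"
  obtains l where "0 < l" "\<And>j. j \<in> {1..N} \<Longrightarrow> \<exists>c. Q j = cbox c (c + vector [l, l])" "real N * l\<^sup>2 = area"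
    "\<And>g :: real^2 \<Rightarrow> real. continuous_on UNIV g \<Longrightarrow> (\<integral>z. g z \<partial>M) = (\<Sum>j\<in>{1..N}. LINT z:Q j|lborel. g z)"
proof -
  note t = assms[unfolded square_tiling_def]
  obtain l where l: "0 < l" and Q': "\<forall>j\<in>{1..N}. \<exists>c. Q j = cbox c (c + vector [l, l])"
    using conjunct1[OF t] by blast
  have Q: "\<And>j. j \<in> {1..N} \<Longrightarrow> \<exists>c. Q j = cbox c (c + vector [l, l])" using Q' by blast
  have U: "(\<Union>j\<in>{1..N}. Q j) = Omega L \<gamma>" using assms by (simp add: square_tiling_def)
  have disj: "\<And>i j. i \<in> {1..N} \<Longrightarrow> j \<in> {1..N} \<Longrightarrow> i \<noteq> j \<Longrightarrow> interior (Q i) \<inter> interior (Q j) = {}"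
    using conjunct2[OF conjunct2[OF t]] by blast
  have I: "(\<integral>z. g z \<partial>M) = (\<Sum>j\<in>{1..N}. LINT z:Q j|lborel. g z)" if "continuous_on UNIV g" for g :: "real^2 \<Rightarrow> real"
    unfolding LINT_Omega[symmetric] U[symmetric]
    by (rule tiling_integral[OF finite_atLeastAtMost _ disj that]) (use Q in blast)+
  have "(LINT z:Q j|lborel. 1::real) = l\<^sup>2" if "j \<in> {1..N}" for j
    using Q[OF that] square_measure[of l] l by (auto simp: set_lebesgue_integral_def)
  then have "area = (\<Sum>j\<in>{1..N}. l\<^sup>2)" using I[of "\<lambda>_. 1"] measure_M by simp
  then have "real N * l\<^sup>2 = area" by simp
  then show ?thesis using that l Q I by blast
qed

text \<open>The inequality on single squares, added up.  The factor \<open>3 / 2\<close> is \<open>6 / 4\<close>, since the mixed derivative has the symbol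
  \<open>kap 1 k * kap 2 k\<close>, at most half of \<open>kk k\<close>.\<close>

lemma node_inequality_P:
  assumes t: "0 < l" "\<And>j. j \<in> {1..N} \<Longrightarrow> \<exists>c. Q j = cbox c (c + vector [l, l])"
      "\<And>g :: real^2 \<Rightarrow> real. continuous_on UNIV g \<Longrightarrow> (\<integral>z. g z \<partial>M) = (\<Sum>j\<in>{1..N}. LINT z:Q j|lborel. g z)"
    and x: "\<And>j. j \<in> {1..N} \<Longrightarrow> x j \<in> Q j" and f: "flap h k"
  shows "bil n h h \<le> 2 * l\<^sup>2 * (\<Sum>j\<in>{1..N}. (P n h (x j))\<^sup>2) + 6 * l\<^sup>2 * (nrm M h * nrm M k) + 3 / 2 * l ^ 4 * (nrm M k)\<^sup>2"
proof -
  note s = flapD(1,2)[OF f]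
  define h1 where "h1 = T n (\<lambda>q. kap 1 q * B h q) (\<lambda>q. - kap 1 q * A h q)"
  define h2 where "h2 = T n (\<lambda>q. kap 2 q * B h q) (\<lambda>q. - kap 2 q * A h q)"
  define h12 where "h12 = T n (\<lambda>q. kap 1 q * (- kap 2 q * A h q)) (\<lambda>q. - kap 1 q * (kap 2 q * B h q))"
  have d: "has_pd 1 (P n h) h1" "has_pd 2 (P n h) h2" "has_pd 1 h2 h12"
    unfolding P_def h1_def h2_def h12_def by (rule has_pd_T)+
  have c: "continuous_on UNIV (P n h)" "continuous_on UNIV h1" "continuous_on UNIV h2" "continuous_on UNIV h12"
    unfolding h1_def h2_def h12_def by (intro continuous_intros)+
  have i1: "(\<integral>z. (h1 z)\<^sup>2 \<partial>M) = (\<Sum>q\<in>K n. (kap 1 q * B h q)\<^sup>2 + (- kap 1 q * A h q)\<^sup>2) / area"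
    unfolding h1_def by (rule int_T_square) (simp_all add: AB_uminus)
  have i2: "(\<integral>z. (h2 z)\<^sup>2 \<partial>M) = (\<Sum>q\<in>K n. (kap 2 q * B h q)\<^sup>2 + (- kap 2 q * A h q)\<^sup>2) / area"
    unfolding h2_def by (rule int_T_square) (simp_all add: AB_uminus)
  have i12: "(\<integral>z. (h12 z)\<^sup>2 \<partial>M) = (\<Sum>q\<in>K n. (kap 1 q * (- kap 2 q * A h q))\<^sup>2 + (- kap 1 q * (kap 2 q * B h q))\<^sup>2) / area"
    unfolding h12_def by (rule int_T_square) (simp_all add: AB_uminus)
  have "(\<integral>z. (h1 z)\<^sup>2 \<partial>M) + (\<integral>z. (h2 z)\<^sup>2 \<partial>M) = - bil n h k"
    unfolding i1 i2 bil_def add_divide_distrib[symmetric] sum.distrib[symmetric] sum_negf[symmetric] minus_divide_left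
    by (intro arg_cong[where f = "\<lambda>z. z / area"] sum.cong refl)
      (simp add: flapD(4,5)[OF f] kk_def power2_eq_square algebra_simps)
  also have "\<dots> \<le> nrm M (P n h) * nrm M (P n k)"
    using Cauchy_Schwarz_integral[OF sq_P sq_P, of n h n k] unfolding int_P_P by linarith
  also have "\<dots> \<le> nrm M h * nrm M k" by (intro mult_mono nrm_P_le s) auto
  finally have g: "(\<integral>z. (h1 z)\<^sup>2 \<partial>M) + (\<integral>z. (h2 z)\<^sup>2 \<partial>M) \<le> nrm M h * nrm M k" .
  have "(\<integral>z. (h12 z)\<^sup>2 \<partial>M) \<le> (1 / 4) * bil n k k"
  proof -
    have am: "(p * p) * (r * r) \<le> ((p * p + r * r) * (p * p + r * r)) / 4" for p r :: real
    proof -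
      have "0 \<le> (p * p - r * r)\<^sup>2" by simp
      then show ?thesis by (simp add: power2_eq_square algebra_simps)
    qed
    have "(kap 1 q * (- kap 2 q * A h q))\<^sup>2 + (- kap 1 q * (kap 2 q * B h q))\<^sup>2 \<le> (1 / 4) * (A k q * A k q + B k q * B k q)" for q
    proof -
      have "(kap 1 q * kap 1 q) * (kap 2 q * kap 2 q) * (A h q * A h q + B h q * B h q) \<le> ((kk q * kk q) / 4) * (A h q * A h q + B h q * B h q)"
        unfolding kk_def power2_eq_square by (intro mult_right_mono am) simp
      then show ?thesis by (simp add: flapD(4,5)[OF f] power2_eq_square algebra_simps)
    qed
    then show ?thesis unfolding i12 bil_def times_divide_eq_right sum_distrib_left
      using area_pos by (intro divide_right_mono sum_mono) auto
  qed
  also have "\<dots> \<le> (1 / 4) * (nrm M k)\<^sup>2" using Bessel[OF s(2), of n] by simp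
  finally have g12: "(\<integral>z. (h12 z)\<^sup>2 \<partial>M) \<le> (1 / 4) * (nrm M k)\<^sup>2" .
  have "bil n h h = (\<integral>z. (P n h z)\<^sup>2 \<partial>M)" using int_P_P[of n h h] by (simp add: power2_eq_square)
  also have "\<dots> = (\<Sum>j\<in>{1..N}. LINT z:Q j|lborel. (P n h z)\<^sup>2)" by (intro t(3) continuous_intros)
  also have "\<dots> \<le> (\<Sum>j\<in>{1..N}. 2 * l\<^sup>2 * (P n h (x j))\<^sup>2 + 6 * l\<^sup>2 * (LINT z:Q j|lborel. (h1 z)\<^sup>2)
     + 6 * l\<^sup>2 * (LINT z:Q j|lborel. (h2 z)\<^sup>2) + 6 * l ^ 4 * (LINT z:Q j|lborel. (h12 z)\<^sup>2))"
  proof (rule sum_mono)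
    fix j assume j: "j \<in> {1..N}"
    obtain c0 where "Q j = cbox c0 (c0 + vector [l, l])" using t(2)[OF j] by blast
    from square_node_bound[OF d c less_imp_le[OF t(1)] this x[OF j]]
    show "(LINT z:Q j|lborel. (P n h z)\<^sup>2) \<le> 2 * l\<^sup>2 * (P n h (x j))\<^sup>2 + 6 * l\<^sup>2 * (LINT z:Q j|lborel. (h1 z)\<^sup>2)
     + 6 * l\<^sup>2 * (LINT z:Q j|lborel. (h2 z)\<^sup>2) + 6 * l ^ 4 * (LINT z:Q j|lborel. (h12 z)\<^sup>2)" .
  qed
  also have "\<dots> = 2 * l\<^sup>2 * (\<Sum>j\<in>{1..N}. (P n h (x j))\<^sup>2) + 6 * l\<^sup>2 * ((\<integral>z. (h1 z)\<^sup>2 \<partial>M) + (\<integral>z. (h2 z)\<^sup>2 \<partial>M)) + 6 * l ^ 4 * (\<integral>z. (h12 z)\<^sup>2 \<partial>M)"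
    using t(3)[of "\<lambda>z. (h1 z)\<^sup>2"] t(3)[of "\<lambda>z. (h2 z)\<^sup>2"] t(3)[of "\<lambda>z. (h12 z)\<^sup>2"] c
    by (simp add: continuous_intros sum.distrib sum_distrib_left distrib_left)
  also have "\<dots> \<le> 2 * l\<^sup>2 * (\<Sum>j\<in>{1..N}. (P n h (x j))\<^sup>2) + 6 * l\<^sup>2 * (nrm M h * nrm M k) + 6 * l ^ 4 * ((1 / 4) * (nrm M k)\<^sup>2)"
    using g g12 by (intro add_mono mult_left_mono) auto
  finally show ?thesis by simp
qed

text \<open>The Fourier series of a continuous function with square-integrable Laplacian converges at the nodes, so the bound passes to the limit.\<close>

lemma node_inequality:
  assumes t: "0 < l" "\<And>j. j \<in> {1..N} \<Longrightarrow> \<exists>c. Q j = cbox c (c + vector [l, l])"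
      "\<And>g :: real^2 \<Rightarrow> real. continuous_on UNIV g \<Longrightarrow> (\<integral>z. g z \<partial>M) = (\<Sum>j\<in>{1..N}. LINT z:Q j|lborel. g z)"
    and x: "\<And>j. j \<in> {1..N} \<Longrightarrow> x j \<in> Q j" "\<And>j. j \<in> {1..N} \<Longrightarrow> x j \<in> Omega L \<gamma>" and f: "flap h k" and c: "continuous_on UNIV h"
  shows "(nrm M h)\<^sup>2 \<le> 2 * l\<^sup>2 * (\<Sum>j\<in>{1..N}. (h (x j))\<^sup>2) + 6 * l\<^sup>2 * (nrm M h * nrm M k) + 3 / 2 * l ^ 4 * (nrm M k)\<^sup>2"
proof (rule LIMSEQ_le[OF Parseval_nrm[OF flapD(1)[OF f]]])
  show "(\<lambda>n. 2 * l\<^sup>2 * (\<Sum>j\<in>{1..N}. (P n h (x j))\<^sup>2) + 6 * l\<^sup>2 * (nrm M h * nrm M k) + 3 / 2 * l ^ 4 * (nrm M k)\<^sup>2)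
    \<longlonglongrightarrow> 2 * l\<^sup>2 * (\<Sum>j\<in>{1..N}. (h (x j))\<^sup>2) + 6 * l\<^sup>2 * (nrm M h * nrm M k) + 3 / 2 * l ^ 4 * (nrm M k)\<^sup>2"
    by (intro tendsto_intros Sobolev_uniform[OF f c] x(2))
  show "\<exists>N'. \<forall>n\<ge>N'. bil n h h \<le> 2 * l\<^sup>2 * (\<Sum>j\<in>{1..N}. (P n h (x j))\<^sup>2) + 6 * l\<^sup>2 * (nrm M h * nrm M k) + 3 / 2 * l ^ 4 * (nrm M k)\<^sup>2"
    using node_inequality_P[OF t x(1) f] by blast
qed

text \<open>The hypothesis is a quadratic inequality for \<open>W = \<surd>(a\<^sup>2 + b\<^sup>2)\<close> with largest solution at most \<open>(3 + \<surd>10.5) m D + e\<close>, where \<open>D = \<surd>(p\<^sup>2 + q\<^sup>2)\<close>;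
  the round factor \<open>8\<close> exceeds this and is still below \<open>\<surd>68\<close>.\<close>

lemma two_component_bound:
  fixes a b p q e :: real
  assumes "a\<^sup>2 + b\<^sup>2 \<le> e\<^sup>2 + 6 * (m * (a * p + b * q)) + 3 / 2 * (m\<^sup>2 * (p\<^sup>2 + q\<^sup>2))" "0 \<le> m" "0 \<le> e"
  shows "sqrt (a\<^sup>2 + b\<^sup>2) \<le> 8 * m * sqrt (p\<^sup>2 + q\<^sup>2) + e"
proof (rule ccontr)
  define W D where "W = sqrt (a\<^sup>2 + b\<^sup>2)" and "D = sqrt (p\<^sup>2 + q\<^sup>2)"
  define y where "y = m * D"
  have W2: "W\<^sup>2 = a\<^sup>2 + b\<^sup>2" and D2: "D\<^sup>2 = p\<^sup>2 + q\<^sup>2" and W0: "0 \<le> W" and D0: "0 \<le> D" by (simp_all add: W_def D_def)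
  assume "\<not> sqrt (a\<^sup>2 + b\<^sup>2) \<le> 8 * m * sqrt (p\<^sup>2 + q\<^sup>2) + e"
  then have gt: "8 * y + e < W" by (simp add: W_def D_def y_def)
  have y0: "0 \<le> y" using assms(2) D0 by (simp add: y_def)
  have "(a * p + b * q)\<^sup>2 \<le> (W * D)\<^sup>2"
  proof -
    have "0 \<le> (a * q - b * p)\<^sup>2" by simp
    then show ?thesis unfolding power_mult_distrib W2 D2 by (simp add: power2_eq_square algebra_simps)
  qed
  then have "a * p + b * q \<le> W * D" by (rule power2_le_imp_le) (rule mult_nonneg_nonneg[OF W0 D0])
  then have "m * (a * p + b * q) \<le> m * (W * D)" using assms(2) by (rule mult_left_mono)
  also have "m * (W * D) = W * y" by (simp add: y_def)
  finally have 1: "W\<^sup>2 \<le> e\<^sup>2 + 6 * (W * y) + 3 / 2 * y\<^sup>2"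
    using assms(1) unfolding W2[symmetric] D2[symmetric] y_def power_mult_distrib by linarith
  \<comment> \<open>\<open>W > 8 y + e\<close> makes \<open>W (W - 6 y)\<close> at least \<open>16 y\<^sup>2 + e\<^sup>2\<close>, more than allowed unless \<open>y = 0\<close>\<close>
  have "(8 * y + e) * (2 * y + e) \<le> W * (W - 6 * y)" using gt y0 assms(3) by (intro mult_mono) auto
  then have "e\<^sup>2 + 16 * y\<^sup>2 + 10 * (e * y) \<le> e\<^sup>2 + 3 / 2 * y\<^sup>2"
    using 1 by (simp add: power2_eq_square algebra_simps)
  moreover have "0 \<le> e * y" by (rule mult_nonneg_nonneg[OF assms(3) y0])
  ultimately have "y\<^sup>2 \<le> 0" using zero_le_power2[of y] by linarith
  then have "y = 0" by simp
  then have "e < W" "W\<^sup>2 \<le> e\<^sup>2" using gt 1 by simp_all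
  then show False using assms(3) power2_le_imp_le[of W e] by simp
qed

text \<open>The criterion applies with \<open>c = 8 l\<^sup>2\<close>: as \<open>N l\<^sup>2\<close> is the area of the rectangle, \<open>c F / \<mu> < \<nu>\<close> is what the lower bound on
  \<open>N\<close> says, up to the difference between \<open>8\<close> and \<open>\<surd>68\<close>.\<close>

lemma nodes_determining:
  assumes tile: "square_tiling (Omega L \<gamma>) N Q" and x: "\<And>j. j \<in> {1..N} \<Longrightarrow> x j \<in> Q j" and \<nu>: "0 < \<nu>" and \<mu>: "0 < \<mu>"
    and N: "real N > sqrt 68 * (F * area / (\<mu> * \<nu>))"
  shows "determining_nodes L \<gamma> \<nu> \<mu> F x N"
  unfolding determining_nodes_def
proof (intro allI impI)
  fix u v assume sp: "solution_pair L \<gamma> \<nu> \<mu> F u v"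
    and cont: "\<forall>\<^sub>F t in at_top. continuous_on UNIV (u t) \<and> continuous_on UNIV (v t)"
    and lim: "((\<lambda>t. MAX j\<in>{1..N}. norm (u t (x j) - v t (x j))) \<longlongrightarrow> 0) at_top"
  from square_tiling_integral[OF tile] obtain l where l: "0 < l"
    and Q: "\<And>j. j \<in> {1..N} \<Longrightarrow> \<exists>c. Q j = cbox c (c + vector [l, l])" and Nl: "real N * l\<^sup>2 = area"
    and I: "\<And>g :: real^2 \<Rightarrow> real. continuous_on UNIV g \<Longrightarrow> (\<integral>z. g z \<partial>M) = (\<Sum>j\<in>{1..N}. LINT z:Q j|lborel. g z)"
    by metis
  have xO: "x j \<in> Omega L \<gamma>" if "j \<in> {1..N}" for j
    using x[OF that] that tile unfolding square_tiling_def by blast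
  have c: "8 * l\<^sup>2 * (max F 0 / \<mu>) < \<nu>"
  proof (cases "0 \<le> F")
    case True
    have N0: "0 < real N" using Nl area_pos by (cases "N = 0") auto
    have "8 * (F * area / (\<mu> * \<nu>)) \<le> sqrt 68 * (F * area / (\<mu> * \<nu>))"
      using True area_pos \<mu> \<nu> by (intro mult_right_mono real_le_rsqrt) auto
    then have "8 * (F * area / (\<mu> * \<nu>)) < real N" using N by linarith
    then have "8 * (F * (real N * l\<^sup>2)) < real N * (\<mu> * \<nu>)" using \<mu> \<nu> unfolding Nl by (simp add: field_simps)
    then have "real N * (8 * l\<^sup>2 * F) < real N * (\<mu> * \<nu>)" by (simp add: mult_ac)
    then have "8 * l\<^sup>2 * F < \<mu> * \<nu>" using N0 by (simp only: mult_less_cancel_left_pos)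
    then show ?thesis using True \<mu> by (simp add: max_def field_simps)
  qed (use \<nu> in simp)
  let ?w = "\<lambda>i t x. u t x $ i - v t x $ i"
  define \<eta> where "\<eta> t = (MAX j\<in>{1..N}. norm (u t (x j) - v t (x j)))" for t
  \<comment> \<open>the node terms add up to at most \<open>2 N l\<^sup>2 \<eta>\<^sup>2\<close>, and \<open>N l\<^sup>2 = area\<close>\<close>
  define S where "S t = sqrt (2 * area) * \<bar>\<eta> t\<bar>" for t
  have S: "(S \<longlongrightarrow> 0) at_top"
    using tendsto_mult[OF tendsto_const[of "sqrt (2 * area)"] tendsto_rabs[OF lim]] unfolding S_def[abs_def] \<eta>_def[abs_def] by simp
  show "((\<lambda>t. L2_norm L \<gamma> (\<lambda>x. u t x - v t x)) \<longlongrightarrow> 0) at_top"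
  proof (rule determining_criterion[OF sp \<nu> \<mu> _ c S])
    show "0 \<le> 8 * l\<^sup>2" by simp
    show "\<forall>\<^sub>F t in at_top. \<forall>k1 k2. flap (?w 1 t) k1 \<longrightarrow> flap (?w 2 t) k2 \<longrightarrow>
        sqrt ((nrm M (?w 1 t))\<^sup>2 + (nrm M (?w 2 t))\<^sup>2) \<le> 8 * l\<^sup>2 * sqrt ((nrm M k1)\<^sup>2 + (nrm M k2)\<^sup>2) + S t"
      using cont
    proof eventually_elim
      case (elim t)
      have cw: "continuous_on UNIV (?w i t)" for i using elim by (intro continuous_intros) auto
      have pt: "(\<Sum>j\<in>{1..N}. (?w 1 t (x j))\<^sup>2 + (?w 2 t (x j))\<^sup>2) \<le> (\<Sum>j\<in>{1..N}. (\<eta> t)\<^sup>2)"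
      proof (rule sum_mono)
        fix j assume j: "j \<in> {1..N}"
        have "(?w 1 t (x j))\<^sup>2 + (?w 2 t (x j))\<^sup>2 = (norm (u t (x j) - v t (x j)))\<^sup>2"
          unfolding power2_norm_eq_inner inner_vec_def sum_2 by (simp add: power2_eq_square)
        also have "\<dots> \<le> (\<eta> t)\<^sup>2" unfolding \<eta>_def by (intro power_mono Max_ge) (use j in auto)
        finally show "(?w 1 t (x j))\<^sup>2 + (?w 2 t (x j))\<^sup>2 \<le> (\<eta> t)\<^sup>2" .
      qed
      have pt': "2 * l\<^sup>2 * (\<Sum>j\<in>{1..N}. (?w 1 t (x j))\<^sup>2) + 2 * l\<^sup>2 * (\<Sum>j\<in>{1..N}. (?w 2 t (x j))\<^sup>2) \<le> (S t)\<^sup>2"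
      proof -
        have "2 * l\<^sup>2 * (\<Sum>j\<in>{1..N}. (?w 1 t (x j))\<^sup>2 + (?w 2 t (x j))\<^sup>2) \<le> 2 * l\<^sup>2 * (\<Sum>j\<in>{1..N}. (\<eta> t)\<^sup>2)"
          using pt by (rule mult_left_mono) simp
        also have "\<dots> = 2 * (real N * l\<^sup>2) * (\<eta> t)\<^sup>2" by simp
        also have "\<dots> = (S t)\<^sup>2" unfolding Nl S_def using area_pos by (simp add: power_mult_distrib)
        finally show ?thesis by (simp add: sum.distrib distrib_left)
      qed
      show ?case
      proof (intro allI impI)
        fix k1 k2 assume f: "flap (?w 1 t) k1" "flap (?w 2 t) k2"
        have "(nrm M (?w 1 t))\<^sup>2 + (nrm M (?w 2 t))\<^sup>2 \<le> (S t)\<^sup>2 + 6 * (l\<^sup>2 * (nrm M (?w 1 t) * nrm M k1 + nrm M (?w 2 t) * nrm M k2))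
            + 3 / 2 * ((l\<^sup>2)\<^sup>2 * ((nrm M k1)\<^sup>2 + (nrm M k2)\<^sup>2))"
          using node_inequality[OF l Q I x xO f(1) cw] node_inequality[OF l Q I x xO f(2) cw] pt'
          by (simp add: algebra_simps)
        then show "sqrt ((nrm M (?w 1 t))\<^sup>2 + (nrm M (?w 2 t))\<^sup>2) \<le> 8 * l\<^sup>2 * sqrt ((nrm M k1)\<^sup>2 + (nrm M k2)\<^sup>2) + S t"
          by (rule two_component_bound) (simp_all add: S_def area_pos less_imp_le)
      qed
    qed
  qed
qed

end

section \<open>Determining modes and nodes for the damped system\<close>

theorem theorem3p1:
  fixes L \<gamma> \<nu> \<mu> F :: real
  assumes "0 < L" and "0 < \<gamma>" and "\<gamma> \<le> 1" and "0 < \<nu>" and "0 < \<mu>"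
  shows "(\<forall>(m::nat) ev w.
            stokes_eigensystem L \<gamma> ev w \<and>
            real m + 1 > 2 / \<gamma> + 2 / pi\<^sup>2 * (F * measure lborel (Omega L \<gamma>) / (\<mu> * \<nu>)) \<longrightarrow>
            determining_modes L \<gamma> \<nu> \<mu> F w m)
       \<and> (\<forall>(N::nat) Q x.
            square_tiling (Omega L \<gamma>) N Q \<and> (\<forall>j\<in>{1..N}. x j \<in> Q j) \<and>
            real N > sqrt 68 * (F * measure lborel (Omega L \<gamma>) / (\<mu> * \<nu>)) \<longrightarrow>
            determining_nodes L \<gamma> \<nu> \<mu> F x N)"
proof -
  interpret cell L \<gamma> using assms(1,2) by (rule cell.intro)
  show ?thesis unfolding measure_Omega
  proof (intro conjI allI impI)
    fix m ev w
    assume "stokes_eigensystem L \<gamma> ev w \<and> real m + 1 > 2 / \<gamma> + 2 / pi\<^sup>2 * (F * area / (\<mu> * \<nu>))"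
    then show "determining_modes L \<gamma> \<nu> \<mu> F w m"
      using modes_determining assms(3-5) by blast
  next
    fix N Q x
    assume "square_tiling (Omega L \<gamma>) N Q \<and> (\<forall>j\<in>{1..N}. x j \<in> Q j) \<and> real N > sqrt 68 * (F * area / (\<mu> * \<nu>))"
    then show "determining_nodes L \<gamma> \<nu> \<mu> F x N"
      using nodes_determining assms(4,5) by blast
  qed
qed

end
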